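(* Let $f$ be univalent and analytic in $\mathbb H$ with $\lim_{z\to\infty}f(z)=\infty$ such that $f(\mathbb H)$ is a Jordan domain. Let $f$ satisfy $$\lim_{\mathrm{Re}\,z\to0^+}(2\,\mathrm{Re}\,z)\,|Pf(z)|=0.$$ Suppose further that either (A) both $f$ and $f^{-1}$ are locally uniformly continuous in a neighborhood of $\infty$, or (B) $f$ is locally quasiconformally extendible to a neighborhood of $\infty$. Then there is some $\tau>0$ such that the function $$\hat f(z)=\begin{cases} f(z), & \mathrm{Re}\,z\ge0,\\ f(z^* )+(2\,\mathrm{Re}\,z)\,f'(z^* )\quad(z^*:=-\bar z), & -\tau<\mathrm{Re}\,z<0,\end{cases}$$ defines a quasiconformal extension of $f$ over $i\mathbb R$ to $\mathbb H^*_{(0,\tau)}:=\{z\in\mathbb C:-\tau<\mathrm{Re}\,z<0\}$ (that is, $\hat f$ is a quasiconformal mapping of $\{z\in\mathbb C:\mathrm{Re}\,z>-\tau\}$ onto its image), and its complex dilatation $\mu$ on $\mathbb H^*_{(0,\tau)}$ has the form $$\mu(z)=-(2\,\mathrm{Re}\,z)\,Pf(z^* ).$$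
   Context: $\mathbb H=\{z=x+iy\in\mathbb C:x>0\}$ is the right half-plane. $Pf:=f''/f'$ is the pre-Schwarzian derivative. The limit $\lim_{\mathrm{Re}\,z\to0^+}$ is uniform in $\mathrm{Im}\,z$: the supremum over $0<\mathrm{Re}\,z\le t$ tends to $0$ as $t\to0^+$. A Jordan domain is a domain in $\overline{\mathbb C}$ bounded by a Jordan curve of $\overline{\mathbb C}$; since $f(\mathbb H)$ is a Jordan domain, $f$ extends continuously and injectively to $i\mathbb R\cup\{\infty\}$ with $f(\infty)=\infty$, and values of $f$ on $i\mathbb R$ are those of this extension. The complex dilatation of a quasiconformal mapping $F$ is $\bar\partial F/\partial F$. Condition (A) means: for some $M>0$, $f$ is uniformly continuous (Euclidean metric) on $\{z\in\mathbb H:|z|>M\}$ and $f^{-1}$ is uniformly continuous on $\{w\in f(\mathbb H):|w|>M\}$. Condition (B) means: for some $M>0$, there is a quasiconformal mapping of $\{z\in\mathbb C:|z|>M\}$ into $\mathbb C$ which coincides with $f$ on $\{z\in\mathbb H:|z|>M\}$ and tends to $\infty$ as $z\to\infty$. *)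

theory Defs
  imports "HOL-Analysis.Analysis"
begin

definition right_half_plane :: "complex set" where
  "right_half_plane = {z. 0 < Re z}"

definition pre_schwarzian :: "(complex \<Rightarrow> complex) \<Rightarrow> complex \<Rightarrow> complex" where
  "pre_schwarzian f z = deriv (deriv f) z / deriv f z"

(* The extended complex plane: None is the point at infinity. *)

abbreviation Riemann_sphere :: "complex option topology" where
  "Riemann_sphere \<equiv> Alexandroff_compactification euclidean"

definition jordan_curve_sphere :: "complex option set \<Rightarrow> bool" where
  "jordan_curve_sphere J \<longleftrightarrow>
     (\<exists>\<gamma>. embedding_map (top_of_set (sphere (0::complex) 1)) Riemann_sphere \<gamma> \<and>
          J = \<gamma> ` sphere 0 1)"

definition jordan_domain_sphere :: "complex option set \<Rightarrow> bool" where
  "jordan_domain_sphere D \<longleftrightarrow>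
     D \<noteq> {} \<and> openin Riemann_sphere D \<and> connectedin Riemann_sphere D \<and>
     jordan_curve_sphere (Riemann_sphere frontier_of D)"

(* Sup k and Inf k are the endpoints of the closed interval k; division_of allows
   finitely many closed intervals with disjoint interiors. *)

definition abs_cont_on :: "real set \<Rightarrow> (real \<Rightarrow> complex) \<Rightarrow> bool" where
  "abs_cont_on I g \<longleftrightarrow>
     (\<forall>\<epsilon>>0. \<exists>\<delta>>0. \<forall>d S. d division_of S \<and> S \<subseteq> I \<and> (\<Sum>k\<in>d. Sup k - Inf k) < \<delta> \<longrightarrow>
        (\<Sum>k\<in>d. norm (g (Sup k) - g (Inf k))) < \<epsilon>)"

definition ACL_on :: "complex set \<Rightarrow> (complex \<Rightarrow> complex) \<Rightarrow> bool" where
  "ACL_on \<Omega> F \<longleftrightarrow>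
     (\<forall>a b. cbox a b \<subseteq> \<Omega> \<longrightarrow>
        (AE y in lebesgue. y \<in> {Im a..Im b} \<longrightarrow>
           abs_cont_on {Re a..Re b} (\<lambda>x. F (Complex x y))) \<and>
        (AE x in lebesgue. x \<in> {Re a..Re b} \<longrightarrow>
           abs_cont_on {Im a..Im b} (\<lambda>y. F (Complex x y))))"

(* The Wirtinger derivatives are formed from the partial derivatives with respect
   to x and y, which exist almost everywhere for ACL functions. *)

definition partial_x :: "(complex \<Rightarrow> complex) \<Rightarrow> complex \<Rightarrow> complex" where
  "partial_x F z = vector_derivative (\<lambda>t. F (z + of_real t)) (at 0)"

definition partial_y :: "(complex \<Rightarrow> complex) \<Rightarrow> complex \<Rightarrow> complex" where
  "partial_y F z = vector_derivative (\<lambda>t. F (z + \<i> * of_real t)) (at 0)"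

definition wirtinger :: "(complex \<Rightarrow> complex) \<Rightarrow> complex \<Rightarrow> complex" where
  "wirtinger F z = (partial_x F z - \<i> * partial_y F z) / 2"

definition wirtinger_bar :: "(complex \<Rightarrow> complex) \<Rightarrow> complex \<Rightarrow> complex" where
  "wirtinger_bar F z = (partial_x F z + \<i> * partial_y F z) / 2"

definition complex_dilatation :: "(complex \<Rightarrow> complex) \<Rightarrow> complex \<Rightarrow> complex" where
  "complex_dilatation F z = wirtinger_bar F z / wirtinger F z"

(* The analytic definition of a quasiconformal mapping of the domain \<Omega> onto F ` \<Omega>
   (K-quasiconformal with K = (1 + k) / (1 - k)). The dilatation inequality makes
   the Jacobian non-negative almost everywhere, so F preserves orientation. *)

definition quasiconformal_on :: "(complex \<Rightarrow> complex) \<Rightarrow> complex set \<Rightarrow> bool" where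
  "quasiconformal_on F \<Omega> \<longleftrightarrow>
     open \<Omega> \<and> connected \<Omega> \<and>
     (\<exists>G. homeomorphism \<Omega> (F ` \<Omega>) F G) \<and>
     ACL_on \<Omega> F \<and>
     (\<exists>k. 0 \<le> k \<and> k < 1 \<and>
        (AE z in lebesgue. z \<in> \<Omega> \<longrightarrow> cmod (wirtinger_bar F z) \<le> k * cmod (wirtinger F z)))"

definition locally_unif_cont_at_infinity :: "(complex \<Rightarrow> complex) \<Rightarrow> bool" where
  "locally_unif_cont_at_infinity f \<longleftrightarrow>
     (\<exists>M>0. uniformly_continuous_on {z \<in> right_half_plane. cmod z > M} f \<and>
            uniformly_continuous_on {w \<in> f ` right_half_plane. cmod w > M}
              (inv_into right_half_plane f))"

definition locally_qc_extendible_at_infinity :: "(complex \<Rightarrow> complex) \<Rightarrow> bool" where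
  "locally_qc_extendible_at_infinity f \<longleftrightarrow>
     (\<exists>M>0. \<exists>F. quasiconformal_on F {z. cmod z > M} \<and>
            (\<forall>z\<in>right_half_plane. cmod z > M \<longrightarrow> F z = f z) \<and>
            filterlim F at_infinity at_infinity)"

(* On the imaginary axis the value is that of the continuous boundary extension of f,
   i.e. the limit of f from within the half-plane; - cnj z is the reflection of z
   in the imaginary axis. *)

definition reflected_extension :: "(complex \<Rightarrow> complex) \<Rightarrow> complex \<Rightarrow> complex" where
  "reflected_extension f z =
     (if 0 < Re z then f z
      else if Re z = 0 then Lim (at z within right_half_plane) f
      else f (- cnj z) + of_real (2 * Re z) * deriv f (- cnj z))"

end

(* On squares of side Re p resting on the imaginary axis, the smallness of Re z * |Pf(z)| makes f, and its
   reflected extension g, close to an affine map with derivative f'(p). Hence g is continuous across the axis and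
   injective on any two points at a distance below a uniform constant, and its dilatation is computed directly.
   On the closed half-plane g is injective, because two equal boundary values would contradict the Jordan
   curve theorem together with local injectivity.

   What remains is to separate distant points near infinity. There g z is shown to equal, up to a small error in
   case (A) and exactly in case (B), a value of an injective map close to z. In case (A) that map is f
   itself and uniform continuity bounds (2 Re z) f'(z). In case (B) it is the quasiconformal extension F;
   a length-area estimate shows that F maps a square around a boundary point a onto a disc that contains g z.
   The length-area estimate for the analytic definition of quasiconformality needs that absolutely continuous
   functions are differentiable almost everywhere and the theorem of Gehring and Lehto: an ACL homeomorphism is
   differentiable almost everywhere. *)
theory Submission
  imports Defs "HOL-Complex_Analysis.Complex_Analysis"
begin

text \<open>Local injectivity holds with the radius \<open>t0 / 4\<close>, whatever the width of the
  strip. So injectivity can fail in every strip only through pairs of points at distance at least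
  \<open>t0 / 4\<close>. Such pairs, if bounded, accumulate at two distinct points of the closed
  half-plane with the same image. Near infinity this compactness is lost, and two distant points of
  the strip could a priori be folded onto each other; this is why (A) or (B) is assumed.

  The other obstacle is the growth of f' at the axis. The derivative of log f' is Pf, of size at
  most \<kappa> / Re z, and the integral of this bound diverges, but only logarithmically. Hence f'
  grows at most like a small power of 1 / Re z. The estimates below replace this power by the square
  root of 1 / Re z, which is still integrable: this gives the boundary values, the affine
  approximation up to the axis and absolute continuity across it.\<close>

section \<open>Absolutely continuous functions on an interval\<close>

(* The generalisation of abs_cont_on to other target spaces is needed for real and imaginary parts. *)
definition abs_cont :: "real set \<Rightarrow> (real \<Rightarrow> 'a::real_normed_vector) \<Rightarrow> bool" where
  "abs_cont I g \<longleftrightarrow>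
     (\<forall>\<epsilon>>0. \<exists>\<delta>>0. \<forall>d S. d division_of S \<and> S \<subseteq> I \<and> (\<Sum>k\<in>d. Sup k - Inf k) < \<delta> \<longrightarrow>
        (\<Sum>k\<in>d. norm (g (Sup k) - g (Inf k))) < \<epsilon>)"

lemma abs_cont_on_iff: "abs_cont_on I g \<longleftrightarrow> abs_cont I g"
  by (simp add: abs_cont_def abs_cont_on_def)

lemma abs_contD:
  assumes "abs_cont I g" "0 < \<epsilon>"
  obtains \<delta> where "0 < \<delta>"
    "\<And>d S. \<lbrakk>d division_of S; S \<subseteq> I; (\<Sum>k\<in>d. Sup k - Inf k) < \<delta>\<rbrakk> \<Longrightarrow> (\<Sum>k\<in>d. norm (g (Sup k) - g (Inf k))) < \<epsilon>"
  using assms unfolding abs_cont_def by metis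

text \<open>Comparison principle, used for real and imaginary parts, for a change of sign, for
  truncations and for domination by the square root. Since \<open>C\<close> may have any sign, it is
  replaced by \<open>max C 1\<close>.\<close>

lemma abs_cont_mono:
  assumes "abs_cont I g" and "\<And>x y. x \<in> I \<Longrightarrow> y \<in> I \<Longrightarrow> norm (h x - h y) \<le> C * norm (g x - g y)"
  shows "abs_cont I h"
  unfolding abs_cont_def
proof (intro allI impI)
  fix \<epsilon> :: real assume "0 < \<epsilon>"
  define C' where "C' = max C 1"
  have C': "C' > 0" "C \<le> C'" by (auto simp: C'_def)
  have "0 < \<epsilon> / C'" using \<open>0 < \<epsilon>\<close> C' by simp
  from abs_contD[OF assms(1) this]
  obtain \<delta> where d: "\<delta> > 0" "\<And>d S. \<lbrakk>d division_of S; S \<subseteq> I; (\<Sum>k\<in>d. Sup k - Inf k) < \<delta>\<rbrakk> \<Longrightarrow>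
    (\<Sum>k\<in>d. norm (g (Sup k) - g (Inf k))) < \<epsilon> / C'"
    by blast
  show "\<exists>\<delta>>0. \<forall>d S. d division_of S \<and> S \<subseteq> I \<and> (\<Sum>k\<in>d. Sup k - Inf k) < \<delta> \<longrightarrow>
        (\<Sum>k\<in>d. norm (h (Sup k) - h (Inf k))) < \<epsilon>"
  proof (intro exI[of _ \<delta>] conjI allI impI d(1), elim conjE)
    fix d S assume *: "d division_of S" "S \<subseteq> I" "(\<Sum>k\<in>d. Sup k - Inf k) < \<delta>"
    have "norm (h (Sup k) - h (Inf k)) \<le> C' * norm (g (Sup k) - g (Inf k))" if kd: "k \<in> d" for k
    proof -
      obtain a b where ab: "k = {a..b}" "a \<le> b"
        using division_ofD(3,4)[OF *(1) kd] by fastforce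
      have "k \<subseteq> I" using division_ofD(2)[OF *(1) kd] *(2) by blast
      then have "Sup k \<in> I" "Inf k \<in> I" using ab by auto
      then have "norm (h (Sup k) - h (Inf k)) \<le> C * norm (g (Sup k) - g (Inf k))" by (rule assms(2))
      also have "\<dots> \<le> C' * norm (g (Sup k) - g (Inf k))" using C' by (intro mult_right_mono) auto
      finally show ?thesis .
    qed
    then have "(\<Sum>k\<in>d. norm (h (Sup k) - h (Inf k))) \<le> C' * (\<Sum>k\<in>d. norm (g (Sup k) - g (Inf k)))"
      by (simp add: sum_distrib_left sum_mono)
    also have "\<dots> < \<epsilon>" using d(2)[OF *] C' by (simp add: field_simps)
    finally show "(\<Sum>k\<in>d. norm (h (Sup k) - h (Inf k))) < \<epsilon>" .
  qed
qed

lemma abs_cont_subset: "abs_cont I g \<Longrightarrow> J \<subseteq> I \<Longrightarrow> abs_cont J g"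
  unfolding abs_cont_def by (meson order_trans)

lemma division_increments:
  fixes f :: "real \<Rightarrow> 'a::real_normed_vector"
  assumes "a \<le> b" and "p division_of {a..b}"
  shows "(\<Sum>K\<in>p. f (Sup K) - f (Inf K)) = f b - f a"
proof -
  let ?f = "(\<lambda>K::real set. if K = {} then 0 else f(interval_upperbound K) - f(interval_lowerbound K))"
  interpret operative_real plus 0 ?f
    rewrites "comm_monoid_set.F (+) 0 = sum"
    by standard[1] (auto simp add: sum_def)
  have "f b - f a = (\<Sum>l\<in>p. ?f l)"
    using division[OF assms(2)] assms(1) by simp
  also have "\<dots> = (\<Sum>K\<in>p. f (Sup K) - f (Inf K))"
  proof (rule sum.cong[OF refl])
    fix k assume "k \<in> p"
    then obtain c d where "k = {c..d}" "c \<le> d"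
      using division_ofD(3,4)[OF assms(2) \<open>k \<in> p\<close>] by fastforce
    then show "?f k = f (Sup k) - f (Inf k)" by auto
  qed
  finally show ?thesis by simp
qed

text \<open>The parts of \<open>D\<close> not covered by \<open>D'\<close> form a division
  \<open>R\<close> of total length below \<delta>, so the increments over \<open>R\<close> add up to
  less than \<epsilon>; and the increments over \<open>D\<close> are those over \<open>D'\<close>
  plus those over \<open>R\<close>. The closed intervals in \<open>D\<close> are disjoint, not
  merely nonoverlapping, as otherwise a degenerate interval at a common endpoint could be counted in
  two subdivisions.\<close>

lemma abs_cont_refine:
  fixes u :: "real \<Rightarrow> real"
  assumes ac: "\<And>d S. \<lbrakk>d division_of S; S \<subseteq> I; (\<Sum>k\<in>d. Sup k - Inf k) < \<delta>\<rbrakk> \<Longrightarrow> (\<Sum>k\<in>d. norm (u (Sup k) - u (Inf k)))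
    < \<epsilon>"
    and D: "D division_of S" "S \<subseteq> I" "\<And>j k. j \<in> D \<Longrightarrow> k \<in> D \<Longrightarrow> j \<noteq> k \<Longrightarrow> j \<inter> k = {}"
    and D': "D' division_of S'" "\<And>k. k \<in> D' \<Longrightarrow> \<exists>j\<in>D. k \<subseteq> j"
    and len: "(\<Sum>k\<in>D. Sup k - Inf k) < (\<Sum>k\<in>D'. Sup k - Inf k) + \<delta>"
  shows "(\<Sum>k\<in>D'. u (Sup k) - u (Inf k)) < (\<Sum>k\<in>D. u (Sup k) - u (Inf k)) + \<epsilon>"
proof -
  define P where "P j = {k \<in> D'. k \<subseteq> j}" for j
  have finD: "finite D" "finite D'" using D(1) D'(1) by auto
  have Dj: "\<exists>a b. j = {a..b} \<and> a \<le> b" if "j \<in> D" for j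
    using division_ofD(3,4)[OF D(1) that] by fastforce
  have D'j: "k \<noteq> {}" if "k \<in> D'" for k
    using division_ofD(3)[OF D'(1) that] .
  have "\<exists>r. P j \<subseteq> r \<and> r division_of j" if jD: "j \<in> D" for j
  proof -
    obtain a b where ab: "j = cbox a b" using Dj[OF jD] by (metis box_real(2))
    have "P j division_of (\<Union>(P j))"
      using division_of_subset[OF division_of_union_self[OF D'(1)], of "P j"] by (auto simp: P_def)
    moreover have "\<Union>(P j) \<subseteq> cbox a b" using ab by (auto simp: P_def)
    ultimately obtain q where "P j \<subseteq> q" "q division_of cbox a b" by (rule partial_division_extend_interval)
    then show ?thesis using ab by blast
  qed
  then obtain r where r: "\<And>j. j \<in> D \<Longrightarrow> P j \<subseteq> r j" "\<And>j. j \<in> D \<Longrightarrow> r j division_of j"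
    by metis
  define R where "R = (\<Union>j\<in>D. r j - P j)"
  have D'eq: "D' = (\<Union>j\<in>D. P j)" using D'(2) by (auto simp: P_def)
  have Psub: "k \<noteq> {} \<and> k \<subseteq> j" if "k \<in> P j" for k j using that D'j by (auto simp: P_def)
  have rsub: "k \<noteq> {} \<and> k \<subseteq> j" if "k \<in> r j" "j \<in> D" for k j using division_ofD(2,3)[OF r(2)[OF that(2)] that(1)]
    by auto
  have finr: "finite (r j)" "finite (P j)" if "j \<in> D" for j
    using r[OF that] finite_subset by auto
  have key: "(\<Sum>j\<in>D. g (Sup j) - g (Inf j)) = (\<Sum>k\<in>D'. g (Sup k) - g (Inf k)) + (\<Sum>k\<in>R. g (Sup k) - g (Inf k))"
    for g :: "real \<Rightarrow> real"
  proof -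
    have "(\<Sum>j\<in>D. g (Sup j) - g (Inf j)) = (\<Sum>j\<in>D. \<Sum>k\<in>r j. g (Sup k) - g (Inf k))"
    proof (rule sum.cong[OF refl])
      fix j assume j: "j \<in> D"
      obtain a b where ab: "j = {a..b}" "a \<le> b" using Dj[OF j] by auto
      show "g (Sup j) - g (Inf j) = (\<Sum>k\<in>r j. g (Sup k) - g (Inf k))"
        using division_increments[of a b "r j" g] r(2)[OF j] ab by simp
    qed
    also have "\<dots> = (\<Sum>j\<in>D. (\<Sum>k\<in>P j. g (Sup k) - g (Inf k)) + (\<Sum>k\<in>r j - P j. g (Sup k) - g (Inf k)))"
      by (intro sum.cong refl) (subst sum.subset_diff[OF r(1) finr(1)], auto)
    also have "\<dots> = (\<Sum>j\<in>D. (\<Sum>k\<in>P j. g (Sup k) - g (Inf k))) + (\<Sum>j\<in>D. \<Sum>k\<in>r j - P j. g (Sup k) - g (Inf k))"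
      by (rule sum.distrib)
    also have "(\<Sum>j\<in>D. (\<Sum>k\<in>P j. g (Sup k) - g (Inf k))) = (\<Sum>k\<in>D'. g (Sup k) - g (Inf k))"
      unfolding D'eq
    proof (rule sum.UNION_disjoint[symmetric])
      show "\<forall>i\<in>D. \<forall>j\<in>D. i \<noteq> j \<longrightarrow> P i \<inter> P j = {}"
      proof (intro ballI impI equals0I)
        fix i j k assume ij: "i \<in> D" "j \<in> D" "i \<noteq> j" and k: "k \<in> P i \<inter> P j"
        have "k \<noteq> {}" "k \<subseteq> i" "k \<subseteq> j" using k ij Psub[of k i] Psub[of k j] by auto
        then show False using D(3)[OF ij] by auto
      qed
    qed (use finD finr in auto)
    also have "(\<Sum>j\<in>D. \<Sum>k\<in>r j - P j. g (Sup k) - g (Inf k)) = (\<Sum>k\<in>R. g (Sup k) - g (Inf k))"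
      unfolding R_def
    proof (rule sum.UNION_disjoint[symmetric])
      show "\<forall>i\<in>D. \<forall>j\<in>D. i \<noteq> j \<longrightarrow> (r i - P i) \<inter> (r j - P j) = {}"
      proof (intro ballI impI equals0I)
        fix i j k assume ij: "i \<in> D" "j \<in> D" "i \<noteq> j" and k: "k \<in> (r i - P i) \<inter> (r j - P j)"
        have "k \<noteq> {}" "k \<subseteq> i" "k \<subseteq> j" using k ij rsub[of k i] rsub[of k j] by auto
        then show False using D(3)[OF ij] by auto
      qed
    qed (use finD finr in auto)
    finally show ?thesis .
  qed
  have "R division_of \<Union>R"
  proof (rule division_ofI)
    show "finite R" using finD finr by (auto simp: R_def)
    fix k1 assume k1: "k1 \<in> R"
    then obtain j1 where j1: "j1 \<in> D" "k1 \<in> r j1" by (auto simp: R_def)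
    show "k1 \<subseteq> \<Union>R" "k1 \<noteq> {}" "\<exists>a b. k1 = cbox a b"
      using k1 division_ofD(3,4)[OF r(2)[OF j1(1)] j1(2)] by auto
    fix k2 assume k2: "k2 \<in> R" "k1 \<noteq> k2"
    then obtain j2 where j2: "j2 \<in> D" "k2 \<in> r j2" by (auto simp: R_def)
    show "interior k1 \<inter> interior k2 = {}"
    proof (cases "j1 = j2")
      case True then show ?thesis using division_ofD(5)[OF r(2)[OF j1(1)]] j1 j2 k2 by auto
    next
      case False
      then have "k1 \<inter> k2 = {}" using D(3)[OF j1(1) j2(1)] rsub[of k1 j1] rsub[of k2 j2] j1 j2 by auto
      then show ?thesis using interior_subset[of k1] interior_subset[of k2] by auto
    qed
  qed auto
  moreover have "\<Union>R \<subseteq> I"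
    using rsub division_ofD(2)[OF D(1)] D(2) unfolding R_def by blast
  moreover have "(\<Sum>k\<in>R. Sup k - Inf k) < \<delta>" using key[of "\<lambda>x. x"] len by simp
  ultimately have "(\<Sum>k\<in>R. norm (u (Sup k) - u (Inf k))) < \<epsilon>" by (rule ac)
  moreover have "\<bar>\<Sum>k\<in>R. u (Sup k) - u (Inf k)\<bar> \<le> (\<Sum>k\<in>R. norm (u (Sup k) - u (Inf k)))"
    using sum_abs[of "\<lambda>k. u (Sup k) - u (Inf k)" R] by simp
  ultimately show ?thesis using key[of u] by linarith
qed

section \<open>Vitali coverings and differentiability almost everywhere\<close>

lemma vitali_intervals_finite:
  fixes E :: "real set"
  assumes E: "E \<in> lmeasurable" "0 < e"
    and K: "\<And>c d. (c, d) \<in> K \<Longrightarrow> c < d \<and> a \<le> c \<and> d \<le> b"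
    and fine: "\<And>x \<eta>. x \<in> E \<Longrightarrow> 0 < \<eta> \<Longrightarrow> \<exists>c d. (c, d) \<in> K \<and> c \<le> x \<and> x \<le> d \<and> d - c < \<eta>"
  obtains D where "finite D" "D \<subseteq> K" "disjoint_family_on (\<lambda>(c, d). {c..d}) D"
    "measure lebesgue E - e < measure lebesgue (E \<inter> (\<Union>(c, d)\<in>D. {c..d}))"
proof -
  have cb: "cball ((c + d) / 2) ((d - c) / 2) = {c..d}" for c d :: real
    by (simp add: cball_eq_atLeastAtMost field_simps)
  obtain C where C: "countable C" "C \<subseteq> K"
     "pairwise (\<lambda>i j. disjnt (cball ((fst i + snd i) / 2) ((snd i - fst i) / 2)) (cball ((fst j + snd j) / 2)
       ((snd j - fst j) / 2))) C"
     "negligible(E - (\<Union>i \<in> C. cball ((fst i + snd i) / 2) ((snd i - fst i) / 2)))"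
  proof (rule Vitali_covering_theorem_cballs[of K "\<lambda>i. (snd i - fst i) / 2" E "\<lambda>i. (fst i + snd i) / 2"])
    show "0 < (snd i - fst i) / 2" if "i \<in> K" for i using K[of "fst i" "snd i"] that by simp
    show "\<exists>i. i \<in> K \<and> x \<in> cball ((fst i + snd i) / 2) ((snd i - fst i) / 2) \<and> (snd i - fst i) / 2 < d"
      if xd: "x \<in> E" "0 < d" for x d
    proof -
      obtain c d' where "(c, d') \<in> K" "c \<le> x" "x \<le> d'" "d' - c < d" using fine[OF xd] by auto
      then show ?thesis by (intro exI[of _ "(c, d')"]) (use xd K[of c d'] in \<open>auto simp: cb\<close>)
    qed
  qed
  have C': "pairwise (\<lambda>i j. disjnt {fst i..snd i} {fst j..snd j}) C"
       "negligible(E - (\<Union>i \<in> C. {fst i..snd i}))"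
    using C(3,4) unfolding cb by auto
  define \<D> where "\<D> = (\<lambda>i. {fst i..snd i} \<inter> E) ` C"
  have lm: "X \<in> lmeasurable" if "X \<in> \<D>" for X
    using that E(1) by (auto simp: \<D>_def intro: fmeasurable.Int)
  \<comment> \<open>The Vitali theorem gives countably many disjoint intervals that cover
    \<open>E\<close> up to a null set; by continuity of the measure, finitely many of them lose less
    than \<open>e\<close>.\<close>
  obtain \<D>' where D': "\<D>' \<subseteq> \<D>" "finite \<D>'" "measure lebesgue (\<Union>\<D>) - e < measure lebesgue (\<Union>\<D>')"
  proof (rule measure_countable_Union_approachable[of \<D> e "measure lebesgue E"])
    show "countable \<D>" using C(1) by (simp add: \<D>_def)
    show "measure lebesgue (\<Union>\<D>') \<le> measure lebesgue E" if "\<D>' \<subseteq> \<D>" "finite \<D>'" for \<D>'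
    proof (rule measure_mono_fmeasurable)
      show "\<Union>\<D>' \<subseteq> E" using that by (auto simp: \<D>_def)
      show "\<Union>\<D>' \<in> sets lebesgue" using that lm by (intro sets.finite_Union) auto
    qed (rule E)
  qed (use E lm in auto)
  obtain D where D: "finite D" "D \<subseteq> C" "\<D>' = (\<lambda>i. {fst i..snd i} \<inter> E) ` D"
    using finite_subset_image[OF D'(2), of "\<lambda>i. {fst i..snd i} \<inter> E" C] D'(1) by (auto simp: \<D>_def)
  have "measure lebesgue (\<Union>\<D>) = measure lebesgue E"
  proof (rule measure_negligible_symdiff[OF E(1)])
    have "E - \<Union>\<D> \<union> (\<Union>\<D> - E) = E - (\<Union>i \<in> C. {fst i..snd i})" by (auto simp: \<D>_def)
    then show "negligible (E - \<Union>\<D> \<union> (\<Union>\<D> - E))" using C'(2) by simp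
  qed
  moreover have "\<Union>\<D>' = E \<inter> (\<Union>(c, d)\<in>D. {c..d})" by (auto simp: D(3))
  ultimately have "measure lebesgue E - e < measure lebesgue (E \<inter> (\<Union>(c, d)\<in>D. {c..d}))" using D'(3) by simp
  moreover have "disjoint_family_on (\<lambda>(c, d). {c..d}) D"
    unfolding disjoint_family_on_def
  proof (intro ballI impI)
    fix i j assume "i \<in> D" "j \<in> D" "i \<noteq> j"
    then have "disjnt {fst i..snd i} {fst j..snd j}" using C'(1) D(2) unfolding pairwise_def by blast
    then show "(case i of (c, d) \<Rightarrow> {c..d}) \<inter> (case j of (c, d) \<Rightarrow> {c..d}) = {}"
      by (simp add: disjnt_def case_prod_beta)
  qed
  ultimately show thesis using that D C(2) by blast
qed

lemma disjoint_pairs_division: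
  fixes D :: "(real \<times> real) set"
  assumes "finite D" "\<forall>(c, d)\<in>D. c < d" "disjoint_family_on (\<lambda>(c, d). {c..d}) D"
  defines "\<I> \<equiv> (\<lambda>(c, d). {c..d}) ` D"
  shows "\<I> division_of \<Union>\<I>" "(\<Sum>k\<in>\<I>. h (Sup k) (Inf k)) = (\<Sum>(c, d)\<in>D. h d c)"
    "measure lebesgue (\<Union>(c, d)\<in>D. {c..d}) = (\<Sum>(c, d)\<in>D. d - c)"
    "\<And>j k. j \<in> \<I> \<Longrightarrow> k \<in> \<I> \<Longrightarrow> j \<noteq> k \<Longrightarrow> j \<inter> k = {}"
proof -
  show disj: "j \<inter> k = {}" if "j \<in> \<I>" "k \<in> \<I>" "j \<noteq> k" for j k
    using that assms(3) unfolding \<I>_def disjoint_family_on_def by fastforce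
  show "\<I> division_of \<Union>\<I>"
  proof (rule division_ofI)
    show "finite \<I>" using assms(1) by (simp add: \<I>_def)
    fix k assume k: "k \<in> \<I>"
    then obtain c d where "(c, d) \<in> D" "k = {c..d}" by (auto simp: \<I>_def)
    then show "k \<noteq> {}" "\<exists>a b. k = cbox a b" using assms(2) by force+
    show "interior k \<inter> interior k' = {}" if "k' \<in> \<I>" "k \<noteq> k'" for k'
      using disj[OF k that] interior_subset[of k] interior_subset[of k'] by auto
  qed auto
  have inj: "inj_on (\<lambda>(c, d). {c..d}) D"
    using assms(2) by (force simp: inj_on_def Icc_eq_Icc)
  show "(\<Sum>k\<in>\<I>. h (Sup k) (Inf k)) = (\<Sum>(c, d)\<in>D. h d c)"
    unfolding \<I>_def sum.reindex[OF inj] by (intro sum.cong refl) (use assms(2) in \<open>force simp: less_imp_le\<close>)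
  have
    "measure lebesgue (\<Union>i\<in>D. case i of (c, d) \<Rightarrow> {c..d}) = (\<Sum>i\<in>D. measure lebesgue (case i of (c, d) \<Rightarrow> {c..d}))"
  proof (rule measure_UNION')
    show "pairwise (\<lambda>i j. disjnt (case i of (c, d) \<Rightarrow> {c..d}) (case j of (c, d) \<Rightarrow> {c..d})) D"
      using assms(3) by (auto simp: pairwise_def disjnt_def disjoint_family_on_def)
  qed (use assms(1) in auto)
  also have "\<dots> = (\<Sum>(c, d)\<in>D. d - c)"
    by (intro sum.cong refl) (use assms(2) in \<open>force simp: less_imp_le\<close>)
  finally show "measure lebesgue (\<Union>(c, d)\<in>D. {c..d}) = (\<Sum>(c, d)\<in>D. d - c)" .
qed

text \<open>With \<open>x\<close> strictly inside the intervals, the set is an intersection of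
  countably many open sets. This is why slopes are taken over intervals around \<open>x\<close>
  throughout and not over one-sided intervals as for Dini derivatives: measurability is then
  immediate.\<close>

lemma interval_cover_borel:
  fixes P :: "real \<Rightarrow> real \<Rightarrow> bool"
  shows "{x. \<forall>\<eta>>0. \<exists>c d. a \<le> c \<and> c < x \<and> x < d \<and> d \<le> b \<and> d - c < \<eta> \<and> P c d} \<in> lmeasurable" (is "?E \<in> _")
proof -
  define U where "U n = (\<Union>(c,d)\<in>{(c, d). a \<le> c \<and> d \<le> b \<and> d - c < inverse (real (Suc n)) \<and> P c d}. {c<..<d})"
    for n
  have "open (U n)" for n unfolding U_def by auto
  have "?E = (\<Inter>n. U n)"
  proof safe
    fix x n assume "\<forall>\<eta>>0. \<exists>c d. a \<le> c \<and> c < x \<and> x < d \<and> d \<le> b \<and> d - c < \<eta> \<and> P c d"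
    then show "x \<in> U n" by (drule_tac x="inverse (real (Suc n))" in spec) (force simp: U_def)
  next
    fix x \<eta> :: real assume x: "x \<in> (\<Inter>n. U n)" "0 < \<eta>"
    obtain n where n: "inverse (real (Suc n)) < \<eta>" using reals_Archimedean[OF x(2)] by auto
    have "x \<in> U n" using x by auto
    then show "\<exists>c d. a \<le> c \<and> c < x \<and> x < d \<and> d \<le> b \<and> d - c < \<eta> \<and> P c d"
      using n by (fastforce simp: U_def)
  qed
  then have "?E \<in> sets borel" using \<open>\<And>n. open (U n)\<close> by auto
  then have "?E \<in> sets lebesgue" by simp
  moreover have "?E \<subseteq> {a..b}" by (force dest: spec[of _ 1])
  ultimately show ?thesis
    using bounded_set_imp_lmeasurable[OF bounded_subset[OF bounded_closed_interval[of a b]]] by blast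
qed

lemma negligible_if_no_measure:
  assumes "E \<in> lmeasurable" "\<not> 0 < measure lebesgue E" shows "negligible E"
  using assms by (metis negligible_iff_measure0 less_le measure_nonneg)

lemma lmeasurable_outer_open:
  assumes S: "S \<in> lmeasurable" and e: "0 < e"
  obtains T where "open T" "S \<subseteq> T" "T \<in> lmeasurable" "measure lebesgue T < measure lebesgue S + e"
proof -
  obtain T where T: "open T" "S \<subseteq> T" "T - S \<in> lmeasurable" "emeasure lebesgue (T - S) < ennreal e"
    using sets_lebesgue_outer_open[OF fmeasurableD[OF S] e] by blast
  have eq: "T = S \<union> (T - S)" using T(2) by blast
  have "T \<in> lmeasurable" by (subst eq) (intro fmeasurable.Un S T(3))
  moreover have "measure lebesgue (T - S) < e"
    using T(3,4) e by (simp add: emeasure_eq_measure2 ennreal_less_iff)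
  moreover have "measure lebesgue T \<le> measure lebesgue S + measure lebesgue (T - S)"
    by (subst eq) (intro measure_Un_le fmeasurableD S T(3))
  ultimately show thesis using that T(1,2) by force
qed

(* Vitali twice: cover the set by disjoint intervals of slope below p, then cover it inside these by
   disjoint intervals of slope above q. By absolute continuity the uncovered remainder hardly contributes to
   the increment, so (q - p) times the measure of the set is arbitrarily small. *)
lemma abs_cont_slopes_null:
  fixes u :: "real \<Rightarrow> real"
  assumes ac: "abs_cont {a..b} u" and pq: "p < q"
  shows "negligible ({x. \<forall>\<eta>>0. \<exists>c d. a \<le> c \<and> c < x \<and> x < d \<and> d \<le> b \<and> d - c < \<eta> \<and> u d - u c < p * (d - c)} \<inter>
     {x. \<forall>\<eta>>0. \<exists>c d. a \<le> c \<and> c < x \<and> x < d \<and> d \<le> b \<and> d - c < \<eta> \<and> q * (d - c) < u d - u c})" (is "negligible (?A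
       \<inter> ?B)")
proof (rule negligible_if_no_measure)
  define E where "E = ?A \<inter> ?B"
  show Em: "?A \<inter> ?B \<in> lmeasurable"
    by (intro fmeasurable.Int interval_cover_borel)
  show "\<not> 0 < measure lebesgue (?A \<inter> ?B)"
  proof
    define m where "m = measure lebesgue (?A \<inter> ?B)"
    assume "0 < measure lebesgue (?A \<inter> ?B)"
    then have m: "m > 0" by (simp add: m_def)
    define \<epsilon> where "\<epsilon> = (q - p) * m / 8"
    have e: "\<epsilon> > 0" using m pq by (simp add: \<epsilon>_def)
    from abs_contD[OF ac e] obtain \<delta> where d: "\<delta> > 0"
      "\<And>d S. \<lbrakk>d division_of S; S \<subseteq> {a..b}; (\<Sum>k\<in>d. Sup k - Inf k) < \<delta>\<rbrakk> \<Longrightarrow> (\<Sum>k\<in>d. norm (u (Sup k) - u (Inf k)))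
        < \<epsilon>" by blast
    \<comment> \<open>All losses are of order \<open>t\<close>. The bound
      \<open>\<delta> / 4\<close> makes the uncovered length, below \<open>3 * t\<close>, admissible
      for absolute continuity; \<open>m / 4\<close> keeps the length \<open>L2\<close> above
      \<open>m / 2\<close>; the third bound gives
      \<open>\<bar>p\<bar> * (3 * t) \<le> 2 * \<epsilon>\<close>. In the end
      \<open>(q - p) * L2\<close> is below \<open>3 * \<epsilon>\<close>, whereas
      \<open>(q - p) * (m / 2)\<close> equals \<open>4 * \<epsilon>\<close>.\<close>
    define t where "t = min (\<delta> / 4) (min (m / 4) (\<epsilon> / (2 * (\<bar>p\<bar> + 1))))"
    have "0 < \<epsilon> / (2 * (\<bar>p\<bar> + 1))" using e by simp
    then have t: "t > 0" "t \<le> \<delta> / 4" "t \<le> m / 4" "t \<le> \<epsilon> / (2 * (\<bar>p\<bar> + 1))"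
      unfolding t_def using d(1) m by (simp, linarith, linarith, linarith)
    have "t * (2 * (\<bar>p\<bar> + 1)) \<le> \<epsilon>" using t(4) by (simp add: pos_le_divide_eq)
    then have tp: "2 * t * \<bar>p\<bar> \<le> \<epsilon>" using t(1) by (simp add: algebra_simps)
    obtain O' where O: "open O'" "?A \<inter> ?B \<subseteq> O'" "O' \<in> lmeasurable" "measure lebesgue O' < m + t"
      using lmeasurable_outer_open[OF Em t(1)] unfolding m_def by blast
    define K1 where "K1 = {(c, d). a \<le> c \<and> c < d \<and> d \<le> b \<and> {c..d} \<subseteq> O' \<and> u d - u c < p * (d - c)}"
    obtain D1 where D1: "finite D1" "D1 \<subseteq> K1" "disjoint_family_on (\<lambda>(c, d). {c..d}) D1"
       "measure lebesgue (?A \<inter> ?B) - t < measure lebesgue ((?A \<inter> ?B) \<inter> (\<Union>(c, d)\<in>D1. {c..d}))"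
    proof (rule vitali_intervals_finite[OF Em t(1), of K1 a b])
      show "\<exists>c d. (c, d) \<in> K1 \<and> c \<le> x \<and> x \<le> d \<and> d - c < \<eta>" if x: "x \<in> ?A \<inter> ?B" and \<eta>: "0 < \<eta>" for x \<eta>
      proof -
        have "x \<in> O'" using x O(2) by blast
        then obtain r where r: "r > 0" "ball x r \<subseteq> O'" using O(1) open_contains_ball by blast
        have "0 < min \<eta> r" using \<eta> r by simp
        then obtain c d where cd: "a \<le> c" "c < x" "x < d" "d \<le> b" "d - c < min \<eta> r" "u d - u c < p * (d - c)"
          using x by blast
        have "{c..d} \<subseteq> ball x r" using cd by (auto simp: dist_real_def)
        then show ?thesis using cd r by (intro exI[of _ c] exI[of _ d]) (auto simp: K1_def)
      qed
      show "c < d \<and> a \<le> c \<and> d \<le> b" if "(c, d) \<in> K1" for c d using that by (auto simp: K1_def)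
    qed (rule that; assumption)
    have D1': "\<forall>(c, d)\<in>D1. c < d" using D1(2) by (auto simp: K1_def)
    \<comment> \<open>Around a point of an open interval of \<open>D1\<close>, all short intervals
      stay in that interval, so the second covering can be nested in the first. Only the finitely
      many endpoints are lost.\<close>
    define E2 where "E2 = (?A \<inter> ?B) \<inter> (\<Union>(c, d)\<in>D1. {c<..<d})"
    have E2: "E2 \<in> lmeasurable" unfolding E2_def
    proof (rule fmeasurable_Int_fmeasurable[OF Em])
      have "open (\<Union>(c, d)\<in>D1. {c<..<d})" by auto
      then show "(\<Union>(c, d)\<in>D1. {c<..<d}) \<in> sets lebesgue" by simp
    qed
    have "measure lebesgue E2 = measure lebesgue ((?A \<inter> ?B) \<inter> (\<Union>(c, d)\<in>D1. {c..d}))"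
    proof (rule measure_negligible_symdiff)
      show "(?A \<inter> ?B) \<inter> (\<Union>(c, d)\<in>D1. {c..d}) \<in> lmeasurable"
      proof (rule fmeasurable_Int_fmeasurable[OF Em])
        have "closed (\<Union>(c, d)\<in>D1. {c..d})" using D1(1) by auto
        then show "(\<Union>(c, d)\<in>D1. {c..d}) \<in> sets lebesgue" by simp
      qed
      have "finite (fst ` D1 \<union> snd ` D1)" using D1(1) by auto
      then show "negligible ((?A \<inter> ?B) \<inter> (\<Union>(c, d)\<in>D1. {c..d}) - E2 \<union> (E2 - (?A \<inter> ?B) \<inter> (\<Union>(c, d)\<in>D1. {c..d})))"
      proof (rule negligible_subset[OF negligible_finite], intro subsetI)
        fix x assume x: "x \<in> (?A \<inter> ?B) \<inter> (\<Union>(c, d)\<in>D1. {c..d}) - E2 \<union> (E2 - (?A \<inter> ?B) \<inter> (\<Union>(c, d)\<in>D1. {c..d}))"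
        have "E2 \<subseteq> (?A \<inter> ?B) \<inter> (\<Union>(c, d)\<in>D1. {c..d})" unfolding E2_def
          by (intro Int_mono order_refl UN_mono) auto
        with x have x': "x \<in> ?A \<inter> ?B" "x \<in> (\<Union>(c, d)\<in>D1. {c..d})" "x \<notin> E2" by blast+
        then obtain c d where cd: "(c, d) \<in> D1" "c \<le> x" "x \<le> d" by auto
        have "x \<notin> {c<..<d}" using x' cd(1) unfolding E2_def by blast
        then have "x = c \<or> x = d" using cd by auto
        then show "x \<in> fst ` D1 \<union> snd ` D1" using cd(1) by force
      qed
    qed
    then have m2: "measure lebesgue E2 > m - t" using D1(4) by (simp add: m_def)
    define K2 where "K2 = {(c, d). a \<le> c \<and> c < d \<and> d \<le> b \<and> (\<exists>(c', d')\<in>D1. {c..d} \<subseteq> {c'..d'}) \<and>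
      q * (d - c) < u d - u c}"
    obtain D2 where D2: "finite D2" "D2 \<subseteq> K2" "disjoint_family_on (\<lambda>(c, d). {c..d}) D2"
       "measure lebesgue E2 - t < measure lebesgue (E2 \<inter> (\<Union>(c, d)\<in>D2. {c..d}))"
    proof (rule vitali_intervals_finite[OF E2 t(1), of K2 a b])
      show "\<exists>c d. (c, d) \<in> K2 \<and> c \<le> x \<and> x \<le> d \<and> d - c < \<eta>" if x: "x \<in> E2" and \<eta>: "0 < \<eta>" for x \<eta>
      proof -
        obtain c' d' where cd': "(c', d') \<in> D1" "c' < x" "x < d'" using x by (auto simp: E2_def)
        have "0 < min \<eta> (min (x - c') (d' - x))" using \<eta> cd' by simp
        moreover have "x \<in> ?B" using x by (simp add: E2_def)
        ultimately obtain c d where cd: "a \<le> c" "c < x" "x < d" "d \<le> b" "d - c < min \<eta> (min (x - c') (d' - x))"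
          "q * (d - c) < u d - u c"
          by blast
        then have "{c..d} \<subseteq> {c'..d'}" by auto
        then have "(c, d) \<in> K2" using cd cd'(1) unfolding K2_def mem_Collect_eq prod.case
          by (intro conjI bexI[of _ "(c', d')"]) auto
        then show ?thesis using cd by (intro exI[of _ c] exI[of _ d]) auto
      qed
      show "c < d \<and> a \<le> c \<and> d \<le> b" if "(c, d) \<in> K2" for c d using that unfolding K2_def by blast
    qed (rule that; assumption)
    have D2': "\<forall>(c, d)\<in>D2. c < d" using D2(2) unfolding K2_def by blast
    define L1 where "L1 = (\<Sum>(c, d)\<in>D1. d - c)"
    define L2 where "L2 = (\<Sum>(c, d)\<in>D2. d - c)"
    note dp1 = disjoint_pairs_division[OF D1(1) D1' D1(3)]
    note dp2 = disjoint_pairs_division[OF D2(1) D2' D2(3)]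
    have L1m: "L1 = measure lebesgue (\<Union>(c, d)\<in>D1. {c..d})" unfolding L1_def by (rule dp1(3)[symmetric])
    have L2m: "L2 = measure lebesgue (\<Union>(c, d)\<in>D2. {c..d})" unfolding L2_def by (rule dp2(3)[symmetric])
    have fm: "(\<Union>(c, d)\<in>D. {c..d::real}) \<in> lmeasurable" if "finite D" for D
      using that by (intro fmeasurable.finite_UN) (auto simp: case_prod_beta)
    have S1a: "(\<Sum>k\<in>(\<lambda>(c, d). {c..d}) ` D1. Sup k - Inf k) = L1"
      unfolding L1_def by (rule dp1(2)[of "(-)"])
    have S1b: "(\<Sum>k\<in>(\<lambda>(c, d). {c..d}) ` D1. u (Sup k) - u (Inf k)) = (\<Sum>(c, d)\<in>D1. u d - u c)"
      by (rule dp1(2)[of "\<lambda>s i. u s - u i"])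
    have S2a: "(\<Sum>k\<in>(\<lambda>(c, d). {c..d}) ` D2. Sup k - Inf k) = L2"
      unfolding L2_def by (rule dp2(2)[of "(-)"])
    have S2b: "(\<Sum>k\<in>(\<lambda>(c, d). {c..d}) ` D2. u (Sup k) - u (Inf k)) = (\<Sum>(c, d)\<in>D2. u d - u c)"
      by (rule dp2(2)[of "\<lambda>s i. u s - u i"])
    have sub1: "(\<Union>(c, d)\<in>D1. {c..d}) \<subseteq> O'" using D1(2) unfolding K1_def by blast
    have "L1 \<le> measure lebesgue O'"
      unfolding L1m by (rule measure_mono_fmeasurable[OF sub1 fmeasurableD[OF fm[OF D1(1)]] O(3)])
    then have L1: "L1 < m + t" using O(4) by linarith
    have sub2: "(\<Union>(c, d)\<in>D2. {c..d}) \<subseteq> (\<Union>(c, d)\<in>D1. {c..d})" using D2(2) unfolding K2_def by blast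
    have L21: "L2 \<le> L1"
      unfolding L1m L2m
      by (rule measure_mono_fmeasurable[OF sub2 fmeasurableD[OF fm[OF D2(1)]] fm[OF D1(1)]])
    have "measure lebesgue (E2 \<inter> (\<Union>(c, d)\<in>D2. {c..d})) \<le> L2"
      unfolding L2m
      by (rule measure_mono_fmeasurable[OF Int_lower2 fmeasurableD[OF fmeasurable.Int[OF E2 fm[OF D2(1)]]] fm[OF
        D2(1)]])
    then have L2: "m - 2 * t < L2" using D2(4) m2 by linarith
    have
      "(\<Sum>k\<in>(\<lambda>(c, d). {c..d}) ` D2. u (Sup k) - u (Inf k)) < (\<Sum>k\<in>(\<lambda>(c, d). {c..d}) ` D1. u (Sup k) - u (Inf k))
      + \<epsilon>"
    proof (rule abs_cont_refine[where I = "{a..b}" and \<delta> = \<delta>])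
      show "(\<Sum>k\<in>d. norm (u (Sup k) - u (Inf k))) < \<epsilon>"
        if "d division_of S" "S \<subseteq> {a..b}" "(\<Sum>k\<in>d. Sup k - Inf k) < \<delta>" for d S
        by (rule d(2)[OF that])
      show "(\<lambda>(c, d). {c..d}) ` D1 division_of \<Union> ((\<lambda>(c, d). {c..d}) ` D1)" by (rule dp1(1))
      show "(\<lambda>(c, d). {c..d}) ` D2 division_of \<Union> ((\<lambda>(c, d). {c..d}) ` D2)" by (rule dp2(1))
      show "j \<inter> k = {}" if "j \<in> (\<lambda>(c, d). {c..d}) ` D1" "k \<in> (\<lambda>(c, d). {c..d}) ` D1" "j \<noteq> k" for j k
        by (rule dp1(4)[OF that])
      show "\<Union> ((\<lambda>(c, d). {c..d}) ` D1) \<subseteq> {a..b}"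
        by (intro Union_least) (use D1(2) in \<open>auto simp: K1_def\<close>)
      show "\<exists>j\<in>(\<lambda>(c, d). {c..d}) ` D1. k \<subseteq> j" if kD: "k \<in> (\<lambda>(c, d). {c..d}) ` D2" for k
      proof -
        obtain c d where cd: "(c, d) \<in> D2" "k = {c..d}" using kD by auto
        then obtain c' d' where "(c', d') \<in> D1" "{c..d} \<subseteq> {c'..d'}" using D2(2) unfolding K2_def by blast
        then show ?thesis using cd(2)
          by (intro bexI[of _ "{c'..d'}"]) (auto intro!: image_eqI[of _ _ "(c', d')"])
      qed
      show "(\<Sum>k\<in>(\<lambda>(c, d). {c..d}) ` D1. Sup k - Inf k) < (\<Sum>k\<in>(\<lambda>(c, d). {c..d}) ` D2. Sup k - Inf k) + \<delta>"
        using S1a S2a L1 L2 t(1,2) d(1) by linarith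
    qed
    then have "(\<Sum>(c, d)\<in>D2. u d - u c) < (\<Sum>(c, d)\<in>D1. u d - u c) + \<epsilon>"
      using S1b S2b by linarith
    moreover have "(\<Sum>(c, d)\<in>D1. u d - u c) \<le> p * L1"
      unfolding L1_def sum_distrib_left by (rule sum_mono) (use D1(2) in \<open>auto simp: K1_def less_imp_le\<close>)
    moreover have "q * L2 \<le> (\<Sum>(c, d)\<in>D2. u d - u c)"
      unfolding L2_def sum_distrib_left
    proof (rule sum_mono)
      fix i assume "i \<in> D2"
      then have "i \<in> K2" using D2(2) by blast
      then have "q * (snd i - fst i) < u (snd i) - u (fst i)" unfolding K2_def by (cases i) simp
      then show "q * (case i of (c, d) \<Rightarrow> d - c) \<le> (case i of (c, d) \<Rightarrow> u d - u c)" by (simp add: case_prod_beta)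
    qed
    ultimately have "q * L2 < p * L1 + \<epsilon>" by linarith
    also have "p * L1 = p * L2 + p * (L1 - L2)" by (simp add: algebra_simps)
    also have "p * (L1 - L2) \<le> \<bar>p\<bar> * (3 * t)"
      by (rule order_trans[OF mult_right_mono[of p "\<bar>p\<bar>"] mult_left_mono]) (use L1 L2 L21 in auto)
    finally have "q * L2 < p * L2 + \<bar>p\<bar> * (3 * t) + \<epsilon>" by simp
    moreover have "\<bar>p\<bar> * (3 * t) \<le> 2 * \<epsilon>" using tp e by (simp add: mult.commute mult.left_commute)
    ultimately have "(q - p) * L2 < 3 * \<epsilon>" by (simp add: left_diff_distrib)
    moreover have "(q - p) * L2 \<ge> (q - p) * (m / 2)" using L2 t(3) pq by (intro mult_left_mono) auto
    moreover have "(q - p) * m > 0" using m pq by simp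
    ultimately show False by (simp add: \<epsilon>_def)
  qed
qed

lemma abs_cont_continuous_on:
  fixes u :: "real \<Rightarrow> 'a::real_normed_vector"
  assumes "abs_cont {a..b} u" shows "continuous_on {a..b} u"
  unfolding continuous_on_iff
proof (intro ballI allI impI)
  fix x e :: real assume x: "x \<in> {a..b}" and e: "0 < e"
  from abs_contD[OF assms e] obtain \<delta> where d: "\<delta> > 0"
    "\<And>d S. \<lbrakk>d division_of S; S \<subseteq> {a..b}; (\<Sum>k\<in>d. Sup k - Inf k) < \<delta>\<rbrakk> \<Longrightarrow> (\<Sum>k\<in>d. norm (u (Sup k) - u (Inf k))) < e"
      by blast
  have *: "norm (u z - u y) < e" if "y \<le> z" "y \<in> {a..b}" "z \<in> {a..b}" "z - y < \<delta>" for y z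
  proof -
    have "{{y..z}} division_of {y..z}" using division_of_self[of y z] that(1) by simp
    from d(2)[OF this] that show ?thesis by simp
  qed
  show "\<exists>d>0. \<forall>x'\<in>{a..b}. dist x' x < d \<longrightarrow> dist (u x') (u x) < e"
  proof (intro exI[of _ \<delta>] conjI d(1) ballI impI)
    fix y assume "y \<in> {a..b}" "dist y x < \<delta>"
    then show "dist (u y) (u x) < e" using *[of y x] *[of x y] x
      by (cases "y \<le> x") (auto simp: dist_norm norm_minus_commute)
  qed
qed

text \<open>If the set had positive measure, disjoint intervals of slope above \<open>n\<close>
  would cover half of it and have increments of order \<open>n\<close>. Absolute continuity bounds
  these by 1 as soon as the total length is below \<delta>, so the argument is applied to pieces of
  length \<open>\<delta> / 2\<close>.\<close>

lemma abs_cont_steep_null: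
  fixes u :: "real \<Rightarrow> real"
  assumes ac: "abs_cont {a..b} u"
  shows "negligible {x. \<forall>n::nat. \<forall>\<eta>>0. \<exists>c d. a \<le> c \<and> c < x \<and> x < d \<and> d \<le> b \<and> d - c < \<eta> \<and>
    real n * (d - c) < u d - u c}" (is "negligible ?E")
proof -
  define B where
    "B n = {x. \<forall>\<eta>>0. \<exists>c d. a \<le> c \<and> c < x \<and> x < d \<and> d \<le> b \<and> d - c < \<eta> \<and> real n * (d - c) < u d - u c}" for n
  have Bm: "B n \<in> lmeasurable" for n unfolding B_def by (rule interval_cover_borel)
  have E: "?E = (\<Inter>n. B n)" by (auto simp: B_def)
  obtain \<delta> where d: "\<delta> > 0"
    "\<And>d S. \<lbrakk>d division_of S; S \<subseteq> {a..b}; (\<Sum>k\<in>d. Sup k - Inf k) < \<delta>\<rbrakk> \<Longrightarrow> (\<Sum>k\<in>d. norm (u (Sup k) - u (Inf k))) < 1"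
    using abs_contD[OF ac zero_less_one] by blast
  have Bs: "(\<Inter>n. B n) \<in> sets lebesgue" using Bm by (intro sets.countable_INT) auto
  have piece: "negligible ((\<Inter>n. B n) \<inter> {x0<..<x0 + \<delta> / 2})" for x0
  proof (rule negligible_if_no_measure)
    let ?E' = "(\<Inter>n. B n) \<inter> {x0<..<x0 + \<delta> / 2}"
    show Em: "?E' \<in> lmeasurable"
      using fmeasurable_Int_fmeasurable[of "{x0<..<x0 + \<delta> / 2}" lebesgue "\<Inter>n. B n"] Bs
      by (simp add: Int_commute lmeasurable_open bounded_subset[OF bounded_closed_interval[of x0 "x0 + \<delta> / 2"]])
    show "\<not> 0 < measure lebesgue ?E'"
    proof
      assume m: "0 < measure lebesgue ?E'"
      obtain n :: nat where n: "2 / measure lebesgue ?E' < real n" using reals_Archimedean2 by blast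
      define K where
        "K = {(c, d). a \<le> c \<and> c < d \<and> d \<le> b \<and> x0 < c \<and> d < x0 + \<delta> / 2 \<and> real n * (d - c) < u d - u c}"
      have m2: "0 < measure lebesgue ?E' / 2" using m by simp
      obtain D where D: "finite D" "D \<subseteq> K" "disjoint_family_on (\<lambda>(c, d). {c..d}) D"
         "measure lebesgue ?E' - measure lebesgue ?E' / 2 < measure lebesgue (?E' \<inter> (\<Union>(c, d)\<in>D. {c..d}))"
      proof (rule vitali_intervals_finite[OF Em m2, of K a b])
        show "c < d \<and> a \<le> c \<and> d \<le> b" if "(c, d) \<in> K" for c d using that unfolding K_def by blast
        show "\<exists>c d. (c, d) \<in> K \<and> c \<le> x \<and> x \<le> d \<and> d - c < \<eta>" if x: "x \<in> ?E'" and \<eta>: "0 < \<eta>" for x \<eta>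
        proof -
          have "0 < min \<eta> (min (x - x0) (x0 + \<delta> / 2 - x))" using \<eta> x by simp
          moreover have "x \<in> B n" using x by blast
          ultimately obtain c d where cd: "a \<le> c" "c < x" "x < d" "d \<le> b"
            "d - c < min \<eta> (min (x - x0) (x0 + \<delta> / 2 - x))" "real n * (d - c) < u d - u c"
            unfolding B_def by blast
          have "(c, d) \<in> K" unfolding K_def mem_Collect_eq prod.case using cd by linarith
          then show ?thesis using cd by (intro exI[of _ c] exI[of _ d]) auto
        qed
      qed (rule that; assumption)
      have D': "\<forall>(c, d)\<in>D. c < d" using D(2) unfolding K_def by blast
      note dp = disjoint_pairs_division[OF D(1) D' D(3)]
      define L where "L = (\<Sum>(c, d)\<in>D. d - c)"
      have Lm: "L = measure lebesgue (\<Union>(c, d)\<in>D. {c..d})" unfolding L_def by (rule dp(3)[symmetric])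
      have fm: "(\<Union>(c, d)\<in>D. {c..d}) \<in> lmeasurable"
        using D(1) by (intro fmeasurable.finite_UN) (auto simp: case_prod_beta)
      have "(\<Union>(c, d)\<in>D. {c..d}) \<subseteq> {x0..x0 + \<delta> / 2}" using D(2) unfolding K_def by fastforce
      then have "L \<le> measure lebesgue {x0..x0 + \<delta> / 2}"
        unfolding Lm by (intro measure_mono_fmeasurable fmeasurableD[OF fm]) auto
      then have Ld: "L < \<delta>" using d(1) by simp
      have "measure lebesgue (?E' \<inter> (\<Union>(c, d)\<in>D. {c..d})) \<le> L"
        unfolding Lm
          by (rule measure_mono_fmeasurable[OF Int_lower2 fmeasurableD[OF fmeasurable.Int[OF Em fm]] fm])
      then have L2: "measure lebesgue ?E' / 2 < L" using D(4) by linarith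
      have "(\<Sum>k\<in>(\<lambda>(c, d). {c..d}) ` D. norm (u (Sup k) - u (Inf k))) < 1"
      proof (rule d(2)[OF dp(1)])
        show "\<Union> ((\<lambda>(c, d). {c..d}) ` D) \<subseteq> {a..b}"
          by (intro Union_least) (use D(2) in \<open>auto simp: K_def\<close>)
        have "(\<Sum>k\<in>(\<lambda>(c, d). {c..d}) ` D. Sup k - Inf k) = L" unfolding L_def by (rule dp(2)[of "(-)"])
        then show "(\<Sum>k\<in>(\<lambda>(c, d). {c..d}) ` D. Sup k - Inf k) < \<delta>" using Ld by simp
      qed
      moreover have "(\<Sum>k\<in>(\<lambda>(c, d). {c..d}) ` D. norm (u (Sup k) - u (Inf k))) = (\<Sum>(c, d)\<in>D. norm (u d - u c))"
        by (rule dp(2)[of "\<lambda>s i. norm (u s - u i)"])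
      moreover have "real n * L \<le> (\<Sum>(c, d)\<in>D. norm (u d - u c))"
        unfolding L_def sum_distrib_left
      proof (rule sum_mono)
        fix i assume "i \<in> D"
        then have "i \<in> K" using D(2) by blast
        then have "real n * (snd i - fst i) < u (snd i) - u (fst i)" unfolding K_def by (cases i) simp
        then show "real n * (case i of (c, d) \<Rightarrow> d - c) \<le> (case i of (c, d) \<Rightarrow> norm (u d - u c))"
          by (simp add: case_prod_beta)
      qed
      moreover have "real n * L \<ge> real n * (measure lebesgue ?E' / 2)" using L2 by (intro mult_left_mono) auto
      moreover have "real n * (measure lebesgue ?E' / 2) > 1"
        using n m by (simp add: field_simps)
      ultimately show False by linarith
    qed
  qed
  have "(\<Inter>n. B n) \<subseteq> (\<Union>k::int. (\<Inter>n. B n) \<inter> {of_int k * (\<delta> / 4)<..<of_int k * (\<delta> / 4) + \<delta> / 2})"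
  proof
    fix x assume x: "x \<in> (\<Inter>n. B n)"
    \<comment> \<open>The open pieces start at the multiples of \<open>\<delta> / 4\<close> and have
      twice that length, so they overlap and no endpoint is missed. Ceiling minus one gives a
      starting point strictly to the left of \<open>x\<close>.\<close>
    define k where "k = \<lceil>x / (\<delta> / 4)\<rceil> - 1"
    have "of_int k < x / (\<delta> / 4)" "x / (\<delta> / 4) \<le> of_int k + 1" unfolding k_def by linarith+
    then have "of_int k * (\<delta> / 4) < x" "x \<le> (of_int k + 1) * (\<delta> / 4)"
      using d(1) by (simp_all add: field_simps)
    then have "x \<in> {of_int k * (\<delta> / 4)<..<of_int k * (\<delta> / 4) + \<delta> / 2}" using d(1) by (simp add: field_simps)
    then show "x \<in> (\<Union>k::int. (\<Inter>n. B n) \<inter> {of_int k * (\<delta> / 4)<..<of_int k * (\<delta> / 4) + \<delta> / 2})" using x by blast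
  qed
  moreover have "negligible (\<Union>k::int. (\<Inter>n. B n) \<inter> {of_int k * (\<delta> / 4)<..<of_int k * (\<delta> / 4) + \<delta> / 2})"
    by (rule negligible_countable_Union) (auto intro: piece)
  ultimately show ?thesis unfolding E by (rule negligible_subset[rotated])
qed

text \<open>Letting the endpoint on one side of \<open>x\<close> tend to \<open>x\<close> turns the
  estimate over intervals around \<open>x\<close> into one for difference quotients at
  \<open>x\<close>; continuity of \<open>u\<close> at \<open>x\<close> justifies the limit.\<close>

lemma straddle_imp_derivative:
  fixes u :: "real \<Rightarrow> real"
  assumes cont: "isCont u x"
    and str: "\<And>e. 0 < e \<Longrightarrow> \<exists>\<eta>>0. \<forall>c d. x - \<eta> < c \<and> c < x \<and> x < d \<and> d < x + \<eta> \<longrightarrow> \<bar>u d - u c - L * (d - c)\<bar>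
      \<le> e * (d - c)"
  shows "(u has_real_derivative L) (at x)"
  unfolding has_field_derivative_def has_derivative_at_alt
proof (intro conjI allI impI)
  show "bounded_linear ((*) L)" by (rule bounded_linear_mult_right)
  fix e :: real assume "0 < e"
  from str[OF this] obtain \<eta> where \<eta>: "\<eta> > 0"
    "\<And>c d. x - \<eta> < c \<Longrightarrow> c < x \<Longrightarrow> x < d \<Longrightarrow> d < x + \<eta> \<Longrightarrow> \<bar>u d - u c - L * (d - c)\<bar> \<le> e * (d - c)" by blast
  show "\<exists>d>0. \<forall>y. norm (y - x) < d \<longrightarrow> norm (u y - u x - L * (y - x)) \<le> e * norm (y - x)"
  proof (intro exI[of _ \<eta>] conjI allI impI \<eta>(1))
    fix y assume y: "norm (y - x) < \<eta>"
    have uL: "(u \<longlongrightarrow> u x) (at_left x)" "(u \<longlongrightarrow> u x) (at_right x)"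
      using cont unfolding isCont_def by (auto intro: filterlim_at_within_not_equal tendsto_within_subset)
    consider "y > x" | "y = x" | "y < x" by linarith
    then show "norm (u y - u x - L * (y - x)) \<le> e * norm (y - x)"
    proof cases
      case 1
      have "((\<lambda>c. \<bar>u y - u c - L * (y - c)\<bar>) \<longlongrightarrow> \<bar>u y - u x - L * (y - x)\<bar>) (at_left x)"
        by (intro tendsto_intros uL)
      moreover have up: "((\<lambda>c. e * (y - c)) \<longlongrightarrow> e * (y - x)) (at_left x)" by (intro tendsto_intros)
      moreover have "eventually (\<lambda>c. \<bar>u y - u c - L * (y - c)\<bar> \<le> e * (y - c)) (at_left x)"
        unfolding eventually_at_left_field using \<eta> 1 y by (intro exI[of _ "x - \<eta>"]) auto
      ultimately have "\<bar>u y - u x - L * (y - x)\<bar> \<le> e * (y - x)"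
        using tendsto_le[OF trivial_limit_at_left_real up] by blast
      then show ?thesis using 1 by simp
    next
      case 3
      have "((\<lambda>d. \<bar>u d - u y - L * (d - y)\<bar>) \<longlongrightarrow> \<bar>u x - u y - L * (x - y)\<bar>) (at_right x)"
        by (intro tendsto_intros uL)
      moreover have up: "((\<lambda>d. e * (d - y)) \<longlongrightarrow> e * (x - y)) (at_right x)" by (intro tendsto_intros)
      moreover have "eventually (\<lambda>d. \<bar>u d - u y - L * (d - y)\<bar> \<le> e * (d - y)) (at_right x)"
        unfolding eventually_at_right_field using \<eta> 3 y by (intro exI[of _ "x + \<eta>"]) auto
      ultimately have "\<bar>u x - u y - L * (x - y)\<bar> \<le> e * (x - y)"
        using tendsto_le[OF trivial_limit_at_right_real up] by blast
      moreover have "u y - u x - L * (y - x) = - (u x - u y - L * (x - y))" by (simp add: algebra_simps)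
      ultimately show ?thesis using 3 by (simp add: abs_minus_commute[of y x])
    qed simp
  qed
qed

text \<open>The derivative at \<open>x\<close> is the supremum \<open>L\<close> of the slopes that
  are exceeded on arbitrarily short intervals around \<open>x\<close>. Off \<open>N2\<close> and
  \<open>N3\<close> it is finite. Off \<open>N1\<close> no rational slope below \<open>L\<close> can
  be undercut on arbitrarily short intervals, so all short intervals around \<open>x\<close> have
  slope close to \<open>L\<close>.\<close>

lemma abs_cont_real_differentiable_ae:
  fixes u :: "real \<Rightarrow> real"
  assumes ac: "abs_cont {a..b} u"
  obtains N where "negligible N" "\<And>x. x \<in> {a<..<b} - N \<Longrightarrow> \<exists>D. (u has_real_derivative D) (at x)"
proof -
  define S where "S P x \<longleftrightarrow> (\<forall>\<eta>>0. \<exists>c d. a \<le> c \<and> c < x \<and> x < d \<and> d \<le> b \<and> d - c < \<eta> \<and> P c d)"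
    for P :: "real \<Rightarrow> real \<Rightarrow> bool" and x
  define A where "A p = S (\<lambda>c d. u d - u c < p * (d - c))" for p
  define B where "B q = S (\<lambda>c d. q * (d - c) < u d - u c)" for q
  define N1 where "N1 = (\<Union>(p, q)\<in>{(p, q). p \<in> \<rat> \<and> q \<in> \<rat> \<and> p < q}. {x. A p x} \<inter> {x. B q x})"
  define N2 where "N2 = {x. \<forall>n::nat. B (real n) x}"
  define N3 where "N3 = {x. \<forall>n::nat. A (- real n) x}"
  have "negligible N1" unfolding N1_def
  proof (rule negligible_countable_Union)
    have "countable (\<rat> \<times> \<rat> :: (real \<times> real) set)" by (intro countable_SIGMA countable_rat)
    then show "countable ((\<lambda>(p, q). {x. A p x} \<inter> {x. B q x}) ` {(p, q). p \<in> \<rat> \<and> q \<in> \<rat> \<and> p < q})"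
      by (intro countable_image) (erule countable_subset[rotated], auto)
    show "negligible X" if "X \<in> (\<lambda>(p, q). {x. A p x} \<inter> {x. B q x}) ` {(p, q). p \<in> \<rat> \<and> q \<in> \<rat> \<and> p < q}" for X
      using that abs_cont_slopes_null[OF ac] by (auto simp: A_def B_def S_def)
  qed
  moreover have "negligible N2"
    using abs_cont_steep_null[OF ac] by (simp add: N2_def B_def S_def)
  moreover have "abs_cont {a..b} (\<lambda>x. - u x)"
    by (rule abs_cont_mono[OF ac, where C = 1]) simp
  then have "negligible N3"
    using abs_cont_steep_null[of a b "\<lambda>x. - u x"]
      by (simp add: N3_def A_def S_def less_diff_eq diff_less_eq algebra_simps)
  ultimately have "negligible (N1 \<union> N2 \<union> N3)" by (intro negligible_Un)
  moreover have "\<exists>D. (u has_real_derivative D) (at x)" if x: "x \<in> {a<..<b} - (N1 \<union> N2 \<union> N3)" for x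
  proof -
    have notS: "\<exists>\<eta>>0. \<forall>c d. a \<le> c \<and> c < x \<and> x < d \<and> d \<le> b \<and> d - c < \<eta> \<longrightarrow> \<not> P c d" if "\<not> S P x" for P
      using that unfolding S_def by blast
    have SI: "S P x" if P: "0 < \<eta>" "\<And>c d. a \<le> c \<Longrightarrow> c < x \<Longrightarrow> x < d \<Longrightarrow> d \<le> b \<Longrightarrow> d - c < \<eta> \<Longrightarrow> P c d" for P \<eta>
      unfolding S_def
    proof (intro allI impI)
      fix \<eta>' :: real assume "0 < \<eta>'"
      define r where "r = min (min \<eta> \<eta>') (min (x - a) (b - x)) / 3"
      have r: "r > 0" "3 * r \<le> \<eta>" "3 * r \<le> \<eta>'" "r < x - a" "r < b - x" unfolding r_def using P(1) \<open>0 < \<eta>'\<close> x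
        by auto
      show "\<exists>c d. a \<le> c \<and> c < x \<and> x < d \<and> d \<le> b \<and> d - c < \<eta>' \<and> P c d"
        using r by (intro exI[of _ "x - r"] exI[of _ "x + r"]) (auto intro!: P(2))
    qed
    have anti: "B q' x" if "B q x" "q' \<le> q" for q q'
      unfolding B_def S_def
    proof (intro allI impI)
      fix \<eta> :: real assume "0 < \<eta>"
      then obtain c d where cd: "a \<le> c" "c < x" "x < d" "d \<le> b" "d - c < \<eta>" "q * (d - c) < u d - u c"
        using \<open>B q x\<close> unfolding B_def S_def by blast
      have "q' * (d - c) \<le> q * (d - c)" using \<open>q' \<le> q\<close> cd by (intro mult_right_mono) auto
      then have "q' * (d - c) < u d - u c" using cd by linarith
      then show "\<exists>c d. a \<le> c \<and> c < x \<and> x < d \<and> d \<le> b \<and> d - c < \<eta> \<and> q' * (d - c) < u d - u c"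
        using cd by blast
    qed
    obtain n :: nat where n: "\<not> B (real n) x" using x by (auto simp: N2_def)
    obtain k :: nat where k: "\<not> A (- real k) x" using x by (auto simp: N3_def)
    obtain \<eta>k where \<eta>k: "\<eta>k > 0" "\<And>c d. a \<le> c \<Longrightarrow> c < x \<Longrightarrow> x < d \<Longrightarrow> d \<le> b \<Longrightarrow> d - c < \<eta>k \<Longrightarrow>
      \<not> u d - u c < - real k * (d - c)"
      using notS[OF k[unfolded A_def]] by blast
    \<comment> \<open>This makes the set whose supremum is \<open>L\<close> nonempty: since slopes
      below \<open>- k\<close> do not occur on short intervals, every slope there exceeds
      \<open>- k - 1\<close>.\<close>
    have Bk: "B (- real k - 1) x" unfolding B_def
    proof (rule SI[OF \<eta>k(1)])
      fix c d assume cd: "a \<le> c" "c < x" "x < d" "d \<le> b" "d - c < \<eta>k"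
      show "(- real k - 1) * (d - c) < u d - u c" using \<eta>k(2)[OF cd] cd by (simp add: algebra_simps)
    qed
    have bdd: "bdd_above {q. B q x}"
    proof (rule bdd_aboveI)
      fix q assume "q \<in> {q. B q x}"
      then show "q \<le> real n" using n anti[of q "real n"] by force
    qed
    define L where "L = Sup {q. B q x}"
    have up: "\<not> B q x" if "L < q" for q
      using that cSup_upper[OF _ bdd, of q] by (auto simp: L_def)
    have low: "B q x" if qL: "q < L" for q
    proof -
      obtain q' where "B q' x" "q < q'" using less_cSupD[of "{q. B q x}" q] qL Bk by (auto simp: L_def)
      then show ?thesis using anti by auto
    qed
    have notA: "\<not> A p x" if pQ: "p \<in> \<rat>" "p < L" for p
    proof
      assume "A p x"
      obtain q where q: "q \<in> \<rat>" "p < q" "q < L" using Rats_dense_in_real[OF pQ(2)] by auto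
      have "x \<in> N1" unfolding N1_def using pQ q low[OF q(3)] \<open>A p x\<close> by blast
      then show False using x by blast
    qed
    have "(u has_real_derivative L) (at x)"
    proof (rule straddle_imp_derivative)
      show "isCont u x"
        using abs_cont_continuous_on[OF ac] x continuous_on_interior[of "{a..b}" u x]
          by (simp add: interior_atLeastAtMost_real)
      fix e :: real assume e: "0 < e"
      obtain p where p: "p \<in> \<rat>" "L - e < p" "p < L" using Rats_dense_in_real[of "L - e" L] e by auto
      obtain \<eta>1 where \<eta>1: "\<eta>1 > 0" "\<And>c d. a \<le> c \<Longrightarrow> c < x \<Longrightarrow> x < d \<Longrightarrow> d \<le> b \<Longrightarrow> d - c < \<eta>1 \<Longrightarrow>
        \<not> u d - u c < p * (d - c)"
        using notS[OF notA[OF p(1,3), unfolded A_def]] by blast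
      have "\<not> B (L + e) x" using up e by simp
      then obtain \<eta>2 where \<eta>2: "\<eta>2 > 0" "\<And>c d. a \<le> c \<Longrightarrow> c < x \<Longrightarrow> x < d \<Longrightarrow> d \<le> b \<Longrightarrow> d - c < \<eta>2 \<Longrightarrow> \<not> (L + e) * (d - c)
        < u d - u c"
        using notS[of "\<lambda>c d. (L + e) * (d - c) < u d - u c"] unfolding B_def by blast
      define \<eta> where "\<eta> = min (min \<eta>1 \<eta>2) (min (x - a) (b - x)) / 2"
      have \<eta>: "\<eta> > 0" "2 * \<eta> \<le> \<eta>1" "2 * \<eta> \<le> \<eta>2" "\<eta> < x - a" "\<eta> < b - x" unfolding \<eta>_def using \<eta>1(1) \<eta>2(1) x
        by auto
      show "\<exists>\<eta>>0. \<forall>c d. x - \<eta> < c \<and> c < x \<and> x < d \<and> d < x + \<eta> \<longrightarrow> \<bar>u d - u c - L * (d - c)\<bar> \<le> e * (d - c)"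
      proof (intro exI[of _ \<eta>] conjI allI impI \<eta>(1), elim conjE)
        fix c d assume cd: "x - \<eta> < c" "c < x" "x < d" "d < x + \<eta>"
        have 1: "p * (d - c) \<le> u d - u c" using \<eta>1(2)[of c d] cd \<eta> by auto
        have 2: "u d - u c \<le> (L + e) * (d - c)" using \<eta>2(2)[of c d] cd \<eta> by auto
        have "(L - e) * (d - c) \<le> p * (d - c)" using p cd by (intro mult_right_mono) auto
        with 1 2 show "\<bar>u d - u c - L * (d - c)\<bar> \<le> e * (d - c)"
          unfolding abs_le_iff by (simp add: distrib_right left_diff_distrib)
      qed
    qed
    then show ?thesis by blast
  qed
  ultimately show thesis by (rule that)
qed

lemma abs_cont_differentiable_ae:
  fixes u :: "real \<Rightarrow> complex"
  assumes ac: "abs_cont {a..b} u"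
  obtains N where "negligible N" "\<And>x. x \<in> {a<..<b} - N \<Longrightarrow> \<exists>D. (u has_vector_derivative D) (at x)"
proof -
  have "abs_cont {a..b} (\<lambda>x. Re (u x))" "abs_cont {a..b} (\<lambda>x. Im (u x))"
    by (rule abs_cont_mono[OF ac, where C = 1], simp add: abs_Re_le_cmod abs_Im_le_cmod flip:
      minus_complex.sel)+
  then obtain N1 N2 where N: "negligible N1"
    "\<And>x. x \<in> {a<..<b} - N1 \<Longrightarrow> \<exists>D. ((\<lambda>x. Re (u x)) has_real_derivative D) (at x)"
      "negligible N2" "\<And>x. x \<in> {a<..<b} - N2 \<Longrightarrow> \<exists>D. ((\<lambda>x. Im (u x)) has_real_derivative D) (at x)"
    using abs_cont_real_differentiable_ae[of a b "\<lambda>x. Re (u x)"] abs_cont_real_differentiable_ae[of a b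
      "\<lambda>x. Im (u x)"] by metis
  show thesis
  proof (rule that[of "N1 \<union> N2"])
    show "negligible (N1 \<union> N2)" using N by (intro negligible_Un)
    fix x assume "x \<in> {a<..<b} - (N1 \<union> N2)"
    then obtain D1 D2 where "((\<lambda>x. Re (u x)) has_real_derivative D1) (at x)"
      "((\<lambda>x. Im (u x)) has_real_derivative D2) (at x)"
      using N(2)[of x] N(4)[of x] by auto
    then have
      "((\<lambda>x. complex_of_real (Re (u x)) + \<i> * complex_of_real (Im (u x))) has_vector_derivative (of_real D1
      + \<i> * of_real D2)) (at x)"
      by (intro derivative_intros has_vector_derivative_of_real) (auto simp:
        has_real_derivative_iff_has_vector_derivative)
    then have "(u has_vector_derivative (of_real D1 + \<i> * of_real D2)) (at x)" by (simp flip: complex_eq)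
    then show "\<exists>D. (u has_vector_derivative D) (at x)" ..
  qed
qed

text \<open>The gauge integral is used because it requires no integrability of \<open>u'\<close> in
  advance. The gauge confines the intervals with tags in \<open>N\<close> to an open set of measure
  below \<delta>, where absolute continuity makes the increments small; at the other tags the
  definition of the derivative does.\<close>

lemma abs_cont_has_integral:
  fixes u :: "real \<Rightarrow> complex"
  assumes ac: "abs_cont {a..b} u" and ab: "a \<le> b" and N: "negligible N"
    and D: "\<And>x. x \<in> {a..b} - N \<Longrightarrow> (u has_vector_derivative u' x) (at x)"
  shows "((\<lambda>x. if x \<in> N then 0 else u' x) has_integral (u b - u a)) {a..b}"
  unfolding has_integral_real
proof (intro allI impI)
  fix e :: real assume e: "0 < e"
  have "0 < e / 2" using e by simp
  from abs_contD[OF ac this] obtain \<delta> where d: "\<delta> > 0"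
    "\<And>d S. \<lbrakk>d division_of S; S \<subseteq> {a..b}; (\<Sum>k\<in>d. Sup k - Inf k) < \<delta>\<rbrakk> \<Longrightarrow> (\<Sum>k\<in>d. norm (u (Sup k) - u (Inf k)))
      < e / 2" by blast
  define e1 where "e1 = e / (2 * (b - a + 1))"
  have e1: "e1 > 0" "e1 * (b - a) \<le> e / 2" using e ab by (auto simp: e1_def field_simps)
  obtain O' where O: "open O'" "N \<subseteq> O'" "O' \<in> lmeasurable" "measure lebesgue O' < \<delta>"
    using lmeasurable_outer_open[OF negligible_imp_measurable[OF N] d(1)] negligible_imp_measure0[OF N] by auto
  have "\<exists>r>0. (x \<in> N \<longrightarrow> ball x r \<subseteq> O') \<and>
      (x \<in> {a..b} - N \<longrightarrow> (\<forall>y. norm (y - x) < r \<longrightarrow> norm (u y - u x - (y - x) *\<^sub>R u' x) \<le> e1 * norm (y - x)))" for x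
  proof -
    consider "x \<in> N" | "x \<in> {a..b} - N" | "x \<notin> N" "x \<notin> {a..b} - N" by blast
    then show ?thesis
    proof cases
      case 1
      then obtain r where "r > 0" "ball x r \<subseteq> O'" using O open_contains_ball by blast
      then show ?thesis using 1 by blast
    next
      case 2
      from D[OF 2] obtain r where "r > 0" "\<forall>y. norm (y - x) < r \<longrightarrow> norm (u y - u x - (y - x) *\<^sub>R u' x)
        \<le> e1 * norm (y - x)"
        unfolding has_vector_derivative_def has_derivative_at_alt using e1(1) by blast
      then show ?thesis using 2 by blast
    next
      case 3 then show ?thesis by (intro exI[of _ 1]) auto
    qed
  qed
  then obtain r where r: "\<And>x. r x > 0" "\<And>x. x \<in> N \<Longrightarrow> ball x (r x) \<subseteq> O'"
    "\<And>x y. x \<in> {a..b} - N \<Longrightarrow> norm (y - x) < r x \<Longrightarrow> norm (u y - u x - (y - x) *\<^sub>R u' x) \<le> e1 * norm (y - x)"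
    by metis
  let ?f = "\<lambda>x. if x \<in> N then 0 else u' x"
  show "\<exists>\<gamma>. gauge \<gamma> \<and> (\<forall>p. p tagged_division_of {a..b} \<and> \<gamma> fine p \<longrightarrow>
        norm ((\<Sum>(x, k)\<in>p. measure lborel k *\<^sub>R ?f x) - (u b - u a)) < e)"
  proof (intro exI[of _ "\<lambda>x. ball x (r x)"] conjI allI impI)
    show "gauge (\<lambda>x. ball x (r x))" using r(1) by (intro gauge_ball_dependent) auto
    fix p assume p: "p tagged_division_of {a..b} \<and> (\<lambda>x. ball x (r x)) fine p"
    then have pt: "p tagged_division_of {a..b}" and pf: "(\<lambda>x. ball x (r x)) fine p" by auto
    define g where "g k = (if k = {} then 0 else norm (u (Sup k) - u (Inf k)))" for k
    have cell: "norm (measure lborel k *\<^sub>R ?f x - (u (Sup k) - u (Inf k))) \<le> e1 * measure lborel k + (if x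
      \<in> N then g k else 0)"
      if xk: "(x, k) \<in> p" for x k
    proof -
      obtain c d where k: "k = {c..d}" "x \<in> k" "k \<subseteq> {a..b}"
        using tagged_division_ofD(2,3,4)[OF pt xk] by (metis box_real(2))
      then have cd: "c \<le> x" "x \<le> d" "c \<le> d" by auto
      have kb: "k \<subseteq> ball x (r x)" using fineD[OF pf xk] .
      have k': "Sup k = d" "Inf k = c" "measure lborel k = d - c" "k \<noteq> {}" using cd k by auto
      show ?thesis
      proof (cases "x \<in> N")
        case True then show ?thesis using k' e1(1) cd by (simp add: g_def norm_minus_commute)
      next
        case False
        then have x: "x \<in> {a..b} - N" using k by auto
        have "c \<in> k" "d \<in> k" using k(1) cd by auto
        then have "c \<in> ball x (r x)" "d \<in> ball x (r x)" using kb by auto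
        then have 1: "norm (u d - u x - (d - x) *\<^sub>R u' x) \<le> e1 * (d - x)"
          "norm (u c - u x - (c - x) *\<^sub>R u' x) \<le> e1 * (x - c)"
          using r(3)[OF x, of d] r(3)[OF x, of c] cd by (auto simp: dist_real_def)
        have eq:
          "(d - c) *\<^sub>R u' x - (u d - u c) = (u c - u x - (c - x) *\<^sub>R u' x) - (u d - u x - (d - x) *\<^sub>R u' x)"
          by (simp add: algebra_simps)
        have "norm ((d - c) *\<^sub>R u' x - (u d - u c)) \<le> e1 * (x - c) + e1 * (d - x)"
          unfolding eq
          using norm_triangle_ineq4[of "u c - u x - (c - x) *\<^sub>R u' x" "u d - u x - (d - x) *\<^sub>R u' x"] 1
            by linarith
        moreover have "e1 * (x - c) + e1 * (d - x) = e1 * (d - c)" by (simp add: algebra_simps)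
        ultimately have "norm ((d - c) *\<^sub>R u' x - (u d - u c)) \<le> e1 * (d - c) + 0" by linarith
        then show ?thesis using False unfolding k'(1-3) by simp
      qed
    qed
    have "(\<Sum>(x, k)\<in>p. measure lborel k *\<^sub>R ?f x) - (u b - u a) = (\<Sum>(x, k)\<in>p. measure lborel k *\<^sub>R ?f x)
      - (\<Sum>(x, k)\<in>p. u (Sup k) - u (Inf k))"
      using additive_tagged_division_1[OF ab pt, of u] by simp
    also have "\<dots> = (\<Sum>(x, k)\<in>p. measure lborel k *\<^sub>R ?f x - (u (Sup k) - u (Inf k)))"
      by (simp add: sum_subtractf case_prod_beta)
    also have "norm \<dots> \<le> (\<Sum>(x, k)\<in>p. e1 * measure lborel k + (if x \<in> N then g k else 0))"
      by (rule sum_norm_le) (use cell in \<open>auto simp: case_prod_beta\<close>)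
    also have "\<dots> = e1 * (\<Sum>(x, k)\<in>p. measure lborel k) + (\<Sum>(x, k)\<in>p. if x \<in> N then g k else 0)"
      by (simp add: sum.distrib case_prod_beta sum_distrib_left)
    also have "(\<Sum>(x, k)\<in>p. measure lborel k) = b - a"
      using additive_content_tagged_division[of p a b] pt ab by simp
    finally have 1: "norm ((\<Sum>(x, k)\<in>p. measure lborel k *\<^sub>R ?f x) - (u b - u a))
      \<le> e / 2 + (\<Sum>(x, k)\<in>p. if x \<in> N then g k else 0)"
      using e1(2) by linarith
    define q where "q = {xk \<in> p. fst xk \<in> N}"
    have finp: "finite p" using pt by blast
    have "q tagged_partial_division_of {a..b}"
      using pt tagged_partial_division_subset[of p "{a..b}" q] by (auto simp: q_def tagged_division_of_def)
    then have qt: "q tagged_division_of \<Union>(snd ` q)" by (rule tagged_partial_division_of_Union_self)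
    have qd: "snd ` q division_of \<Union>(snd ` q)" by (rule division_of_tagged_division[OF qt])
    have qk: "k \<subseteq> {a..b} \<and> k \<subseteq> O' \<and> k \<noteq> {} \<and> (\<exists>c d. k = {c..d} \<and> c \<le> d)" if kq: "k \<in> snd ` q" for k
    proof -
      obtain x where x: "(x, k) \<in> p" "x \<in> N" using kq by (auto simp: q_def)
      have "k \<subseteq> O'" using fineD[OF pf x(1)] r(2)[OF x(2)] by blast
      moreover have "k \<subseteq> {a..b}" "x \<in> k" using tagged_division_ofD(2,3)[OF pt x(1)] by auto
      moreover obtain c d where "k = {c..d}" using tagged_division_ofD(4)[OF pt x(1)] by (metis box_real(2))
      ultimately show ?thesis by (metis atLeastatMost_empty_iff2 empty_iff)
    qed
    have "(\<Sum>(x, k)\<in>p. if x \<in> N then g k else 0) = (\<Sum>(x, k)\<in>q. g k)"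
      unfolding q_def using finp by (simp add: sum.inter_filter case_prod_beta)
    also have "\<dots> = (\<Sum>k\<in>snd ` q. g k)"
    proof (rule sum.over_tagged_division_lemma[OF qt])
      show "g (cbox v w) = 0" if "box v w = {}" for v w :: real
        using that by (cases "v = w") (auto simp: g_def)
    qed
    also have "\<dots> = (\<Sum>k\<in>snd ` q. norm (u (Sup k) - u (Inf k)))"
      by (rule sum.cong[OF refl]) (use qk in \<open>auto simp: g_def\<close>)
    also have "\<dots> < e / 2"
    proof (rule d(2)[OF qd])
      show "\<Union>(snd ` q) \<subseteq> {a..b}" using qk by blast
      have "(\<Sum>k\<in>snd ` q. Sup k - Inf k) = (\<Sum>k\<in>snd ` q. measure lebesgue k)"
        by (rule sum.cong[OF refl]) (use qk in force)
      also have "\<dots> = measure lebesgue (\<Union>(snd ` q))" using content_division[OF qd] by simp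
      also have "\<dots> \<le> measure lebesgue O'"
      proof (rule measure_mono_fmeasurable[OF _ _ O(3)])
        show "\<Union>(snd ` q) \<subseteq> O'" using qk by blast
        show "\<Union>(snd ` q) \<in> sets lebesgue"
        proof (rule sets.finite_Union)
          show "finite (snd ` q)" using finp by (simp add: q_def)
          show "snd ` q \<subseteq> sets lebesgue"
          proof
            fix k assume "k \<in> snd ` q"
            from qk[OF this] obtain c d where "k = {c..d}" by blast
            then show "k \<in> sets lebesgue" by simp
          qed
        qed
      qed
      also have "\<dots> < \<delta>" by (rule O(4))
      finally show "(\<Sum>k\<in>snd ` q. Sup k - Inf k) < \<delta>" .
    qed
    finally show "norm ((\<Sum>(x, k)\<in>p. measure lborel k *\<^sub>R ?f x) - (u b - u a)) < e" using 1 by linarith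
  qed
qed

lemma AE_lborel_negligible:
  assumes "AE x in lborel. P x" obtains N where "negligible N" "\<And>x. x \<notin> N \<Longrightarrow> P x"
proof -
  obtain N where N: "{x \<in> space lborel. \<not> P x} \<subseteq> N" "emeasure lborel N = 0" "N \<in> sets lborel"
    using assms by (rule AE_E)
  then have "N \<in> null_sets lebesgue" using null_sets_completionI[of N lborel] by auto
  then show thesis using that[of N] N(1) by (auto simp: negligible_iff_null_sets)
qed

text \<open>In this form the length estimate needs only a measurable majorant with values in
  [0, \<infinity>]. If its integral is finite, the gauge integral of the derivative is dominated by
  that of the finite version of \<open>g\<close>.\<close>

lemma abs_cont_increment_le:
  fixes u :: "real \<Rightarrow> complex" and g :: "real \<Rightarrow> ennreal"
  assumes ac: "abs_cont {a..b} u" and ab: "a \<le> b" and g[measurable]: "g \<in> borel_measurable borel"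
    and D: "AE x in lborel. a < x \<and> x < b \<longrightarrow> (\<forall>D. (u has_vector_derivative D) (at x) \<longrightarrow> ennreal (norm D) \<le> g x)"
  shows "ennreal (norm (u b - u a)) \<le> (\<integral>\<^sup>+x\<in>{a..b}. g x \<partial>lborel)"
proof (cases "(\<integral>\<^sup>+x\<in>{a..b}. g x \<partial>lborel) = \<infinity>")
  case False
  obtain N1 where N1: "negligible N1" "\<And>x. x \<in> {a<..<b} - N1 \<Longrightarrow> \<exists>D. (u has_vector_derivative D) (at x)"
    using abs_cont_differentiable_ae[OF ac] by blast
  obtain N2 where N2: "negligible N2" "\<And>x. x \<notin> N2 \<Longrightarrow> a < x \<and> x < b \<longrightarrow> (\<forall>D. (u has_vector_derivative D) (at x) \<longrightarrow>
    ennreal (norm D) \<le> g x)"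
    using AE_lborel_negligible[OF D] by blast
  let ?h = "\<lambda>x. g x * indicator {a..b} x"
  have fin: "AE x in lborel. ?h x \<noteq> \<infinity>"
    by (rule nn_integral_noteq_infinite[OF _ False]) measurable
  obtain N3 where N3: "negligible N3" "\<And>x. x \<notin> N3 \<Longrightarrow> ?h x \<noteq> \<infinity>" using AE_lborel_negligible[OF fin] by blast
  define N where "N = N1 \<union> N2 \<union> N3 \<union> {a, b}"
  have N: "negligible N" unfolding N_def using N1(1) N2(1) N3(1) by (intro negligible_Un) auto
  obtain u' where u': "\<And>x. x \<in> {a<..<b} - N1 \<Longrightarrow> (u has_vector_derivative u' x) (at x)" using N1(2) by metis
  define f where "f x = (if x \<in> N then 0 else u' x)" for x
  have "(f has_integral (u b - u a)) {a..b}" unfolding f_def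
    by (rule abs_cont_has_integral[OF ac ab N]) (rule u', auto simp: N_def)
  then have fi: "((\<lambda>x. if x \<in> {a..b} then f x else 0) has_integral (u b - u a)) UNIV"
    by (simp only: has_integral_restrict_UNIV)
  define h where "h x = enn2real (?h x)" for x
  have hm[measurable]: "h \<in> borel_measurable borel" unfolding h_def by measurable
  have "(\<integral>\<^sup>+x. ennreal (h x) \<partial>lborel) = (\<integral>\<^sup>+x. ?h x \<partial>lborel)"
    by (rule nn_integral_cong_AE) (use fin in \<open>auto simp: h_def ennreal_enn2real_if elim!: eventually_mono\<close>)
  then have hi: "integrable lborel h" "(\<integral>\<^sup>+x. ennreal (h x) \<partial>lborel) = (\<integral>\<^sup>+x\<in>{a..b}. g x \<partial>lborel)"
    using False by (auto intro!: integrableI_nonneg simp: h_def top.not_eq_extremum)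
  have hH: "(h has_integral (integral\<^sup>L lborel h)) UNIV" by (rule has_integral_integral_lborel[OF hi(1)])
  have "norm (integral UNIV (\<lambda>x. if x \<in> {a..b} then f x else 0)) \<le> integral UNIV h"
  proof (rule Henstock_Kurzweil_Integration.integral_norm_bound_integral)
    show "(\<lambda>x. if x \<in> {a..b} then f x else 0) integrable_on UNIV" "h integrable_on UNIV" using fi hH by blast+
    fix x :: real
    show "norm (if x \<in> {a..b} then f x else 0) \<le> h x"
    proof (cases "x \<in> {a..b} - N")
      case True
      then have x: "x \<in> {a<..<b} - N1" "x \<notin> N2" "x \<notin> N3" "x \<notin> N" by (auto simp: N_def)
      have "ennreal (norm (u' x)) \<le> g x" using N2(2)[OF x(2)] u'[OF x(1)] x(1) by auto
      moreover have "g x \<noteq> \<infinity>" using N3(2)[OF x(3)] x(1) by auto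
      ultimately have "norm (u' x) \<le> enn2real (g x)"
        by (metis enn2real_ennreal enn2real_mono norm_ge_zero infinity_ennreal_def top.not_eq_extremum)
      then show ?thesis using x(1,4) by (simp add: f_def h_def)
    next
      case False then show ?thesis by (auto simp: f_def h_def enn2real_nonneg)
    qed
  qed
  then have "norm (u b - u a) \<le> integral\<^sup>L lborel h" using integral_unique[OF fi] integral_unique[OF hH] by simp
  then have "ennreal (norm (u b - u a)) \<le> ennreal (integral\<^sup>L lborel h)" by (rule ennreal_leI)
  also have "\<dots> = (\<integral>\<^sup>+x. ennreal (h x) \<partial>lborel)"
    by (rule nn_integral_eq_integral[symmetric, OF hi(1)]) (simp add: h_def)
  finally show ?thesis using hi(2) by simp
qed simp

section \<open>Differentiability almost everywhere of ACL homeomorphisms\<close>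

lemma measure_cbox_complex:
  assumes "a \<le> c" "b \<le> d" shows "measure lebesgue (cbox (Complex a b) (Complex c d)) = (c - a) * (d - b)"
  using assms content_cbox[of "Complex a b" "Complex c d"] by (simp add: Basis_complex_def)

text \<open>The differentiation theorem is applied to squares with lower left corner
  \<open>z\<close>, whence the first quadrant. A rectangle of relative area \<eta> that misses
  \<open>E\<close> would push the density of \<open>E\<close> in its square down to
  \<open>1 - \<eta>\<close>.\<close>

lemma density_first_quadrant:
  fixes E :: "complex set"
  assumes E: "closed E"
  obtains N where "negligible N" "\<And>z \<eta>. z \<in> E - N \<Longrightarrow> 0 < \<eta> \<Longrightarrow> \<exists>\<theta>>0. \<forall>s a b c d. 0 < s \<and> s < \<theta> \<and>
      0 \<le> a \<and> a \<le> c \<and> c \<le> s \<and> 0 \<le> b \<and> b \<le> d \<and> d \<le> s \<and> \<eta> * s\<^sup>2 \<le> (c - a) * (d - b) \<longrightarrow>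
      (\<exists>x y. a \<le> x \<and> x \<le> c \<and> b \<le> y \<and> y \<le> d \<and> z + Complex x y \<in> E)"
proof -
  have Eb: "E \<inter> cbox a b \<in> lmeasurable" for a b
    using E by (simp add: fmeasurable_Int_fmeasurable Int_commute[of E])
  have int: "(indicat_real E) integrable_on cbox a b"
    and ie: "integral (cbox a b) (indicat_real E) = measure lebesgue (E \<inter> cbox a b)" for a b
    using Eb[of a b] by (simp_all add: integrable_on_indicator integral_indicator)
  obtain N where N: "negligible N"
     "\<And>x e. \<lbrakk>x \<notin> N; 0 < e\<rbrakk> \<Longrightarrow> \<exists>d>0. \<forall>h. 0 < h \<and> h < d \<longrightarrow>
                         norm(integral (cbox x (x + h *\<^sub>R One)) (indicat_real E) /\<^sub>R h ^ DIM(complex) -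
                           indicat_real E x) < e"
    using integrable_ccontinuous_explicit[OF int] by blast
  show thesis
  proof (rule that[OF N(1)])
    fix z :: complex and \<eta> :: real assume z: "z \<in> E - N" and \<eta>: "0 < \<eta>"
    then obtain \<theta> where \<theta>: "\<theta> > 0"
      "\<And>h. 0 < h \<Longrightarrow> h < \<theta> \<Longrightarrow> norm(integral (cbox z (z + h *\<^sub>R One)) (indicat_real E) /\<^sub>R h ^ DIM(complex)
      - indicat_real E z) < \<eta>"
      using N(2)[of z \<eta>] by blast
    show "\<exists>\<theta>>0. \<forall>s a b c d. 0 < s \<and> s < \<theta> \<and>
      0 \<le> a \<and> a \<le> c \<and> c \<le> s \<and> 0 \<le> b \<and> b \<le> d \<and> d \<le> s \<and> \<eta> * s\<^sup>2 \<le> (c - a) * (d - b) \<longrightarrow>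
      (\<exists>x y. a \<le> x \<and> x \<le> c \<and> b \<le> y \<and> y \<le> d \<and> z + Complex x y \<in> E)"
    proof (rule exI[of _ \<theta>], intro conjI \<theta>(1) allI impI, elim conjE, rule ccontr)
      fix s a b c d assume s: "0 < s" "s < \<theta>" and r: "0 \<le> a" "a \<le> c" "c \<le> s" "0 \<le> b" "b \<le> d" "d \<le> s"
        "\<eta> * s\<^sup>2 \<le> (c - a) * (d - b)"
        and no: "\<not> (\<exists>x y. a \<le> x \<and> x \<le> c \<and> b \<le> y \<and> y \<le> d \<and> z + Complex x y \<in> E)"
      define Q where "Q = cbox z (z + s *\<^sub>R One)"
      define B where "B = cbox (Complex (Re z + a) (Im z + b)) (Complex (Re z + c) (Im z + d))"
      have One: "One = Complex 1 1" by (simp add: Basis_complex_def complex_eq_iff)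
      have Q: "Q = cbox (Complex (Re z) (Im z)) (Complex (Re z + s) (Im z + s))"
        unfolding Q_def One by (simp add: complex_eq_iff cbox_def Basis_complex_def)
      have BQ: "B \<subseteq> Q" unfolding B_def Q using r by (auto simp: in_cbox_complex_iff)
      have "v \<notin> E" if "v \<in> B" for v
      proof
        assume "v \<in> E"
        moreover have "v = z + Complex (Re v - Re z) (Im v - Im z)" by (simp add: complex_eq_iff)
        ultimately show False using no that by (auto simp: B_def in_cbox_complex_iff)
          (metis add.commute le_diff_eq diff_le_eq)
      qed
      then have dis: "B \<inter> (E \<inter> Q) = {}" by blast
      have "measure lebesgue B + measure lebesgue (E \<inter> Q) = measure lebesgue (B \<union> (E \<inter> Q))"
        using measure_Un3[of B lebesgue "E \<inter> Q"] dis Eb by (simp add: B_def Q)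
      also have "\<dots> \<le> measure lebesgue Q"
        using BQ Eb
          by (intro measure_mono_fmeasurable) (auto simp: B_def Q_def intro!: fmeasurableD fmeasurable.Un)
      also have "\<dots> = s\<^sup>2" unfolding Q using measure_cbox_complex[of "Re z" "Re z + s" "Im z" "Im z + s"] s
        by (simp add: power2_eq_square)
      finally have 1: "measure lebesgue B + measure lebesgue (E \<inter> Q) \<le> s\<^sup>2" .
      have "measure lebesgue B = (c - a) * (d - b)" unfolding B_def
        using measure_cbox_complex[of "Re z + a" "Re z + c" "Im z + b" "Im z + d"] r by simp
      then have 2: "\<eta> * s\<^sup>2 \<le> measure lebesgue B" using r(7) by simp
      have "integral Q (indicat_real E) = measure lebesgue (E \<inter> Q)" unfolding Q_def by (rule ie)
      then have "\<bar>measure lebesgue (E \<inter> Q) / s\<^sup>2 - 1\<bar> < \<eta>"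
        using \<theta>(2)[OF s] z unfolding Q_def[symmetric] by (simp add: divide_inverse mult.commute)
      then have "1 - \<eta> < measure lebesgue (E \<inter> Q) / s\<^sup>2" by linarith
      then have "(1 - \<eta>) * s\<^sup>2 < measure lebesgue (E \<inter> Q)" using s by (simp add: pos_less_divide_eq)
      then show False using 1 2 by (simp add: left_diff_distrib)
    qed
  qed
qed

(* A consequence of being a density point: every relatively wide strip in a small square around z meets E. *)
definition thick_at :: "complex set \<Rightarrow> complex \<Rightarrow> bool" where
  "thick_at E z \<longleftrightarrow> (\<forall>\<eta>>0. \<exists>\<theta>>0. \<forall>s p q. 0 < s \<and> s < \<theta> \<and> - s \<le> p \<and> q \<le> s \<and> \<eta> * s \<le> q - p \<longrightarrow>
     (\<exists>x y. p \<le> x \<and> x \<le> q \<and> \<bar>y\<bar> \<le> s \<and> z + Complex x y \<in> E) \<and> (\<exists>x y. \<bar>x\<bar> \<le> s \<and> p \<le> y \<and> y \<le> q \<and> z + Complex x y \<in>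
       E))"

text \<open>The reflections \<open>cnj\<close> and \<open>- cnj\<close> carry the density statement
  to two further quadrants. At least half of a strip in the square lies on one side of the axis
  parallel to it, and a rectangle in a single quadrant can be cut from this half; therefore the
  quadrant statement is used with \<open>\<eta> / 2\<close>.\<close>

lemma thick_at_ae:
  assumes E: "closed E"
  obtains N where "negligible N" "\<And>z. z \<in> E - N \<Longrightarrow> thick_at E z"
proof -
  have refl: "\<exists>N. negligible N \<and> (\<forall>z\<in>E - N. \<forall>\<eta>>0. \<exists>\<theta>>0. \<forall>s a b c d. 0 < s \<and> s < \<theta> \<and>
      0 \<le> a \<and> a \<le> c \<and> c \<le> s \<and> 0 \<le> b \<and> b \<le> d \<and> d \<le> s \<and> \<eta> * s\<^sup>2 \<le> (c - a) * (d - b) \<longrightarrow>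
      (\<exists>x y. a \<le> x \<and> x \<le> c \<and> b \<le> y \<and> y \<le> d \<and> z + \<sigma> (Complex x y) \<in> E))"
    if lin: "linear \<sigma>" and inv: "\<And>v. \<sigma> (\<sigma> v) = v" for \<sigma> :: "complex \<Rightarrow> complex"
  proof -
    have im: "\<sigma> ` S = \<sigma> -` S" for S using inv by (auto simp: image_iff) metis
    have "closed (\<sigma> ` E)" unfolding im
      using E linear_continuous_on[of \<sigma> UNIV] lin
        by (intro continuous_closed_vimage) (auto simp: linear_conv_bounded_linear
        continuous_on_eq_continuous_at)
    then obtain N where N: "negligible N" "\<And>z \<eta>. z \<in> \<sigma> ` E - N \<Longrightarrow> 0 < \<eta> \<Longrightarrow> \<exists>\<theta>>0. \<forall>s a b c d. 0 < s \<and> s < \<theta> \<and>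
      0 \<le> a \<and> a \<le> c \<and> c \<le> s \<and> 0 \<le> b \<and> b \<le> d \<and> d \<le> s \<and> \<eta> * s\<^sup>2 \<le> (c - a) * (d - b) \<longrightarrow>
      (\<exists>x y. a \<le> x \<and> x \<le> c \<and> b \<le> y \<and> y \<le> d \<and> z + Complex x y \<in> \<sigma> ` E)" by (rule density_first_quadrant) blast
    have mem: "\<sigma> z + v \<in> \<sigma> ` E \<longleftrightarrow> z + \<sigma> v \<in> E" for z v
      unfolding im using lin inv by (simp add: linear_add)
    show ?thesis
    proof (intro exI[of _ "\<sigma> ` N"] conjI ballI allI impI)
      obtain B where B: "\<And>v. norm (\<sigma> v) \<le> B * norm v" using linear_bounded[OF lin] by blast
      show "negligible (\<sigma> ` N)"
        by (rule negligible_locally_Lipschitz_image[OF _ N(1)])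
          (use B lin in \<open>auto simp: linear_diff[symmetric] intro!: exI[of _ UNIV]\<close>)
      fix z \<eta> assume z: "z \<in> E - \<sigma> ` N" and \<eta>: "(0::real) < \<eta>"
      have "\<sigma> z \<in> \<sigma> ` E - N" using z inv by (auto simp: image_iff)
      from N(2)[OF this \<eta>] show "\<exists>\<theta>>0. \<forall>s a b c d. 0 < s \<and> s < \<theta> \<and>
      0 \<le> a \<and> a \<le> c \<and> c \<le> s \<and> 0 \<le> b \<and> b \<le> d \<and> d \<le> s \<and> \<eta> * s\<^sup>2 \<le> (c - a) * (d - b) \<longrightarrow>
      (\<exists>x y. a \<le> x \<and> x \<le> c \<and> b \<le> y \<and> y \<le> d \<and> z + \<sigma> (Complex x y) \<in> E)" unfolding mem .
    qed
  qed
  have lc: "linear cnj" by (rule bounded_linear.linear[OF bounded_linear_cnj])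
  obtain N1 where N1: "negligible N1" "\<And>z \<eta>. z \<in> E - N1 \<Longrightarrow> 0 < \<eta> \<Longrightarrow> \<exists>\<theta>>0. \<forall>s a b c d. 0 < s \<and> s < \<theta> \<and>
      0 \<le> a \<and> a \<le> c \<and> c \<le> s \<and> 0 \<le> b \<and> b \<le> d \<and> d \<le> s \<and> \<eta> * s\<^sup>2 \<le> (c - a) * (d - b) \<longrightarrow>
      (\<exists>x y. a \<le> x \<and> x \<le> c \<and> b \<le> y \<and> y \<le> d \<and> z + Complex x y \<in> E)"
    by (rule density_first_quadrant[OF E]) blast
  obtain N2 where N2: "negligible N2" "\<And>z \<eta>. z \<in> E - N2 \<Longrightarrow> 0 < \<eta> \<Longrightarrow> \<exists>\<theta>>0. \<forall>s a b c d. 0 < s \<and> s < \<theta> \<and>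
      0 \<le> a \<and> a \<le> c \<and> c \<le> s \<and> 0 \<le> b \<and> b \<le> d \<and> d \<le> s \<and> \<eta> * s\<^sup>2 \<le> (c - a) * (d - b) \<longrightarrow>
      (\<exists>x y. a \<le> x \<and> x \<le> c \<and> b \<le> y \<and> y \<le> d \<and> z + cnj (Complex x y) \<in> E)"
    using refl[OF lc] by auto
  have lm: "linear (\<lambda>v. - cnj v)" using lc by (intro linear_compose_neg)
  obtain N3 where N3: "negligible N3" "\<And>z \<eta>. z \<in> E - N3 \<Longrightarrow> 0 < \<eta> \<Longrightarrow> \<exists>\<theta>>0. \<forall>s a b c d. 0 < s \<and> s < \<theta> \<and>
      0 \<le> a \<and> a \<le> c \<and> c \<le> s \<and> 0 \<le> b \<and> b \<le> d \<and> d \<le> s \<and> \<eta> * s\<^sup>2 \<le> (c - a) * (d - b) \<longrightarrow>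
      (\<exists>x y. a \<le> x \<and> x \<le> c \<and> b \<le> y \<and> y \<le> d \<and> z + - cnj (Complex x y) \<in> E)"
    using refl[OF lm] by auto
  show thesis
  proof (rule that[of "N1 \<union> N2 \<union> N3"])
    show "negligible (N1 \<union> N2 \<union> N3)" using N1(1) N2(1) N3(1) by (intro negligible_Un)
    fix z assume z: "z \<in> E - (N1 \<union> N2 \<union> N3)"
    show "thick_at E z" unfolding thick_at_def
    proof (intro allI impI)
      fix \<eta> :: real assume \<eta>: "0 < \<eta>"
      then have \<eta>2: "0 < \<eta> / 2" by simp
      have z': "z \<in> E - N1" "z \<in> E - N2" "z \<in> E - N3" using z by auto
      obtain \<theta>1 where \<theta>1: "\<theta>1 > 0" "\<And>s a b c d. 0 < s \<Longrightarrow> s < \<theta>1 \<Longrightarrow> 0 \<le> a \<Longrightarrow> a \<le> c \<Longrightarrow> c \<le> s \<Longrightarrow> 0 \<le> b \<Longrightarrow> b \<le> d \<Longrightarrow> d \<le> s \<Longrightarrow>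
        \<eta> / 2 * s\<^sup>2 \<le> (c - a) * (d - b) \<Longrightarrow>
          \<exists>x y. a \<le> x \<and> x \<le> c \<and> b \<le> y \<and> y \<le> d \<and> z + Complex x y \<in> E" using N1(2)[OF z'(1) \<eta>2] by blast
      obtain \<theta>2 where \<theta>2: "\<theta>2 > 0" "\<And>s a b c d. 0 < s \<Longrightarrow> s < \<theta>2 \<Longrightarrow> 0 \<le> a \<Longrightarrow> a \<le> c \<Longrightarrow> c \<le> s \<Longrightarrow> 0 \<le> b \<Longrightarrow> b \<le> d \<Longrightarrow> d \<le> s \<Longrightarrow>
        \<eta> / 2 * s\<^sup>2 \<le> (c - a) * (d - b) \<Longrightarrow>
          \<exists>x y. a \<le> x \<and> x \<le> c \<and> b \<le> y \<and> y \<le> d \<and> z + cnj (Complex x y) \<in> E" using N2(2)[OF z'(2) \<eta>2] by blast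
      obtain \<theta>3 where \<theta>3: "\<theta>3 > 0" "\<And>s a b c d. 0 < s \<Longrightarrow> s < \<theta>3 \<Longrightarrow> 0 \<le> a \<Longrightarrow> a \<le> c \<Longrightarrow> c \<le> s \<Longrightarrow> 0 \<le> b \<Longrightarrow> b \<le> d \<Longrightarrow> d \<le> s \<Longrightarrow>
        \<eta> / 2 * s\<^sup>2 \<le> (c - a) * (d - b) \<Longrightarrow>
          \<exists>x y. a \<le> x \<and> x \<le> c \<and> b \<le> y \<and> y \<le> d \<and> z + - cnj (Complex x y) \<in> E" using N3(2)[OF z'(3) \<eta>2] by blast
      show "\<exists>\<theta>>0. \<forall>s p q. 0 < s \<and> s < \<theta> \<and> - s \<le> p \<and> q \<le> s \<and> \<eta> * s \<le> q - p \<longrightarrow>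
        (\<exists>x y. p \<le> x \<and> x \<le> q \<and> \<bar>y\<bar> \<le> s \<and> z + Complex x y \<in> E) \<and> (\<exists>x y. \<bar>x\<bar> \<le> s \<and> p \<le> y \<and> y \<le> q \<and> z + Complex x y
          \<in> E)"
      proof (rule exI[of _ "min \<theta>1 (min \<theta>2 \<theta>3)"], intro conjI allI impI)
        show "0 < min \<theta>1 (min \<theta>2 \<theta>3)" using \<theta>1 \<theta>2 \<theta>3 by simp
        fix s p q assume "0 < s \<and> s < min \<theta>1 (min \<theta>2 \<theta>3) \<and> - s \<le> p \<and> q \<le> s \<and> \<eta> * s \<le> q - p"
        then have s: "0 < s" "s < \<theta>1" "s < \<theta>2" "s < \<theta>3" "- s \<le> p" "q \<le> s" "\<eta> * s \<le> q - p" by auto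
        have sq: "\<eta> / 2 * s\<^sup>2 \<le> l * (s - 0)" if "\<eta> * s / 2 \<le> l" for l
          using mult_right_mono[OF that, of s] s(1) by (simp add: power2_eq_square)
        have sq': "\<eta> / 2 * s\<^sup>2 \<le> (s - 0) * l" if "\<eta> * s / 2 \<le> l" for l
          using sq[OF that] by (simp add: mult.commute)
        have pos: "0 < \<eta> * s" using \<eta> s by simp
        show "\<exists>x y. p \<le> x \<and> x \<le> q \<and> \<bar>y\<bar> \<le> s \<and> z + Complex x y \<in> E"
        proof (cases "\<eta> * s / 2 \<le> q - max p 0")
          case True
          then have le: "max p 0 \<le> q" using pos by linarith
          obtain x y where "max p 0 \<le> x" "x \<le> q" "0 \<le> y" "y \<le> s" "z + Complex x y \<in> E"
            using \<theta>1(2)[OF s(1,2) _ le s(6) _ _ _ sq[OF True]] s(1) by auto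
          then show ?thesis by (intro exI[of _ x] exI[of _ y]) auto
        next
          case False
          then have F: "\<eta> * s / 2 \<le> - p - max (- q) 0" using s(7) False pos by linarith
          then have le: "max (- q) 0 \<le> - p" using pos by linarith
          have ps: "- p \<le> s" using s(5) by simp
          obtain x y where "max (- q) 0 \<le> x" "x \<le> - p" "0 \<le> y" "y \<le> s" "z + - cnj (Complex x y) \<in> E"
            using \<theta>3(2)[OF s(1,4) _ le ps _ _ _ sq[OF F]] s(1) by auto
          moreover have "- cnj (Complex x y) = Complex (- x) y" by (simp add: complex_eq_iff)
          ultimately show ?thesis by (intro exI[of _ "- x"] exI[of _ y]) auto
        qed
        show "\<exists>x y. \<bar>x\<bar> \<le> s \<and> p \<le> y \<and> y \<le> q \<and> z + Complex x y \<in> E"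
        proof (cases "\<eta> * s / 2 \<le> q - max p 0")
          case True
          then have le: "max p 0 \<le> q" using pos by linarith
          obtain x y where "0 \<le> x" "x \<le> s" "max p 0 \<le> y" "y \<le> q" "z + Complex x y \<in> E"
            using \<theta>1(2)[OF s(1,2) _ _ _ _ le s(6) sq'[OF True]] s(1) by auto
          then show ?thesis by (intro exI[of _ x] exI[of _ y]) auto
        next
          case False
          then have F: "\<eta> * s / 2 \<le> - p - max (- q) 0" using s(7) False pos by linarith
          then have le: "max (- q) 0 \<le> - p" using pos by linarith
          have ps: "- p \<le> s" using s(5) by simp
          obtain x y where "0 \<le> x" "x \<le> s" "max (- q) 0 \<le> y" "y \<le> - p" "z + cnj (Complex x y) \<in> E"
            using \<theta>2(2)[OF s(1,3) _ _ _ _ le ps sq'[OF F]] s(1) by auto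
          moreover have "cnj (Complex x y) = Complex x (- y)" by (simp add: complex_eq_iff)
          ultimately show ?thesis by (intro exI[of _ x] exI[of _ "- y"]) auto
        qed
      qed
    qed
  qed
qed

section \<open>From partial derivatives to the total derivative\<close>

lemma open_map_maximum:
  fixes F :: "complex \<Rightarrow> complex"
  assumes "continuous_on K F" "compact K" "open (F ` interior K)" "w \<in> K"
    and bd: "\<And>\<zeta>. \<zeta> \<in> K - interior K \<Longrightarrow> cmod (F \<zeta> - c) \<le> B"
  shows "cmod (F w - c) \<le> B"
proof -
  have "continuous_on K (\<lambda>\<zeta>. cmod (F \<zeta> - c))" by (intro continuous_intros assms)
  then obtain m where m: "m \<in> K" "\<And>\<zeta>. \<zeta> \<in> K \<Longrightarrow> cmod (F \<zeta> - c) \<le> cmod (F m - c)"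
    using continuous_attains_sup[OF assms(2), of "\<lambda>\<zeta>. cmod (F \<zeta> - c)"] assms(4) by auto
  \<comment> \<open>Maximum principle for open maps: near the image of an interior point there are
    image points further away from \<open>c\<close>, in the direction \<open>u\<close>.\<close>
  have "m \<notin> interior K"
  proof
    assume "m \<in> interior K"
    then obtain r where r: "r > 0" "ball (F m) r \<subseteq> F ` interior K" using assms(3)
      by (meson image_eqI open_contains_ball)
    \<comment> \<open>\<open>u\<close> is the direction from \<open>c\<close> to \<open>F m\<close>;
      if the two coincide, any direction will do.\<close>
    define u where "u = (if F m = c then 1 else sgn (F m - c))"
    have u: "cmod u = 1" "F m - c = of_real (cmod (F m - c)) * u"
      by (auto simp: u_def norm_sgn sgn_eq norm_divide)
    have "F m + of_real (r / 2) * u \<in> ball (F m) r" using r u by (simp add: dist_norm norm_mult)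
    then obtain \<zeta> where \<zeta>: "\<zeta> \<in> K" "F \<zeta> = F m + of_real (r / 2) * u" using r(2) interior_subset
      by (metis (no_types, lifting) imageE subsetD)
    have "F \<zeta> - c = of_real (cmod (F m - c) + r / 2) * u" using \<zeta>(2) u(2) by (simp add: algebra_simps)
    then have "cmod (F \<zeta> - c) = cmod (F m - c) + r / 2" using u(1) r(1)
      by (simp only: norm_mult norm_of_real) simp
    then show False using m(2)[OF \<zeta>(1)] r(1) by simp
  qed
  then show ?thesis using m bd assms(4) by (meson DiffI order_trans)
qed

text \<open>The fixed range of steps and the ball condition, which keeps the points away from the
  complement of \<open>W\<close>, make these sets closed. Countably many of them, with rational
  \<open>a\<close>, suffice to describe the points where \<open>F\<close> has a derivative in
  direction \<open>v\<close>: this gives density points as well as Borel measurability.\<close>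

definition linear_approx_set ::
  "(complex \<Rightarrow> complex) \<Rightarrow> complex set \<Rightarrow> complex \<Rightarrow> real \<Rightarrow> nat \<Rightarrow> complex \<Rightarrow> complex set" where
  "linear_approx_set F W v \<epsilon> n a =
     {z. ball z (inverse (real (Suc n))) \<subseteq> W \<and>
         (\<forall>t::real. \<bar>t\<bar> < inverse (real (Suc n)) \<longrightarrow> cmod (F (z + of_real t * v) - F z - of_real t * a) \<le> \<epsilon> *
           \<bar>t\<bar>)}"

lemma closed_linear_approx_set:
  assumes W: "open W" and F: "continuous_on W F" and v: "cmod v = 1"
  shows "closed (linear_approx_set F W v \<epsilon> n a)"
  unfolding closed_sequential_limits
proof (intro allI impI, elim conjE)
  fix X l assume X: "\<forall>k. X k \<in> linear_approx_set F W v \<epsilon> n a" and l: "X \<longlonglongrightarrow> l"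
  define r where "r = inverse (real (Suc n))"
  have r: "r > 0" by (simp add: r_def)
  have XD: "ball (X k) r \<subseteq> W" "\<And>t. \<bar>t\<bar> < r \<Longrightarrow> cmod (F (X k + of_real t * v) - F (X k) - of_real t * a) \<le> \<epsilon> * \<bar>t\<bar>"
    for k
    using X[rule_format, of k] by (auto simp: linear_approx_set_def r_def)
  have sub: "ball l r \<subseteq> W"
  proof
    fix w assume "w \<in> ball l r"
    then have "0 < r - dist l w" by simp
    then obtain k where "dist (X k) l < r - dist l w" using l unfolding lim_sequentially by blast
    then have "w \<in> ball (X k) r" using dist_triangle[of "X k" w l] by simp
    then show "w \<in> W" using XD(1) by blast
  qed
  have "cmod (F (l + of_real t * v) - F l - of_real t * a) \<le> \<epsilon> * \<bar>t\<bar>" if t: "\<bar>t\<bar> < r" for t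
  proof -
    have in_W: "l + of_real t * v \<in> W" "l \<in> W" using sub t r v by (auto simp: dist_norm norm_mult subset_iff)
    have c: "isCont F w" if "w \<in> W" for w using F W that continuous_on_eq_continuous_at by blast
    have "(\<lambda>k. F (X k + of_real t * v)) \<longlonglongrightarrow> F (l + of_real t * v)"
      by (rule isCont_tendsto_compose[OF c[OF in_W(1)]]) (intro tendsto_intros l)
    moreover have "(\<lambda>k. F (X k)) \<longlonglongrightarrow> F l" by (rule isCont_tendsto_compose[OF c[OF in_W(2)] l])
    ultimately have
      "(\<lambda>k. cmod (F (X k + of_real t * v) - F (X k) - of_real t * a)) \<longlonglongrightarrow> cmod (F (l + of_real t * v) - F l
      - of_real t * a)"
      by (intro tendsto_intros)
    then show ?thesis by (rule LIMSEQ_le_const2) (use XD(2)[OF t] in blast)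
  qed
  then show "l \<in> linear_approx_set F W v \<epsilon> n a" using sub by (simp add: linear_approx_set_def r_def)
qed

lemma linear_approx_setI:
  assumes W: "open W" "z \<in> W" and D: "((\<lambda>t. F (z + of_real t * v)) has_vector_derivative A) (at 0)"
    and a: "cmod (A - a) < \<epsilon>"
  shows "\<exists>n0. \<forall>n\<ge>n0. z \<in> linear_approx_set F W v \<epsilon> n a"
proof -
  obtain r where r: "r > 0" "ball z r \<subseteq> W" using W open_contains_ball by blast
  have "0 < \<epsilon> - cmod (A - a)" using a by simp
  then obtain d where d: "d > 0"
    "\<And>t. norm (t - 0) < d \<Longrightarrow> norm (F (z + of_real t * v) - F (z + of_real 0 * v) - (t - 0) *\<^sub>R A)
    \<le> (\<epsilon> - cmod (A - a)) * norm (t - 0)"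
    using D unfolding has_vector_derivative_def has_derivative_at_alt by blast
  obtain n0 where n0: "inverse (real (Suc n0)) < min r d" using reals_Archimedean[of "min r d"] r d by auto
  show ?thesis
  proof (rule exI[of _ n0], intro allI impI)
    fix n assume "n \<ge> n0"
    then have "inverse (real (Suc n)) \<le> inverse (real (Suc n0))" by (intro le_imp_inverse_le) auto
    then have n: "inverse (real (Suc n)) < min r d" using n0 by linarith
    have "cmod (F (z + of_real t * v) - F z - of_real t * a) \<le> \<epsilon> * \<bar>t\<bar>" if t: "\<bar>t\<bar> < inverse (real (Suc n))"
      for t
    proof -
      have "cmod (F (z + of_real t * v) - F z - of_real t * A) \<le> (\<epsilon> - cmod (A - a)) * \<bar>t\<bar>"
        using d(2)[of t] t n by (simp add: scaleR_conv_of_real)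
      moreover have "cmod (of_real t * (A - a)) = cmod (A - a) * \<bar>t\<bar>" by (simp add: norm_mult)
      moreover have "F (z + of_real t * v) - F z - of_real t * a = (F (z + of_real t * v) - F z - of_real t * A)
        + of_real t * (A - a)"
        by (simp add: algebra_simps)
      ultimately show ?thesis
        using norm_triangle_ineq[of "F (z + of_real t * v) - F z - of_real t * A" "of_real t * (A - a)"]
          by (simp only: left_diff_distrib)
    qed
    moreover have "ball z (inverse (real (Suc n))) \<subseteq> W" using n r(2)
      by (meson less_imp_le min.strict_boundedE order_trans subset_ball)
    ultimately show "z \<in> linear_approx_set F W v \<epsilon> n a" by (simp add: linear_approx_set_def)
  qed
qed

(* A small rectangle around z + w can be chosen with all four sides on lines through points of E, where F is
   almost linear. The maximum principle for the open map F carries the estimate to the interior. *)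
lemma linear_approx_at_thick_point:
  assumes W: "open W" and F: "continuous_on W F" and inj: "inj_on F W" and \<epsilon>: "0 < \<epsilon>"
    and E_def: "E = linear_approx_set F W 1 \<epsilon> n a \<inter> linear_approx_set F W \<i> \<epsilon> n b"
    and z: "z \<in> E" "thick_at E z"
  shows "\<exists>\<theta>>0. \<forall>w. cmod w < \<theta> \<longrightarrow> cmod (F (z + w) - F z - (of_real (Re w) * a + of_real (Im w) * b))
    \<le> 10 * \<epsilon> * cmod w"
proof -
  define K where "K = 1 + cmod a + cmod b"
  \<comment> \<open>\<open>\<eta> \<le> 1 / 2\<close> keeps the rectangle inside the square of
    half-width \<open>s\<close>; \<open>\<eta> * K \<le> \<epsilon>\<close> makes the linear map
    vary by at most \<open>\<epsilon> * s\<close> over the rectangle.\<close>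
  define \<eta> where "\<eta> = min (1 / 2) (\<epsilon> / K)"
  have K: "K > 0" unfolding K_def by (simp add: add_pos_nonneg)
  have \<eta>: "\<eta> > 0" "\<eta> \<le> 1 / 2" "\<eta> * K \<le> \<epsilon>"
    using \<epsilon> K by (auto simp: \<eta>_def min_def field_simps)
  define r where "r = inverse (real (Suc n))"
  have r: "r > 0" by (simp add: r_def)
  have ED: "ball x r \<subseteq> W" "\<And>t. \<bar>t\<bar> < r \<Longrightarrow> cmod (F (x + of_real t) - F x - of_real t * a) \<le> \<epsilon> * \<bar>t\<bar>"
    "\<And>t. \<bar>t\<bar> < r \<Longrightarrow> cmod (F (x + of_real t * \<i>) - F x - of_real t * b) \<le> \<epsilon> * \<bar>t\<bar>" if "x \<in> E" for x
    using that unfolding E_def linear_approx_set_def by (auto simp: r_def)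
  obtain \<theta>1 where \<theta>1: "\<theta>1 > 0" "\<And>s p q. 0 < s \<Longrightarrow> s < \<theta>1 \<Longrightarrow> - s \<le> p \<Longrightarrow> q \<le> s \<Longrightarrow> \<eta> * s \<le> q - p \<Longrightarrow>
     (\<exists>x y. p \<le> x \<and> x \<le> q \<and> \<bar>y\<bar> \<le> s \<and> z + Complex x y \<in> E) \<and> (\<exists>x y. \<bar>x\<bar> \<le> s \<and> p \<le> y \<and> y \<le> q \<and> z + Complex x y \<in>
       E)"
    using z(2)[unfolded thick_at_def, rule_format, OF \<eta>(1)] by blast
  define \<theta> where "\<theta> = min \<theta>1 (r / 4) / 2"
  have \<theta>: "\<theta> > 0" "2 * \<theta> \<le> \<theta>1" "8 * \<theta> \<le> r" using \<theta>1(1) r by (auto simp: \<theta>_def)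
  define L where "L w = of_real (Re w) * a + of_real (Im w) * b" for w
  show ?thesis
  proof (rule exI[of _ \<theta>], intro conjI \<theta>(1) allI impI)
    fix w assume w: "cmod w < \<theta>"
    show "cmod (F (z + w) - F z - (of_real (Re w) * a + of_real (Im w) * b)) \<le> 10 * \<epsilon> * cmod w"
    proof (cases "w = 0")
      case False
      \<comment> \<open>With \<open>w\<close> at most \<open>s / 2\<close> from \<open>z\<close> in
        each coordinate, there is room on all sides of it for strips of width
        \<open>\<eta> * s\<close>. The final bound \<open>5 * \<epsilon> * s\<close> is the claimed
        \<open>10 * \<epsilon> * cmod w\<close>.\<close>
      define s where "s = 2 * cmod w"
      have s: "0 < s" "s < \<theta>1" "4 * s < r" using False w \<theta> by (auto simp: s_def)
      have uv: "\<bar>Re w\<bar> \<le> s / 2" "\<bar>Im w\<bar> \<le> s / 2" using abs_Re_le_cmod[of w] abs_Im_le_cmod[of w]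
        by (auto simp: s_def)
      have \<eta>s: "0 < \<eta> * s" "\<eta> * s \<le> s / 2" using \<eta> s mult_right_mono[of \<eta> "1 / 2" s] by auto
      have rg: "- s \<le> Re w - \<eta> * s" "Re w \<le> s" "- s \<le> Re w" "Re w + \<eta> * s \<le> s"
          "- s \<le> Im w - \<eta> * s" "Im w \<le> s" "- s \<le> Im w" "Im w + \<eta> * s \<le> s"
        using uv \<eta>s by linarith+
      have wd: "\<eta> * s \<le> u - (u - \<eta> * s)" "\<eta> * s \<le> u + \<eta> * s - u" for u by simp_all
      obtain t1 y1 where 1: "Re w - \<eta> * s \<le> t1" "t1 \<le> Re w" "\<bar>y1\<bar> \<le> s" "z + Complex t1 y1 \<in> E"
        using \<theta>1(2)[OF s(1,2) rg(1,2) wd(1)] by blast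
      obtain t2 y2 where 2: "Re w \<le> t2" "t2 \<le> Re w + \<eta> * s" "\<bar>y2\<bar> \<le> s" "z + Complex t2 y2 \<in> E"
        using \<theta>1(2)[OF s(1,2) rg(3,4) wd(2)] by blast
      obtain x3 s1 where 3: "Im w - \<eta> * s \<le> s1" "s1 \<le> Im w" "\<bar>x3\<bar> \<le> s" "z + Complex x3 s1 \<in> E"
        using \<theta>1(2)[OF s(1,2) rg(5,6) wd(1)] by blast
      obtain x4 s2 where 4: "Im w \<le> s2" "s2 \<le> Im w + \<eta> * s" "\<bar>x4\<bar> \<le> s" "z + Complex x4 s2 \<in> E"
        using \<theta>1(2)[OF s(1,2) rg(7,8) wd(2)] by blast
      \<comment> \<open>From \<open>z\<close> a horizontal step leads to \<open>z + t\<close>; from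
        there the vertical line is followed through its point of \<open>E\<close>, where the
        vertical approximation holds in both directions. The three steps have lengths at most
        \<open>s\<close>, \<open>s\<close> and \<open>2 * s\<close>.\<close>
      have vert: "cmod (F (z + Complex t y) - F z - L (Complex t y)) \<le> 4 * \<epsilon> * s"
        if e: "z + Complex t y0 \<in> E" "\<bar>y0\<bar> \<le> s" "\<bar>t\<bar> \<le> s" "\<bar>y\<bar> \<le> s" for t y y0
      proof -
        have A:
          "cmod (F (z + Complex t y0 + of_real (y - y0) * \<i>) - F (z + Complex t y0) - of_real (y - y0) * b)
          \<le> \<epsilon> * \<bar>y - y0\<bar>"
          by (rule ED(3)[OF e(1)]) (use e s in linarith)
        have B: "cmod (F (z + Complex t y0 + of_real (- y0) * \<i>) - F (z + Complex t y0) - of_real (- y0) * b)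
          \<le> \<epsilon> * \<bar>- y0\<bar>"
          by (rule ED(3)[OF e(1)]) (use e s in linarith)
        have C: "cmod (F (z + of_real t) - F z - of_real t * a) \<le> \<epsilon> * \<bar>t\<bar>"
          by (rule ED(2)[OF z(1)]) (use e s in linarith)
        have p: "z + Complex t y0 + of_real (y - y0) * \<i> = z + Complex t y"
          "z + Complex t y0 + of_real (- y0) * \<i> = z + of_real t"
          by (auto simp: complex_eq_iff)
        define X where "X = F (z + Complex t y) - F (z + Complex t y0) - of_real (y - y0) * b"
        define Y where "Y = F (z + of_real t) - F (z + Complex t y0) - of_real (- y0) * b"
        define Z where "Z = F (z + of_real t) - F z - of_real t * a"
        have "F (z + Complex t y) - F z - L (Complex t y) = (X - Y) + Z"
          by (simp add: X_def Y_def Z_def L_def algebra_simps)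
        also have "cmod ((X - Y) + Z) \<le> (cmod X + cmod Y) + cmod Z"
          by (intro order_trans[OF norm_triangle_ineq] add_mono norm_triangle_ineq4 order_refl)
        also have "\<dots> \<le> \<epsilon> * \<bar>y - y0\<bar> + \<epsilon> * \<bar>- y0\<bar> + \<epsilon> * \<bar>t\<bar>"
          using A B C unfolding p X_def Y_def Z_def by linarith
        also have "\<dots> = \<epsilon> * (\<bar>y - y0\<bar> + \<bar>- y0\<bar> + \<bar>t\<bar>)" by (simp add: distrib_left)
        also have "\<dots> \<le> \<epsilon> * (4 * s)" using e \<epsilon> by (intro mult_left_mono) linarith+
        finally show ?thesis by simp
      qed
      have horiz: "cmod (F (z + Complex x t) - F z - L (Complex x t)) \<le> 4 * \<epsilon> * s"
        if e: "z + Complex x0 t \<in> E" "\<bar>x0\<bar> \<le> s" "\<bar>t\<bar> \<le> s" "\<bar>x\<bar> \<le> s" for t x x0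
      proof -
        have A: "cmod (F (z + Complex x0 t + of_real (x - x0)) - F (z + Complex x0 t) - of_real (x - x0) * a)
          \<le> \<epsilon> * \<bar>x - x0\<bar>"
          by (rule ED(2)[OF e(1)]) (use e s in linarith)
        have B: "cmod (F (z + Complex x0 t + of_real (- x0)) - F (z + Complex x0 t) - of_real (- x0) * a)
          \<le> \<epsilon> * \<bar>- x0\<bar>"
          by (rule ED(2)[OF e(1)]) (use e s in linarith)
        have C: "cmod (F (z + of_real t * \<i>) - F z - of_real t * b) \<le> \<epsilon> * \<bar>t\<bar>"
          by (rule ED(3)[OF z(1)]) (use e s in linarith)
        have p: "z + Complex x0 t + of_real (x - x0) = z + Complex x t"
          "z + Complex x0 t + of_real (- x0) = z + of_real t * \<i>"
          by (auto simp: complex_eq_iff)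
        define X where "X = F (z + Complex x t) - F (z + Complex x0 t) - of_real (x - x0) * a"
        define Y where "Y = F (z + of_real t * \<i>) - F (z + Complex x0 t) - of_real (- x0) * a"
        define Z where "Z = F (z + of_real t * \<i>) - F z - of_real t * b"
        have "F (z + Complex x t) - F z - L (Complex x t) = (X - Y) + Z"
          by (simp add: X_def Y_def Z_def L_def algebra_simps)
        also have "cmod ((X - Y) + Z) \<le> (cmod X + cmod Y) + cmod Z"
          by (intro order_trans[OF norm_triangle_ineq] add_mono norm_triangle_ineq4 order_refl)
        also have "\<dots> \<le> \<epsilon> * \<bar>x - x0\<bar> + \<epsilon> * \<bar>- x0\<bar> + \<epsilon> * \<bar>t\<bar>"
          using A B C unfolding p X_def Y_def Z_def by linarith
        also have "\<dots> = \<epsilon> * (\<bar>x - x0\<bar> + \<bar>- x0\<bar> + \<bar>t\<bar>)" by (simp add: distrib_left)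
        also have "\<dots> \<le> \<epsilon> * (4 * s)" using e \<epsilon> by (intro mult_left_mono) linarith+
        finally show ?thesis by simp
      qed
      define Q where "Q = cbox (z + Complex t1 s1) (z + Complex t2 s2)"
      have QW: "Q \<subseteq> W"
      proof
        fix x assume "x \<in> Q"
        then have "t1 \<le> Re (x - z)" "Re (x - z) \<le> t2" "s1 \<le> Im (x - z)" "Im (x - z) \<le> s2"
          by (auto simp: Q_def in_cbox_complex_iff)
        then have "\<bar>Re (x - z)\<bar> \<le> s" "\<bar>Im (x - z)\<bar> \<le> s" using 1 2 3 4 uv \<eta>s by linarith+
        then have "cmod (x - z) < r" using cmod_le[of "x - z"] s by linarith
        then show "x \<in> W" using ED(1)[OF z(1)] by (auto simp: dist_norm norm_minus_commute)
      qed
      have "cmod (F (z + w) - (F z + L w)) \<le> 5 * \<epsilon> * s"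
      proof (rule open_map_maximum[where K = Q and F = F and w = "z + w" and c = "F z + L w"])
        show "continuous_on Q F" by (rule continuous_on_subset[OF F QW])
        show "compact Q" by (simp add: Q_def)
        show "open (F ` interior Q)"
          by (rule invariance_of_domain) (use QW interior_subset[of Q] F inj in
            \<open>auto intro: continuous_on_subset inj_on_subset\<close>)
        show "z + w \<in> Q" using 1 2 3 4 by (simp add: Q_def in_cbox_complex_iff)
        fix \<zeta> assume \<zeta>: "\<zeta> \<in> Q - interior Q"
        define x where "x = Re (\<zeta> - z)"
        define y where "y = Im (\<zeta> - z)"
        have \<zeta>xy: "\<zeta> = z + Complex x y" by (simp add: x_def y_def complex_eq_iff)
        have rng: "t1 \<le> x" "x \<le> t2" "s1 \<le> y" "y \<le> s2" using \<zeta>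
          by (auto simp: Q_def in_cbox_complex_iff x_def y_def)
        have bd: "\<bar>x\<bar> \<le> s" "\<bar>y\<bar> \<le> s" "\<bar>t1\<bar> \<le> s" "\<bar>t2\<bar> \<le> s" "\<bar>s1\<bar> \<le> s" "\<bar>s2\<bar> \<le> s"
          using rng 1 2 3 4 uv \<eta>s by linarith+
        have "\<not> (t1 < x \<and> x < t2 \<and> s1 < y \<and> y < s2)"
          using \<zeta> by (auto simp: Q_def in_box_complex_iff x_def y_def)
        then have "x = t1 \<or> x = t2 \<or> y = s1 \<or> y = s2" using rng by linarith
        then have est: "cmod (F \<zeta> - F z - L (Complex x y)) \<le> 4 * \<epsilon> * s"
        proof (elim disjE)
          assume "x = t1" then show ?thesis unfolding \<zeta>xy using vert[OF _ 1(3)] 1(4) bd by blast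
        next
          assume "x = t2" then show ?thesis unfolding \<zeta>xy using vert[OF _ 2(3)] 2(4) bd by blast
        next
          assume "y = s1" then show ?thesis unfolding \<zeta>xy using horiz[OF _ 3(3)] 3(4) bd by blast
        next
          assume "y = s2" then show ?thesis unfolding \<zeta>xy using horiz[OF _ 4(3)] 4(4) bd by blast
        qed
        have "cmod (L (Complex x y) - L w) = cmod (of_real (x - Re w) * a + of_real (y - Im w) * b)"
          by (simp add: L_def algebra_simps)
        also have "\<dots> \<le> \<bar>x - Re w\<bar> * cmod a + \<bar>y - Im w\<bar> * cmod b"
          by (rule order_trans[OF norm_triangle_ineq]) (simp only: norm_mult norm_of_real order_refl)
        also have "\<dots> \<le> (\<eta> * s) * cmod a + (\<eta> * s) * cmod b"
          using rng 1 2 3 4 by (intro add_mono mult_right_mono) (auto simp: abs_le_iff)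
        also have "\<dots> \<le> (\<eta> * s) * K" using \<eta>s by (simp add: K_def algebra_simps)
        also have "\<dots> = (\<eta> * K) * s" by simp
        also have "\<dots> \<le> \<epsilon> * s" using \<eta>(3) s(1) by (intro mult_right_mono) auto
        finally have "cmod (L (Complex x y) - L w) \<le> \<epsilon> * s" .
        moreover have eq: "F \<zeta> - (F z + L w) = (F \<zeta> - F z - L (Complex x y)) + (L (Complex x y) - L w)" by simp
        ultimately show "cmod (F \<zeta> - (F z + L w)) \<le> 5 * \<epsilon> * s"
          unfolding eq using est norm_triangle_ineq[of "F \<zeta> - F z - L (Complex x y)" "L (Complex x y) - L w"]
            by linarith
      qed
      then show ?thesis by (simp add: s_def L_def diff_diff_eq mult_ac)
    qed simp
  qed
qed

lemma rational_complex_dense: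
  assumes "0 < e" obtains a where "Re a \<in> \<rat>" "Im a \<in> \<rat>" "cmod (A - a) < e"
proof -
  obtain p where p: "p \<in> \<rat>" "Re A < p" "p < Re A + e / 2"
    using Rats_dense_in_real[of "Re A" "Re A + e / 2"] assms by auto
  obtain q where q: "q \<in> \<rat>" "Im A < q" "q < Im A + e / 2"
    using Rats_dense_in_real[of "Im A" "Im A + e / 2"] assms by auto
  have "cmod (A - Complex p q) \<le> \<bar>Re A - p\<bar> + \<bar>Im A - q\<bar>" using cmod_le[of "A - Complex p q"] by simp
  then show thesis using p q by (intro that[of "Complex p q"]) auto
qed

lemma countable_rational_complex: "countable {a::complex. Re a \<in> \<rat> \<and> Im a \<in> \<rat>}"
proof -
  have "{a::complex. Re a \<in> \<rat> \<and> Im a \<in> \<rat>} = (\<lambda>(p, q). Complex p q) ` (\<rat> \<times> \<rat>)"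
    by (force simp: image_iff complex_eq_iff)
  then show ?thesis by (simp add: countable_rat)
qed

text \<open>For every \<open>m\<close>, a point with both partial derivatives lies in some closed
  set \<open>E m n a b\<close> with rational \<open>a\<close> and \<open>b\<close>. There are
  countably many of these, and from each only the null set of its points that are not thick is
  discarded; at the remaining points the approximation holds for every \<open>m\<close>.\<close>

lemma gehring_lehto:
  fixes F :: "complex \<Rightarrow> complex"
  assumes W: "open W" and F: "continuous_on W F" and inj: "inj_on F W"
    and Nx: "negligible Nx" "\<And>z. z \<in> W - Nx \<Longrightarrow> \<exists>A. ((\<lambda>t. F (z + of_real t)) has_vector_derivative A) (at 0)"
    and Ny: "negligible Ny" "\<And>z. z \<in> W - Ny \<Longrightarrow> \<exists>B. ((\<lambda>t. F (z + of_real t * \<i>)) has_vector_derivative B) (at 0)"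
  obtains N where "negligible N"
    "\<And>z. z \<in> W - N \<Longrightarrow> \<exists>A B. (F has_derivative (\<lambda>h. of_real (Re h) * A + of_real (Im h) * B)) (at z)"
proof -
  let ?Q = "{a::complex. Re a \<in> \<rat> \<and> Im a \<in> \<rat>}"
  define E where "E m n a b = linear_approx_set F W 1 (inverse (real (Suc m))) n a
    \<inter> linear_approx_set F W \<i> (inverse (real (Suc m))) n b" for m n a b
  have cl: "closed (E m n a b)" for m n a b
    unfolding E_def by (intro closed_Int closed_linear_approx_set W F) auto
  have "\<exists>N. negligible N \<and> (\<forall>z\<in>E m n a b - N. thick_at (E m n a b) z)" for m n a b
    using thick_at_ae[OF cl] by metis
  then obtain M where M: "\<And>m n a b. negligible (M m n a b)" "\<And>m n a b z. z \<in> E m n a b - M m n a b \<Longrightarrow>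
    thick_at (E m n a b) z"
    by metis
  define I where "I = (UNIV :: nat set) \<times> (UNIV :: nat set) \<times> ?Q \<times> ?Q"
  have cI: "countable I" unfolding I_def by (intro countable_SIGMA countable_rational_complex) auto
  define N where "N = Nx \<union> Ny \<union> (\<Union>(m, n, a, b)\<in>I. M m n a b)"
  have "negligible N" unfolding N_def
    using cI Nx(1) Ny(1) M(1) by (intro negligible_Un negligible_countable_Union) auto
  moreover have "\<exists>A B. (F has_derivative (\<lambda>h. of_real (Re h) * A + of_real (Im h) * B)) (at z)"
    if z: "z \<in> W - N" for z
  proof -
    obtain A where A: "((\<lambda>t. F (z + of_real t * 1)) has_vector_derivative A) (at 0)" using Nx(2)[of z] z
      by (auto simp: N_def)
    obtain B where B: "((\<lambda>t. F (z + of_real t * \<i>)) has_vector_derivative B) (at 0)" using Ny(2)[of z] z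
      by (auto simp: N_def)
    have "(F has_derivative (\<lambda>h. of_real (Re h) * A + of_real (Im h) * B)) (at z)"
      unfolding has_derivative_at_alt
    proof (intro conjI allI impI)
      show "bounded_linear (\<lambda>h. of_real (Re h) * A + of_real (Im h) * B)"
        by (intro bounded_linear_add bounded_linear_mult_const[THEN bounded_linear_compose]
          bounded_linear_compose[OF bounded_linear_of_real] bounded_linear_Re bounded_linear_Im
          bounded_linear_ident)
      fix e :: real assume e: "0 < e"
      \<comment> \<open>The factor 12 is 10 from the estimate at thick points plus 1 for each
        partial derivative replaced by a rational number.\<close>
      obtain m where m: "inverse (real (Suc m)) < e / 12" using reals_Archimedean[of "e / 12"] e by auto
      define \<epsilon> where "\<epsilon> = inverse (real (Suc m))"
      have \<epsilon>: "0 < \<epsilon>" "12 * \<epsilon> < e" using m by (auto simp: \<epsilon>_def)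
      obtain a where a: "Re a \<in> \<rat>" "Im a \<in> \<rat>" "cmod (A - a) < \<epsilon>" using rational_complex_dense[OF \<epsilon>(1)] by metis
      obtain b where b: "Re b \<in> \<rat>" "Im b \<in> \<rat>" "cmod (B - b) < \<epsilon>" using rational_complex_dense[OF \<epsilon>(1)] by metis
      have zW: "z \<in> W" using z by blast
      obtain n1 where n1: "\<And>n. n \<ge> n1 \<Longrightarrow> z \<in> linear_approx_set F W 1 \<epsilon> n a"
        using linear_approx_setI[OF W zW A a(3)] by blast
      obtain n2 where n2: "\<And>n. n \<ge> n2 \<Longrightarrow> z \<in> linear_approx_set F W \<i> \<epsilon> n b"
        using linear_approx_setI[OF W zW B b(3)] by blast
      define n where "n = max n1 n2"
      have zE: "z \<in> E m n a b" using n1[of n] n2[of n] by (simp add: E_def n_def \<epsilon>_def)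
      have "(m, n, a, b) \<in> I" using a b by (simp add: I_def)
      then have "z \<notin> M m n a b" using z by (force simp: N_def)
      then have th: "thick_at (E m n a b) z" using M(2)[of z m n a b] zE by blast
      have "E m n a b = linear_approx_set F W 1 \<epsilon> n a \<inter> linear_approx_set F W \<i> \<epsilon> n b"
        by (simp add: E_def \<epsilon>_def)
      from linear_approx_at_thick_point[OF W F inj \<epsilon>(1) this zE th]
      obtain \<theta> where \<theta>: "\<theta> > 0"
        "\<And>w. cmod w < \<theta> \<Longrightarrow> cmod (F (z + w) - F z - (of_real (Re w) * a + of_real (Im w) * b)) \<le> 10 * \<epsilon> * cmod w"
        by blast
      show
        "\<exists>d>0. \<forall>y. norm (y - z) < d \<longrightarrow> norm (F y - F z - (of_real (Re (y - z)) * A + of_real (Im (y - z)) * B))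
        \<le> e * norm (y - z)"
      proof (rule exI[of _ \<theta>], intro conjI \<theta>(1) allI impI)
        fix y assume y: "norm (y - z) < \<theta>"
        define w where "w = y - z"
        have 1: "cmod (F y - F z - (of_real (Re w) * a + of_real (Im w) * b)) \<le> 10 * \<epsilon> * cmod w"
          using \<theta>(2)[of w] y by (simp add: w_def)
        have 2: "cmod (of_real (Re w) * (a - A)) \<le> cmod w * \<epsilon>" unfolding norm_mult norm_of_real
          using a(3) abs_Re_le_cmod[of w] by (intro mult_mono) (auto simp: norm_minus_commute)
        have 3: "cmod (of_real (Im w) * (b - B)) \<le> cmod w * \<epsilon>" unfolding norm_mult norm_of_real
          using b(3) abs_Im_le_cmod[of w] by (intro mult_mono) (auto simp: norm_minus_commute)
        have eq:
          "F y - F z - (of_real (Re w) * A + of_real (Im w) * B)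
          = (F y - F z - (of_real (Re w) * a + of_real (Im w) * b)) + (of_real (Re w) * (a - A) + of_real
          (Im w) * (b - B))"
          by (simp add: algebra_simps)
        have "cmod (F y - F z - (of_real (Re w) * A + of_real (Im w) * B))
          \<le> 10 * \<epsilon> * cmod w + (cmod w * \<epsilon> + cmod w * \<epsilon>)"
          unfolding eq by (intro norm_triangle_mono 1 2 3)
        also have "\<dots> = (12 * \<epsilon>) * cmod w" by simp
        also have "\<dots> \<le> e * cmod w" using \<epsilon> by (intro mult_right_mono) auto
        finally show "norm (F y - F z - (of_real (Re (y - z)) * A + of_real (Im (y - z)) * B))
          \<le> e * norm (y - z)" by (simp add: w_def)
      qed
    qed
    then show ?thesis by blast
  qed
  ultimately show thesis by (rule that)
qed

section \<open>Functions with small pre-Schwarzian derivative near the imaginary axis\<close>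

lemma open_rhp: "open right_half_plane" and convex_rhp: "convex right_half_plane"
  unfolding right_half_plane_def by (rule open_halfspace_Re_gt, rule convex_halfspace_Re_gt)

lemma mult_sqrt_divide:
  fixes a b :: real assumes "0 < a" "0 \<le> b" shows "a * sqrt (b / a) = sqrt (b * a)"
proof -
  have "sqrt (b * a) = sqrt (b / a * a\<^sup>2)" using assms by (simp add: power2_eq_square)
  then show ?thesis using assms by (simp only: real_sqrt_mult) simp
qed

lemma norm_exp_minus_one_le: "norm (exp z - 1) \<le> norm z * exp (norm z)" for z :: complex
proof -
  have "norm (exp z - exp 0) \<le> exp (norm z) * norm (z - 0)"
  proof (rule field_differentiable_bound[where S = "cball 0 (norm z)" and f' = exp])
    show "norm (exp w) \<le> exp (norm z)" if "w \<in> cball 0 (norm z)" for w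
      using that norm_exp[of w] by (auto intro: order_trans)
  qed (auto intro!: derivative_eq_intros)
  then show ?thesis by (simp add: mult.commute)
qed

text \<open>The value 1/1000 is not sharp: it is small enough for the numerical factors below, such
  as \<open>320 * \<kappa>\<close> in the separation of points, to be less than 1.\<close>

locale small_pre_schwarzian =
  fixes f :: "complex \<Rightarrow> complex" and \<kappa> t0 :: real
  assumes hol: "f holomorphic_on right_half_plane"
    and inj: "inj_on f right_half_plane"
    and t0: "0 < t0"
    and kap: "0 < \<kappa>" "\<kappa> \<le> 1 / 1000"
    and small: "\<And>z. 0 < Re z \<Longrightarrow> Re z \<le> t0 \<Longrightarrow> Re z * cmod (pre_schwarzian f z) \<le> \<kappa>"
begin

lemma deriv_nz: "0 < Re z \<Longrightarrow> deriv f z \<noteq> 0"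
  using holomorphic_injective_imp_regular[OF hol open_rhp inj] by (simp add: right_half_plane_def)

lemma DERIV_f: "0 < Re z \<Longrightarrow> (f has_field_derivative deriv f z) (at z)"
  using hol open_rhp holomorphic_derivI by (auto simp: right_half_plane_def)

lemma DERIV_f': "0 < Re z \<Longrightarrow> (deriv f has_field_derivative deriv (deriv f) z) (at z)"
  using holomorphic_deriv[OF hol open_rhp] open_rhp holomorphic_derivI by (auto simp: right_half_plane_def)

text \<open>All distortion estimates integrate Pf as the derivative of a branch of log f'. The
  branch exists because f' has no zeros and the half-plane is contractible.\<close>

lemma log_deriv:
  obtains \<phi> where "\<And>z. 0 < Re z \<Longrightarrow> deriv f z = exp (\<phi> z)"
    "\<And>z. 0 < Re z \<Longrightarrow> (\<phi> has_field_derivative pre_schwarzian f z) (at z)"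
proof -
  obtain \<phi> where \<phi>: "\<phi> holomorphic_on right_half_plane" "\<And>z. z \<in> right_half_plane \<Longrightarrow> deriv f z = exp (\<phi> z)"
    using contractible_imp_holomorphic_log[OF holomorphic_deriv[OF hol open_rhp] convex_imp_contractible[OF
      convex_rhp]]
      deriv_nz by (auto simp: right_half_plane_def)
  have D: "(\<phi> has_field_derivative deriv \<phi> z) (at z)" if "0 < Re z" for z
    using holomorphic_derivI[OF \<phi>(1) open_rhp, of z] that by (simp add: right_half_plane_def)
  have "deriv \<phi> z = pre_schwarzian f z" if z: "0 < Re z" for z
  proof -
    have "((\<lambda>w. exp (\<phi> w)) has_field_derivative exp (\<phi> z) * deriv \<phi> z) (at z)"
      by (rule DERIV_chain2[OF DERIV_exp D[OF z]])
    moreover have "((\<lambda>w. exp (\<phi> w)) has_field_derivative deriv (deriv f) z) (at z)"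
      by (rule has_field_derivative_transform_within_open[OF DERIV_f'[OF z] open_rhp])
        (use z \<phi>(2) in \<open>auto simp: right_half_plane_def\<close>)
    ultimately have "deriv (deriv f) z = deriv f z * deriv \<phi> z"
      using \<phi>(2)[of z] z by (metis DERIV_unique mem_Collect_eq right_half_plane_def)
    then show ?thesis using deriv_nz[OF z] by (simp add: pre_schwarzian_def)
  qed
  then show thesis using that[of \<phi>] \<phi>(2) D by (auto simp: right_half_plane_def)
qed

lemma horizontal_derivative:
  assumes "(g has_field_derivative D) (at (Complex x y))"
  shows "((\<lambda>t. g (Complex t y)) has_vector_derivative D) (at x)"
proof -
  have "((\<lambda>t. Complex t y) has_vector_derivative 1) (at x)"
    unfolding Complex_eq by (auto intro!: derivative_eq_intros has_vector_derivative_of_real)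
  from field_vector_diff_chain_at[OF this assms] show ?thesis by (simp add: o_def)
qed

text \<open>From \<open>p\<close> to \<open>w\<close> one goes first vertically at distance
  \<open>Re p\<close> from the axis, then horizontally. Along this path log f' changes by at most
  \<kappa> and \<open>\<kappa> * ln (Re p / Re w)\<close> respectively.\<close>

lemma deriv_ratio:
  assumes "0 < Re w" "Re w \<le> Re p" "\<bar>Im w - Im p\<bar> \<le> Re p" "Re p \<le> t0"
  shows "cmod (deriv f w - deriv f p) \<le> 8 * \<kappa> * sqrt (Re p / Re w) * cmod (deriv f p)"
proof -
  define s where "s = Re p"
  have s: "0 < s" "Re w \<le> s" "s \<le> t0" using assms by (auto simp: s_def)
  obtain \<phi> where \<phi>: "\<And>z. 0 < Re z \<Longrightarrow> deriv f z = exp (\<phi> z)"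
    "\<And>z. 0 < Re z \<Longrightarrow> (\<phi> has_field_derivative pre_schwarzian f z) (at z)" by (rule log_deriv) blast
  have ps: "cmod (pre_schwarzian f z) \<le> \<kappa> / Re z" if "0 < Re z" "Re z \<le> t0" for z
    using small[OF that] that by (simp add: field_simps)
  have v: "cmod (\<phi> (Complex s (Im w)) - \<phi> p) \<le> \<kappa> / s * cmod (Complex s (Im w) - p)"
  proof (rule field_differentiable_bound[where S = "cbox (Complex s (Im p - s)) (Complex s (Im p + s))" and f' =
    "pre_schwarzian f"])
    show
      "(\<phi> has_field_derivative pre_schwarzian f z) (at z within cbox (Complex s (Im p - s)) (Complex s (Im p
      + s)))"
      if "z \<in> cbox (Complex s (Im p - s)) (Complex s (Im p + s))" for z
      using \<phi>(2)[of z] that s by (auto simp: in_cbox_complex_iff intro: has_field_derivative_at_within)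
    show "cmod (pre_schwarzian f z) \<le> \<kappa> / s" if "z \<in> cbox (Complex s (Im p - s)) (Complex s (Im p + s))" for z
      using ps[of z] that s by (auto simp: in_cbox_complex_iff)
    show "Complex s (Im w) \<in> cbox (Complex s (Im p - s)) (Complex s (Im p + s))"
      "p \<in> cbox (Complex s (Im p - s)) (Complex s (Im p + s))"
      using assms by (auto simp: in_cbox_complex_iff s_def abs_le_iff)
  qed (rule convex_box)
  have "Complex s (Im w) - p = \<i> * of_real (Im w - Im p)" by (simp add: complex_eq_iff s_def)
  then have "cmod (Complex s (Im w) - p) \<le> s" using assms by (simp add: norm_mult s_def flip: of_real_diff)
  then have v': "cmod (\<phi> (Complex s (Im w)) - \<phi> p) \<le> \<kappa>"
    using v mult_left_mono[of "cmod (Complex s (Im w) - p)" s "\<kappa> / s"] s kap by simp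
  have h: "cmod (\<phi> (Complex s (Im w)) - \<phi> w) \<le> \<kappa> * ln (s / Re w)"
  proof (cases "Re w = s")
    case True then show ?thesis using s
      by (simp add: complex_eq_iff) (metis complex_surj norm_zero diff_self order_refl)
  next
    case False
    then have "Re w < s" using s by simp
    then have "cmod (\<phi> (Complex s (Im w)) - \<phi> (Complex (Re w) (Im w))) \<le> \<kappa> * ln s - \<kappa> * ln (Re w)"
    proof (rule differentiable_bound_general[where f' = "\<lambda>x. pre_schwarzian f (Complex x (Im w))" and \<phi>' = "\<lambda>x.
      \<kappa> / x"])
      show vd: "((\<lambda>t. \<phi> (Complex t (Im w))) has_vector_derivative pre_schwarzian f (Complex x (Im w))) (at x)"
        if "Re w < x" for x using that assms(1) by (intro horizontal_derivative \<phi>(2)) auto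
      have "continuous (at x within {Re w..s}) (\<lambda>t. \<phi> (Complex t (Im w)))" if "x \<in> {Re w..s}" for x
        by (rule continuous_at_imp_continuous_within, rule has_vector_derivative_continuous, rule
          horizontal_derivative, rule \<phi>(2))
          (use that assms(1) in auto)
      then show "continuous_on {Re w..s} (\<lambda>t. \<phi> (Complex t (Im w)))"
        by (auto simp: continuous_on_eq_continuous_within)
      show "continuous_on {Re w..s} (\<lambda>x. \<kappa> * ln x)" using assms(1) by (intro continuous_intros) auto
      show "((\<lambda>x. \<kappa> * ln x) has_vector_derivative \<kappa> / x) (at x)" if "Re w < x" for x
        using that assms(1)
          by (auto intro!: derivative_eq_intros simp flip: has_real_derivative_iff_has_vector_derivative)
      show "cmod (pre_schwarzian f (Complex x (Im w))) \<le> \<kappa> / x" if "Re w < x" "x < s" for x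
        using ps[of "Complex x (Im w)"] that assms(1) s by auto
    qed
    also have "\<dots> = \<kappa> * ln (s / Re w)" using s assms(1) by (simp add: ln_div right_diff_distrib)
    finally show ?thesis by simp
  qed
  define u where "u = s / Re w"
  have u: "1 \<le> u" using s assms(1) by (simp add: u_def)
  define y where "y = 1 + ln u"
  have y: "1 \<le> y" using u by (simp add: y_def)
  define d where "d = \<phi> w - \<phi> p"
  have "cmod d \<le> cmod (\<phi> w - \<phi> (Complex s (Im w))) + cmod (\<phi> (Complex s (Im w)) - \<phi> p)"
    unfolding d_def
      by (metis norm_diff_triangle_ineq add.commute diff_add_cancel norm_triangle_ineq add_diff_eq)
  then have d: "cmod d \<le> \<kappa> * y" using h v' by (simp add: norm_minus_commute u_def y_def distrib_left)
  have "cmod (exp d - 1) \<le> cmod d * exp (cmod d)" by (rule norm_exp_minus_one_le)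
  also have "\<dots> \<le> (\<kappa> * y) * exp (\<kappa> * y)" using d kap y by (intro mult_mono) auto
  \<comment> \<open>Both the logarithmic factor \<open>y\<close> and the small power
    \<open>exp (\<kappa> * y)\<close> are absorbed by \<open>exp (y / 4)\<close>. The product
    \<open>exp (y / 2)\<close> is a multiple of \<open>sqrt u\<close>, a rate that remains
    integrable up to the axis, and the factor \<kappa> is kept.\<close>
  also have "\<dots> \<le> (\<kappa> * (4 * exp (y / 4))) * exp (y / 4)"
  proof (intro mult_mono)
    have "y / 4 \<le> exp (y / 4)" using exp_ge_add_one_self[of "y / 4"] by linarith
    then show "y \<le> 4 * exp (y / 4)" by linarith
    show "exp (\<kappa> * y) \<le> exp (y / 4)" using kap y by simp
  qed (use kap y in auto)
  also have "\<dots> = 4 * \<kappa> * exp (y / 2)" by (simp flip: exp_add)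
  also have "exp (y / 2) = exp (1 / 2) * sqrt u"
    using u by (simp add: y_def exp_add add_divide_distrib ln_sqrt[symmetric])
  also have "\<dots> \<le> 2 * sqrt u"
  proof (intro mult_right_mono)
    have "exp (1 / 2 :: real) ^ 2 = exp 1" by (simp add: power2_eq_square flip: exp_add)
    also have "\<dots> \<le> 2 ^ 2" using exp_le by simp
    finally show "exp (1 / 2) \<le> (2 :: real)" by (rule power2_le_imp_le) simp
  qed (use u in simp)
  finally have e: "cmod (exp d - 1) \<le> 8 * \<kappa> * sqrt u" using kap by simp
  have "deriv f w - deriv f p = deriv f p * (exp d - 1)"
    using \<phi>(1)[of w] \<phi>(1)[of p] assms by (simp add: d_def exp_diff right_diff_distrib)
  then have "cmod (deriv f w - deriv f p) = cmod (deriv f p) * cmod (exp d - 1)" by (simp add: norm_mult)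
  also have "\<dots> \<le> cmod (deriv f p) * (8 * \<kappa> * sqrt u)" by (intro mult_left_mono e) auto
  finally show ?thesis by (simp add: u_def s_def mult_ac)
qed

text \<open>Integration of \<open>deriv_ratio\<close>: the bound
  \<open>8 * \<kappa> * sqrt (Re p / x)\<close> has the primitive
  \<open>16 * \<kappa> * sqrt (Re p) * sqrt x\<close>. Nothing blows up as \<open>x1\<close> tends
  to 0.\<close>

lemma horizontal_increment:
  assumes "0 < x1" "x1 \<le> x2" "x2 \<le> Re p" "\<bar>y - Im p\<bar> \<le> Re p" "Re p \<le> t0"
  shows "cmod (f (Complex x2 y) - f (Complex x1 y) - deriv f p * of_real (x2 - x1))
    \<le> 16 * \<kappa> * sqrt (Re p) * cmod (deriv f p) * (sqrt x2 - sqrt x1)"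
proof (cases "x1 = x2")
  case False
  then have "x1 < x2" using assms by simp
  then have "cmod ((f (Complex x2 y) - deriv f p * of_real x2) - (f (Complex x1 y) - deriv f p * of_real x1))
     \<le> 16 * \<kappa> * sqrt (Re p) * cmod (deriv f p) * sqrt x2 - 16 * \<kappa> * sqrt (Re p) * cmod (deriv f p) * sqrt x1"
  proof (rule differentiable_bound_general[where f' = "\<lambda>x. deriv f (Complex x y) - deriv f p" and
        \<phi>' = "\<lambda>x. 8 * \<kappa> * sqrt (Re p / x) * cmod (deriv f p)"])
    have vd:
      "((\<lambda>t. f (Complex t y) - deriv f p * complex_of_real t) has_vector_derivative deriv f (Complex x y)
      - deriv f p) (at x)"
      if "x1 \<le> x" for x
    proof -
      have
        "((\<lambda>z. f z - deriv f p * z) has_field_derivative deriv f (Complex x y) - deriv f p * 1)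
        (at (Complex x y))"
        using that assms(1) by (intro DERIV_diff DERIV_f DERIV_cmult DERIV_ident) simp
      then have
        "((\<lambda>z. f z - deriv f p * (z - \<i> * of_real y)) has_field_derivative deriv f (Complex x y) - deriv f p)
        (at (Complex x y))"
        by (auto intro!: derivative_eq_intros DERIV_f simp: that) (use that assms(1) in auto)
      from horizontal_derivative[OF this] show ?thesis by (simp add: Complex_eq)
    qed
    then show
      "((\<lambda>t. f (Complex t y) - deriv f p * complex_of_real t) has_vector_derivative deriv f (Complex x y)
      - deriv f p) (at x)"
      if "x1 < x" for x using that by simp
    have "continuous (at x within {x1..x2}) (\<lambda>t. f (Complex t y) - deriv f p * complex_of_real t)"
      if "x \<in> {x1..x2}" for x
      by (rule continuous_at_imp_continuous_within, rule has_vector_derivative_continuous, rule vd) (use that in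
        auto)
    then show "continuous_on {x1..x2} (\<lambda>t. f (Complex t y) - deriv f p * complex_of_real t)"
      by (auto simp: continuous_on_eq_continuous_within)
    show "continuous_on {x1..x2} (\<lambda>x. 16 * \<kappa> * sqrt (Re p) * cmod (deriv f p) * sqrt x)"
      by (intro continuous_intros)
    show
      "((\<lambda>x. 16 * \<kappa> * sqrt (Re p) * cmod (deriv f p) * sqrt x) has_vector_derivative 8 * \<kappa> * sqrt (Re p / x) *
      cmod (deriv f p)) (at x)"
      if "x1 < x" for x
    proof -
      have "x > 0" using that assms(1) by simp
      then have
        "((\<lambda>x. 16 * \<kappa> * sqrt (Re p) * cmod (deriv f p) * sqrt x) has_real_derivative 16 * \<kappa> * sqrt (Re p) * cmod
        (deriv f p) * (inverse (sqrt x) / 2)) (at x)"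
        by (intro DERIV_cmult DERIV_real_sqrt)
      then show ?thesis
        by (simp add: has_real_derivative_iff_has_vector_derivative real_sqrt_divide field_simps)
    qed
    show "cmod (deriv f (Complex x y) - deriv f p) \<le> 8 * \<kappa> * sqrt (Re p / x) * cmod (deriv f p)"
      if "x1 < x" "x < x2" for x
      using deriv_ratio[of "Complex x y" p] that assms by simp
  qed
  then show ?thesis by (simp add: algebra_simps)
qed simp

text \<open>Same path as for \<open>deriv_ratio\<close>: the vertical part contributes 8 and the
  horizontal part 16 to the constant. It is uniform up to the axis, so it passes to boundary
  values.\<close>

lemma f_linear:
  assumes "0 < Re w" "Re w \<le> Re p" "\<bar>Im w - Im p\<bar> \<le> Re p" "Re p \<le> t0"
  shows "cmod (f w - f p - deriv f p * (w - p)) \<le> 24 * \<kappa> * Re p * cmod (deriv f p)"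
proof -
  define q where "q = Complex (Re p) (Im w)"
  have p0: "0 < Re p" using assms by simp
  have h:
    "cmod (f q - f w - deriv f p * of_real (Re p - Re w))
    \<le> 16 * \<kappa> * sqrt (Re p) * cmod (deriv f p) * (sqrt (Re p) - sqrt (Re w))"
    using horizontal_increment[of "Re w" "Re p" p "Im w"] assms by (simp add: q_def)
  have "16 * \<kappa> * sqrt (Re p) * cmod (deriv f p) * (sqrt (Re p) - sqrt (Re w))
    \<le> 16 * \<kappa> * sqrt (Re p) * cmod (deriv f p) * sqrt (Re p)"
    using kap assms by (intro mult_left_mono) auto
  also have "\<dots> = 16 * \<kappa> * Re p * cmod (deriv f p)" using p0 by simp
  finally have h': "cmod (f q - f w - deriv f p * of_real (Re p - Re w)) \<le> 16 * \<kappa> * Re p * cmod (deriv f p)"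
    using h by linarith
  have "cmod ((f q - deriv f p * q) - (f p - deriv f p * p)) \<le> (8 * \<kappa> * cmod (deriv f p)) * cmod (q - p)"
  proof (rule field_differentiable_bound[where S = "cbox (Complex (Re p) (Im p - Re p)) (Complex (Re p) (Im p
    + Re p))" and f' = "\<lambda>z. deriv f z - deriv f p"])
    show "convex (cbox (Complex (Re p) (Im p - Re p)) (Complex (Re p) (Im p + Re p)))" by (rule convex_box)
    show
      "((\<lambda>z. f z - deriv f p * z) has_field_derivative deriv f z - deriv f p)
      (at z within cbox (Complex (Re p) (Im p - Re p)) (Complex (Re p) (Im p + Re p)))"
      if "z \<in> cbox (Complex (Re p) (Im p - Re p)) (Complex (Re p) (Im p + Re p))" for z
    proof -
      have "0 < Re z" using that p0 by (simp add: in_cbox_complex_iff)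
      then have "((\<lambda>z. f z - deriv f p * z) has_field_derivative deriv f z - deriv f p * 1) (at z)"
        by (intro DERIV_diff DERIV_f DERIV_cmult DERIV_ident)
      then show ?thesis by (simp add: has_field_derivative_at_within)
    qed
    show "cmod (deriv f z - deriv f p) \<le> 8 * \<kappa> * cmod (deriv f p)"
      if "z \<in> cbox (Complex (Re p) (Im p - Re p)) (Complex (Re p) (Im p + Re p))" for z
    proof -
      have "Re z = Re p" "\<bar>Im z - Im p\<bar> \<le> Re p" using that by (auto simp: in_cbox_complex_iff abs_le_iff)
      then show ?thesis using deriv_ratio[of z p] p0 assms(4) by simp
    qed
    show "q \<in> cbox (Complex (Re p) (Im p - Re p)) (Complex (Re p) (Im p + Re p))"
      "p \<in> cbox (Complex (Re p) (Im p - Re p)) (Complex (Re p) (Im p + Re p))"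
      using assms p0 by (auto simp: q_def in_cbox_complex_iff abs_le_iff)
  qed
  moreover have "q - p = \<i> * of_real (Im w - Im p)" by (simp add: complex_eq_iff q_def)
  then have "cmod (q - p) \<le> Re p" using assms by (simp add: norm_mult flip: of_real_diff)
  then have "(8 * \<kappa> * cmod (deriv f p)) * cmod (q - p) \<le> (8 * \<kappa> * cmod (deriv f p)) * Re p"
    using kap by (intro mult_left_mono) auto
  ultimately have v: "cmod ((f q - deriv f p * q) - (f p - deriv f p * p)) \<le> 8 * \<kappa> * Re p * cmod (deriv f p)"
    by (simp add: mult_ac)
  have "q - w = of_real (Re p - Re w)" by (simp add: complex_eq_iff q_def)
  then have "f w - f p - deriv f p * (w - p) = ((f q - deriv f p * q) - (f p - deriv f p * p))
    - (f q - f w - deriv f p * of_real (Re p - Re w))"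
    by (simp only: \<open>q - w = _\<close>[symmetric]) (simp add: algebra_simps)
  then have "cmod (f w - f p - deriv f p * (w - p)) \<le> cmod ((f q - deriv f p * q) - (f p - deriv f p * p))
    + cmod (f q - f w - deriv f p * of_real (Re p - Re w))"
    by (metis norm_triangle_ineq4)
  with v h' show ?thesis by linarith
qed

end

section \<open>Boundary values, affine approximation and local injectivity of the reflected
  extension\<close>

context small_pre_schwarzian begin

text \<open>The product of f' with the distance to the axis tends to 0 at each boundary point. This
  gives the boundary values and the continuity of the extension, and it controls f' along horizontal
  lines.\<close>

lemma deriv_growth:
  assumes "0 < r" "r \<le> t0"
  shows "r * cmod (deriv f (Complex r y)) \<le> 2 * sqrt (t0 * r) * cmod (deriv f (Complex t0 y))"
proof -
  have
    "cmod (deriv f (Complex r y) - deriv f (Complex t0 y))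
    \<le> 8 * \<kappa> * sqrt (t0 / r) * cmod (deriv f (Complex t0 y))"
    using deriv_ratio[of "Complex r y" "Complex t0 y"] assms t0 by simp
  moreover have
    "8 * \<kappa> * sqrt (t0 / r) * cmod (deriv f (Complex t0 y)) \<le> 1 * sqrt (t0 / r) * cmod (deriv f (Complex t0 y))"
    using kap assms t0 by (intro mult_right_mono) auto
  moreover have "1 * cmod (deriv f (Complex t0 y)) \<le> sqrt (t0 / r) * cmod (deriv f (Complex t0 y))"
    using assms by (intro mult_right_mono) auto
  ultimately have "cmod (deriv f (Complex r y)) \<le> 2 * sqrt (t0 / r) * cmod (deriv f (Complex t0 y))"
    using norm_triangle_sub[of "deriv f (Complex r y)" "deriv f (Complex t0 y)"] by linarith
  then have "r * cmod (deriv f (Complex r y)) \<le> r * (2 * sqrt (t0 / r) * cmod (deriv f (Complex t0 y)))"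
    using assms by (intro mult_left_mono) auto
  also have
    "r * (2 * sqrt (t0 / r) * cmod (deriv f (Complex t0 y)))
    = 2 * (r * sqrt (t0 / r)) * cmod (deriv f (Complex t0 y))" by simp
  also have "r * sqrt (t0 / r) = sqrt (t0 * r)"
    using assms t0 by (intro mult_sqrt_divide) auto
  finally show ?thesis .
qed

lemma growth_small:
  assumes "0 < e"
  obtains r where "0 < r" "r \<le> t0" "\<And>\<rho>. 0 < \<rho> \<Longrightarrow> \<rho> \<le> r \<Longrightarrow> \<rho> * cmod (deriv f (Complex \<rho> y)) < e"
proof -
  have
    "((\<lambda>r. 2 * sqrt (t0 * r) * cmod (deriv f (Complex t0 y))) \<longlongrightarrow> 2 * sqrt (t0 * 0) * cmod
    (deriv f (Complex t0 y))) (at_right 0)"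
    by (intro tendsto_intros)
  then have "eventually (\<lambda>r. 2 * sqrt (t0 * r) * cmod (deriv f (Complex t0 y)) < e) (at_right 0)"
    using assms by (intro order_tendstoD(2)) auto
  then obtain b where b: "b > 0" "\<And>r. 0 < r \<Longrightarrow> r < b \<Longrightarrow> 2 * sqrt (t0 * r) * cmod (deriv f (Complex t0 y)) < e"
    unfolding eventually_at_right_field by auto
  show thesis
  proof (rule that[of "min t0 (b / 2)"])
    fix \<rho> assume "0 < \<rho>" "\<rho> \<le> min t0 (b / 2)"
    then show "\<rho> * cmod (deriv f (Complex \<rho> y)) < e"
      using deriv_growth[of \<rho> y] b(2)[of \<rho>] b(1) by auto
  qed (use b t0 in auto)
qed

lemma f_oscillation:
  assumes "0 < Re w" "Re w \<le> r" "\<bar>Im w - y\<bar> \<le> r" "r \<le> t0"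
  shows "cmod (f w - f (Complex r y)) \<le> 3 * r * cmod (deriv f (Complex r y))"
proof -
  have r: "0 < r" using assms by simp
  have 1: "cmod (f w - f (Complex r y) - deriv f (Complex r y) * (w - Complex r y))
    \<le> 24 * \<kappa> * r * cmod (deriv f (Complex r y))"
    using f_linear[of w "Complex r y"] assms by simp
  have "cmod (w - Complex r y) \<le> \<bar>Re w - r\<bar> + \<bar>Im w - y\<bar>" using cmod_le[of "w - Complex r y"] by simp
  then have "cmod (w - Complex r y) \<le> 2 * r" using assms by linarith
  then have 2: "cmod (deriv f (Complex r y) * (w - Complex r y)) \<le> cmod (deriv f (Complex r y)) * (2 * r)"
    unfolding norm_mult by (rule mult_left_mono) simp
  have "24 * \<kappa> * r * cmod (deriv f (Complex r y)) \<le> 1 * r * cmod (deriv f (Complex r y))"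
    using kap r by (intro mult_right_mono) auto
  moreover have
    "cmod (f w - f (Complex r y)) \<le> cmod (f w - f (Complex r y) - deriv f (Complex r y) * (w - Complex r y))
    + cmod (deriv f (Complex r y) * (w - Complex r y))"
    by (metis diff_add_cancel norm_triangle_ineq)
  ultimately show ?thesis using 1 2 by (simp add: mult_ac)
qed

lemma f_oscillation_small:
  assumes "0 < e"
  obtains r where "0 < r" "r \<le> t0"
    "\<And>w w'. 0 < Re w \<Longrightarrow> Re w \<le> r \<Longrightarrow> \<bar>Im w - y\<bar> \<le> r \<Longrightarrow> 0 < Re w' \<Longrightarrow> Re w' \<le> r \<Longrightarrow> \<bar>Im w' - y\<bar> \<le> r \<Longrightarrow>
      cmod (f w - f w') < e"
proof -
  have "0 < e / 6" using assms by simp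
  then obtain r where r: "0 < r" "r \<le> t0" "\<And>\<rho>. 0 < \<rho> \<Longrightarrow> \<rho> \<le> r \<Longrightarrow> \<rho> * cmod (deriv f (Complex \<rho> y)) < e / 6"
    by (rule growth_small) blast
  show thesis
  proof (rule that[OF r(1,2)])
    fix w w' assume "0 < Re w" "Re w \<le> r" "\<bar>Im w - y\<bar> \<le> r" "0 < Re w'" "Re w' \<le> r" "\<bar>Im w' - y\<bar> \<le> r"
    then have "cmod (f w - f (Complex r y)) \<le> 3 * r * cmod (deriv f (Complex r y))"
      "cmod (f w' - f (Complex r y)) \<le> 3 * r * cmod (deriv f (Complex r y))"
      using f_oscillation r(2) by blast+
    moreover have "3 * r * cmod (deriv f (Complex r y)) < e / 2" using r(3)[of r] r(1) by simp
    ultimately show "cmod (f w - f w') < e"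
      using norm_triangle_ineq4[of "f w - f (Complex r y)" "f w' - f (Complex r y)"] by simp
  qed
qed

lemma trivial_limit_rhp: "Re z = 0 \<Longrightarrow> at z within right_half_plane \<noteq> bot"
proof -
  assume z: "Re z = 0"
  have "z islimpt right_half_plane" unfolding islimpt_approachable
  proof (intro allI impI)
    fix e :: real assume "0 < e"
    then show "\<exists>x'\<in>right_half_plane. x' \<noteq> z \<and> dist x' z < e"
      using z by (intro bexI[of _ "z + of_real (e / 2)"]) (auto simp: right_half_plane_def dist_norm)
  qed
  then show ?thesis by (simp add: trivial_limit_within)
qed

lemma fhat_pos: "0 < Re z \<Longrightarrow> reflected_extension f z = f z"
  by (simp add: reflected_extension_def)

lemma fhat_neg: "Re z < 0 \<Longrightarrow> reflected_extension f z = f (- cnj z) + of_real (2 * Re z) * deriv f (- cnj z)"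
  by (simp add: reflected_extension_def)

text \<open>\<open>Lim\<close> is an unspecified value when no limit exists; here the limit is shown
  to exist. The oscillation of \<open>f\<close> on small squares at the boundary point tends to 0,
  so the values along the horizontal segment form a Cauchy sequence, and their limit is attained
  from all of the half-plane.\<close>

lemma fhat_boundary:
  assumes z: "Re z = 0" shows "(f \<longlongrightarrow> reflected_extension f z) (at z within right_half_plane)"
proof -
  define y where "y = Im z"
  have zy: "z = Complex 0 y" using z by (simp add: y_def complex_eq_iff)
  define X where "X n = f (Complex (t0 / real (Suc n)) y)" for n
  have inv: "(\<lambda>n. t0 / real (Suc n)) \<longlonglongrightarrow> 0" by (rule lim_const_over_n[THEN LIMSEQ_Suc])
  have ev: "eventually (\<lambda>n. t0 / real (Suc n) < r) sequentially" if "0 < r" for r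
    using order_tendstoD(2)[OF inv that] .
  have "Cauchy X"
  proof (rule CauchyI)
    fix e :: real assume "0 < e"
    then obtain r where r: "0 < r" "r \<le> t0"
      "\<And>w w'. 0 < Re w \<Longrightarrow> Re w \<le> r \<Longrightarrow> \<bar>Im w - y\<bar> \<le> r \<Longrightarrow> 0 < Re w' \<Longrightarrow> Re w' \<le> r \<Longrightarrow> \<bar>Im w' - y\<bar> \<le> r \<Longrightarrow>
        cmod (f w - f w') < e"
      by (rule f_oscillation_small) blast
    obtain M where M: "\<And>n. n \<ge> M \<Longrightarrow> t0 / real (Suc n) < r" using ev[OF r(1)] unfolding eventually_sequentially
      by blast
    show "\<exists>M. \<forall>m\<ge>M. \<forall>n\<ge>M. norm (X m - X n) < e"
      unfolding X_def using M t0 r(1)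
        by (intro exI[of _ M] allI impI r(3)) (auto simp: less_imp_le simp del: of_nat_Suc)
  qed
  then obtain L where L: "X \<longlonglongrightarrow> L" using Cauchy_convergent_iff convergent_def by blast
  have lim: "(f \<longlongrightarrow> L) (at z within right_half_plane)"
  proof (rule tendstoI)
    fix e :: real assume "0 < e"
    then have "0 < e / 2" by simp
    then obtain r where r: "0 < r" "r \<le> t0"
      "\<And>w w'. 0 < Re w \<Longrightarrow> Re w \<le> r \<Longrightarrow> \<bar>Im w - y\<bar> \<le> r \<Longrightarrow> 0 < Re w' \<Longrightarrow> Re w' \<le> r \<Longrightarrow> \<bar>Im w' - y\<bar> \<le> r \<Longrightarrow>
        cmod (f w - f w') < e / 2"
      by (rule f_oscillation_small) blast
    have "dist (f w) L < e" if w: "w \<in> right_half_plane" "dist w z < r" for w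
    proof -
      have w': "0 < Re w" "Re w \<le> r" "\<bar>Im w - y\<bar> \<le> r"
        using w abs_Re_le_cmod[of "w - z"] abs_Im_le_cmod[of "w - z"] z
          by (auto simp: right_half_plane_def dist_norm y_def)
      have "((\<lambda>n. cmod (f w - X n)) \<longlonglongrightarrow> cmod (f w - L))" by (intro tendsto_intros L)
      moreover have "eventually (\<lambda>n. cmod (f w - X n) \<le> e / 2) sequentially"
        using ev[OF r(1)]
      proof eventually_elim
        case (elim n)
        have "0 < t0 / real (Suc n)" using t0 by simp
        then show ?case unfolding X_def using elim r(1)
          by (intro less_imp_le[OF r(3)] w') (auto simp del: of_nat_Suc)
      qed
      ultimately have "cmod (f w - L) \<le> e / 2" by (rule tendsto_upperbound) simp
      then show ?thesis using \<open>0 < e\<close> by (simp add: dist_norm)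
    qed
    then show "eventually (\<lambda>w. dist (f w) L < e) (at z within right_half_plane)"
      unfolding eventually_at using r(1) by blast
  qed
  have "Lim (at z within right_half_plane) f = L" by (rule tendsto_Lim[OF trivial_limit_rhp[OF z] lim])
  then show ?thesis using lim z by (simp add: reflected_extension_def)
qed

lemma fhat_boundary_horizontal:
  "((\<lambda>x. f (Complex x y)) \<longlongrightarrow> reflected_extension f (Complex 0 y)) (at_right 0)"
proof (rule filterlim_compose[OF fhat_boundary])
  have
    "((\<lambda>x. complex_of_real x + \<i> * complex_of_real y) \<longlongrightarrow> complex_of_real 0 + \<i> * complex_of_real y) (at_right 0)"
    by (intro tendsto_intros)
  then show "filterlim (\<lambda>x. Complex x y) (at (Complex 0 y) within right_half_plane) (at_right 0)"
    unfolding filterlim_at Complex_eq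
    by (auto simp: eventually_at_right_field right_half_plane_def complex_eq_iff intro!: exI[of _ 1])
qed simp

text \<open>For \<open>Re z < 0\<close> the extension at \<open>z\<close> is the value at
  \<open>z\<close> of the tangent map of \<open>f\<close> at the reflected point \<open>w\<close>.
  Replacing \<open>deriv f w\<close> by \<open>deriv f p\<close> costs \<open>2 * Re w\<close> times
  the bound of \<open>deriv_ratio\<close>, at most
  \<open>16 * \<kappa> * Re p * cmod (deriv f p)\<close>, and 24 + 16 = 40. On the axis the estimate
  follows by passing to the limit.\<close>

lemma fhat_linear:
  assumes "\<bar>Re z\<bar> \<le> Re p" "\<bar>Im z - Im p\<bar> \<le> Re p" "0 < Re p" "Re p \<le> t0"
  shows "cmod (reflected_extension f z - f p - deriv f p * (z - p)) \<le> 40 * \<kappa> * Re p * cmod (deriv f p)"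
proof -
  have mono: "24 * \<kappa> * Re p * cmod (deriv f p) \<le> 40 * \<kappa> * Re p * cmod (deriv f p)"
    using kap assms(3) by (intro mult_right_mono) auto
  consider "0 < Re z" | "Re z = 0" | "Re z < 0" by linarith
  then show ?thesis
  proof cases
    case 1
    then show ?thesis using f_linear[of z p] assms mono by (simp add: fhat_pos)
  next
    case 2
    then have z: "z = Complex 0 (Im z)" by (simp add: complex_eq_iff)
    have "((\<lambda>x. Complex x (Im z)) \<longlongrightarrow> Complex 0 (Im z)) (at_right 0)"
      unfolding Complex_eq by (intro tendsto_intros)
    then have "((\<lambda>x. cmod (f (Complex x (Im z)) - f p - deriv f p * (Complex x (Im z) - p))) \<longlongrightarrow>
        cmod (reflected_extension f (Complex 0 (Im z)) - f p - deriv f p * (Complex 0 (Im z) - p))) (at_right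
          0)"
      by (intro tendsto_intros fhat_boundary_horizontal)
    moreover have "eventually (\<lambda>x. cmod (f (Complex x (Im z)) - f p - deriv f p * (Complex x (Im z) - p))
      \<le> 24 * \<kappa> * Re p * cmod (deriv f p)) (at_right 0)"
      unfolding eventually_at_right_field using assms by (intro exI[of _ "Re p"]) (auto intro!: f_linear)
    ultimately have "cmod (reflected_extension f (Complex 0 (Im z)) - f p - deriv f p * (Complex 0 (Im z) - p))
      \<le> 24 * \<kappa> * Re p * cmod (deriv f p)"
      by (rule tendsto_upperbound) simp
    then show ?thesis using mono z by simp
  next
    case 3
    define w where "w = - cnj z"
    have w: "Re w = - Re z" "Im w = Im z" "0 < Re w" using 3 by (auto simp: w_def)
    have zw: "z = w + of_real (2 * Re z)" by (simp add: complex_eq_iff w_def)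
    have 1: "cmod (f w - f p - deriv f p * (w - p)) \<le> 24 * \<kappa> * Re p * cmod (deriv f p)"
      using w assms by (intro f_linear) auto
    have "cmod (deriv f w - deriv f p) \<le> 8 * \<kappa> * sqrt (Re p / Re w) * cmod (deriv f p)"
      using w assms by (intro deriv_ratio) auto
    then have
      "2 * Re w * cmod (deriv f w - deriv f p) \<le> 2 * Re w * (8 * \<kappa> * sqrt (Re p / Re w) * cmod (deriv f p))"
      using w by (intro mult_left_mono) auto
    also have "\<dots> = 16 * \<kappa> * (Re w * sqrt (Re p / Re w)) * cmod (deriv f p)" by simp
    also have "Re w * sqrt (Re p / Re w) = sqrt (Re p * Re w)"
      using w assms by (intro mult_sqrt_divide) auto
    also have "16 * \<kappa> * sqrt (Re p * Re w) * cmod (deriv f p) \<le> 16 * \<kappa> * sqrt (Re p * Re p) * cmod (deriv f p)"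
      using w assms kap by (intro mult_right_mono mult_left_mono real_sqrt_le_mono) auto
    finally have 2: "cmod (of_real (2 * Re z) * (deriv f w - deriv f p)) \<le> 16 * \<kappa> * Re p * cmod (deriv f p)"
      using w assms by (simp add: norm_mult)
    have eq: "reflected_extension f z - f p - deriv f p * (z - p) = (f w - f p - deriv f p * (w - p))
      + of_real (2 * Re z) * (deriv f w - deriv f p)"
      by (subst (2) zw) (simp add: fhat_neg[OF 3] w_def[symmetric] algebra_simps)
    have "cmod (reflected_extension f z - f p - deriv f p * (z - p)) \<le> 24 * \<kappa> * Re p * cmod (deriv f p)
      + 16 * \<kappa> * Re p * cmod (deriv f p)"
      unfolding eq by (rule norm_triangle_mono[OF 1 2])
    then show ?thesis by linarith
  qed
qed

text \<open>For points whose distance \<open>d\<close> is at least a quarter of their distances to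
  the axis, one affine map serves both, with \<open>p\<close> at distance \<open>4 * d\<close> from
  the axis. Both errors together are \<open>320 * \<kappa> * d * cmod (deriv f p)\<close>, less than
  the distance \<open>d * cmod (deriv f p)\<close> of the affine images.\<close>

lemma fhat_separates_large:
  assumes "z \<noteq> z'" "\<bar>Re z\<bar> \<le> 4 * cmod (z - z')" "\<bar>Re z'\<bar> \<le> 4 * cmod (z - z')" "4 * cmod (z - z') \<le> t0"
  shows "reflected_extension f z \<noteq> reflected_extension f z'"
proof
  assume eq: "reflected_extension f z = reflected_extension f z'"
  define d where "d = cmod (z - z')"
  have d: "d > 0" using assms by (simp add: d_def)
  define p where "p = Complex (4 * d) (Im z)"
  have "\<bar>Im z' - Im z\<bar> \<le> d" using abs_Im_le_cmod[of "z - z'"] by (simp add: d_def)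
  then have "cmod (reflected_extension f z - f p - deriv f p * (z - p)) \<le> 40 * \<kappa> * Re p * cmod (deriv f p)"
      "cmod (reflected_extension f z' - f p - deriv f p * (z' - p)) \<le> 40 * \<kappa> * Re p * cmod (deriv f p)"
    using assms(2-4)[folded d_def] d by (intro fhat_linear; simp add: p_def)+
  then have
    "cmod ((reflected_extension f z - f p - deriv f p * (z - p)) - (reflected_extension f z' - f p
    - deriv f p * (z' - p))) \<le> 80 * \<kappa> * Re p * cmod (deriv f p)"
    using norm_triangle_ineq4[of "reflected_extension f z - f p - deriv f p * (z - p)" "reflected_extension f z'
      - f p - deriv f p * (z' - p)"] by linarith
  also have
    "(reflected_extension f z - f p - deriv f p * (z - p)) - (reflected_extension f z' - f p
    - deriv f p * (z' - p)) = deriv f p * (z' - z)"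
    using eq by (simp add: algebra_simps)
  finally have "cmod (deriv f p) * d \<le> 320 * \<kappa> * (cmod (deriv f p) * d)"
    by (simp add: norm_mult d_def norm_minus_commute p_def mult_ac)
  moreover have "cmod (deriv f p) * d > 0" using d deriv_nz[of p] by (simp add: p_def)
  then have "320 * \<kappa> * (cmod (deriv f p) * d) < 1 * (cmod (deriv f p) * d)" using kap
    by (intro mult_strict_right_mono) auto
  ultimately show False by linarith
qed

text \<open>The real derivative in the form A h + B cnj h, from which the Wirtinger derivatives A
  and B can be read off.\<close>

definition "fhat_deriv z h = deriv f (- cnj z) * h - of_real (2 * Re z) * deriv (deriv f) (- cnj z) * cnj h"

lemma fhat_has_derivative:
  assumes z: "Re z < 0" shows "(reflected_extension f has_derivative fhat_deriv z) (at z)"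
proof -
  have w: "0 < Re (- cnj z)" using z by simp
  have c: "((\<lambda>z. - cnj z) has_derivative (\<lambda>h. - cnj h)) (at z)"
    by (intro derivative_intros bounded_linear.has_derivative[OF bounded_linear_cnj])
  have R: "((\<lambda>z. complex_of_real (2 * Re z)) has_derivative (\<lambda>h. of_real (2 * Re h))) (at z)"
    by (intro bounded_linear_imp_has_derivative bounded_linear_compose[OF bounded_linear_of_real]
      bounded_linear_const_mult bounded_linear_Re)
  have 1: "((\<lambda>z. f (- cnj z)) has_derivative (\<lambda>h. deriv f (- cnj z) * (- cnj h))) (at z)"
    using has_derivative_compose[OF c, of f "(*) (deriv f (- cnj z))"] DERIV_f[OF w]
      by (simp add: has_field_derivative_def)
  have 2: "((\<lambda>z. deriv f (- cnj z)) has_derivative (\<lambda>h. deriv (deriv f) (- cnj z) * (- cnj h))) (at z)"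
    using has_derivative_compose[OF c, of "deriv f" "(*) (deriv (deriv f) (- cnj z))"] DERIV_f'[OF w]
      by (simp add: has_field_derivative_def)
  have "((\<lambda>z. f (- cnj z) + of_real (2 * Re z) * deriv f (- cnj z)) has_derivative
      (\<lambda>h. deriv f (- cnj z) * (- cnj h) + (of_real (2 * Re z) * (deriv (deriv f) (- cnj z) * (- cnj h)) +
        of_real (2 * Re h) * deriv f (- cnj z)))) (at z)"
    by (intro has_derivative_add 1 has_derivative_mult R 2)
  also have
    "(\<lambda>h. deriv f (- cnj z) * (- cnj h) + (of_real (2 * Re z) * (deriv (deriv f) (- cnj z) * (- cnj h))
    + of_real (2 * Re h) * deriv f (- cnj z))) = fhat_deriv z"
  proof
    fix h
    \<comment> \<open>The derivative of the factor \<open>2 * Re z\<close> cancels the antilinear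
      term coming from \<open>f (- cnj z)\<close> and leaves
      \<open>deriv f (- cnj z) * h\<close>.\<close>
    have "complex_of_real (2 * Re h) = h + cnj h" by (simp add: complex_add_cnj)
    then show
      "deriv f (- cnj z) * (- cnj h) + (of_real (2 * Re z) * (deriv (deriv f) (- cnj z) * (- cnj h))
      + of_real (2 * Re h) * deriv f (- cnj z)) = fhat_deriv z h"
      unfolding fhat_deriv_def by (simp only:) (simp add: algebra_simps)
  qed
  finally show ?thesis
    by (rule has_derivative_transform_within_open[OF _ open_halfspace_Re_lt[of 0]]) (use z in
      \<open>auto simp: fhat_neg\<close>)
qed

lemma second_deriv_small:
  assumes "- t0 \<le> Re z" "Re z < 0"
  shows "cmod (of_real (2 * Re z) * deriv (deriv f) (- cnj z)) \<le> 2 * \<kappa> * cmod (deriv f (- cnj z))"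
proof -
  have "0 < Re (- cnj z)" "Re (- cnj z) \<le> t0" using assms by auto
  note s = small[OF this] and nz = deriv_nz[OF this(1)]
  have "- Re z * cmod (deriv (deriv f) (- cnj z)) \<le> \<kappa> * cmod (deriv f (- cnj z))"
    using s nz by (simp add: pre_schwarzian_def norm_divide field_simps)
  then show ?thesis using assms by (simp add: norm_mult)
qed

text \<open>The segment between the points stays away from the axis relative to its length, and on
  it the extension minus the linear map with factor \<open>deriv f p\<close> has a small derivative:
  \<open>12 * \<kappa>\<close> from the variation of f' and \<open>3 * \<kappa>\<close> from the
  antilinear term. The point further from the axis is named \<open>z\<close>, so that
  \<open>deriv_ratio\<close> with base point \<open>- cnj z\<close> covers the whole
  segment.\<close>

lemma fhat_separates_small:
  assumes "- t0 \<le> Re z" "Re z' < 0" "Re z \<le> Re z'" "4 * cmod (z - z') \<le> - Re z" "z \<noteq> z'"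
  shows "reflected_extension f z \<noteq> reflected_extension f z'"
proof
  assume eq: "reflected_extension f z = reflected_extension f z'"
  define p where "p = - cnj z"
  have p: "Re p = - Re z" "Im p = Im z" "0 < Re p" "Re p \<le> t0" using assms by (auto simp: p_def)
  define g where "g v = reflected_extension f v - deriv f p * v" for v
  have "norm (g z - g z') \<le> (15 * \<kappa> * cmod (deriv f p)) * norm (z - z')"
  proof (rule differentiable_bound[where S = "closed_segment z z'" and f' = "\<lambda>v h. fhat_deriv v h
    - deriv f p * h"])
    fix v assume "v \<in> closed_segment z z'"
    then obtain t where t: "0 \<le> t" "t \<le> 1" "v = (1 - t) *\<^sub>R z + t *\<^sub>R z'" by (auto simp: in_segment)
    then have vz: "v - z = t *\<^sub>R (z' - z)" by (simp add: algebra_simps)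
    then have "cmod (v - z) \<le> cmod (z - z')" using t by (simp add: norm_minus_commute mult_left_le_one_le)
    then have v: "\<bar>Re v - Re z\<bar> \<le> - Re z / 4" "\<bar>Im v - Im z\<bar> \<le> - Re z / 4"
      using abs_Re_le_cmod[of "v - z"] abs_Im_le_cmod[of "v - z"] assms(4) by auto
    have "Re (v - z) = t * (Re z' - Re z)" by (simp add: vz)
    moreover have "0 \<le> t * (Re z' - Re z)" using t assms(3) by simp
    ultimately have "Re z \<le> Re v" by (simp only: minus_complex.sel)
    then have v': "- t0 \<le> Re v" "Re v < 0" using v p assms(1) by linarith+
    show "(g has_derivative (\<lambda>h. fhat_deriv v h - deriv f p * h)) (at v within closed_segment z z')"
      unfolding g_def by (intro has_derivative_diff has_derivative_at_withinI[OF fhat_has_derivative[OF v'(2)]]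
          has_derivative_at_withinI[OF has_derivative_mult_right[OF has_derivative_ident]])
    show "onorm (\<lambda>h. fhat_deriv v h - deriv f p * h) \<le> 15 * \<kappa> * cmod (deriv f p)"
    proof (rule onorm_le)
      fix h
      have "cmod (deriv f (- cnj v) - deriv f p) \<le> 8 * \<kappa> * sqrt (Re p / Re (- cnj v)) * cmod (deriv f p)"
        using v v' p \<open>Re z \<le> Re v\<close> by (intro deriv_ratio) auto
      also have "8 * \<kappa> * sqrt (Re p / Re (- cnj v)) * cmod (deriv f p) \<le> 8 * \<kappa> * (3 / 2) * cmod (deriv f p)"
      proof (intro mult_right_mono mult_left_mono)
        have "Re p / Re (- cnj v) \<le> (3 / 2)\<^sup>2" using v v' p
          by (simp add: field_simps power2_eq_square abs_le_iff)
        from real_sqrt_le_mono[OF this] show "sqrt (Re p / Re (- cnj v)) \<le> 3 / 2" by simp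
      qed (use kap in auto)
      finally have 1: "cmod (deriv f (- cnj v) - deriv f p) \<le> 12 * \<kappa> * cmod (deriv f p)" by simp
      also have "\<dots> \<le> 1 / 2 * cmod (deriv f p)" using kap by (intro mult_right_mono) auto
      finally have "cmod (deriv f (- cnj v)) \<le> 3 / 2 * cmod (deriv f p)"
        using norm_triangle_sub[of "deriv f (- cnj v)" "deriv f p"] by linarith
      then have "2 * \<kappa> * cmod (deriv f (- cnj v)) \<le> 2 * \<kappa> * (3 / 2 * cmod (deriv f p))" using kap
        by (intro mult_left_mono) auto
      then have 2: "cmod (of_real (2 * Re v) * deriv (deriv f) (- cnj v)) \<le> 3 * \<kappa> * cmod (deriv f p)"
        using second_deriv_small[OF v'] by linarith
      have
        "fhat_deriv v h - deriv f p * h = (deriv f (- cnj v) - deriv f p) * h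
        - (of_real (2 * Re v) * deriv (deriv f) (- cnj v)) * cnj h"
        by (simp add: fhat_deriv_def algebra_simps)
      then have "cmod (fhat_deriv v h - deriv f p * h) \<le> cmod (deriv f (- cnj v) - deriv f p) * cmod h
        + cmod (of_real (2 * Re v) * deriv (deriv f) (- cnj v)) * cmod h"
        by (metis norm_triangle_ineq4 norm_mult complex_mod_cnj)
      also have "\<dots> \<le> (12 * \<kappa> * cmod (deriv f p)) * cmod h + (3 * \<kappa> * cmod (deriv f p)) * cmod h"
        by (intro add_mono mult_right_mono 1 2) auto
      finally show "cmod (fhat_deriv v h - deriv f p * h) \<le> 15 * \<kappa> * cmod (deriv f p) * cmod h"
        by (simp add: algebra_simps)
    qed
  qed auto
  moreover have "g z - g z' = deriv f p * (z' - z)" using eq by (simp add: g_def algebra_simps)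
  ultimately have "cmod (deriv f p) * cmod (z - z') \<le> 15 * \<kappa> * (cmod (deriv f p) * cmod (z - z'))"
    by (simp add: norm_mult norm_minus_commute mult_ac)
  moreover have "cmod (deriv f p) * cmod (z - z') > 0" using assms(5) deriv_nz[OF p(3)] by simp
  then have "15 * \<kappa> * (cmod (deriv f p) * cmod (z - z')) < 1 * (cmod (deriv f p) * cmod (z - z'))" using kap
    by (intro mult_strict_right_mono) auto
  ultimately show False by linarith
qed

text \<open>If \<open>z\<close>, the point further from the axis, is at a distance of more than
  \<open>4 * cmod (z - z')\<close> from it, both points lie on the same side: on the right
  \<open>f\<close> is injective, on the left \<open>fhat_separates_small\<close> applies. Otherwise
  \<open>fhat_separates_large\<close> does. The radius \<open>t0 / 4\<close> is the same
  everywhere.\<close>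

lemma fhat_locally_injective:
  assumes "- t0 \<le> Re z" "- t0 \<le> Re z'" "z \<noteq> z'" "4 * cmod (z - z') \<le> t0"
  shows "reflected_extension f z \<noteq> reflected_extension f z'"
proof -
  have main: "reflected_extension f z \<noteq> reflected_extension f z'"
    if zz: "- t0 \<le> Re z" "- t0 \<le> Re z'" "z \<noteq> z'" "4 * cmod (z - z') \<le> t0" "\<bar>Re z'\<bar> \<le> \<bar>Re z\<bar>" for z z'
  proof (cases "\<bar>Re z\<bar> \<le> 4 * cmod (z - z')")
    case True then show ?thesis using zz by (intro fhat_separates_large) auto
  next
    case False
    have d: "\<bar>Re z - Re z'\<bar> \<le> cmod (z - z')" using abs_Re_le_cmod[of "z - z'"] by simp
    show ?thesis
    proof (cases "0 < Re z")
      case True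
      then have "0 < Re z'" using d False norm_ge_zero[of "z - z'"] by linarith
      then show ?thesis using True zz(3) inj by (auto simp: fhat_pos right_half_plane_def inj_on_def)
    next
      case neg: False
      then have "Re z' < 0" using d False norm_ge_zero[of "z - z'"] by linarith
      then show ?thesis using zz neg False d by (intro fhat_separates_small) auto
    qed
  qed
  show ?thesis
  proof (cases "\<bar>Re z'\<bar> \<le> \<bar>Re z\<bar>")
    case True then show ?thesis using main assms by blast
  next
    case False
    then show ?thesis using main[of z' z] assms by (simp add: norm_minus_commute)
  qed
qed

lemma fhat_isCont:
  assumes "- t0 < Re z" shows "isCont (reflected_extension f) z"
proof -
  consider "0 < Re z" | "Re z = 0" | "Re z < 0" by linarith
  then show ?thesis
  proof cases
    case 1
    have "isCont f z" using DERIV_f[OF 1] by (rule DERIV_isCont)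
    moreover have "eventually (\<lambda>w. f w = reflected_extension f w) (nhds z)"
      using eventually_nhds_in_open[of "{w. 0 < Re w}" z] 1
        by (auto simp: open_halfspace_Re_gt fhat_pos elim!: eventually_mono)
    ultimately show ?thesis using isCont_cong by metis
  next
    case 3 then show ?thesis using fhat_has_derivative has_derivative_continuous by blast
  next
    case 2
    define y where "y = Im z"
    have zy: "z = Complex 0 y" using 2 by (simp add: y_def complex_eq_iff)
    show ?thesis unfolding continuous_at_eps_delta
    proof (intro allI impI)
      fix e :: real assume "0 < e"
      then have "0 < e / 3" by simp
      then obtain r where r: "0 < r" "r \<le> t0" "\<And>\<rho>. 0 < \<rho> \<Longrightarrow> \<rho> \<le> r \<Longrightarrow> \<rho> * cmod (deriv f (Complex \<rho> y)) < e / 3"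
        by (rule growth_small) blast
      \<comment> \<open>Both values are compared with the affine map at the point \<open>p\<close>
        at distance \<open>r\<close> from the axis. The errors and the variation of this map over
        the neighbourhood are bounded by multiples of \<open>r * cmod (deriv f p)\<close>, in total
        at most twice this quantity, which is below \<open>e / 3\<close>.\<close>
      define p where "p = Complex r y"
      show "\<exists>d>0. \<forall>w. dist w z < d \<longrightarrow> dist (reflected_extension f w) (reflected_extension f z) < e"
      proof (intro exI[of _ r] conjI r(1) allI impI)
        fix w assume "dist w z < r"
        then have w: "\<bar>Re w\<bar> \<le> r" "\<bar>Im w - y\<bar> \<le> r" "cmod (w - z) \<le> r"
          using abs_Re_le_cmod[of "w - z"] abs_Im_le_cmod[of "w - z"] by (auto simp: dist_norm zy)
        have "cmod (reflected_extension f w - f p - deriv f p * (w - p)) \<le> 40 * \<kappa> * Re p * cmod (deriv f p)"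
          "cmod (reflected_extension f z - f p - deriv f p * (z - p)) \<le> 40 * \<kappa> * Re p * cmod (deriv f p)"
          using w r by (intro fhat_linear; simp add: p_def zy)+
        then have
          "cmod ((reflected_extension f w - f p - deriv f p * (w - p)) - (reflected_extension f z - f p
          - deriv f p * (z - p))) \<le> 80 * \<kappa> * Re p * cmod (deriv f p)"
          using norm_triangle_ineq4[of "reflected_extension f w - f p - deriv f p * (w - p)"
            "reflected_extension f z - f p - deriv f p * (z - p)"] by linarith
        moreover have
          "(reflected_extension f w - f p - deriv f p * (w - p)) - (reflected_extension f z - f p
          - deriv f p * (z - p))
            = (reflected_extension f w - reflected_extension f z) - deriv f p * (w -
              z)" by (simp add: algebra_simps)
        ultimately have
          "cmod (reflected_extension f w - reflected_extension f z) \<le> 80 * \<kappa> * Re p * cmod (deriv f p)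
          + cmod (deriv f p * (w - z))"
          using norm_triangle_sub[of "reflected_extension f w - reflected_extension f z" "deriv f p * (w - z)"]
            by simp
        also have "cmod (deriv f p * (w - z)) \<le> cmod (deriv f p) * r" unfolding norm_mult using w
          by (intro mult_left_mono) auto
        also have "80 * \<kappa> * Re p * cmod (deriv f p) \<le> 1 * Re p * cmod (deriv f p)"
          using kap r by (intro mult_right_mono) (auto simp: p_def)
        finally have "cmod (reflected_extension f w - reflected_extension f z) \<le> 2 * (r * cmod (deriv f p))"
          by (simp add: p_def)
        also have "\<dots> < e" using r(3)[of r] r(1) \<open>0 < e\<close> by (simp add: p_def)
        finally show "dist (reflected_extension f w) (reflected_extension f z) < e" by (simp add: dist_norm)
      qed
    qed
  qed
qed

end

section \<open>Dilatation and absolute continuity on lines of the reflected extension\<close>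

lemma partials_of_derivative:
  assumes "(F has_derivative D) (at z)"
  shows "partial_x F z = D 1" "partial_y F z = D \<i>"
    "((\<lambda>t. F (z + of_real t)) has_vector_derivative D 1) (at 0)"
      "((\<lambda>t. F (z + \<i> * of_real t)) has_vector_derivative D \<i>) (at 0)"
proof -
  interpret D: bounded_linear D using assms by (rule has_derivative_bounded_linear)
  have "((\<lambda>t. z + of_real t) has_derivative (\<lambda>h. complex_of_real h)) (at 0)"
    by (auto intro!: derivative_eq_intros bounded_linear.has_derivative[OF bounded_linear_of_real])
  from has_derivative_compose[OF this, of F D] assms
  show x: "((\<lambda>t. F (z + of_real t)) has_vector_derivative D 1) (at 0)"
    unfolding has_vector_derivative_def using D.scaleR[of _ 1] by (simp add: scaleR_conv_of_real)
  have "((\<lambda>t. z + \<i> * of_real t) has_derivative (\<lambda>h. \<i> * complex_of_real h)) (at 0)"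
    by (auto intro!: derivative_eq_intros bounded_linear.has_derivative[OF bounded_linear_of_real])
  from has_derivative_compose[OF this, of F D] assms
  show y: "((\<lambda>t. F (z + \<i> * of_real t)) has_vector_derivative D \<i>) (at 0)"
    unfolding has_vector_derivative_def using D.scaleR[of _ \<i>] by (simp add: scaleR_conv_of_real mult.commute)
  show "partial_x F z = D 1" "partial_y F z = D \<i>"
    unfolding partial_x_def partial_y_def using x y by (auto intro: vector_derivative_at)
qed

lemma wirtinger_of_derivative:
  assumes "(F has_derivative (\<lambda>h. A * h + B * cnj h)) (at z)"
  shows "wirtinger F z = A" "wirtinger_bar F z = B"
proof -
  have x: "partial_x F z = A + B" using partials_of_derivative(1)[OF assms] by simp
  have y: "partial_y F z = \<i> * (A - B)" using partials_of_derivative(2)[OF assms] by (simp add: algebra_simps)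
  show "wirtinger F z = A" "wirtinger_bar F z = B"
    unfolding wirtinger_def wirtinger_bar_def x y by simp_all
qed

lemma abs_cont_empty: "abs_cont {} g"
  unfolding abs_cont_def by (auto intro!: exI[of _ 1])

lemma abs_cont_ident: "abs_cont I (\<lambda>x. x)"
  unfolding abs_cont_def
proof (intro allI impI)
  fix \<epsilon> :: real assume "0 < \<epsilon>"
  show "\<exists>\<delta>>0. \<forall>d S. d division_of S \<and> S \<subseteq> I \<and> (\<Sum>k\<in>d. Sup k - Inf k) < \<delta> \<longrightarrow> (\<Sum>k\<in>d. norm (Sup k - Inf k)) < \<epsilon>"
  proof (intro exI[of _ \<epsilon>] conjI allI impI, fact, elim conjE)
    fix d S assume d: "d division_of S" "(\<Sum>k\<in>d. Sup k - Inf k) < \<epsilon>"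
    have "norm (Sup k - Inf k) = Sup k - Inf k" if "k \<in> d" for k
      using division_ofD(3,4)[OF d(1) that] by fastforce
    then show "(\<Sum>k\<in>d. norm (Sup k - Inf k)) < \<epsilon>" using d(2) by simp
  qed
qed

lemma lipschitz_abs_cont:
  fixes g :: "real \<Rightarrow> 'a::real_normed_vector"
  assumes "\<And>x y. x \<in> I \<Longrightarrow> y \<in> I \<Longrightarrow> norm (g x - g y) \<le> C * \<bar>x - y\<bar>"
  shows "abs_cont I g"
  by (rule abs_cont_mono[OF abs_cont_ident, where C = C]) (use assms in simp)

lemma mono_division_sum_le:
  fixes m :: "real \<Rightarrow> real"
  assumes "mono m" "d division_of S" "S \<subseteq> {a..b}" "a \<le> b"
  shows "(\<Sum>k\<in>d. m (Sup k) - m (Inf k)) \<le> m b - m a"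
proof -
  have "\<Union>d = S" using division_ofD(6)[OF assms(2)] .
  then obtain q where q: "d \<subseteq> q" "q division_of cbox a b"
    using partial_division_extend_interval[of d a b] assms(2,3) by (metis box_real(2))
  have "(\<Sum>k\<in>d. m (Sup k) - m (Inf k)) \<le> (\<Sum>k\<in>q. m (Sup k) - m (Inf k))"
  proof (rule sum_mono2[OF _ q(1)])
    show "finite q" using q(2) by blast
    fix k assume "k \<in> q - d"
    then have "k \<in> q" by simp
    then obtain c d where "k = {c..d}" "c \<le> d" using division_ofD(3,4)[OF q(2) \<open>k \<in> q\<close>] by fastforce
    then show "0 \<le> m (Sup k) - m (Inf k)" using assms(1) by (simp add: mono_def)
  qed
  also have "\<dots> = m b - m a" using division_increments[OF assms(4), of q m] q(2) by simp
  finally show ?thesis .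
qed

lemma sqrt_lipschitz_away:
  assumes "0 < \<eta>" "\<eta> \<le> x" "x \<le> y" shows "sqrt y - sqrt x \<le> (y - x) / sqrt \<eta>"
proof -
  have e: "sqrt \<eta> > 0" "sqrt \<eta> \<le> sqrt x" "sqrt x \<le> sqrt y" using assms by auto
  have "(sqrt y - sqrt x) * sqrt \<eta> \<le> (sqrt y - sqrt x) * (sqrt y + sqrt x)"
    using e by (intro mult_left_mono) linarith+
  also have "\<dots> = y - x" using assms by (simp add: algebra_simps)
  finally show ?thesis using e(1) by (simp add: pos_le_divide_eq)
qed

text \<open>\<open>sqrt\<close> is odd, with \<open>sqrt (- x) = - sqrt x\<close>, so it serves as a
  comparison function on both sides of 0. Near 0 it is monotone with small total increment, away
  from 0 it is Lipschitz.\<close>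

lemma sqrt_abs_cont: "abs_cont {a..b} sqrt"
proof (cases "a \<le> b")
  case True
  show ?thesis unfolding abs_cont_def
  proof (intro allI impI)
    fix \<epsilon> :: real assume e: "0 < \<epsilon>"
    \<comment> \<open>Half of \<epsilon> is spent on the truncation \<open>m\<close>, whose total
      increment is at most \<open>2 * sqrt \<eta> = \<epsilon> / 2\<close>, and half on the two
      Lipschitz tails.\<close>
    define \<eta> where "\<eta> = (\<epsilon> / 4)\<^sup>2"
    have \<eta>: "\<eta> > 0" "sqrt \<eta> = \<epsilon> / 4" using e by (auto simp: \<eta>_def)
    define m where "m x = sqrt (max (- \<eta>) (min \<eta> x))" for x
    have mm: "mono m" by (auto simp: mono_def m_def)
    have inc: "sqrt y - sqrt x \<le> (m y - m x) + 2 * ((y - x) / sqrt \<eta>)" if "x \<le> y" for x y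
    proof -
      have dec: "sqrt z = m z + (sqrt (max \<eta> z) - sqrt \<eta>) - (sqrt (max \<eta> (- z)) - sqrt \<eta>)" for z
        using \<eta>(1) by (auto simp: m_def max_def min_def real_sqrt_minus)
      have "sqrt (max \<eta> y) - sqrt (max \<eta> x) \<le> (max \<eta> y - max \<eta> x) / sqrt \<eta>"
        using \<eta> that by (intro sqrt_lipschitz_away) auto
      also have "\<dots> \<le> (y - x) / sqrt \<eta>" using that \<eta> by (intro divide_right_mono) auto
      finally have 1: "sqrt (max \<eta> y) - sqrt (max \<eta> x) \<le> (y - x) / sqrt \<eta>" .
      have "sqrt (max \<eta> (- x)) - sqrt (max \<eta> (- y)) \<le> (max \<eta> (- x) - max \<eta> (- y)) / sqrt \<eta>"
        using \<eta> that by (intro sqrt_lipschitz_away) auto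
      also have "\<dots> \<le> (y - x) / sqrt \<eta>" using that \<eta> by (intro divide_right_mono) auto
      finally have 2: "sqrt (max \<eta> (- x)) - sqrt (max \<eta> (- y)) \<le> (y - x) / sqrt \<eta>" .
      show ?thesis using dec[of x] dec[of y] 1 2 by linarith
    qed
    show "\<exists>\<delta>>0. \<forall>d S. d division_of S \<and> S \<subseteq> {a..b} \<and> (\<Sum>k\<in>d. Sup k - Inf k) < \<delta> \<longrightarrow>
      (\<Sum>k\<in>d. norm (sqrt (Sup k) - sqrt (Inf k))) < \<epsilon>"
    proof (intro exI[of _ "\<epsilon> * sqrt \<eta> / 4"] conjI allI impI, use e \<eta> in simp, elim conjE)
      fix d S assume d: "d division_of S" "S \<subseteq> {a..b}" "(\<Sum>k\<in>d. Sup k - Inf k) < \<epsilon> * sqrt \<eta> / 4"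
      have "norm (sqrt (Sup k) - sqrt (Inf k)) \<le> (m (Sup k) - m (Inf k)) + 2 / sqrt \<eta> * (Sup k - Inf k)"
        if kd: "k \<in> d" for k
      proof -
        obtain c d' where "k = {c..d'}" "c \<le> d'" using division_ofD(3,4)[OF d(1) kd] by fastforce
        then show ?thesis using inc[of c d'] by simp
      qed
      then have
        "(\<Sum>k\<in>d. norm (sqrt (Sup k) - sqrt (Inf k)))
        \<le> (\<Sum>k\<in>d. (m (Sup k) - m (Inf k)) + 2 / sqrt \<eta> * (Sup k - Inf k))"
        by (rule sum_mono)
      also have "\<dots> = (\<Sum>k\<in>d. m (Sup k) - m (Inf k)) + 2 / sqrt \<eta> * (\<Sum>k\<in>d. Sup k - Inf k)"
        by (simp only: sum.distrib sum_distrib_left)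
      also have "(\<Sum>k\<in>d. m (Sup k) - m (Inf k)) \<le> m b - m a"
        by (rule mono_division_sum_le[OF mm d(1,2) True])
      also have "m b - m a \<le> 2 * sqrt \<eta>"
      proof -
        have "m b \<le> sqrt \<eta>" "- sqrt \<eta> \<le> m a" using \<eta>(1) by (auto simp: m_def real_sqrt_minus[symmetric])
        then show ?thesis by linarith
      qed
      also have "2 / sqrt \<eta> * (\<Sum>k\<in>d. Sup k - Inf k) < 2 / sqrt \<eta> * (\<epsilon> * sqrt \<eta> / 4)"
        using d(3) \<eta> e by (intro mult_strict_left_mono) auto
      finally show "(\<Sum>k\<in>d. norm (sqrt (Sup k) - sqrt (Inf k))) < \<epsilon>" using \<eta> e by simp
    qed
  qed
qed (simp add: abs_cont_empty)

text \<open>\<open>2 * C * sqrt\<close> is a primitive of the bound on either side of 0, so by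
  continuity of \<open>g\<close> at 0 the increments of \<open>g\<close> are dominated by those of
  \<open>sqrt\<close>. The point 0 is where a horizontal line crosses the axis.\<close>

lemma abs_cont_of_root_derivative_bound:
  fixes g :: "real \<Rightarrow> complex"
  assumes cont: "continuous_on {a..b} g"
    and D: "\<And>x. a < x \<Longrightarrow> x < b \<Longrightarrow> x \<noteq> 0 \<Longrightarrow> (g has_vector_derivative g' x) (at x)"
    and bd: "\<And>x. a < x \<Longrightarrow> x < b \<Longrightarrow> x \<noteq> 0 \<Longrightarrow> norm (g' x) \<le> C / sqrt \<bar>x\<bar>"
  shows "abs_cont {a..b} g"
proof (rule abs_cont_mono[OF sqrt_abs_cont])
  have half: "norm (g y - g x) \<le> 2 * C * (sqrt y - sqrt x)" if xy: "a \<le> x" "x \<le> y" "y \<le> b" "0 \<notin> {x<..<y}"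
    for x y
  proof (cases "x = y")
    case False
    then have "x < y" using xy by simp
    then have "norm (g y - g x) \<le> 2 * C * sqrt y - 2 * C * sqrt x"
    proof (rule differentiable_bound_general[where f' = g' and \<phi>' = "\<lambda>x. C / sqrt \<bar>x\<bar>"])
      show "continuous_on {x..y} g" by (rule continuous_on_subset[OF cont]) (use xy in auto)
      show "continuous_on {x..y} (\<lambda>x. 2 * C * sqrt x)" by (intro continuous_intros)
      fix t assume t: "x < t" "t < y"
      then have t0: "t \<noteq> 0" "a < t" "t < b" using xy by auto
      show "(g has_vector_derivative g' t) (at t)" "norm (g' t) \<le> C / sqrt \<bar>t\<bar>" using D bd t0 by auto
      have "(sqrt has_real_derivative inverse (sqrt \<bar>t\<bar>) / 2) (at t)"
        by (rule DERIV_real_sqrt_generic[OF t0(1)]) (auto simp: real_sqrt_minus abs_if)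
      then have "((\<lambda>x. 2 * C * sqrt x) has_real_derivative 2 * C * (inverse (sqrt \<bar>t\<bar>) / 2)) (at t)"
        by (rule DERIV_cmult)
      then show "((\<lambda>x. 2 * C * sqrt x) has_vector_derivative C / sqrt \<bar>t\<bar>) (at t)"
        by (simp add: has_real_derivative_iff_has_vector_derivative field_simps)
    qed
    then show ?thesis by (simp add: algebra_simps)
  qed simp
  have inc: "norm (g y - g x) \<le> 2 * C * (sqrt y - sqrt x)" if xy: "a \<le> x" "x \<le> y" "y \<le> b" for x y
  proof (cases "0 \<in> {x<..<y}")
    case True
    then have "norm (g y - g 0) \<le> 2 * C * (sqrt y - sqrt 0)" "norm (g 0 - g x) \<le> 2 * C * (sqrt 0 - sqrt x)"
      using xy by (intro half; auto)+
    then show ?thesis using norm_triangle_ineq[of "g y - g 0" "g 0 - g x"] by (simp add: algebra_simps)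
  qed (use half xy in blast)
  fix x y assume xy: "x \<in> {a..b}" "y \<in> {a..b}"
  show "norm (g x - g y) \<le> (2 * C) * norm (sqrt x - sqrt y)"
  proof (cases "x \<le> y")
    case True then show ?thesis using inc[of x y] xy by (simp add: norm_minus_commute abs_minus_commute)
  next
    case False then show ?thesis using inc[of y x] xy by simp
  qed
qed

context small_pre_schwarzian begin

lemma fhat_deriv_bound:
  assumes "- t0 \<le> Re z" "Re z < 0" "cmod h = 1"
  shows "cmod (fhat_deriv z h) \<le> 2 * cmod (deriv f (- cnj z))"
proof -
  have
    "cmod (fhat_deriv z h) \<le> cmod (deriv f (- cnj z)) + cmod (of_real (2 * Re z) * deriv (deriv f) (- cnj z))"
    unfolding fhat_deriv_def by (rule order_trans[OF norm_triangle_ineq4]) (simp add: norm_mult assms(3))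
  also have "\<dots> \<le> cmod (deriv f (- cnj z)) + 2 * \<kappa> * cmod (deriv f (- cnj z))"
    using second_deriv_small[OF assms(1,2)] by simp
  also have "2 * \<kappa> * cmod (deriv f (- cnj z)) \<le> 1 * cmod (deriv f (- cnj z))" using kap
    by (intro mult_right_mono) auto
  finally show ?thesis by simp
qed

lemma fhat_has_derivative_pos:
  assumes "0 < Re z" shows "(reflected_extension f has_derivative (\<lambda>h. deriv f z * h)) (at z)"
  by (rule has_derivative_transform_within_open[OF _ open_halfspace_Re_gt[of 0]])
    (use assms DERIV_f in \<open>auto simp: fhat_pos has_field_derivative_def\<close>)

lemma deriv_bounded_on_segment:
  assumes "0 < x1" obtains B where "0 < B" "\<And>x y. x1 \<le> x \<Longrightarrow> x \<le> x2 \<Longrightarrow> y1 \<le> y \<Longrightarrow> y \<le> y2 \<Longrightarrow>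
    cmod (deriv f (Complex x y)) \<le> B"
proof -
  have "continuous_on (cbox (Complex x1 y1) (Complex x2 y2)) (deriv f)"
    by (rule continuous_on_subset[OF holomorphic_on_imp_continuous_on[OF holomorphic_deriv[OF hol open_rhp]]])
      (use assms in \<open>auto simp: in_cbox_complex_iff right_half_plane_def\<close>)
  then have "bounded (deriv f ` cbox (Complex x1 y1) (Complex x2 y2))"
    by (intro compact_imp_bounded compact_continuous_image compact_cbox)
  then obtain B where B: "B > 0" "\<forall>w\<in>deriv f ` cbox (Complex x1 y1) (Complex x2 y2). cmod w \<le> B"
    unfolding bounded_pos by blast
  then show thesis by (intro that[of B]) (auto simp: in_cbox_complex_iff)
qed

lemma fhat_horizontal_abs_cont:
  assumes "- t0 < a" shows "abs_cont {a..b} (\<lambda>x. reflected_extension f (Complex x y))"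
proof -
  let ?D = "\<lambda>x. if 0 < x then deriv f (Complex x y) * 1 else fhat_deriv (Complex x y) 1"
  obtain B where B: "B > 0" "\<And>x. t0 \<le> x \<Longrightarrow> x \<le> b \<Longrightarrow> cmod (deriv f (Complex x y)) \<le> B"
    using deriv_bounded_on_segment[OF t0, of b y y] by (metis order_refl)
  \<comment> \<open>The first summand bounds the derivative for
    \<open>\<bar>x\<bar> \<le> t0\<close>, by \<open>deriv_growth\<close> and the factor 2 of
    \<open>fhat_deriv_bound\<close>; the second one covers \<open>x\<close> between
    \<open>t0\<close> and \<open>b\<close>, where f' is bounded by \<open>B\<close>.\<close>
  define C where "C = 4 * sqrt t0 * cmod (deriv f (Complex t0 y)) + B * sqrt \<bar>b\<bar>"
  have near: "2 * cmod (deriv f (Complex r y)) \<le> C / sqrt r" if r: "0 < r" "r \<le> t0" for r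
  proof -
    have 1: "sqrt r * (sqrt r * cmod (deriv f (Complex r y))) = r * cmod (deriv f (Complex r y))"
      using r by (simp flip: mult.assoc)
    have 2:
      "sqrt r * (2 * sqrt t0 * cmod (deriv f (Complex t0 y)))
      = 2 * sqrt (t0 * r) * cmod (deriv f (Complex t0 y))"
      by (simp add: real_sqrt_mult)
    have
      "sqrt r * (sqrt r * cmod (deriv f (Complex r y)))
      \<le> sqrt r * (2 * sqrt t0 * cmod (deriv f (Complex t0 y)))"
      unfolding 1 2 by (rule deriv_growth[OF r])
    then have "sqrt r * cmod (deriv f (Complex r y)) \<le> 2 * sqrt t0 * cmod (deriv f (Complex t0 y))"
      using r by (simp add: mult_le_cancel_left_pos)
    moreover have "0 \<le> B * sqrt \<bar>b\<bar>" using B(1) by simp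
    ultimately have "2 * cmod (deriv f (Complex r y)) * sqrt r \<le> C" unfolding C_def by (simp add: mult_ac)
    then show ?thesis using r by (simp add: pos_le_divide_eq)
  qed
  show ?thesis
  proof (rule abs_cont_of_root_derivative_bound[where g' = ?D and C = C])
    have "isCont (\<lambda>x. reflected_extension f (Complex x y)) x" if "a \<le> x" for x
    proof (rule isCont_o2[where g = "reflected_extension f"])
      show "isCont (\<lambda>x. Complex x y) x" unfolding Complex_eq by (intro continuous_intros)
      show "isCont (reflected_extension f) (Complex x y)" using that assms by (intro fhat_isCont) simp
    qed
    then show "continuous_on {a..b} (\<lambda>x. reflected_extension f (Complex x y))"
      by (intro continuous_at_imp_continuous_on) auto
    fix x assume x: "a < x" "x < b" "x \<noteq> 0"
    have "((\<lambda>t. reflected_extension f (Complex x y + of_real t)) has_vector_derivative ?D x) (at 0)"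
      using partials_of_derivative(3)[OF fhat_has_derivative_pos[of "Complex x y"]]
        partials_of_derivative(3)[OF fhat_has_derivative[of "Complex x y"]] x by (cases "0 < x") auto
    moreover have "((\<lambda>t. t - x) has_vector_derivative 1) (at x)" by (auto intro!: derivative_eq_intros)
    ultimately have
      "(((\<lambda>t. reflected_extension f (Complex x y + of_real t)) \<circ> (\<lambda>t. t - x)) has_vector_derivative 1 *\<^sub>R ?D x)
      (at x)"
      by (intro vector_diff_chain_at) auto
    moreover have "((\<lambda>t. reflected_extension f (Complex x y + of_real t)) \<circ> (\<lambda>t. t - x))
      = (\<lambda>x. reflected_extension f (Complex x y))"
      by (auto simp: fun_eq_iff Complex_eq algebra_simps)
    ultimately show "((\<lambda>x. reflected_extension f (Complex x y)) has_vector_derivative ?D x) (at x)" by simp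
    show "norm (?D x) \<le> C / sqrt \<bar>x\<bar>"
    proof (cases "0 < x")
      case True
      show ?thesis
      proof (cases "x \<le> t0")
        case True
        then have "cmod (deriv f (Complex x y)) \<le> C / sqrt x"
          using near[of x] \<open>0 < x\<close> norm_ge_zero[of "deriv f (Complex x y)"] by linarith
        then show ?thesis using \<open>0 < x\<close> by simp
      next
        case False
        have "cmod (deriv f (Complex x y)) * sqrt x \<le> B * sqrt \<bar>b\<bar>"
          using B(2)[of x] False x True B(1) by (intro mult_mono) auto
        also have "\<dots> \<le> C" unfolding C_def using t0 by simp
        finally show ?thesis using True by (simp add: pos_le_divide_eq)
      qed
    next
      case False
      then have "cmod (fhat_deriv (Complex x y) 1) \<le> 2 * cmod (deriv f (- cnj (Complex x y)))"
        using x assms by (intro fhat_deriv_bound) auto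
      also have "- cnj (Complex x y) = Complex (- x) y" by (simp add: complex_eq_iff)
      also have "2 * cmod (deriv f (Complex (- x) y)) \<le> C / sqrt (- x)" using False x assms by (intro near) auto
      finally show ?thesis using False by simp
    qed
  qed
qed

text \<open>Off the axis the extension is differentiable with a derivative bounded on vertical
  segments, hence Lipschitz there. Nothing is claimed on the axis itself, which is a single
  exceptional line for \<open>ACL_on\<close>.\<close>

lemma fhat_vertical_abs_cont:
  assumes "- t0 < x" "x \<noteq> 0" shows "abs_cont {a..b} (\<lambda>y. reflected_extension f (Complex x y))"
proof -
  let ?D = "\<lambda>y. if 0 < x then deriv f (Complex x y) * \<i> else fhat_deriv (Complex x y) \<i>"
  obtain B where B: "B > 0" "\<And>y. a \<le> y \<Longrightarrow> y \<le> b \<Longrightarrow> cmod (deriv f (Complex \<bar>x\<bar> y)) \<le> B"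
    using deriv_bounded_on_segment[of "\<bar>x\<bar>" "\<bar>x\<bar>" a b] assms(2) by (metis order_refl zero_less_abs_iff)
  have D: "((\<lambda>y. reflected_extension f (Complex x y)) has_vector_derivative ?D y) (at y)" for y
  proof -
    have "((\<lambda>t. reflected_extension f (Complex x y + \<i> * of_real t)) has_vector_derivative ?D y) (at 0)"
      using partials_of_derivative(4)[OF fhat_has_derivative_pos[of "Complex x y"]]
        partials_of_derivative(4)[OF fhat_has_derivative[of "Complex x y"]] assms by (cases "0 < x") auto
    moreover have "((\<lambda>t. t - y) has_vector_derivative 1) (at y)" by (auto intro!: derivative_eq_intros)
    ultimately have
      "(((\<lambda>t. reflected_extension f (Complex x y + \<i> * of_real t)) \<circ> (\<lambda>t. t - y)) has_vector_derivative 1 *\<^sub>R ?D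
      y) (at y)"
      by (intro vector_diff_chain_at) auto
    moreover have "((\<lambda>t. reflected_extension f (Complex x y + \<i> * of_real t)) \<circ> (\<lambda>t. t - y))
      = (\<lambda>y. reflected_extension f (Complex x y))"
      by (auto simp: fun_eq_iff Complex_eq algebra_simps)
    ultimately show ?thesis by simp
  qed
  have bd: "norm (?D y) \<le> 2 * B" if "a \<le> y" "y \<le> b" for y
  proof (cases "0 < x")
    case True then show ?thesis using B(2)[OF that] B(1) by (simp add: norm_mult)
  next
    case False
    then have le: "cmod (fhat_deriv (Complex x y) \<i>) \<le> 2 * cmod (deriv f (- cnj (Complex x y)))"
      using assms by (intro fhat_deriv_bound) auto
    have eq: "- cnj (Complex x y) = Complex \<bar>x\<bar> y" using False by (simp add: complex_eq_iff)
    show ?thesis unfolding if_not_P[OF False] using le[unfolded eq] B(2)[OF that] by linarith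
  qed
  show ?thesis
  proof (rule lipschitz_abs_cont[where C = "2 * B"])
    fix y y' assume y: "y \<in> {a..b}" "y' \<in> {a..b}"
    have "norm (reflected_extension f (Complex x y) - reflected_extension f (Complex x y'))
      \<le> 2 * B * norm (y - y')"
    proof (rule differentiable_bound[where S = "{a..b}" and f' = "\<lambda>y h. h *\<^sub>R ?D y"])
      show "((\<lambda>y. reflected_extension f (Complex x y)) has_derivative (\<lambda>h. h *\<^sub>R ?D y)) (at y within {a..b})"
        for y
        by (rule has_derivative_at_withinI[OF D[unfolded has_vector_derivative_def]])
      show "onorm (\<lambda>h. h *\<^sub>R ?D y) \<le> 2 * B" if "y \<in> {a..b}" for y
        by (rule onorm_le) (use bd[of y] that in \<open>auto simp: mult.commute intro!: mult_left_mono\<close>)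
    qed (use y in auto)
    then show "norm (reflected_extension f (Complex x y) - reflected_extension f (Complex x y'))
      \<le> 2 * B * \<bar>y - y'\<bar>" by simp
  qed
qed

lemma fhat_ACL:
  assumes "\<tau> \<le> t0" shows "ACL_on {z. - \<tau> < Re z} (reflected_extension f)"
  unfolding ACL_on_def abs_cont_on_iff
proof (intro allI impI conjI)
  fix a b assume ab: "cbox a b \<subseteq> {z. - \<tau> < Re z}"
  have "abs_cont {Re a..Re b} (\<lambda>x. reflected_extension f (Complex x y))" if "y \<in> {Im a..Im b}" for y
  proof (cases "Re a \<le> Re b")
    case True
    then have "Complex (Re a) y \<in> cbox a b" using that by (simp add: in_cbox_complex_iff)
    then have "- \<tau> < Re a" using ab by auto
    then show ?thesis using assms by (intro fhat_horizontal_abs_cont) auto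
  qed (simp add: abs_cont_empty)
  then show
    "AE y in lebesgue. y \<in> {Im a..Im b} \<longrightarrow> abs_cont {Re a..Re b} (\<lambda>x. reflected_extension f (Complex x y))"
    by simp
  have "negligible {0::real}" by simp
  then have "AE x in lebesgue. x \<notin> {0::real}"
    by (intro AE_not_in) (simp only: negligible_iff_null_sets)
  then show
    "AE x in lebesgue. x \<in> {Re a..Re b} \<longrightarrow> abs_cont {Im a..Im b} (\<lambda>y. reflected_extension f (Complex x y))"
  proof (rule eventually_mono, intro impI)
    fix x :: real assume x: "x \<notin> {0}" "x \<in> {Re a..Re b}"
    show "abs_cont {Im a..Im b} (\<lambda>y. reflected_extension f (Complex x y))"
    proof (cases "Im a \<le> Im b")
      case True
      then have "Complex x (Im a) \<in> cbox a b" using x by (simp add: in_cbox_complex_iff)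
      then have "- \<tau> < x" using ab by auto
      then show ?thesis using assms x by (intro fhat_vertical_abs_cont) auto
    qed (simp add: abs_cont_empty)
  qed
qed

lemma fhat_dilatation:
  assumes "- t0 \<le> Re z" "Re z < 0"
  shows "complex_dilatation (reflected_extension f) z = - of_real (2 * Re z) * pre_schwarzian f (- cnj z)"
    "cmod (wirtinger_bar (reflected_extension f) z) \<le> 1 / 2 * cmod (wirtinger (reflected_extension f) z)"
proof -
  have
    "(reflected_extension f has_derivative (\<lambda>h. deriv f (- cnj z) * h
    + (- (of_real (2 * Re z) * deriv (deriv f) (- cnj z))) * cnj h)) (at z)"
    using fhat_has_derivative[OF assms(2)] unfolding fhat_deriv_def[abs_def] by simp
  note w = wirtinger_of_derivative[OF this]
  show "complex_dilatation (reflected_extension f) z = - of_real (2 * Re z) * pre_schwarzian f (- cnj z)"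
    unfolding complex_dilatation_def w pre_schwarzian_def by simp
  have "2 * \<kappa> * cmod (deriv f (- cnj z)) \<le> 1 / 2 * cmod (deriv f (- cnj z))" using kap
    by (intro mult_right_mono) auto
  then show
    "cmod (wirtinger_bar (reflected_extension f) z) \<le> 1 / 2 * cmod (wirtinger (reflected_extension f) z)"
    unfolding w using second_deriv_small[OF assms] by (simp only: norm_minus_cancel)
qed

text \<open>Reduces the theorem to injectivity on some strip: continuity, absolute continuity on
  lines and the dilatation bound hold for every width up to \<open>t0\<close>, and the inverse is
  continuous by invariance of domain.\<close>

lemma fhat_quasiconformal:
  assumes \<tau>: "0 < \<tau>" "\<tau> \<le> t0" and inj: "inj_on (reflected_extension f) {z. - \<tau> < Re z}"
  shows "quasiconformal_on (reflected_extension f) {z. - \<tau> < Re z}"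
  unfolding quasiconformal_on_def
proof (intro conjI)
  let ?\<Omega> = "{z. - \<tau> < Re z}"
  show op: "open ?\<Omega>" by (rule open_halfspace_Re_gt)
  show "connected ?\<Omega>" by (rule convex_connected[OF convex_halfspace_Re_gt])
  have "continuous_on ?\<Omega> (reflected_extension f)"
    using fhat_isCont \<tau> by (intro continuous_at_imp_continuous_on) auto
  from invariance_of_domain_homeomorphism[OF op this _ inj]
  show "\<exists>G. homeomorphism ?\<Omega> (reflected_extension f ` ?\<Omega>) (reflected_extension f) G" by auto
  show "ACL_on ?\<Omega> (reflected_extension f)" by (rule fhat_ACL[OF \<tau>(2)])
  have "{z::complex. Re z = 0} \<in> null_sets lebesgue"
  proof -
    have "negligible {z::complex. 1 \<bullet> z = 0}" by (rule negligible_hyperplane) simp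
    then show ?thesis by (simp add: inner_complex_def negligible_iff_null_sets)
  qed
  then have "AE z in lebesgue. z \<notin> {z::complex. Re z = 0}" by (rule AE_not_in)
  then have "AE z in lebesgue. z \<in> ?\<Omega> \<longrightarrow> cmod (wirtinger_bar (reflected_extension f) z)
    \<le> 1 / 2 * cmod (wirtinger (reflected_extension f) z)"
  proof (rule eventually_mono, intro impI)
    fix z :: complex assume z: "z \<notin> {z. Re z = 0}" "z \<in> ?\<Omega>"
    show "cmod (wirtinger_bar (reflected_extension f) z) \<le> 1 / 2 * cmod (wirtinger (reflected_extension f) z)"
    proof (cases "0 < Re z")
      case True
      have "(reflected_extension f has_derivative (\<lambda>h. deriv f z * h + 0 * cnj h)) (at z)"
        using fhat_has_derivative_pos[OF True] by simp
      from wirtinger_of_derivative[OF this] show ?thesis by simp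
    next
      case False then show ?thesis using z \<tau> by (intro fhat_dilatation) auto
    qed
  qed
  then show "\<exists>k. 0 \<le> k \<and> k < 1 \<and> (AE z in lebesgue. z \<in> ?\<Omega> \<longrightarrow> cmod (wirtinger_bar (reflected_extension f) z)
    \<le> k * cmod (wirtinger (reflected_extension f) z))"
    by (intro exI[of _ "1 / 2"]) auto
qed

end

section \<open>Injectivity on the closed half-plane\<close>

lemma connected_circle_minus_point:
  assumes "a \<in> sphere (0::complex) 1" shows "connected (sphere 0 1 - {a})"
proof -
  have a: "cmod a = 1" "a \<noteq> 0" using assms by auto
  have "sphere 0 1 - {a} = (\<lambda>t. a * exp (\<i> * complex_of_real t)) ` {0<..<2 * pi}"
  proof (intro equalityI subsetI)
    fix z assume z: "z \<in> sphere 0 1 - {a}"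
    define t where "t = Arg2pi (z / a)"
    have za: "cmod (z / a) = 1" using z a by (simp add: norm_divide)
    have t: "0 \<le> t" "t < 2 * pi" "z / a = exp (\<i> * of_real t)"
      using Arg2pi[of "z / a"] za by (auto simp: t_def is_Arg_def)
    have "t \<noteq> 0" using t(3) z a by (auto simp: divide_eq_eq)
    then show "z \<in> (\<lambda>t. a * exp (\<i> * complex_of_real t)) ` {0<..<2 * pi}"
      using t a by (intro image_eqI[of _ _ t]) (auto simp: divide_eq_eq mult.commute)
  next
    fix z assume "z \<in> (\<lambda>t. a * exp (\<i> * complex_of_real t)) ` {0<..<2 * pi}"
    then obtain t where t: "0 < t" "t < 2 * pi" "z = a * exp (\<i> * of_real t)" by auto
    have "exp (\<i> * of_real t) \<noteq> 1"
    proof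
      assume "exp (\<i> * of_real t) = 1"
      then have "Arg2pi 1 = t" using t by (intro Arg2pi_unique[of 1]) auto
      moreover have "Arg2pi 1 = 0" by (intro Arg2pi_unique[of 1]) auto
      ultimately show False using t by simp
    qed
    then show "z \<in> sphere 0 1 - {a}" using a t(3) by (auto simp: norm_mult)
  qed
  moreover have "connected ((\<lambda>t. a * exp (\<i> * complex_of_real t)) ` {0<..<2 * pi})"
    by (intro connected_continuous_image continuous_intros) auto
  ultimately show ?thesis by simp
qed

lemma jordan_curve_sphere_minus_point:
  assumes J: "jordan_curve_sphere J" shows "connectedin Riemann_sphere (J - {w})"
proof -
  obtain \<gamma> where \<gamma>: "embedding_map (top_of_set (sphere (0::complex) 1)) Riemann_sphere \<gamma>" "J = \<gamma> ` sphere 0 1"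
    using J unfolding jordan_curve_sphere_def by blast
  have cont: "continuous_map (top_of_set (sphere (0::complex) 1)) Riemann_sphere \<gamma>"
    and inj: "inj_on \<gamma> (sphere 0 1)"
    using homeomorphic_imp_continuous_map[OF \<gamma>(1)[unfolded embedding_map_def]] homeomorphic_imp_injective_map[OF
      \<gamma>(1)[unfolded embedding_map_def]]
    by (auto simp: continuous_map_in_subtopology)
  have img: "connectedin Riemann_sphere (\<gamma> ` S)" if "connected S" "S \<subseteq> sphere 0 1" for S
    by (rule connectedin_continuous_map_image[OF cont]) (use that in \<open>simp add: connectedin_subtopology\<close>)
  show ?thesis
  proof (cases "w \<in> J")
    case True
    then obtain a where a: "a \<in> sphere 0 1" "w = \<gamma> a" using \<gamma>(2) by auto
    have "J - {w} = \<gamma> ` (sphere 0 1 - {a})" using \<gamma>(2) a inj by (auto simp: inj_on_def)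
    then show ?thesis using img[OF connected_circle_minus_point[OF a(1)]] by simp
  next
    case False
    then show ?thesis using img[of "sphere 0 1"] \<gamma>(2) connected_sphere[of "0::complex" 1] by simp
  qed
qed

lemma half_plane_polar:
  assumes "0 < Re z" obtains s \<theta> where "s = cmod z" "- pi / 2 < \<theta>" "\<theta> < pi / 2" "z = of_real s * cis \<theta>"
proof -
  have z: "z \<noteq> 0" using assms by auto
  have "\<bar>Arg z\<bar> < pi / 2" using Re_Ln_pos_lt[OF z] assms z by (simp add: Arg_def)
  moreover have "z = of_real (cmod z) * cis (Arg z)" using z by (simp add: cis_Arg sgn_eq)
  ultimately show thesis by (intro that[of "cmod z" "Arg z"]) auto
qed

locale jordan_pre_schwarzian = small_pre_schwarzian +
  assumes infty: "filterlim f at_infinity (inf at_infinity (principal right_half_plane))"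
    and jordan: "jordan_domain_sphere (Some ` f ` right_half_plane)"
begin

abbreviation "g \<equiv> reflected_extension f"
abbreviation "H \<equiv> right_half_plane"

lemma open_image_rhp: "open (f ` H)"
  using open_mapping_thm3[OF hol open_rhp inj] .

lemma norm_f_large:
  obtains M where "0 < M" "\<And>z. z \<in> H \<Longrightarrow> M \<le> cmod z \<Longrightarrow> B < cmod (f z)"
proof -
  have "eventually (\<lambda>z. B + 1 \<le> cmod (f z)) (inf at_infinity (principal H))"
  proof -
    have "\<forall>r>0. eventually (\<lambda>z. r \<le> cmod (f z)) (inf at_infinity (principal H))"
      using infty filterlim_at_infinity[of 0 f] by simp
    then have "0 < max (B + 1) 1 \<longrightarrow> eventually (\<lambda>z. max (B + 1) 1 \<le> cmod (f z)) (inf at_infinity (principal H))"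
      by (rule spec)
    then have "eventually (\<lambda>z. max (B + 1) 1 \<le> cmod (f z)) (inf at_infinity (principal H))" by simp
    then show ?thesis by (rule eventually_mono) simp
  qed
  then obtain b where b: "\<And>z. b \<le> norm z \<Longrightarrow> z \<in> H \<Longrightarrow> B + 1 \<le> cmod (f z)"
    unfolding eventually_inf_principal eventually_at_infinity by auto
  show thesis by (rule that[of "max b 1"]) (use b in fastforce)+
qed

text \<open>If the boundary value were \<open>f u\<close>, then the continuous inverse of
  \<open>f\<close>, applied to \<open>f v\<close> as \<open>v\<close> tends to \<open>z\<close>,
  would give the limit \<open>u\<close> in the half-plane as well as \<open>z\<close> on the
  axis.\<close>

lemma g_boundary_notin:
  assumes "Re z = 0" shows "g z \<notin> f ` H"
proof
  assume "g z \<in> f ` H"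
  then obtain u where u: "u \<in> H" "g z = f u" by auto
  obtain h where h: "homeomorphism H (f ` H) f h"
    using invariance_of_domain_homeomorphism[OF open_rhp holomorphic_on_imp_continuous_on[OF hol] _ inj] by auto
  have "isCont h (f u)"
    using homeomorphism_cont2[OF h] open_image_rhp u(1) by (simp add: continuous_on_eq_continuous_at)
  then have "((\<lambda>v. h (f v)) \<longlongrightarrow> h (f u)) (at z within H)"
    using fhat_boundary[OF assms] unfolding u(2) by (rule isCont_tendsto_compose)
  moreover have "((\<lambda>v. h (f v)) \<longlongrightarrow> z) (at z within H)"
    by (rule Lim_transform_eventually[OF tendsto_ident_at]) (auto simp: eventually_at_filter
      homeomorphism_apply1[OF h])
  ultimately have "h (f u) = z" using tendsto_unique[OF trivial_limit_rhp[OF assms]] by blast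
  then have "u = z" using homeomorphism_apply1[OF h u(1)] by simp
  then show False using u(1) assms by (simp add: right_half_plane_def)
qed

lemma g_boundary_closure:
  assumes "Re z = 0" shows "g z \<in> closure (f ` H)"
proof (rule Lim_in_closed_set[OF closed_closure _ trivial_limit_rhp[OF assms] fhat_boundary[OF assms]])
  show "eventually (\<lambda>x. f x \<in> closure (f ` H)) (at z within H)"
    unfolding eventually_at_filter by (rule always_eventually) (use closure_subset[of "f ` H"] in auto)
qed

lemma frontier_in_J:
  assumes "w \<in> closure (f ` H)" "w \<notin> f ` H" shows "Some w \<in> Riemann_sphere frontier_of (Some ` f ` H)"
proof -
  have op: "openin Riemann_sphere (Some ` f ` H)" using jordan by (simp add: jordan_domain_sphere_def)
  have "Some w \<in> Riemann_sphere closure_of (Some ` f ` H)"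
    unfolding in_closure_of
  proof (intro conjI allI impI)
    show "Some w \<in> topspace Riemann_sphere" by simp
    fix T assume T: "Some w \<in> T \<and> openin Riemann_sphere T"
    then have "open {z. Some z \<in> T}"
    proof -
      consider U where "open U" "T = Some ` U" | C where "compact C" "T = insert None (Some ` (UNIV - C))"
        using T unfolding openin_Alexandroff_compactification by auto
      then show ?thesis
      proof cases
        case 1 then have "{z. Some z \<in> T} = U" by auto
        then show ?thesis using 1 by simp
      next
        case 2 then have "{z. Some z \<in> T} = - C" by auto
        then show ?thesis using 2 compact_imp_closed by auto
      qed
    qed
    then have "{z. Some z \<in> T} \<inter> f ` H \<noteq> {}"
      using open_Int_closure_eq_empty[of "{z. Some z \<in> T}" "f ` H"] assms(1) T by auto
    then show "\<exists>y. y \<in> Some ` f ` H \<and> y \<in> T" by blast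
  qed
  then show ?thesis using assms(2) interior_of_openin[OF op] by (auto simp: frontier_of_def)
qed

text \<open>Far points of the half-plane have images outside any given compact set. That infinity
  belongs to the boundary curve fixes on which side of an auxiliary Jordan curve the rest of the
  boundary lies.\<close>

lemma None_in_J: "None \<in> Riemann_sphere frontier_of (Some ` f ` H)"
proof -
  have op: "openin Riemann_sphere (Some ` f ` H)" using jordan by (simp add: jordan_domain_sphere_def)
  have "None \<in> Riemann_sphere closure_of (Some ` f ` H)"
    unfolding in_closure_of
  proof (intro conjI allI impI)
    show "None \<in> topspace Riemann_sphere" by simp
    fix T assume T: "None \<in> T \<and> openin Riemann_sphere T"
    then obtain C where C: "compact C" "T = insert None (Some ` (UNIV - C))"
      unfolding openin_Alexandroff_compactification by auto
    obtain B where B: "\<And>x. x \<in> C \<Longrightarrow> norm x \<le> B" using compact_imp_bounded[OF C(1)] unfolding bounded_iff by blast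
    obtain M where M: "0 < M" "\<And>z. z \<in> H \<Longrightarrow> M \<le> cmod z \<Longrightarrow> B < cmod (f z)" using norm_f_large by blast
    have "of_real M \<in> H" using M(1) by (simp add: right_half_plane_def)
    then have "f (of_real M) \<notin> C" using M(2)[of "of_real M"] M(1) B by force
    then show "\<exists>y. y \<in> Some ` f ` H \<and> y \<in> T" using C(2) \<open>of_real M \<in> H\<close> by blast
  qed
  then show ?thesis using interior_of_openin[OF op] by (auto simp: frontier_of_def)
qed

lemma J_disjoint: "Some w \<in> Riemann_sphere frontier_of (Some ` f ` H) \<Longrightarrow> w \<notin> f ` H"
  using jordan interior_of_openin[of Riemann_sphere "Some ` f ` H"]
    by (auto simp: frontier_of_def jordan_domain_sphere_def)

(* The image under f of a half-circle ending at the two points, closed up by the common value w, is a Jordan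
   curve. The rest of the boundary of f(H) is connected and contains infinity, hence lies outside that curve;
   so f(H) fills the inside, and the boundary values between a and b can only be w. *)
lemma g_boundary_inj_aux:
  assumes ab: "a < b" and eq: "g (Complex 0 a) = g (Complex 0 b)" and y: "a < y" "y < b"
  shows "g (Complex 0 y) = g (Complex 0 a)"
proof -
  define w where "w = g (Complex 0 a)"
  define c where "c = Complex 0 ((a + b) / 2)"
  define r where "r = (b - a) / 2"
  have r: "r > 0" using ab by (simp add: r_def)
  \<comment> \<open>The angle runs from -\<pi>/2 to \<pi>/2, so the half-circle leads from the lower
    endpoint to the upper one through the half-plane.\<close>
  define \<sigma> where "\<sigma> t = c + of_real r * cis (pi * (t - 1 / 2))" for t
  define \<Gamma> where "\<Gamma> = g \<circ> \<sigma>"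
  define A where "A = \<sigma> ` {0<..<1}"
  have \<sigma>01: "\<sigma> 0 = Complex 0 a" "\<sigma> 1 = Complex 0 b"
    by (auto simp: \<sigma>_def c_def r_def complex_eq_iff field_simps)
  have \<sigma>pos: "0 < Re (\<sigma> t)" if "0 < t" "t < 1" for t
  proof -
    have "pi * t < pi * 1" using that by (intro mult_strict_left_mono) auto
    then have "- (pi / 2) < pi * (t - 1 / 2)" "pi * (t - 1 / 2) < pi / 2"
      using that pi_gt_zero mult_pos_pos[of pi t] by (auto simp: right_diff_distrib)
    then have "0 < cos (pi * (t - 1 / 2))" by (intro cos_gt_zero_pi) auto
    then show ?thesis using r by (simp add: \<sigma>_def c_def)
  qed
  have \<sigma>nn: "0 \<le> Re (\<sigma> t)" if "0 \<le> t" "t \<le> 1" for t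
    using \<sigma>pos[of t] \<sigma>01 that by (cases "t = 0 \<or> t = 1") (auto simp: less_imp_le)
  have \<sigma>inj: "s = t" if st: "s \<in> {0..1}" "t \<in> {0..1}" "\<sigma> s = \<sigma> t" for s t
  proof -
    have "cis (pi * (s - 1 / 2)) = cis (pi * (t - 1 / 2))" using st(3) r by (simp add: \<sigma>_def)
    then have e: "sin (pi * (s - 1 / 2)) = sin (pi * (t - 1 / 2))" by (simp add: complex_eq_iff)
    have rng: "- (pi / 2) \<le> pi * (s - 1 / 2)" "pi * (s - 1 / 2) \<le> pi / 2" "- (pi / 2) \<le> pi * (t - 1 / 2)"
      "pi * (t - 1 / 2) \<le> pi / 2"
      using st(1,2) mult_left_mono[of s 1 pi] mult_left_mono[of t 1 pi] by (auto simp: right_diff_distrib)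
    have "pi * (s - 1 / 2) = pi * (t - 1 / 2)" using sin_inj_pi[OF rng e] .
    then show ?thesis by simp
  qed
  have AH: "A \<subseteq> H" using \<sigma>pos by (auto simp: A_def right_half_plane_def)
  have Asph: "z \<in> A" if z: "z \<in> H" "dist c z = r" for z
  proof -
    have "0 < Re (z - c)" using z(1) by (simp add: c_def right_half_plane_def)
    then obtain s \<theta> where s: "s = cmod (z - c)" "- pi / 2 < \<theta>" "\<theta> < pi / 2" "z - c = of_real s * cis \<theta>"
      by (rule half_plane_polar)
    have "s = r" using z(2) s(1) by (simp add: dist_norm norm_minus_commute)
    then have "z = \<sigma> (\<theta> / pi + 1 / 2)" using s(4) by (simp add: \<sigma>_def field_simps)
    moreover have "\<theta> / pi + 1 / 2 \<in> {0<..<1}" using s(2,3) by (simp add: field_simps)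
    ultimately show ?thesis by (auto simp: A_def)
  qed
  have wn: "w \<notin> f ` H" "w \<in> closure (f ` H)" using g_boundary_notin g_boundary_closure by (auto simp: w_def)
  have \<Gamma>in: "\<Gamma> t \<in> f ` H" if "0 < t" "t < 1" for t
    using \<sigma>pos[OF that] by (auto simp: \<Gamma>_def fhat_pos right_half_plane_def)
  have \<Gamma>01: "\<Gamma> 0 = w" "\<Gamma> 1 = w" using eq by (auto simp: \<Gamma>_def \<sigma>01 w_def)
  have "simple_path \<Gamma>" unfolding simple_path_def
  proof
    have "continuous_on {0..1} \<sigma>" unfolding \<sigma>_def by (intro continuous_intros)
    moreover have "continuous_on (\<sigma> ` {0..1}) g"
      using \<sigma>nn t0 by (intro continuous_at_imp_continuous_on) (force intro!: fhat_isCont)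
    ultimately show "path \<Gamma>" unfolding path_def \<Gamma>_def by (rule continuous_on_compose)
    show "loop_free \<Gamma>" unfolding loop_free_def
    proof (intro ballI impI)
      fix s t :: real assume st: "s \<in> {0..1}" "t \<in> {0..1}" "\<Gamma> s = \<Gamma> t"
      show "s = t \<or> s = 0 \<and> t = 1 \<or> s = 1 \<and> t = 0"
      proof (cases "s \<in> {0, 1} \<or> t \<in> {0, 1}")
        case True
        have end_w: "v \<in> {0, 1}" if "u \<in> {0, 1}" "v \<in> {0..1}" "\<Gamma> u = \<Gamma> v" for u v
        proof -
          have "\<Gamma> v \<notin> f ` H" using that(1,3) \<Gamma>01 wn(1) by auto
          then have "\<not> (0 < v \<and> v < 1)" using \<Gamma>in[of v] by blast
          then show ?thesis using that(2) by auto
        qed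
        have "t \<in> {0, 1}" if "s \<in> {0, 1}" using end_w[OF that st(2,3)] .
        moreover have "s \<in> {0, 1}" if "t \<in> {0, 1}" using end_w[OF that st(1) st(3)[symmetric]] .
        ultimately show ?thesis using True by auto
      next
        case False
        then have p: "0 < Re (\<sigma> s)" "0 < Re (\<sigma> t)" using st by (auto intro!: \<sigma>pos)
        then have "\<sigma> s = \<sigma> t" using st(3) inj by (auto simp: \<Gamma>_def fhat_pos right_half_plane_def inj_on_def)
        then show ?thesis using \<sigma>inj st by blast
      qed
    qed
  qed
  moreover have "pathfinish \<Gamma> = pathstart \<Gamma>" by (simp add: pathfinish_def pathstart_def \<Gamma>01)
  ultimately have jo: "simple_path \<Gamma>" "pathfinish \<Gamma> = pathstart \<Gamma>" by auto
  define C where "C = path_image \<Gamma>"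
  define I where "I = inside C"
  have I: "I \<noteq> {}" "open I" "connected I" "bounded I" "frontier I = C" "I \<inter> C = {}" "open (outside C)"
    "inside C \<inter> outside C = {}" "inside C \<union> outside C = - C"
    using Jordan_inside_outside[OF jo] inside_no_overlap[of C] inside_Int_outside[of C] inside_Un_outside[of C]
      by (auto simp: I_def C_def)
  have CA: "C = insert w (f ` A)"
  proof -
    have "{0..1} = insert 0 (insert 1 {0<..<1::real})" by auto
    then have "C = insert w (\<Gamma> ` {0<..<1})" unfolding C_def path_image_def using \<Gamma>01 by auto
    moreover have "\<Gamma> ` {0<..<1} = f ` A" unfolding A_def image_image using \<sigma>pos
      by (intro image_cong) (auto simp: \<Gamma>_def fhat_pos)
    ultimately show ?thesis by simp
  qed
  let ?J = "Riemann_sphere frontier_of (Some ` f ` H)"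
  have con: "connectedin Riemann_sphere (?J - {Some w})"
    using jordan by (intro jordan_curve_sphere_minus_point) (simp add: jordan_domain_sphere_def)
  have 1: "Some z \<notin> ?J" if z: "z \<in> I" for z
  proof
    assume zJ: "Some z \<in> ?J"
    \<comment> \<open>The inside and the outside of \<open>C\<close>, the latter with infinity
      added, would disconnect \<open>?J - {Some w}\<close>: apart from \<open>w\<close>, all points
      of \<open>C\<close> are images of interior points and so do not belong to the boundary
      curve.\<close>
    define U1 where "U1 = Some ` I"
    define U2 where "U2 = insert None (Some ` (UNIV - (I \<union> C)))"
    have o1: "openin Riemann_sphere U1" unfolding openin_Alexandroff_compactification U1_def using I(2) by auto
    have "bounded C" unfolding C_def using bounded_simple_path_image[OF jo(1)] .
    then have "bounded (I \<union> C)" using I(4) by simp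
    moreover have "I \<union> C = - outside C" using I(8,9) unfolding I_def by blast
    then have "closed (I \<union> C)" using I(7) by (simp add: closed_Compl)
    ultimately have "compact (I \<union> C)" by (simp add: compact_eq_bounded_closed)
    then have o2: "openin Riemann_sphere U2"
      unfolding openin_Alexandroff_compactification U2_def using compact_imp_closed by auto
    have "w \<noteq> z" using z I(6) CA by auto
    then have "Some z \<in> U1 \<inter> (?J - {Some w})" using z zJ by (auto simp: U1_def)
    moreover have "None \<in> U2 \<inter> (?J - {Some w})" using None_in_J by (auto simp: U2_def)
    moreover have "?J - {Some w} \<subseteq> U1 \<union> U2"
    proof
      fix v assume v: "v \<in> ?J - {Some w}"
      show "v \<in> U1 \<union> U2"
      proof (cases v)
        case None then show ?thesis by (simp add: U2_def)
      next
        case (Some x)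
        then have "x \<notin> f ` H" "x \<noteq> w" using v J_disjoint by auto
        then have "x \<notin> C" using CA AH by auto
        then show ?thesis using Some by (auto simp: U1_def U2_def)
      qed
    qed
    moreover have "U1 \<inter> U2 \<inter> (?J - {Some w}) = {}" by (auto simp: U1_def U2_def)
    ultimately have "openin Riemann_sphere U1 \<and> openin Riemann_sphere U2 \<and> ?J - {Some w} \<subseteq> U1 \<union> U2 \<and>
      U1 \<inter> U2 \<inter> (?J - {Some w}) = {} \<and> U1 \<inter> (?J - {Some w}) \<noteq> {} \<and> U2 \<inter> (?J - {Some w}) \<noteq> {}"
      using o1 o2 by blast
    then show False using con unfolding connectedin by metis
  qed
  have ID: "I \<inter> f ` H \<noteq> {}"
  proof -
    have "\<sigma> (1 / 2) \<in> A" by (simp add: A_def)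
    then have "f (\<sigma> (1 / 2)) \<in> closure I" "f (\<sigma> (1 / 2)) \<in> f ` H" using I(5) CA AH by (auto simp: frontier_def)
    then show ?thesis using open_Int_closure_eq_empty[OF open_image_rhp, of I] by auto
  qed
  have "I \<subseteq> f ` H"
  proof (rule ccontr)
    assume "\<not> I \<subseteq> f ` H"
    then have "I - f ` H \<noteq> {}" by blast
    then have "I \<inter> frontier (f ` H) \<noteq> {}" by (rule connected_Int_frontier[OF I(3) ID])
    then obtain z where "z \<in> I" "z \<in> closure (f ` H)" "z \<notin> f ` H" using open_image_rhp
      by (auto simp: frontier_def interior_open)
    then show False using 1[of z] frontier_in_J[of z] by simp
  qed
  define R where "R = ball c r \<inter> H"
  define R' where "R' = H - cball c r"
  have conR: "connected R" unfolding R_def by (intro convex_connected convex_Int convex_ball convex_rhp)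
  have conR': "connected R'"
  proof -
    have "R' = (\<lambda>(s, \<theta>). c + of_real s * cis \<theta>) ` ({r<..} \<times> {- pi / 2<..<pi / 2})"
    proof (intro equalityI subsetI)
      fix z assume z: "z \<in> R'"
      have "0 < Re (z - c)" using z by (simp add: c_def R'_def right_half_plane_def)
      then obtain s \<theta> where s: "s = cmod (z - c)" "- pi / 2 < \<theta>" "\<theta> < pi / 2" "z - c = of_real s * cis \<theta>"
        by (rule half_plane_polar)
      have "r < s" using z s(1) by (simp add: R'_def dist_norm norm_minus_commute)
      then show "z \<in> (\<lambda>(s, \<theta>). c + of_real s * cis \<theta>) ` ({r<..} \<times> {- pi / 2<..<pi / 2})"
      proof (intro image_eqI[of _ _ "(s, \<theta>)"])
        show "z = (case (s, \<theta>) of (s, \<theta>) \<Rightarrow> c + of_real s * cis \<theta>)" unfolding prod.case s(4)[symmetric] by simp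
        show "(s, \<theta>) \<in> {r<..} \<times> {- pi / 2<..<pi / 2}" using s(2,3) \<open>r < s\<close> by simp
      qed
    next
      fix z assume "z \<in> (\<lambda>(s, \<theta>). c + of_real s * cis \<theta>) ` ({r<..} \<times> {- pi / 2<..<pi / 2})"
      then obtain s \<theta> where s: "r < s" "- pi / 2 < \<theta>" "\<theta> < pi / 2" "z = c + of_real s * cis \<theta>" by auto
      have "0 < cos \<theta>" using s by (intro cos_gt_zero_pi) auto
      then show "z \<in> R'" using s r by (auto simp: R'_def right_half_plane_def c_def dist_norm norm_mult)
    qed
    moreover have "connected ((\<lambda>(s, \<theta>). c + of_real s * cis \<theta>) ` ({r<..} \<times> {- pi / 2<..<pi / 2}))"
    proof (intro connected_continuous_image convex_connected convex_Times)
      show "continuous_on ({r<..} \<times> {- pi / 2<..<pi / 2}) (\<lambda>(s, \<theta>). c + of_real s * cis \<theta>)"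
        unfolding case_prod_beta by (intro continuous_intros)
    qed auto
    ultimately show ?thesis by simp
  qed
  \<comment> \<open>The image of a connected set that avoids the half-circle does not meet
    \<open>C\<close>, so it lies entirely inside or entirely outside.\<close>
  have sub: "f ` S \<subseteq> I" if S: "connected S" "S \<subseteq> H" "S \<inter> A = {}" "f ` S \<inter> I \<noteq> {}" for S
  proof (rule ccontr)
    assume "\<not> f ` S \<subseteq> I"
    then have ne: "f ` S - I \<noteq> {}" by blast
    have cn: "connected (f ` S)"
      using S holomorphic_on_imp_continuous_on[OF hol]
        by (intro connected_continuous_image) (auto intro: continuous_on_subset)
    have "f ` S \<inter> C \<noteq> {}" using connected_Int_frontier[OF cn S(4) ne] I(5) by simp
    moreover have "w \<notin> f ` S" using wn(1) S(2) by auto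
    ultimately have "f ` S \<inter> f ` A \<noteq> {}" using CA by auto
    then obtain y where y: "y \<in> f ` S" "y \<in> f ` A" by blast
    from y(1) obtain u where u: "y = f u" "u \<in> S" by (rule imageE)
    from y(2) obtain v where v: "y = f v" "v \<in> A" by (rule imageE)
    have uv: "u \<in> S" "v \<in> A" "f u = f v" using u v by simp_all
    have "u \<in> H" "v \<in> H" using uv S(2) AH by blast+
    then have "u = v" by (rule inj_onD[OF inj uv(3)])
    then show False using uv S(3) by blast
  qed
  have Ad: "dist c z = r" if "z \<in> A" for z using that r by (auto simp: A_def \<sigma>_def dist_norm norm_mult)
  have "R' \<inter> A = {}" "R \<inter> A = {}" using Ad by (force simp: R'_def R_def)+
  \<comment> \<open>\<open>R'\<close> is unbounded and \<open>f\<close> tends to infinity, whereas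
    the inside of \<open>C\<close> is bounded. Consequently the inside is the image of the half-disc
    \<open>R\<close>.\<close>
  have R'I: "f ` R' \<inter> I = {}"
  proof (rule ccontr)
    assume "f ` R' \<inter> I \<noteq> {}"
    then have s: "f ` R' \<subseteq> I" using sub[OF conR'] \<open>R' \<inter> A = {}\<close> by (auto simp: R'_def)
    obtain B where B: "\<And>z. z \<in> I \<Longrightarrow> cmod z \<le> B" using I(4) unfolding bounded_iff by blast
    obtain M where M: "0 < M" "\<And>z. z \<in> H \<Longrightarrow> M \<le> cmod z \<Longrightarrow> B < cmod (f z)" using norm_f_large by blast
    define x where "x = M + r + 1"
    have x: "x > 0" "x > r" "x \<ge> M" using M(1) r by (auto simp: x_def)
    have "\<bar>Re (of_real x - c)\<bar> \<le> cmod (of_real x - c)" by (rule abs_Re_le_cmod)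
    then have "r < dist c (of_real x)" using x r by (simp add: c_def dist_norm norm_minus_commute)
    then have "of_real x \<in> R'" using x by (simp add: R'_def right_half_plane_def)
    then have "f (of_real x) \<in> I" "of_real x \<in> H" using s by (blast, simp add: R'_def)
    then have "cmod (f (of_real x)) \<le> B" "of_real x \<in> H" using B by blast+
    then show False using M(2)[of "of_real x"] x by simp
  qed
  have IR: "I \<subseteq> f ` R"
  proof
    fix v assume v: "v \<in> I"
    then obtain z where z: "z \<in> H" "v = f z" using \<open>I \<subseteq> f ` H\<close> by auto
    have "z \<notin> A" using v z I(6) CA by auto
    then have "dist c z \<noteq> r" using Asph z by auto
    moreover have "z \<notin> R'" using R'I v z by auto
    ultimately have "z \<in> R" using z by (auto simp: R_def R'_def)
    then show "v \<in> f ` R" using z by auto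
  qed
  have RI: "f ` R \<subseteq> I" using IR I(1) \<open>R \<inter> A = {}\<close> by (intro sub[OF conR]) (auto simp: R_def)
  \<comment> \<open>For \<open>0 < x < d\<close> the horizontal segment ending at the boundary point
    lies in the half-disc, so the boundary value is in the closure of the inside. Not being an
    interior image, it can only be \<open>w\<close>.\<close>
  define d where "d = r - \<bar>y - (a + b) / 2\<bar>"
  have d: "d > 0" using y by (auto simp: d_def r_def abs_if field_simps)
  have inR: "Complex x y \<in> R" if "0 < x" "x < d" for x
  proof -
    have "cmod (Complex x y - c) \<le> \<bar>x\<bar> + \<bar>y - (a + b) / 2\<bar>" using cmod_le[of "Complex x y - c"]
      by (simp add: c_def)
    then show ?thesis using that by (simp add: R_def right_half_plane_def dist_norm norm_minus_commute d_def)
  qed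
  have "g (Complex 0 y) \<in> closure I"
  proof (rule Lim_in_closed_set[OF closed_closure _ _ fhat_boundary_horizontal])
    have "eventually (\<lambda>x. 0 < x \<and> x < d) (at_right (0::real))" unfolding eventually_at_right_field using d
      by auto
    then show "eventually (\<lambda>x. f (Complex x y) \<in> closure I) (at_right 0)"
      by (rule eventually_mono) (use inR RI closure_subset in blast)
  qed simp
  then have "g (Complex 0 y) \<in> I \<union> C" using I(5) interior_subset by (auto simp: frontier_def)
  moreover have "g (Complex 0 y) \<notin> f ` H" by (intro g_boundary_notin) simp
  ultimately have "g (Complex 0 y) = w" using \<open>I \<subseteq> f ` H\<close> CA AH by auto
  then show ?thesis by (simp add: w_def)
qed

lemma g_boundary_inj:
  assumes "a < b" shows "g (Complex 0 a) \<noteq> g (Complex 0 b)"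
proof
  assume eq: "g (Complex 0 a) = g (Complex 0 b)"
  \<comment> \<open>Chosen so that \<open>a + d\<close> and \<open>a + 2 * d\<close> lie between
    \<open>a\<close> and \<open>b\<close> and are close enough for local injectivity, although both
    would have to take the same value.\<close>
  define d where "d = min (b - a) t0 / 8"
  have d: "d > 0" "8 * d \<le> b - a" "8 * d \<le> t0" using assms t0 by (auto simp: d_def)
  have "g (Complex 0 (a + d)) = g (Complex 0 (a + 2 * d))"
    using g_boundary_inj_aux[OF assms eq, of "a + d"] g_boundary_inj_aux[OF assms eq, of "a + 2 * d"] d by simp
  moreover have "Complex 0 (a + d) - Complex 0 (a + 2 * d) = \<i> * of_real (- d)" by (simp add: complex_eq_iff)
  then have "cmod (Complex 0 (a + d) - Complex 0 (a + 2 * d)) = d" using d(1) by (simp add: norm_mult)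
  then have "g (Complex 0 (a + d)) \<noteq> g (Complex 0 (a + 2 * d))"
    using d t0 by (intro fhat_locally_injective) auto
  ultimately show False by simp
qed

lemma g_closed_half_plane_inj: "inj_on g {z. 0 \<le> Re z}"
proof (rule inj_onI)
  fix z z' assume z: "z \<in> {z. 0 \<le> Re z}" "z' \<in> {z. 0 \<le> Re z}" "g z = g z'"
  have nb: False if "Re u = 0" "0 < Re v" "g u = g v" for u v
    using g_boundary_notin[OF that(1)] that(2,3) by (auto simp: fhat_pos right_half_plane_def)
  consider "Re z = 0" "Re z' = 0" | "Re z = 0" "0 < Re z'" | "0 < Re z" "Re z' = 0" | "0 < Re z" "0 < Re z'"
    using z by fastforce
  then show "z = z'"
  proof cases
    case 1
    then have "z = Complex 0 (Im z)" "z' = Complex 0 (Im z')" by (simp_all add: complex_eq_iff)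
    then show ?thesis using g_boundary_inj z(3) by (metis linorder_neq_iff)
  next
    case 4 then show ?thesis using z(3) inj by (auto simp: fhat_pos right_half_plane_def inj_on_def)
  next
    case 2 then show ?thesis using nb[of z z'] z(3) by auto
  next
    case 3 then show ?thesis using nb[of z' z] z(3) by auto
  qed
qed

end

section \<open>Integration along lines, area and directional derivatives\<close>

lemma measurable_Complex_pair[measurable]: "(\<lambda>(x, y). Complex x y) \<in> borel_measurable (borel \<Otimes>\<^sub>M borel)"
  unfolding Complex_eq case_prod_beta by measurable

lemma lborel_complex_pair:
  "(lborel :: complex measure) = distr (lborel \<Otimes>\<^sub>M lborel) borel (\<lambda>(x, y). Complex x y)"
proof (rule lborel_eqI)
  fix l u :: complex assume lu: "\<And>b. b \<in> Basis \<Longrightarrow> l \<bullet> b \<le> u \<bullet> b"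
  have le: "Re l \<le> Re u" "Im l \<le> Im u" using lu[of 1] lu[of \<i>] by (auto simp: Basis_complex_def)
  have "emeasure (distr (lborel \<Otimes>\<^sub>M lborel) borel (\<lambda>(x, y). Complex x y)) (box l u)
     = emeasure (lborel \<Otimes>\<^sub>M lborel) ((\<lambda>(x, y). Complex x y) -` box l u \<inter> space (lborel \<Otimes>\<^sub>M lborel))"
    by (rule emeasure_distr) auto
  also have "(\<lambda>(x, y). Complex x y) -` box l u \<inter> space (lborel \<Otimes>\<^sub>M lborel) = {Re l<..<Re u} \<times> {Im l<..<Im u}"
    by (auto simp: in_box_complex_iff space_pair_measure)
  also have "emeasure (lborel \<Otimes>\<^sub>M lborel) ({Re l<..<Re u} \<times> {Im l<..<Im u})
    = ennreal (Re u - Re l) * ennreal (Im u - Im l)"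
    using le by (subst lborel.emeasure_pair_measure_Times) auto
  also have "\<dots> = ennreal (\<Prod>b\<in>Basis. (u - l) \<bullet> b)"
    using le by (simp add: Basis_complex_def ennreal_mult'[symmetric])
  finally show "emeasure (distr (lborel \<Otimes>\<^sub>M lborel) borel (\<lambda>(x, y). Complex x y)) (box l u)
    = ennreal (\<Prod>b\<in>Basis. (u - l) \<bullet> b)" .
qed simp

lemma nn_integral_complex:
  fixes g :: "complex \<Rightarrow> ennreal"
  assumes [measurable]: "g \<in> borel_measurable borel"
  shows "(\<integral>\<^sup>+z. g z \<partial>lborel) = (\<integral>\<^sup>+y. \<integral>\<^sup>+x. g (Complex x y) \<partial>lborel \<partial>lborel)" (is ?A)
    and "(\<integral>\<^sup>+z. g z \<partial>lborel) = (\<integral>\<^sup>+x. \<integral>\<^sup>+y. g (Complex x y) \<partial>lborel \<partial>lborel)" (is ?B)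
proof -
  have m: "(\<lambda>(x, y). g (Complex x y)) \<in> borel_measurable (lborel \<Otimes>\<^sub>M lborel)"
    unfolding Complex_eq case_prod_beta by measurable
  have "(\<integral>\<^sup>+z. g z \<partial>lborel) = (\<integral>\<^sup>+p. g ((\<lambda>(x, y). Complex x y) p) \<partial>(lborel \<Otimes>\<^sub>M lborel))"
    by (subst lborel_complex_pair, rule nn_integral_distr) auto
  also have "\<dots> = (\<integral>\<^sup>+p. (\<lambda>(x, y). g (Complex x y)) p \<partial>(lborel \<Otimes>\<^sub>M lborel))" by (simp add: case_prod_beta)
  finally have e: "(\<integral>\<^sup>+z. g z \<partial>lborel) = (\<integral>\<^sup>+p. (\<lambda>(x, y). g (Complex x y)) p \<partial>(lborel \<Otimes>\<^sub>M lborel))" .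
  show ?B unfolding e using lborel.nn_integral_fst[OF m] by simp
  show ?A unfolding e using lborel_pair.nn_integral_snd[OF m] by simp
qed

lemma null_by_horizontal_lines:
  fixes X :: "complex set"
  assumes X: "X \<in> sets borel" and lines: "AE y in lborel. AE x in lborel. Complex x y \<notin> X"
  shows "negligible X"
proof -
  have [measurable]: "X \<in> sets borel" by fact
  have "emeasure lborel X = (\<integral>\<^sup>+z. indicator X z \<partial>lborel)" using X by simp
  also have "\<dots> = (\<integral>\<^sup>+y. \<integral>\<^sup>+x. indicator X (Complex x y) \<partial>lborel \<partial>lborel)"
    by (rule nn_integral_complex(1)) measurable
  also have "\<dots> = (\<integral>\<^sup>+y. 0 \<partial>(lborel :: real measure))"
  proof (rule nn_integral_cong_AE, use lines in eventually_elim)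
    fix y assume "AE x in lborel. Complex x y \<notin> X"
    then have "(\<integral>\<^sup>+x. indicator X (Complex x y) \<partial>lborel) = (\<integral>\<^sup>+x. 0 \<partial>(lborel :: real measure))"
      by (intro nn_integral_cong_AE) (auto simp: indicator_def elim!: eventually_mono)
    then show "(\<integral>\<^sup>+x. indicator X (Complex x y) \<partial>lborel) = 0" by simp
  qed
  finally have "X \<in> null_sets lborel" using X by (auto simp: null_sets_def)
  then show ?thesis using null_sets_completionI negligible_iff_null_sets by blast
qed

lemma AE_lborel_if_negligible:
  assumes "negligible N" "\<And>x. x \<notin> N \<Longrightarrow> P x" shows "AE x in lborel. P x"
proof -
  have "AE x in lebesgue. x \<notin> N" using assms(1) by (intro AE_not_in) (simp add: negligible_iff_null_sets)
  then have "AE x in lebesgue. P x" by (rule eventually_mono) (rule assms(2))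
  then show ?thesis by (simp add: AE_completion_iff)
qed

text \<open>On almost every horizontal line the derivative exists almost everywhere. To conclude by
  Tonelli's theorem, the exceptional set in the plane has to be Borel, and this is what the sets
  \<open>linear_approx_set\<close> provide.\<close>

lemma ACL_horizontal_partials:
  fixes F :: "complex \<Rightarrow> complex"
  assumes W: "open W" and F: "continuous_on W F"
    and acl: "\<And>a b. cbox a b \<subseteq> W \<Longrightarrow> AE y in lebesgue. y \<in> {Im a..Im b} \<longrightarrow>
      abs_cont_on {Re a..Re b} (\<lambda>x. F (Complex x y))"
  obtains N where "negligible N" "\<And>z. z \<in> W - N \<Longrightarrow> \<exists>A. ((\<lambda>t. F (z + of_real t)) has_vector_derivative A) (at 0)"
proof -
  let ?Q = "{a::complex. Re a \<in> \<rat> \<and> Im a \<in> \<rat>}"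
  define E where "E m n a = linear_approx_set F W 1 (inverse (real (Suc m))) n a" for m n a
  \<comment> \<open>Inside \<open>W\<close> these are exactly the points with a horizontal
    derivative, by \<open>inD\<close> and \<open>derivD\<close>. Rational slopes make the union
    countable.\<close>
  define D where "D = (\<Inter>m. \<Union>n. \<Union>a\<in>?Q. E m n a)"
  have cl: "closed (E m n a)" for m n a unfolding E_def by (rule closed_linear_approx_set[OF W F]) simp
  have "(\<Union>a\<in>?Q. E m n a) \<in> sets borel" for m n
    using cl by (intro sets.countable_UN' countable_rational_complex) auto
  then have Db: "W - D \<in> sets borel" unfolding D_def using W
    by (intro sets.Diff sets.countable_INT'' sets.countable_UN') auto
  have inD: "z \<in> D" if z: "z \<in> W" and A: "((\<lambda>t. F (z + of_real t)) has_vector_derivative A) (at 0)" for z A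
  proof -
    have "\<exists>n. \<exists>a\<in>?Q. z \<in> E m n a" for m
    proof -
      obtain a where a: "Re a \<in> \<rat>" "Im a \<in> \<rat>" "cmod (A - a) < inverse (real (Suc m))"
        using rational_complex_dense[of "inverse (real (Suc m))" A] by auto
      have "((\<lambda>t. F (z + of_real t * 1)) has_vector_derivative A) (at 0)" using A by simp
      from linear_approx_setI[OF W z this a(3)] a show ?thesis unfolding E_def by blast
    qed
    then show ?thesis unfolding D_def by blast
  qed
  have derivD: "\<exists>A. ((\<lambda>t. F (z + of_real t)) has_vector_derivative A) (at 0)" if z: "z \<in> W" "z \<in> D" for z
  proof -
    have "\<exists>n a. z \<in> E m n a" for m using z(2) unfolding D_def by blast
    then obtain n a where na: "\<And>m. z \<in> E m (n m) (a m)" by metis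
    have bd: "cmod (F (z + of_real t) - F z - of_real t * a m) \<le> inverse (real (Suc m)) * \<bar>t\<bar>"
      if "\<bar>t\<bar> < inverse (real (Suc (n m)))" for m t
      using na[of m] that unfolding E_def linear_approx_set_def by auto
    \<comment> \<open>For a step \<open>t\<close> admissible for both \<open>m\<close> and
      \<open>k\<close>, the two slopes approximate the same difference quotient. Hence the slopes
      form a Cauchy sequence, whose limit is the derivative.\<close>
    have close: "cmod (a m - a k) \<le> inverse (real (Suc m)) + inverse (real (Suc k))" for m k
    proof -
      have inv_pos: "0 < inverse (real (Suc j))" for j by simp
      define t where "t = min (inverse (real (Suc (n m)))) (inverse (real (Suc (n k)))) / 2"
      have t: "t > 0" "\<bar>t\<bar> < inverse (real (Suc (n m)))" "\<bar>t\<bar> < inverse (real (Suc (n k)))"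
        using inv_pos[of "n m"] inv_pos[of "n k"] unfolding t_def by linarith+
      have eq:
        "of_real t * (a m - a k) = (F (z + of_real t) - F z - of_real t * a k)
        - (F (z + of_real t) - F z - of_real t * a m)"
        by (simp add: algebra_simps)
      have "cmod (of_real t * (a m - a k)) \<le> inverse (real (Suc k)) * \<bar>t\<bar> + inverse (real (Suc m)) * \<bar>t\<bar>"
        unfolding eq
          using norm_triangle_ineq4[of "F (z + of_real t) - F z - of_real t * a k" "F (z + of_real t) - F z
          - of_real t * a m"] bd[OF t(2)] bd[OF t(3)] by linarith
      then have "t * cmod (a m - a k) \<le> inverse (real (Suc k)) * t + inverse (real (Suc m)) * t"
        using t(1) by (simp only: norm_mult norm_of_real)
      moreover have "t * (inverse (real (Suc m)) + inverse (real (Suc k))) = inverse (real (Suc k)) * t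
        + inverse (real (Suc m)) * t"
        by (simp add: algebra_simps)
      ultimately have "t * cmod (a m - a k) \<le> t * (inverse (real (Suc m)) + inverse (real (Suc k)))" by linarith
      then show ?thesis using t(1) by (simp add: mult_le_cancel_left_pos)
    qed
    have inv0: "\<exists>M. \<forall>m\<ge>M. inverse (real (Suc m)) < e" if "0 < e" for e
      using order_tendstoD(2)[OF LIMSEQ_inverse_real_of_nat that] unfolding eventually_sequentially .
    have "Cauchy a"
    proof (rule CauchyI)
      fix e :: real assume "0 < e"
      then obtain M where M: "\<And>m. m \<ge> M \<Longrightarrow> inverse (real (Suc m)) < e / 2" using inv0[of "e / 2"] by auto
      show "\<exists>M. \<forall>m\<ge>M. \<forall>k\<ge>M. norm (a m - a k) < e"
      proof (intro exI[of _ M] allI impI)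
        fix m k assume "m \<ge> M" "k \<ge> M"
        then show "norm (a m - a k) < e" using close[of m k] M[of m] M[of k] by linarith
      qed
    qed
    then obtain A where A: "a \<longlonglongrightarrow> A" using Cauchy_convergent_iff convergent_def by blast
    have aA: "cmod (a m - A) \<le> inverse (real (Suc m))" for m
    proof (rule LIMSEQ_le)
      show "(\<lambda>k. cmod (a m - a k)) \<longlonglongrightarrow> cmod (a m - A)" by (intro tendsto_intros A)
      have "(\<lambda>k. inverse (real (Suc m)) + inverse (real (Suc k))) \<longlonglongrightarrow> inverse (real (Suc m)) + 0"
        by (intro tendsto_intros LIMSEQ_inverse_real_of_nat)
      then show "(\<lambda>k. inverse (real (Suc m)) + inverse (real (Suc k))) \<longlonglongrightarrow> inverse (real (Suc m))" by simp
      show "\<exists>N. \<forall>k\<ge>N. cmod (a m - a k) \<le> inverse (real (Suc m)) + inverse (real (Suc k))" using close by blast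
    qed
    have "((\<lambda>t. F (z + of_real t)) has_vector_derivative A) (at 0)"
      unfolding has_vector_derivative_def has_derivative_at_alt
    proof (intro conjI allI impI)
      show "bounded_linear (\<lambda>h. h *\<^sub>R A)" by (rule bounded_linear_scaleR_left)
      fix e :: real assume "0 < e"
      then obtain m where m: "inverse (real (Suc m)) < e / 2" using inv0[of "e / 2"] by auto
      show "\<exists>d>0. \<forall>t. norm (t - 0) < d \<longrightarrow> norm (F (z + of_real t) - F (z + of_real 0) - (t - 0) *\<^sub>R A)
        \<le> e * norm (t - 0)"
      proof (rule exI[of _ "inverse (real (Suc (n m)))"], intro conjI allI impI)
        fix t :: real assume "norm (t - 0) < inverse (real (Suc (n m)))"
        then have 1: "cmod (F (z + of_real t) - F z - of_real t * a m) \<le> inverse (real (Suc m)) * \<bar>t\<bar>"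
          by (intro bd) simp
        have 2: "cmod (of_real t * (a m - A)) \<le> inverse (real (Suc m)) * \<bar>t\<bar>"
          using mult_left_mono[OF aA[of m], of "\<bar>t\<bar>"] by (simp add: norm_mult mult.commute)
        have eq:
          "F (z + of_real t) - F (z + of_real 0) - (t - 0) *\<^sub>R A = (F (z + of_real t) - F z - of_real t * a m)
          + of_real t * (a m - A)"
          by (simp add: scaleR_conv_of_real algebra_simps)
        have "cmod (F (z + of_real t) - F (z + of_real 0) - (t - 0) *\<^sub>R A) \<le> inverse (real (Suc m)) * \<bar>t\<bar>
          + inverse (real (Suc m)) * \<bar>t\<bar>"
          unfolding eq by (rule norm_triangle_mono[OF 1 2])
        also have "\<dots> = (2 * inverse (real (Suc m))) * \<bar>t\<bar>" by simp
        also have "\<dots> \<le> e * \<bar>t\<bar>" using m by (intro mult_right_mono) auto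
        finally show "norm (F (z + of_real t) - F (z + of_real 0) - (t - 0) *\<^sub>R A) \<le> e * norm (t - 0)" by simp
      qed simp
    qed
    then show ?thesis by blast
  qed
  have box: "negligible ((W - D) \<inter> cbox a b)" if ab: "cbox a b \<subseteq> W" for a b
  proof (rule null_by_horizontal_lines)
    show "(W - D) \<inter> cbox a b \<in> sets borel" using Db by auto
    have "AE y in lborel. y \<in> {Im a..Im b} \<longrightarrow> abs_cont_on {Re a..Re b} (\<lambda>x. F (Complex x y))"
      using acl[OF ab] by (simp only: AE_completion_iff)
    then show "AE y in lborel. AE x in lborel. Complex x y \<notin> (W - D) \<inter> cbox a b"
    proof (rule eventually_mono)
      fix y assume y: "y \<in> {Im a..Im b} \<longrightarrow> abs_cont_on {Re a..Re b} (\<lambda>x. F (Complex x y))"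
      show "AE x in lborel. Complex x y \<notin> (W - D) \<inter> cbox a b"
      proof (cases "y \<in> {Im a..Im b}")
        case True
        then have ac: "abs_cont {Re a..Re b} (\<lambda>x. F (Complex x y))" using y by (simp add: abs_cont_on_iff)
        obtain N where N: "negligible N"
          "\<And>x. x \<in> {Re a<..<Re b} - N \<Longrightarrow> \<exists>A. ((\<lambda>x. F (Complex x y)) has_vector_derivative A) (at x)"
          using abs_cont_differentiable_ae[OF ac] by blast
        show ?thesis
        proof (rule AE_lborel_if_negligible[of "N \<union> {Re a, Re b}"])
          show "negligible (N \<union> {Re a, Re b})" using N(1) by (intro negligible_Un) auto
          fix x assume x: "x \<notin> N \<union> {Re a, Re b}"
          show "Complex x y \<notin> (W - D) \<inter> cbox a b"
          proof
            assume c: "Complex x y \<in> (W - D) \<inter> cbox a b"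
            then have "x \<in> {Re a<..<Re b} - N" using x by (auto simp: in_cbox_complex_iff)
            then obtain A where A: "((\<lambda>x. F (Complex x y)) has_vector_derivative A) (at x)" using N(2) by blast
            have "((\<lambda>t. x + t) has_vector_derivative 1) (at 0)" by (auto intro!: derivative_eq_intros)
            moreover have "((\<lambda>x. F (Complex x y)) has_vector_derivative A) (at (x + 0))" using A by simp
            ultimately have "((\<lambda>x. F (Complex x y)) \<circ> (\<lambda>t. x + t) has_vector_derivative 1 *\<^sub>R A) (at 0)"
              by (rule vector_diff_chain_at)
            moreover have "(\<lambda>x. F (Complex x y)) \<circ> (\<lambda>t. x + t) = (\<lambda>t. F (Complex x y + of_real t))"
              by (auto simp: fun_eq_iff Complex_eq algebra_simps)
            ultimately have "((\<lambda>t. F (Complex x y + of_real t)) has_vector_derivative A) (at 0)" by simp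
            then have "Complex x y \<in> D" using c by (intro inD) auto
            then show False using c by blast
          qed
        qed
      qed (auto simp: in_cbox_complex_iff)
    qed
  qed
  obtain \<D> where \<D>: "countable \<D>" "\<D> \<subseteq> Pow W" "\<And>X. X \<in> \<D> \<Longrightarrow> \<exists>a b. X = cbox a b" "\<Union>\<D> = W"
    by (rule open_countable_Union_open_cbox[OF W]) (rule that; assumption)
  have "W - D = (W - D) \<inter> \<Union>\<D>" unfolding \<D>(4) by blast
  also have "\<dots> = (\<Union>X\<in>\<D>. (W - D) \<inter> X)" by (rule Int_Union)
  finally have "W - D = (\<Union>X\<in>\<D>. (W - D) \<inter> X)" .
  moreover have "negligible (\<Union>X\<in>\<D>. (W - D) \<inter> X)"
  proof (rule negligible_countable_Union)
    show "countable ((\<lambda>X. (W - D) \<inter> X) ` \<D>)" using \<D>(1) by simp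
    fix Y assume "Y \<in> (\<lambda>X. (W - D) \<inter> X) ` \<D>"
    then obtain X where X: "X \<in> \<D>" "Y = (W - D) \<inter> X" by blast
    from \<D>(3)[OF X(1)] obtain a b where ab: "X = cbox a b" by blast
    moreover have "X \<subseteq> W" using X(1) \<D>(2) by blast
    ultimately show "negligible Y" using box[of a b] X(2) by simp
  qed
  ultimately have "negligible (W - D)" by simp
  then show thesis by (rule that) (rule derivD; simp)
qed

text \<open>Reflection in the diagonal. It carries the result for horizontal lines over to vertical
  lines and, being an isometry, preserves null sets.\<close>

definition swap_axes :: "complex \<Rightarrow> complex" where "swap_axes z = Complex (Im z) (Re z)"

lemma swap_axes_simps[simp]: "swap_axes (swap_axes z) = z" "Re (swap_axes z) = Im z" "Im (swap_axes z) = Re z"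
  "swap_axes (Complex x y) = Complex y x"
  by (auto simp: swap_axes_def)

lemma swap_axes_alt: "swap_axes z = \<i> * cnj z"
  by (simp add: complex_eq_iff)

lemma swap_axes_cont: "continuous_on S swap_axes"
  unfolding swap_axes_alt[abs_def] by (intro continuous_intros)

lemma swap_axes_image: "swap_axes ` S = swap_axes -` S"
  by (auto simp: image_iff) (metis swap_axes_simps(1))

lemma negligible_swap_axes: "negligible N \<Longrightarrow> negligible (swap_axes ` N)"
proof (rule negligible_locally_Lipschitz_image)
  fix x :: complex
  have "norm (swap_axes y - swap_axes x) \<le> 1 * norm (y - x)" for y
    by (simp add: swap_axes_alt norm_mult flip: right_diff_distrib complex_cnj_diff)
  then show "\<exists>T B. open T \<and> x \<in> T \<and> (\<forall>y\<in>N \<inter> T. norm (swap_axes y - swap_axes x) \<le> B * norm (y - x))"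
    by (intro exI[of _ UNIV] exI[of _ 1]) auto
qed auto

lemma ACL_vertical_partials:
  fixes F :: "complex \<Rightarrow> complex"
  assumes W: "open W" and F: "continuous_on W F" and acl: "ACL_on W F"
  obtains N where "negligible N"
    "\<And>z. z \<in> W - N \<Longrightarrow> \<exists>B. ((\<lambda>t. F (z + of_real t * \<i>)) has_vector_derivative B) (at 0)"
proof -
  have W': "open (swap_axes ` W)" unfolding swap_axes_image
    using W swap_axes_cont[of UNIV] by (simp add: open_vimage)
  have F': "continuous_on (swap_axes ` W) (\<lambda>z. F (swap_axes z))"
    by (rule continuous_on_compose2[OF F swap_axes_cont]) auto
  obtain N where N: "negligible N"
    "\<And>z. z \<in> swap_axes ` W - N \<Longrightarrow> \<exists>A. ((\<lambda>t. F (swap_axes (z + of_real t))) has_vector_derivative A) (at 0)"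
  proof (rule ACL_horizontal_partials[OF W' F'])
    fix a b assume ab: "cbox a b \<subseteq> swap_axes ` W"
    have "cbox (swap_axes a) (swap_axes b) \<subseteq> W"
    proof
      fix z assume "z \<in> cbox (swap_axes a) (swap_axes b)"
      then have "swap_axes z \<in> cbox a b" by (auto simp: in_cbox_complex_iff)
      then show "z \<in> W" using ab by (auto simp: swap_axes_image)
    qed
    then show "AE y in lebesgue. y \<in> {Im a..Im b} \<longrightarrow> abs_cont_on {Re a..Re b} (\<lambda>x. F (swap_axes (Complex x y)))"
      using acl unfolding ACL_on_def by fastforce
  qed (rule that; assumption)
  show thesis
  proof (rule that[OF negligible_swap_axes[OF N(1)]])
    fix z assume z: "z \<in> W - swap_axes ` N"
    then have "swap_axes z \<in> swap_axes ` W - N" by (force simp: image_iff)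
    then obtain B where "((\<lambda>t. F (swap_axes (swap_axes z + of_real t))) has_vector_derivative B) (at 0)"
      using N(2) by blast
    moreover have "swap_axes (swap_axes z + of_real t) = z + of_real t * \<i>" for t by (simp add: complex_eq_iff)
    ultimately show "\<exists>B. ((\<lambda>t. F (z + of_real t * \<i>)) has_vector_derivative B) (at 0)" by auto
  qed
qed

text \<open>A segment from \<open>F a\<close> to an omitted point meets the frontier of the image of
  the interior. Frontier points are images of boundary points of \<open>K\<close>, hence at distance
  at least \<rho> from \<open>F a\<close>.\<close>

lemma ball_subset_open_image:
  fixes F :: "complex \<Rightarrow> complex"
  assumes K: "compact K" "continuous_on K F" "open (F ` interior K)" "a \<in> interior K"
    and far: "\<And>w. w \<in> K - interior K \<Longrightarrow> \<rho> \<le> cmod (F w - F a)"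
  shows "ball (F a) \<rho> \<subseteq> F ` interior K"
proof (rule subsetI, rule ccontr)
  fix \<zeta> assume \<zeta>: "\<zeta> \<in> ball (F a) \<rho>" "\<zeta> \<notin> F ` interior K"
  have "F a \<in> closed_segment (F a) \<zeta> \<inter> F ` interior K" using K(4) by auto
  moreover have "\<zeta> \<in> closed_segment (F a) \<zeta> - F ` interior K" using \<zeta>(2) by auto
  ultimately have "closed_segment (F a) \<zeta> \<inter> frontier (F ` interior K) \<noteq> {}"
    by (intro connected_Int_frontier connected_segment) blast+
  then obtain \<eta> where \<eta>: "\<eta> \<in> closed_segment (F a) \<zeta>" "\<eta> \<in> closure (F ` interior K)" "\<eta> \<notin> F ` interior K"
    using K(3) by (auto simp: frontier_def interior_open)
  have "closed (F ` K)" using K(1,2) compact_continuous_image compact_imp_closed by blast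
  then have "closure (F ` interior K) \<subseteq> F ` K" using interior_subset[of K] by (intro closure_minimal image_mono)
  then obtain w where "w \<in> K" "\<eta> = F w" using \<eta>(2) by blast
  then have "\<rho> \<le> cmod (\<eta> - F a)" using far[of w] \<eta>(3) by blast
  moreover have "cmod (\<eta> - F a) \<le> cmod (\<zeta> - F a)" using segment_bound(1)[OF \<eta>(1)]
    by (simp add: norm_minus_commute)
  ultimately show False using \<zeta>(1) by (simp add: dist_norm norm_minus_commute)
qed

(* A substitute for the change of variables formula: w n z is the normalised measure of the image of the ball of
   radius 1/(n+1) about z; its integral is bounded by Tonelli and its lower limit dominates c^2. *)
lemma area_bound:
  fixes F G :: "complex \<Rightarrow> complex"
  assumes W: "open W" and hom: "homeomorphism W (F ` W) F G" and op: "open (F ` W)"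
    and B: "open B"
    and c: "\<And>z. 0 \<le> c z"
    and exp:
      "AE z in lborel. z \<in> W \<and> F z \<in> B \<longrightarrow> (\<exists>h0>0. \<forall>h. 0 < h \<and> h < h0 \<longrightarrow> ball (F z) (c z * h)
      \<subseteq> F ` (ball z h \<inter> W))"
  shows "(\<integral>\<^sup>+z. ennreal ((c z)\<^sup>2) * indicator {z \<in> W. F z \<in> B} z \<partial>lborel) \<le> emeasure lborel B"
proof -
  define V where "V = F ` W \<inter> B"
  have Vo: "open V" unfolding V_def using op B by blast
  have [measurable]: "V \<in> sets borel" using Vo by simp
  \<comment> \<open>The inverse, extended by 0, is Borel measurable on the whole plane. The value 0
    is harmless because \<open>indicator V\<close> accompanies it.\<close>
  define G0 where "G0 \<zeta> = indicator V \<zeta> *\<^sub>R G \<zeta>" for \<zeta>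
  have [measurable]: "G0 \<in> borel_measurable borel" unfolding G0_def
  proof (rule borel_measurable_continuous_on_indicator)
    show "continuous_on V G" by (rule continuous_on_subset[OF homeomorphism_cont2[OF hom]]) (simp add: V_def)
  qed measurable
  define v where "v = unit_ball_vol 2"
  have v: "v > 0" by (simp add: v_def)
  have volball: "emeasure lborel (ball (x::complex) r) = ennreal (v * r\<^sup>2)" if "0 \<le> r" for x r
    using emeasure_ball[OF that, of x] by (simp add: v_def)
  \<comment> \<open>This is the area of the part of the image of \<open>ball z h\<close> that lies
    in \<open>B\<close>. Written through the inverse it is jointly measurable, so the integrals over
    \<open>z\<close> and \<open>\<zeta>\<close> can be interchanged.\<close>
  define U where "U h z = (\<integral>\<^sup>+\<zeta>. indicator V \<zeta> * indicator {..<h} (dist (G0 \<zeta>) z) \<partial>lborel)" for h :: real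
    and z :: complex
  have mU: "(\<lambda>z. U h z) \<in> borel_measurable lborel" for h
    unfolding U_def by measurable
  have intU: "(\<integral>\<^sup>+z. U h z \<partial>lborel) \<le> ennreal (v * h\<^sup>2) * emeasure lborel B" if h: "0 < h" for h
  proof -
    have
      "(\<integral>\<^sup>+z. U h z \<partial>lborel) = (\<integral>\<^sup>+\<zeta>. \<integral>\<^sup>+z. indicator V \<zeta> * indicator {..<h} (dist (G0 \<zeta>) z) \<partial>lborel \<partial>lborel)"
      unfolding U_def by (rule lborel_pair.Fubini') measurable
    also have "\<dots> = (\<integral>\<^sup>+\<zeta>. indicator V \<zeta> * ennreal (v * h\<^sup>2) \<partial>lborel)"
    proof (rule nn_integral_cong)
      fix \<zeta> :: complex
      have "(\<integral>\<^sup>+z. indicator V \<zeta> * indicator {..<h} (dist (G0 \<zeta>) z) \<partial>lborel)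
        = indicator V \<zeta> * (\<integral>\<^sup>+z. indicator {..<h} (dist (G0 \<zeta>) z) \<partial>lborel)"
        by (rule nn_integral_cmult) measurable
      also have "(\<integral>\<^sup>+z. indicator {..<h} (dist (G0 \<zeta>) z) \<partial>lborel) = (\<integral>\<^sup>+z. indicator (ball (G0 \<zeta>) h) z \<partial>lborel)"
        by (intro nn_integral_cong) (auto simp: indicator_def)
      also have "\<dots> = ennreal (v * h\<^sup>2)" using h by (simp add: volball)
      finally show "(\<integral>\<^sup>+z. indicator V \<zeta> * indicator {..<h} (dist (G0 \<zeta>) z) \<partial>lborel)
        = indicator V \<zeta> * ennreal (v * h\<^sup>2)" .
    qed
    also have "\<dots> = ennreal (v * h\<^sup>2) * emeasure lborel V" by (simp add: nn_integral_multc mult.commute)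
    also have "\<dots> \<le> ennreal (v * h\<^sup>2) * emeasure lborel B" using B
      by (intro mult_left_mono emeasure_mono) (auto simp: V_def)
    finally show ?thesis .
  qed
  define hn where "hn n = inverse (real (Suc n))" for n
  have hn: "hn n > 0" "hn \<longlonglongrightarrow> 0" for n using LIMSEQ_inverse_real_of_nat by (auto simp: hn_def[abs_def])
  define w where "w n z = U (hn n) z * ennreal (1 / (v * (hn n)\<^sup>2))" for n z
  have mw: "(\<lambda>z. w n z) \<in> borel_measurable lborel" for n unfolding w_def using mU by measurable
  have iw: "(\<integral>\<^sup>+z. w n z \<partial>lborel) \<le> emeasure lborel B" for n
  proof -
    have "(\<integral>\<^sup>+z. w n z \<partial>lborel) = (\<integral>\<^sup>+z. U (hn n) z \<partial>lborel) * ennreal (1 / (v * (hn n)\<^sup>2))"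
      unfolding w_def by (rule nn_integral_multc[OF mU])
    also have "\<dots> \<le> (ennreal (v * (hn n)\<^sup>2) * emeasure lborel B) * ennreal (1 / (v * (hn n)\<^sup>2))"
      by (intro mult_right_mono intU hn) auto
    also have "\<dots> = emeasure lborel B * (ennreal (v * (hn n)\<^sup>2) * ennreal (1 / (v * (hn n)\<^sup>2)))"
      by (simp add: mult_ac)
    also have "ennreal (v * (hn n)\<^sup>2) * ennreal (1 / (v * (hn n)\<^sup>2)) = 1"
      using v hn(1)[of n] by (simp flip: ennreal_mult)
    finally show ?thesis by simp
  qed
  have "(\<integral>\<^sup>+z. ennreal ((c z)\<^sup>2) * indicator {z \<in> W. F z \<in> B} z \<partial>lborel) \<le> (\<integral>\<^sup>+z. liminf (\<lambda>n. w n z) \<partial>lborel)"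
  proof (rule nn_integral_mono_AE, use exp in eventually_elim)
    fix z assume z: "z \<in> W \<and> F z \<in> B \<longrightarrow> (\<exists>h0>0. \<forall>h. 0 < h \<and> h < h0 \<longrightarrow> ball (F z) (c z * h) \<subseteq> F ` (ball z h \<inter> W))"
    show "ennreal ((c z)\<^sup>2) * indicator {z \<in> W. F z \<in> B} z \<le> liminf (\<lambda>n. w n z)"
    proof (cases "z \<in> W \<and> F z \<in> B")
      case True
      then obtain h0 where h0: "h0 > 0" "\<And>h. 0 < h \<Longrightarrow> h < h0 \<Longrightarrow> ball (F z) (c z * h) \<subseteq> F ` (ball z h \<inter> W)" using z
        by blast
      obtain r where r: "r > 0" "ball (F z) r \<subseteq> B" using True B open_contains_ball by blast
      \<comment> \<open>The second bound makes the disc of radius \<open>c z * h\<close> about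
        \<open>F z\<close> lie in \<open>B\<close>; the added 1 avoids division by zero.\<close>
      define h1 where "h1 = min h0 (r / (c z + 1))"
      have h1: "h1 > 0" using h0(1) r(1) c[of z] by (simp add: h1_def)
      have low: "ennreal ((c z)\<^sup>2) \<le> w n z" if n: "hn n < h1" for n
      proof -
        define h where "h = hn n"
        have h: "0 < h" "h < h0" "h < r / (c z + 1)" using n hn(1)[of n] by (auto simp: h_def h1_def)
        have "c z * h \<le> (c z + 1) * h" using h by (intro mult_right_mono) auto
        also have "\<dots> < r" using h(3) c[of z] by (simp add: pos_less_divide_eq mult.commute)
        finally have chr: "c z * h \<le> r" by simp
        have "ennreal (v * (c z * h)\<^sup>2) = emeasure lborel (ball (F z) (c z * h))" using c h
          by (simp add: volball)
        also have "\<dots> = (\<integral>\<^sup>+\<zeta>. indicator (ball (F z) (c z * h)) \<zeta> \<partial>lborel)" by simp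
        also have "\<dots> \<le> U h z" unfolding U_def
        proof (rule nn_integral_mono)
          fix \<zeta> :: complex
          show
            "indicator (ball (F z) (c z * h)) \<zeta> \<le> (indicator V \<zeta> * indicator {..<h} (dist (G0 \<zeta>) z) :: ennreal)"
          proof (cases "\<zeta> \<in> ball (F z) (c z * h)")
            case True
            then obtain x where x: "\<zeta> = F x" "x \<in> ball z h" "x \<in> W" using h0(2)[OF h(1,2)] by auto
            have "\<zeta> \<in> B" using True chr r(2) by (auto simp: subset_iff)
            then have V: "\<zeta> \<in> V" using x by (auto simp: V_def)
            have "G \<zeta> = x" using x homeomorphism_apply1[OF hom] by simp
            then have "dist (G0 \<zeta>) z < h" using V x(2) by (simp add: G0_def dist_commute)
            then show ?thesis using V by (simp add: indicator_def)
          qed simp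
        qed
        finally have 1: "ennreal (v * (c z * h)\<^sup>2) \<le> U h z" .
        have "ennreal ((c z)\<^sup>2) = ennreal (v * (c z * h)\<^sup>2) * ennreal (1 / (v * h\<^sup>2))"
          using v h by (simp add: power_mult_distrib flip: ennreal_mult)
        also have "\<dots> \<le> U h z * ennreal (1 / (v * h\<^sup>2))" by (intro mult_right_mono 1) auto
        finally show ?thesis by (simp add: w_def h_def)
      qed
      have "eventually (\<lambda>n. hn n < h1) sequentially" using order_tendstoD(2)[OF hn(2) h1] .
      then have "eventually (\<lambda>n. ennreal ((c z)\<^sup>2) \<le> w n z) sequentially" by (rule eventually_mono) (rule low)
      then have "ennreal ((c z)\<^sup>2) \<le> liminf (\<lambda>n. w n z)" by (intro Liminf_bounded)
      then show ?thesis using True by simp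
    qed auto
  qed
  also have "\<dots> \<le> liminf (\<lambda>n. \<integral>\<^sup>+z. w n z \<partial>lborel)" by (rule nn_integral_liminf[OF mw])
  also have "\<dots> \<le> emeasure lborel B"
    by (rule Liminf_le) (use iw in auto)
  finally show ?thesis .
qed

section \<open>Increments along lines and bounds for directional derivatives\<close>

lemma vector_derivative_norm_le:
  fixes u :: "real \<Rightarrow> complex"
  assumes D: "(u has_vector_derivative D) (at x)" and A: "(\<phi> has_vector_derivative A) (at x)"
    and le: "\<And>y. norm (u y - u x) \<le> norm (\<phi> y - \<phi> x :: complex)"
  shows "norm D \<le> norm A"
proof (rule field_le_epsilon)
  fix e :: real assume "0 < e"
  then have e2: "0 < e / 2" by simp
  obtain d1 where d1: "d1 > 0" "\<And>y. norm (y - x) < d1 \<Longrightarrow> norm (u y - u x - (y - x) *\<^sub>R D) \<le> e / 2 * norm (y - x)"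
    using D e2 unfolding has_vector_derivative_def has_derivative_at_alt by blast
  obtain d2 where d2: "d2 > 0" "\<And>y. norm (y - x) < d2 \<Longrightarrow> norm (\<phi> y - \<phi> x - (y - x) *\<^sub>R A) \<le> e / 2 * norm (y - x)"
    using A e2 unfolding has_vector_derivative_def has_derivative_at_alt by blast
  define h where "h = min d1 d2 / 2"
  have h: "0 < h" "h < d1" "h < d2" using d1(1) d2(1) by (auto simp: h_def)
  have 1: "norm (u (x + h) - u x - h *\<^sub>R D) \<le> e / 2 * h" using d1(2)[of "x + h"] h by simp
  have 2: "norm (\<phi> (x + h) - \<phi> x - h *\<^sub>R A) \<le> e / 2 * h" using d2(2)[of "x + h"] h by simp
  have 3: "norm (h *\<^sub>R D) \<le> norm (u (x + h) - u x) + e / 2 * h"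
    using norm_triangle_ineq4[of "u (x + h) - u x" "u (x + h) - u x - h *\<^sub>R D"] 1 by simp
  have 4: "norm (\<phi> (x + h) - \<phi> x) \<le> norm (h *\<^sub>R A) + e / 2 * h"
    using norm_triangle_ineq[of "h *\<^sub>R A" "\<phi> (x + h) - \<phi> x - h *\<^sub>R A"] 2 by simp
  have "norm (h *\<^sub>R D) \<le> norm (h *\<^sub>R A) + e * h" using 3 4 le[of "x + h"] by linarith
  then have "h * norm D \<le> h * (norm A + e)" using h by (simp add: algebra_simps)
  then show "norm D \<le> norm A + e" using h by (simp add: mult_le_cancel_left_pos)
qed

text \<open>The truncation is locally constant where \<open>\<phi>\<close> is at distance at least
  \<open>2 * L\<close> from \<open>c\<close>, so \<open>g\<close> has to dominate the derivative
  only over a disc, whose area is finite. Since the disc has radius \<open>2 * L\<close> and not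
  \<open>L\<close>, the corner of the truncation causes no trouble.\<close>

lemma truncated_increment:
  fixes \<phi> :: "real \<Rightarrow> complex"
  assumes ac: "abs_cont {x1..x2} \<phi>" and le: "x1 \<le> x2" and L: "0 < L" and g: "g \<in> borel_measurable borel"
    and D: "\<And>x A. x1 < x \<Longrightarrow> x < x2 \<Longrightarrow> (\<phi> has_vector_derivative A) (at x) \<Longrightarrow> cmod (\<phi> x - c) < 2 * L \<Longrightarrow>
      ennreal (cmod A) \<le> g x"
  shows "ennreal \<bar>min (cmod (\<phi> x2 - c)) L - min (cmod (\<phi> x1 - c)) L\<bar> \<le> (\<integral>\<^sup>+x\<in>{x1..x2}. g x \<partial>lborel)"
proof -
  define u where "u x = complex_of_real (min (cmod (\<phi> x - c)) L)" for x
  have lip: "norm (u x - u y) \<le> norm (\<phi> x - \<phi> y)" for x y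
  proof -
    have "\<bar>cmod (\<phi> x - c) - cmod (\<phi> y - c)\<bar> \<le> cmod (\<phi> x - \<phi> y)"
      using norm_triangle_ineq3[of "\<phi> x - c" "\<phi> y - c"] by simp
    then have "\<bar>min (cmod (\<phi> x - c)) L - min (cmod (\<phi> y - c)) L\<bar> \<le> cmod (\<phi> x - \<phi> y)" by linarith
    then show ?thesis by (simp add: u_def flip: of_real_diff)
  qed
  have acu: "abs_cont {x1..x2} u" by (rule abs_cont_mono[OF ac, where C = 1]) (use lip in simp)
  obtain N where N: "negligible N" "\<And>x. x \<in> {x1<..<x2} - N \<Longrightarrow> \<exists>A. (\<phi> has_vector_derivative A) (at x)"
    using abs_cont_differentiable_ae[OF ac] by blast
  have "ennreal (norm (u x2 - u x1)) \<le> (\<integral>\<^sup>+x\<in>{x1..x2}. g x \<partial>lborel)"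
  proof (rule abs_cont_increment_le[OF acu le g], rule AE_lborel_if_negligible[OF N(1)], intro impI allI)
    fix x D' assume x: "x \<notin> N" "x1 < x \<and> x < x2" and D': "(u has_vector_derivative D') (at x)"
    then obtain A where A: "(\<phi> has_vector_derivative A) (at x)" using N(2)[of x] by auto
    show "ennreal (norm D') \<le> g x"
    proof (cases "cmod (\<phi> x - c) < 2 * L")
      case True
      have "ennreal (norm D') \<le> ennreal (norm A)" by (intro ennreal_leI vector_derivative_norm_le[OF D' A] lip)
      also have "\<dots> \<le> g x" using D x A True by blast
      finally show ?thesis .
    next
      case False
      have "((\<lambda>y. cmod (\<phi> y - c)) \<longlongrightarrow> cmod (\<phi> x - c)) (at x)"
        using has_vector_derivative_continuous[OF A] unfolding continuous_at by (intro tendsto_intros)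
      then have ev: "eventually (\<lambda>y. L < cmod (\<phi> y - c)) (at x)" using False L by (intro order_tendstoD(1)) auto
      then have "eventually (\<lambda>y. u x = u y) (at x)"
        by (rule eventually_mono) (use False L in \<open>auto simp: u_def min_def\<close>)
      then have "(u has_vector_derivative 0) (at x)"
        unfolding has_vector_derivative_def
        by (intro has_derivative_transform_eventually[OF has_vector_derivative_const[of "u x" "at x", unfolded
          has_vector_derivative_def]]) simp_all
      then have "D' = 0" using D' vector_derivative_unique_at by blast
      then show ?thesis by simp
    qed
  qed
  then show ?thesis by (simp add: u_def flip: of_real_diff)
qed

(* A lower limit along the steps 1/(n+1), with F extended by zero off W, is Borel measurable without any
   differentiability assumption. *)
definition dirderiv :: "(complex \<Rightarrow> complex) \<Rightarrow> complex set \<Rightarrow> complex \<Rightarrow> complex \<Rightarrow> ennreal" where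
  "dirderiv F W v z
    = liminf (\<lambda>n. ennreal (norm (indicator W (z + of_real (inverse (real (Suc n))) * v) *\<^sub>R F (z + of_real
    (inverse (real (Suc n))) * v)
     - indicator W z *\<^sub>R F z) * real (Suc n)))"

lemma dirderiv_measurable:
  assumes "open W" "continuous_on W F" shows "dirderiv F W v \<in> borel_measurable borel"
proof -
  have [measurable]: "(\<lambda>z. indicator W z *\<^sub>R F z) \<in> borel_measurable borel"
    using assms by (intro borel_measurable_continuous_on_indicator) auto
  have "(\<lambda>z. (\<lambda>z. indicator W z *\<^sub>R F z) (z + c)) \<in> borel_measurable borel" for c
    by (rule measurable_compose[of "\<lambda>z. z + c" _ borel]) measurable
  then have [measurable]: "(\<lambda>z. indicator W (z + c) *\<^sub>R F (z + c)) \<in> borel_measurable borel" for c by simp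
  show ?thesis unfolding dirderiv_def[abs_def] by measurable
qed

lemma dirderiv_eq:
  assumes W: "open W" "z \<in> W" and A: "((\<lambda>t. F (z + of_real t * v)) has_vector_derivative A) (at 0)"
  shows "dirderiv F W v z = ennreal (norm A)"
proof -
  define q where
    "q n = indicator W (z + of_real (inverse (real (Suc n))) * v) *\<^sub>R F (z
    + of_real (inverse (real (Suc n))) * v) - indicator W z *\<^sub>R F z" for n
  have "(\<lambda>n. norm (q n) * real (Suc n)) \<longlonglongrightarrow> norm A"
  proof (rule LIMSEQ_I)
    fix e :: real assume e: "0 < e"
    obtain d where d: "d > 0"
      "\<And>t. norm (t - 0) < d \<Longrightarrow> norm (F (z + of_real t * v) - F (z + of_real 0 * v) - (t - 0) *\<^sub>R A)
      \<le> e / 2 * norm (t - 0)"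
      using A e unfolding has_vector_derivative_def has_derivative_at_alt by (meson half_gt_zero)
    obtain r where r: "r > 0" "ball z r \<subseteq> W" using W open_contains_ball by blast
    have "0 < min d (r / (norm v + 1))" using d r by (simp add: add_nonneg_pos)
    then obtain M where M: "\<And>n. n \<ge> M \<Longrightarrow> inverse (real (Suc n)) < min d (r / (norm v + 1))"
      using order_tendstoD(2)[OF LIMSEQ_inverse_real_of_nat] unfolding eventually_sequentially by blast
    show "\<exists>no. \<forall>n\<ge>no. norm (norm (q n) * real (Suc n) - norm A) < e"
    proof (intro exI[of _ M] allI impI)
      fix n assume "n \<ge> M"
      define t where "t = inverse (real (Suc n))"
      have t: "0 < t" "t < d" "t < r / (norm v + 1)" "real (Suc n) = 1 / t" using M[OF \<open>n \<ge> M\<close>]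
        by (auto simp: t_def inverse_eq_divide)
      have "t * norm v \<le> t * (norm v + 1)" using t by simp
      also have "\<dots> < r" using t(3) by (simp add: pos_less_divide_eq add_nonneg_pos)
      finally have "z + of_real t * v \<in> W" using r(2) t(1) by (auto simp: dist_norm norm_mult subset_iff)
      then have q: "q n = F (z + of_real t * v) - F z" using W(2) by (simp add: q_def t_def)
      have "norm (q n - t *\<^sub>R A) \<le> e / 2 * t" using d(2)[of t] t by (simp add: q)
      then have "\<bar>norm (q n) - t * norm A\<bar> \<le> e / 2 * t"
        using norm_triangle_ineq3[of "q n" "t *\<^sub>R A"] t(1) by simp
      moreover have "\<bar>norm (q n) / t - norm A\<bar> = \<bar>norm (q n) - t * norm A\<bar> / t"
      proof -
        have "norm (q n) / t - norm A = (norm (q n) - t * norm A) / t" using t(1)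
          by (simp add: diff_divide_distrib)
        then show ?thesis using t(1) by (simp only: abs_divide abs_of_pos)
      qed
      ultimately have "\<bar>norm (q n) / t - norm A\<bar> \<le> e / 2" using t(1) by (simp only: pos_divide_le_eq)
      then show "norm (norm (q n) * real (Suc n) - norm A) < e" using e unfolding t(4) by (simp del: of_nat_Suc)
    qed
  qed
  then have "(\<lambda>n. ennreal (norm (q n) * real (Suc n))) \<longlonglongrightarrow> ennreal (norm A)" by (rule tendsto_ennrealI)
  then show ?thesis unfolding dirderiv_def q_def by (rule lim_imp_Liminf[OF trivial_limit_sequentially])
qed

text \<open>Takes the place of the Cauchy-Schwarz inequality in the length-area argument. Being
  linear in the square of \<open>x\<close>, it can be integrated directly over [0, \<infinity>];
  \<alpha> is adjusted afterwards.\<close>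

lemma ennreal_amgm:
  assumes "0 < \<alpha>" shows "x \<le> ennreal \<alpha> * x\<^sup>2 + ennreal (1 / (4 * \<alpha>))"
proof (cases x)
  case (real r)
  have "0 \<le> \<alpha> * (r - 1 / (2 * \<alpha>))\<^sup>2" using assms by simp
  also have "\<dots> = \<alpha> * r\<^sup>2 + 1 / (4 * \<alpha>) - r" using assms by (simp add: power2_eq_square field_simps)
  finally have "r \<le> \<alpha> * r\<^sup>2 + 1 / (4 * \<alpha>)" by simp
  then have "ennreal r \<le> ennreal (\<alpha> * r\<^sup>2 + 1 / (4 * \<alpha>))" by (rule ennreal_leI)
  also have "\<dots> = ennreal \<alpha> * (ennreal r)\<^sup>2 + ennreal (1 / (4 * \<alpha>))" using assms real
    by (simp add: ennreal_mult ennreal_power)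
  finally show ?thesis using real by simp
next
  case top then show ?thesis using assms by (simp add: ennreal_mult_top)
qed

text \<open>The linear part stretches every vector by at least \<open>(1 - k) * cmod P\<close>, and
  half of this pays for the remainder. So the boundary of a small disc goes far enough from
  \<open>F z\<close> for \<open>ball_subset_open_image\<close>. For \<open>P = 0\<close> the claim
  is about an empty ball.\<close>

lemma derivative_expands:
  fixes F :: "complex \<Rightarrow> complex"
  assumes W: "open W" "z \<in> W" and F: "continuous_on W F" "inj_on F W"
    and D: "(F has_derivative (\<lambda>h. P * h + Q * cnj h)) (at z)" and k: "k < 1" "cmod Q \<le> k * cmod P"
  shows "\<exists>h0>0. \<forall>h. 0 < h \<and> h < h0 \<longrightarrow> ball (F z) ((1 - k) / 2 * cmod P * h) \<subseteq> F ` (ball z h \<inter> W)"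
proof (cases "P = 0")
  case False
  define e where "e = (1 - k) / 2 * cmod P"
  have e: "e > 0" using False k by (simp add: e_def)
  obtain d where d: "d > 0" "\<And>y. norm (y - z) < d \<Longrightarrow> norm (F y - F z - (P * (y - z) + Q * cnj (y - z)))
    \<le> e * norm (y - z)"
    using D e unfolding has_derivative_at_alt by blast
  obtain r where r: "r > 0" "ball z r \<subseteq> W" using W open_contains_ball by blast
  show ?thesis
  proof (rule exI[of _ "min d r"], intro conjI allI impI)
    show "0 < min d r" using d r by simp
    fix h assume h: "0 < h \<and> h < min d r"
    have KW: "cball z h \<subseteq> W" using h r(2) by (auto simp: subset_iff)
    have "ball (F z) (e * h) \<subseteq> F ` interior (cball z h)"
    proof (rule ball_subset_open_image)
      show "continuous_on (cball z h) F" by (rule continuous_on_subset[OF F(1) KW])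
      show "open (F ` interior (cball z h))"
      proof -
        have iW: "interior (cball z h) \<subseteq> W" using KW interior_subset[of "cball z h"] by blast
        show ?thesis
          by (rule invariance_of_domain[OF continuous_on_subset[OF F(1) iW] open_interior inj_on_subset[OF F(2)
          iW]])
      qed
      show "z \<in> interior (cball z h)" using h by simp
      fix w assume "w \<in> cball z h - interior (cball z h)"
      then have w: "cmod (w - z) = h" by (auto simp: dist_norm norm_minus_commute)
      have 1: "norm (F w - F z - (P * (w - z) + Q * cnj (w - z))) \<le> e * h" using d(2)[of w] w h by simp
      have "cmod (Q * cnj (w - z)) \<le> k * cmod P * h" using w k(2) h
        by (simp only: norm_mult complex_mod_cnj) (simp add: mult_right_mono)
      moreover have "cmod (P * (w - z)) = cmod P * h" using w by (simp add: norm_mult)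
      ultimately have 2: "cmod P * h - k * cmod P * h \<le> cmod (P * (w - z) + Q * cnj (w - z))"
        using norm_diff_ineq[of "P * (w - z)" "Q * cnj (w - z)"] by linarith
      have 3:
        "cmod (P * (w - z) + Q * cnj (w - z))
        \<le> cmod (F w - F z) + norm (F w - F z - (P * (w - z) + Q * cnj (w - z)))"
        using norm_triangle_ineq4[of "F w - F z" "F w - F z - (P * (w - z) + Q * cnj (w - z))"] by simp
      have "cmod P * h - k * cmod P * h = 2 * (e * h)" by (simp add: e_def algebra_simps)
      then show "e * h \<le> cmod (F w - F z)" using 1 2 3 by linarith
    qed simp
    then show "ball (F z) ((1 - k) / 2 * cmod P * h) \<subseteq> F ` (ball z h \<inter> W)"
      using KW by (auto simp: e_def Int_absorb2 subset_iff)
  qed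
qed (auto intro: exI[of _ 1])

text \<open>Combines a lower bound for images of small discs, needed for areas, with an upper bound
  for directional derivatives, needed for lengths. The ratio of the factors 2 and
  \<open>(1 - k) / 2\<close>, squared, is the constant \<open>16 / (1 - k)\<^sup>2\<close> of the
  distortion estimate.\<close>

lemma qc_stretch_ae:
  fixes F :: "complex \<Rightarrow> complex"
  assumes W: "open W" and F: "continuous_on W F" "inj_on F W" and acl: "ACL_on W F"
    and k: "0 \<le> k" "k < 1" "AE z in lebesgue. z \<in> W \<longrightarrow> cmod (wirtinger_bar F z) \<le> k * cmod (wirtinger F z)"
  shows "AE z in lborel. z \<in> W \<longrightarrow>
     (\<exists>h0>0. \<forall>h. 0 < h \<and> h < h0 \<longrightarrow> ball (F z) ((1 - k) / 2 * cmod (wirtinger F z) * h) \<subseteq> F ` (ball z h \<inter> W)) \<and>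
     dirderiv F W 1 z \<le> ennreal (2 * cmod (wirtinger F z)) \<and> dirderiv F W \<i> z \<le> ennreal (2 * cmod
       (wirtinger F z))"
proof -
  have "AE y in lebesgue. y \<in> {Im a..Im b} \<longrightarrow> abs_cont_on {Re a..Re b} (\<lambda>x. F (Complex x y))" if "cbox a b \<subseteq> W"
    for a b
    using acl that unfolding ACL_on_def by blast
  then obtain Nx where Nx: "negligible Nx"
    "\<And>z. z \<in> W - Nx \<Longrightarrow> \<exists>A. ((\<lambda>t. F (z + of_real t)) has_vector_derivative A) (at 0)"
    using ACL_horizontal_partials[OF W F(1)] by blast
  obtain Ny where Ny: "negligible Ny"
    "\<And>z. z \<in> W - Ny \<Longrightarrow> \<exists>B. ((\<lambda>t. F (z + of_real t * \<i>)) has_vector_derivative B) (at 0)"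
    using ACL_vertical_partials[OF W F(1) acl] by blast
  obtain N where N: "negligible N"
    "\<And>z. z \<in> W - N \<Longrightarrow> \<exists>A B. (F has_derivative (\<lambda>h. of_real (Re h) * A + of_real (Im h) * B)) (at z)"
    using gehring_lehto[OF W F Nx Ny] by blast
  have "AE z in lborel. z \<in> W \<longrightarrow> cmod (wirtinger_bar F z) \<le> k * cmod (wirtinger F z)" using k(3)
    by (simp only: AE_completion_iff)
  moreover have "AE z in lborel. z \<notin> N" by (rule AE_lborel_if_negligible[OF N(1)])
  ultimately show ?thesis
  proof (eventually_elim, intro impI)
    fix z assume w: "z \<in> W \<longrightarrow> cmod (wirtinger_bar F z) \<le> k * cmod (wirtinger F z)" and z: "z \<notin> N" "z \<in> W"
    obtain A B where D: "(F has_derivative (\<lambda>h. of_real (Re h) * A + of_real (Im h) * B)) (at z)"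
      using N(2)[of z] z by blast
    define P where "P = (A - \<i> * B) / 2"
    define Q where "Q = (A + \<i> * B) / 2"
    have eqD: "(\<lambda>h. of_real (Re h) * A + of_real (Im h) * B) = (\<lambda>h. P * h + Q * cnj h)"
    proof
      fix h
      have "P * h + Q * cnj h = A * ((h + cnj h) / 2) + B * (- \<i> * (h - cnj h) / 2)"
        by (simp add: P_def Q_def field_simps)
      also have "(h + cnj h) / 2 = of_real (Re h)" by (simp add: complex_eq_iff)
      also have "- \<i> * (h - cnj h) / 2 = of_real (Im h)" by (simp add: complex_eq_iff)
      finally show "of_real (Re h) * A + of_real (Im h) * B = P * h + Q * cnj h" by (simp add: mult.commute)
    qed
    note D' = D[unfolded eqD]
    note wi = wirtinger_of_derivative[OF D']
    have kQ: "cmod Q \<le> k * cmod P" using w z wi by simp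
    also have "\<dots> \<le> 1 * cmod P" using k by (intro mult_right_mono) auto
    finally have QP: "cmod Q \<le> cmod P" by simp
    have vx: "((\<lambda>t. F (z + of_real t * 1)) has_vector_derivative (P + Q)) (at 0)"
      using partials_of_derivative(3)[OF D'] by simp
    have vy: "((\<lambda>t. F (z + of_real t * \<i>)) has_vector_derivative (P * \<i> - Q * \<i>)) (at 0)"
      using partials_of_derivative(4)[OF D'] by (simp add: mult.commute)
    have "cmod (P + Q) \<le> 2 * cmod P" using norm_triangle_ineq[of P Q] QP by linarith
    moreover have "cmod (P * \<i> - Q * \<i>) \<le> 2 * cmod P" using norm_triangle_ineq4[of "P * \<i>" "Q * \<i>"] QP
      by (simp add: norm_mult)
    ultimately show
      "(\<exists>h0>0. \<forall>h. 0 < h \<and> h < h0 \<longrightarrow> ball (F z) ((1 - k) / 2 * cmod (wirtinger F z) * h) \<subseteq> F ` (ball z h \<inter> W)) \<and>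
     dirderiv F W 1 z \<le> ennreal (2 * cmod (wirtinger F z)) \<and> dirderiv F W \<i> z \<le> ennreal (2 * cmod
       (wirtinger F z))"
      using derivative_expands[OF W z(2) F D' k(2) kQ] dirderiv_eq[OF W z(2) vx] dirderiv_eq[OF W z(2) vy] wi(1)
      by (simp add: ennreal_leI)
  qed
qed

section \<open>A distortion estimate for quasiconformal mappings\<close>

text \<open>Squares take the place of discs because their sides lie on horizontal and vertical
  lines, the only ones on which absolute continuity is given.\<close>

definition square :: "complex \<Rightarrow> real \<Rightarrow> complex set" where
  "square a r = cbox (Complex (Re a - r) (Im a - r)) (Complex (Re a + r) (Im a + r))"

lemma mem_square: "w \<in> square a r \<longleftrightarrow> \<bar>Re w - Re a\<bar> \<le> r \<and> \<bar>Im w - Im a\<bar> \<le> r"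
  by (auto simp: square_def in_cbox_complex_iff abs_le_iff)

lemma mem_interior_square: "w \<in> interior (square a r) \<longleftrightarrow> \<bar>Re w - Re a\<bar> < r \<and> \<bar>Im w - Im a\<bar> < r"
  by (auto simp: square_def in_box_complex_iff abs_less_iff)

lemma ennreal_abs_triangle: "ennreal \<bar>x - z\<bar> \<le> ennreal \<bar>x - y\<bar> + ennreal \<bar>y - z\<bar>"
  by (simp flip: ennreal_plus add: ennreal_leI)

text \<open>Any boundary point is reached from the midpoint of the right side along the boundary
  without using a side twice; the longest route uses the right, the top and the left side.\<close>

lemma square_boundary_chain:
  fixes m :: "complex \<Rightarrow> real"
  assumes r: "0 < r" and w: "w \<in> square a r" "w \<notin> interior (square a r)"
    and T: "\<And>x1 x2. Re a - r \<le> x1 \<Longrightarrow> x1 \<le> x2 \<Longrightarrow> x2 \<le> Re a + r \<Longrightarrow>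
      ennreal \<bar>m (Complex x2 (Im a + r)) - m (Complex x1 (Im a + r))\<bar> \<le> T"
    and B: "\<And>x1 x2. Re a - r \<le> x1 \<Longrightarrow> x1 \<le> x2 \<Longrightarrow> x2 \<le> Re a + r \<Longrightarrow>
      ennreal \<bar>m (Complex x2 (Im a - r)) - m (Complex x1 (Im a - r))\<bar> \<le> B"
    and R: "\<And>y1 y2. Im a - r \<le> y1 \<Longrightarrow> y1 \<le> y2 \<Longrightarrow> y2 \<le> Im a + r \<Longrightarrow>
      ennreal \<bar>m (Complex (Re a + r) y2) - m (Complex (Re a + r) y1)\<bar> \<le> R"
    and Le: "\<And>y1 y2. Im a - r \<le> y1 \<Longrightarrow> y1 \<le> y2 \<Longrightarrow> y2 \<le> Im a + r \<Longrightarrow>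
      ennreal \<bar>m (Complex (Re a - r) y2) - m (Complex (Re a - r) y1)\<bar> \<le> Le"
  shows "ennreal \<bar>m (Complex (Re a + r) (Im a)) - m w\<bar> \<le> T + B + (R + Le)"
proof -
  have T': "ennreal \<bar>m (Complex x2 (Im a + r)) - m (Complex x1 (Im a + r))\<bar> \<le> T"
    if "\<bar>x1 - Re a\<bar> \<le> r" "\<bar>x2 - Re a\<bar> \<le> r" for x1 x2
    using T[of x1 x2] T[of x2 x1] that by (cases "x1 \<le> x2") (auto simp: abs_minus_commute abs_le_iff)
  have B': "ennreal \<bar>m (Complex x2 (Im a - r)) - m (Complex x1 (Im a - r))\<bar> \<le> B"
    if "\<bar>x1 - Re a\<bar> \<le> r" "\<bar>x2 - Re a\<bar> \<le> r" for x1 x2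
    using B[of x1 x2] B[of x2 x1] that by (cases "x1 \<le> x2") (auto simp: abs_minus_commute abs_le_iff)
  have R': "ennreal \<bar>m (Complex (Re a + r) y2) - m (Complex (Re a + r) y1)\<bar> \<le> R"
    if "\<bar>y1 - Im a\<bar> \<le> r" "\<bar>y2 - Im a\<bar> \<le> r" for y1 y2
    using R[of y1 y2] R[of y2 y1] that by (cases "y1 \<le> y2") (auto simp: abs_minus_commute abs_le_iff)
  have L': "ennreal \<bar>m (Complex (Re a - r) y2) - m (Complex (Re a - r) y1)\<bar> \<le> Le"
    if "\<bar>y1 - Im a\<bar> \<le> r" "\<bar>y2 - Im a\<bar> \<le> r" for y1 y2
    using Le[of y1 y2] Le[of y2 y1] that by (cases "y1 \<le> y2") (auto simp: abs_minus_commute abs_le_iff)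
  let ?P = "Complex (Re a + r) (Im a)"
  have b: "\<bar>Re w - Re a\<bar> \<le> r" "\<bar>Im w - Im a\<bar> \<le> r" using w(1) by (auto simp: mem_square)
  consider "Re w = Re a + r" | "Im w = Im a + r" | "Im w = Im a - r" | "Re w = Re a - r"
    using b w(2) unfolding mem_interior_square by linarith
  then show ?thesis
  proof cases
    case 1
    then have "w = Complex (Re a + r) (Im w)" by (simp add: complex_eq_iff)
    then have "ennreal \<bar>m ?P - m w\<bar> \<le> R" using R'[of "Im w" "Im a"] b r
      by (metis abs_zero diff_self less_imp_le)
    also have "R \<le> T + B + (R + Le)" by (simp add: add_increasing add_increasing2)
    finally show ?thesis .
  next
    case 2
    then have e: "w = Complex (Re w) (Im a + r)" by (simp add: complex_eq_iff)
    have
      "ennreal \<bar>m ?P - m w\<bar> \<le> ennreal \<bar>m ?P - m (Complex (Re a + r) (Im a + r))\<bar>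
      + ennreal \<bar>m (Complex (Re a + r) (Im a + r)) - m w\<bar>"
      by (rule ennreal_abs_triangle)
    also have "\<dots> \<le> R + T"
    proof (rule add_mono)
      show "ennreal \<bar>m ?P - m (Complex (Re a + r) (Im a + r))\<bar> \<le> R" using r by (intro R') auto
      show "ennreal \<bar>m (Complex (Re a + r) (Im a + r)) - m w\<bar> \<le> T" using r b by (subst e, intro T') auto
    qed
    also have "R + T = T + 0 + (R + 0)" by (simp add: add.commute)
    also have "\<dots> \<le> T + B + (R + Le)" by (intro add_mono order_refl zero_le)
    finally show ?thesis .
  next
    case 3
    then have e: "w = Complex (Re w) (Im a - r)" by (simp add: complex_eq_iff)
    have
      "ennreal \<bar>m ?P - m w\<bar> \<le> ennreal \<bar>m ?P - m (Complex (Re a + r) (Im a - r))\<bar>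
      + ennreal \<bar>m (Complex (Re a + r) (Im a - r)) - m w\<bar>"
      by (rule ennreal_abs_triangle)
    also have "\<dots> \<le> R + B"
    proof (rule add_mono)
      show "ennreal \<bar>m ?P - m (Complex (Re a + r) (Im a - r))\<bar> \<le> R" using r by (intro R') auto
      show "ennreal \<bar>m (Complex (Re a + r) (Im a - r)) - m w\<bar> \<le> B" using r b by (subst e, intro B') auto
    qed
    also have "R + B = 0 + B + (R + 0)" by (simp add: add.commute)
    also have "\<dots> \<le> T + B + (R + Le)" by (intro add_mono order_refl zero_le)
    finally show ?thesis .
  next
    case 4
    then have e: "w = Complex (Re a - r) (Im w)" by (simp add: complex_eq_iff)
    have
      "ennreal \<bar>m ?P - m w\<bar> \<le> ennreal \<bar>m ?P - m (Complex (Re a + r) (Im a + r))\<bar>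
      + ennreal \<bar>m (Complex (Re a + r) (Im a + r)) - m w\<bar>"
      by (rule ennreal_abs_triangle)
    also have "\<dots> \<le> R + (T + Le)"
    proof (rule add_mono)
      show "ennreal \<bar>m ?P - m (Complex (Re a + r) (Im a + r))\<bar> \<le> R" using r by (intro R') auto
      have "ennreal \<bar>m (Complex (Re a + r) (Im a + r)) - m w\<bar> \<le> ennreal \<bar>m (Complex (Re a + r) (Im a + r))
        - m (Complex (Re a - r) (Im a + r))\<bar> + ennreal \<bar>m (Complex (Re a - r) (Im a + r)) - m w\<bar>"
        by (rule ennreal_abs_triangle)
      also have "\<dots> \<le> T + Le"
      proof (rule add_mono)
        show "ennreal \<bar>m (Complex (Re a + r) (Im a + r)) - m (Complex (Re a - r) (Im a + r))\<bar> \<le> T" using r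
          by (intro T') auto
        show "ennreal \<bar>m (Complex (Re a - r) (Im a + r)) - m w\<bar> \<le> Le" using r b by (subst e, intro L') auto
      qed
      finally show "ennreal \<bar>m (Complex (Re a + r) (Im a + r)) - m w\<bar> \<le> T + Le" .
    qed
    also have "R + (T + Le) = T + 0 + (R + Le)" by (simp add: ac_simps)
    also have "\<dots> \<le> T + B + (R + Le)" by (intro add_mono order_refl zero_le)
    finally show ?thesis .
  qed
qed

text \<open>Turns a statement about almost every line into one about almost every half-width
  \<open>r\<close>, the sides of a square being at \<open>Im a + r\<close>, \<open>Im a - r\<close>,
  \<open>Re a + r\<close> and \<open>Re a - r\<close>.\<close>

lemma AE_lborel_affine:
  fixes P :: "real \<Rightarrow> bool"
  assumes "AE x in lborel. P x" "c \<noteq> 0" shows "AE x in lborel. P (t + c * x)"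
proof -
  obtain N where N: "{x \<in> space lborel. \<not> P x} \<subseteq> N" "emeasure lborel N = 0" "N \<in> sets lborel"
    using assms(1) by (rule AE_E)
  have "N \<in> null_sets lborel" using N(2,3) by auto
  then have "AE x in lborel. x \<notin> N" by (rule AE_not_in)
  moreover have "Measurable.pred borel (\<lambda>x. x \<notin> N)" using N(3) by measurable
  ultimately have "AE x in lborel. t + c * x \<notin> N" using AE_borel_affine[OF assms(2), of "\<lambda>x. x \<notin> N" t] by blast
  then show ?thesis by (rule eventually_mono) (use N(1) in auto)
qed

lemma amgm_integral:
  fixes X :: "real \<Rightarrow> ennreal"
  assumes [measurable]: "X \<in> borel_measurable borel" and \<alpha>: "0 < \<alpha>" and r: "0 \<le> r"
  shows "(\<integral>\<^sup>+x\<in>{c - r..c + r}. X x \<partial>lborel) \<le> ennreal \<alpha> * (\<integral>\<^sup>+x. (X x)\<^sup>2 \<partial>lborel) + ennreal (r / (2 * \<alpha>))"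
proof -
  have
    "(\<integral>\<^sup>+x\<in>{c - r..c + r}. X x \<partial>lborel)
    \<le> (\<integral>\<^sup>+x. ennreal \<alpha> * (X x)\<^sup>2 + ennreal (1 / (4 * \<alpha>)) * indicator {c - r..c + r} x \<partial>lborel)"
    by (intro nn_integral_mono) (use ennreal_amgm[OF \<alpha>] in \<open>auto simp: indicator_def\<close>)
  also have
    "\<dots> = (\<integral>\<^sup>+x. ennreal \<alpha> * (X x)\<^sup>2 \<partial>lborel)
    + (\<integral>\<^sup>+x. ennreal (1 / (4 * \<alpha>)) * indicator {c - r..c + r} x \<partial>lborel)"
    by (rule nn_integral_add) measurable
  also have "(\<integral>\<^sup>+x. ennreal \<alpha> * (X x)\<^sup>2 \<partial>lborel) = ennreal \<alpha> * (\<integral>\<^sup>+x. (X x)\<^sup>2 \<partial>lborel)"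
    by (rule nn_integral_cmult) measurable
  also have "(\<integral>\<^sup>+x. ennreal (1 / (4 * \<alpha>)) * indicator {c - r..c + r} x \<partial>lborel)
    = ennreal (1 / (4 * \<alpha>)) * emeasure lborel {c - r..c + r}"
    by (rule nn_integral_cmult_indicator) simp
  also have "emeasure lborel {c - r..c + r} = ennreal (2 * r)" using r by simp
  also have "ennreal (1 / (4 * \<alpha>)) * ennreal (2 * r) = ennreal (r / (2 * \<alpha>))" using \<alpha> r
    by (simp flip: ennreal_mult)
  finally show ?thesis .
qed

(* The length-area method on the squares around a of half-width r, for r from theta * rho to rho. If the
   conclusion fails, then |F - F a|, truncated at L, varies by more than L/2 on the boundary of each of them;
   integrating over r gives log (1 / theta) * L^2 at most a constant times L^2. The value of theta makes the
   two constants 513 and 512. *)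
lemma quasiconformal_distortion:
  fixes F :: "complex \<Rightarrow> complex"
  assumes W: "open W" and F: "continuous_on W F" "inj_on F W" and acl: "ACL_on W F"
    and k: "0 \<le> k" "k < 1" "AE z in lebesgue. z \<in> W \<longrightarrow> cmod (wirtinger_bar F z) \<le> k * cmod (wirtinger F z)"
    and Q: "square a \<rho> \<subseteq> W" and \<rho>: "0 < \<rho>" and L: "0 < L"
    and lam: "\<theta> = exp (- (513 * (16 / (1 - k)\<^sup>2 * unit_ball_vol 2)))"
    and far: "\<And>r. \<theta> * \<rho> \<le> r \<Longrightarrow> r \<le> \<rho> \<Longrightarrow> L \<le> cmod (F (Complex (Re a + r) (Im a)) - F a)"
  shows "ball (F a) (L / 2) \<subseteq> F ` square a \<rho>"
proof (rule ccontr)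
  assume contra: "\<not> ball (F a) (L / 2) \<subseteq> F ` square a \<rho>"
  define v where "v = unit_ball_vol (2 :: real)"
  have v: "v > 0" by (simp add: v_def)
  define \<kappa> where "\<kappa> = 16 / (1 - k)\<^sup>2"
  have \<kappa>: "\<kappa> > 0" using k by (simp add: \<kappa>_def)
  have lam1: "0 < \<theta>" "\<theta> < 1" unfolding lam using \<kappa> v by (auto simp: \<kappa>_def v_def)
  have Qr: "square a r \<subseteq> W" if "r \<le> \<rho>" for r using Q that by (force simp: mem_square subset_iff)
  \<comment> \<open>If no boundary point of a square came within \<open>L / 2\<close> of
    \<open>F a\<close>, then the image of its interior would contain the disc. Together with
    \<open>far\<close> this forces a variation of more than \<open>L / 2\<close> along the
    boundary.\<close>
  have near: "\<exists>w\<in>square a r - interior (square a r). cmod (F w - F a) < L / 2" if r: "0 < r" "r \<le> \<rho>" for r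
  proof (rule ccontr)
    assume no: "\<not> (\<exists>w\<in>square a r - interior (square a r). cmod (F w - F a) < L / 2)"
    have iW: "interior (square a r) \<subseteq> W" using Qr[OF r(2)] interior_subset by blast
    have "ball (F a) (L / 2) \<subseteq> F ` interior (square a r)"
    proof (rule ball_subset_open_image)
      show "compact (square a r)" by (simp add: square_def)
      show "continuous_on (square a r) F" by (rule continuous_on_subset[OF F(1) Qr[OF r(2)]])
      show "open (F ` interior (square a r))"
        by (rule invariance_of_domain[OF continuous_on_subset[OF F(1) iW] open_interior inj_on_subset[OF F(2)
          iW]])
      show "a \<in> interior (square a r)" using r by (simp add: mem_interior_square)
      show "L / 2 \<le> cmod (F w - F a)" if "w \<in> square a r - interior (square a r)" for w
        using no that by (meson not_le)
    qed
    moreover have "interior (square a r) \<subseteq> square a \<rho>" using r by (auto simp: mem_interior_square mem_square)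
    ultimately show False using contra by blast
  qed
  define m where "m z = min (cmod (F z - F a)) L" for z
  define U where "U = {z \<in> W. F z \<in> ball (F a) (2 * L)}"
  have "open U" unfolding U_def using continuous_open_preimage[OF F(1) W open_ball]
    by (simp add: vimage_def Int_def)
  then have [measurable]: "U \<in> sets borel" by simp
  note [measurable] = dirderiv_measurable[OF W F(1)]
  \<comment> \<open>Cutting down to \<open>U\<close>, where \<open>F\<close> takes values in the
    disc of radius \<open>2 * L\<close>, makes the integral of the square comparable with the area
    of this disc.\<close>
  define X where "X z = dirderiv F W 1 z * indicator U z" for z
  define Y where "Y z = dirderiv F W \<i> z * indicator U z" for z
  have [measurable]: "X \<in> borel_measurable borel" "Y \<in> borel_measurable borel"
    unfolding X_def[abs_def] Y_def[abs_def] by measurable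
  have Xl[measurable]: "(\<lambda>x. X (Complex x y)) \<in> borel_measurable borel" for y unfolding Complex_eq by measurable
  have Yl[measurable]: "(\<lambda>y. Y (Complex x y)) \<in> borel_measurable borel" for x unfolding Complex_eq by measurable
  define SX where "SX y = (\<integral>\<^sup>+x. (X (Complex x y))\<^sup>2 \<partial>lborel)" for y
  define SY where "SY x = (\<integral>\<^sup>+y. (Y (Complex x y))\<^sup>2 \<partial>lborel)" for x
  have [measurable]: "SX \<in> borel_measurable borel" "SY \<in> borel_measurable borel"
    unfolding SX_def[abs_def] SY_def[abs_def] Complex_eq by measurable
  have IX: "(\<integral>\<^sup>+y. SX y \<partial>lborel) = (\<integral>\<^sup>+z. (X z)\<^sup>2 \<partial>lborel)"
    unfolding SX_def by (rule nn_integral_complex(1)[symmetric]) measurable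
  have IY: "(\<integral>\<^sup>+x. SY x \<partial>lborel) = (\<integral>\<^sup>+z. (Y z)\<^sup>2 \<partial>lborel)"
    unfolding SY_def by (rule nn_integral_complex(2)[symmetric]) measurable
  have horiz:
    "ennreal \<bar>m (Complex x2 y) - m (Complex x1 y)\<bar> \<le> (\<integral>\<^sup>+x\<in>{Re a - r..Re a + r}. X (Complex x y) \<partial>lborel)"
    if ac: "abs_cont {Re a - \<rho>..Re a + \<rho>} (\<lambda>x. F (Complex x y))" and y: "\<bar>y - Im a\<bar> \<le> \<rho>" and r: "r \<le> \<rho>"
      and x: "Re a - r \<le> x1" "x1 \<le> x2" "x2 \<le> Re a + r" for y r x1 x2
  proof -
    have "ennreal \<bar>min (cmod (F (Complex x2 y) - F a)) L - min (cmod (F (Complex x1 y) - F a)) L\<bar>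
      \<le> (\<integral>\<^sup>+x\<in>{x1..x2}. X (Complex x y) \<partial>lborel)"
    proof (rule truncated_increment[OF abs_cont_subset[OF ac] x(2) L Xl])
      show "{x1..x2} \<subseteq> {Re a - \<rho>..Re a + \<rho>}" using x r by auto
      fix x A assume xx: "x1 < x" "x < x2" and A: "((\<lambda>x. F (Complex x y)) has_vector_derivative A) (at x)"
        and lt: "cmod (F (Complex x y) - F a) < 2 * L"
      have "Complex x y \<in> W" using Q xx x r y by (auto simp: mem_square subset_iff abs_le_iff)
      then have U: "Complex x y \<in> U" "Complex x y \<in> W" using lt
        by (auto simp: U_def dist_norm norm_minus_commute)
      have "((\<lambda>t. x + t) has_vector_derivative 1) (at 0)" by (auto intro!: derivative_eq_intros)
      moreover have "((\<lambda>x. F (Complex x y)) has_vector_derivative A) (at (x + 0))" using A by simp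
      ultimately have "((\<lambda>x. F (Complex x y)) \<circ> (\<lambda>t. x + t) has_vector_derivative 1 *\<^sub>R A) (at 0)"
        by (rule vector_diff_chain_at)
      moreover have "(\<lambda>x. F (Complex x y)) \<circ> (\<lambda>t. x + t) = (\<lambda>t. F (Complex x y + of_real t * 1))"
        by (auto simp: fun_eq_iff Complex_eq algebra_simps)
      ultimately have "((\<lambda>t. F (Complex x y + of_real t * 1)) has_vector_derivative A) (at 0)" by simp
      from dirderiv_eq[OF W U(2) this] U(1) show "ennreal (cmod A) \<le> X (Complex x y)" by (simp add: X_def)
    qed
    also have "\<dots> \<le> (\<integral>\<^sup>+x\<in>{Re a - r..Re a + r}. X (Complex x y) \<partial>lborel)"
      by (intro nn_integral_mono mult_left_mono) (use x in \<open>auto simp: indicator_def\<close>)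
    finally show ?thesis by (simp add: m_def)
  qed
  have vert:
    "ennreal \<bar>m (Complex x y2) - m (Complex x y1)\<bar> \<le> (\<integral>\<^sup>+y\<in>{Im a - r..Im a + r}. Y (Complex x y) \<partial>lborel)"
    if ac: "abs_cont {Im a - \<rho>..Im a + \<rho>} (\<lambda>y. F (Complex x y))" and x: "\<bar>x - Re a\<bar> \<le> \<rho>" and r: "r \<le> \<rho>"
      and y: "Im a - r \<le> y1" "y1 \<le> y2" "y2 \<le> Im a + r" for x r y1 y2
  proof -
    have "ennreal \<bar>min (cmod (F (Complex x y2) - F a)) L - min (cmod (F (Complex x y1) - F a)) L\<bar>
      \<le> (\<integral>\<^sup>+y\<in>{y1..y2}. Y (Complex x y) \<partial>lborel)"
    proof (rule truncated_increment[OF abs_cont_subset[OF ac] y(2) L Yl])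
      show "{y1..y2} \<subseteq> {Im a - \<rho>..Im a + \<rho>}" using y r by auto
      fix y A assume yy: "y1 < y" "y < y2" and A: "((\<lambda>y. F (Complex x y)) has_vector_derivative A) (at y)"
        and lt: "cmod (F (Complex x y) - F a) < 2 * L"
      have "Complex x y \<in> W" using Q yy y r x by (auto simp: mem_square subset_iff abs_le_iff)
      then have U: "Complex x y \<in> U" "Complex x y \<in> W" using lt
        by (auto simp: U_def dist_norm norm_minus_commute)
      have "((\<lambda>t. y + t) has_vector_derivative 1) (at 0)" by (auto intro!: derivative_eq_intros)
      moreover have "((\<lambda>y. F (Complex x y)) has_vector_derivative A) (at (y + 0))" using A by simp
      ultimately have "((\<lambda>y. F (Complex x y)) \<circ> (\<lambda>t. y + t) has_vector_derivative 1 *\<^sub>R A) (at 0)"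
        by (rule vector_diff_chain_at)
      moreover have "(\<lambda>y. F (Complex x y)) \<circ> (\<lambda>t. y + t) = (\<lambda>t. F (Complex x y + of_real t * \<i>))"
        by (auto simp: fun_eq_iff Complex_eq algebra_simps)
      ultimately have "((\<lambda>t. F (Complex x y + of_real t * \<i>)) has_vector_derivative A) (at 0)" by simp
      from dirderiv_eq[OF W U(2) this] U(1) show "ennreal (cmod A) \<le> Y (Complex x y)" by (simp add: Y_def)
    qed
    also have "\<dots> \<le> (\<integral>\<^sup>+y\<in>{Im a - r..Im a + r}. Y (Complex x y) \<partial>lborel)"
      by (intro nn_integral_mono mult_left_mono) (use y in \<open>auto simp: indicator_def\<close>)
    finally show ?thesis by (simp add: m_def)
  qed
  have acls: "AE y in lborel. y \<in> {Im a - \<rho>..Im a + \<rho>} \<longrightarrow> abs_cont {Re a - \<rho>..Re a + \<rho>} (\<lambda>x. F (Complex x y))"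
    "AE x in lborel. x \<in> {Re a - \<rho>..Re a + \<rho>} \<longrightarrow> abs_cont {Im a - \<rho>..Im a + \<rho>} (\<lambda>y. F (Complex x y))"
  proof -
    have "(AE y in lebesgue. y \<in> {Im a - \<rho>..Im a + \<rho>} \<longrightarrow> abs_cont {Re a - \<rho>..Re a + \<rho>} (\<lambda>x. F (Complex x y))) \<and>
      (AE x in lebesgue. x \<in> {Re a - \<rho>..Re a + \<rho>} \<longrightarrow> abs_cont {Im a - \<rho>..Im a + \<rho>} (\<lambda>y. F (Complex x y)))"
      using acl[unfolded ACL_on_def abs_cont_on_iff, rule_format, OF Q[unfolded square_def]] by simp
    then show "AE y in lborel. y \<in> {Im a - \<rho>..Im a + \<rho>} \<longrightarrow> abs_cont {Re a - \<rho>..Re a + \<rho>} (\<lambda>x. F (Complex x y))"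
    "AE x in lborel. x \<in> {Re a - \<rho>..Re a + \<rho>} \<longrightarrow> abs_cont {Im a - \<rho>..Im a + \<rho>} (\<lambda>y. F (Complex x y))"
      by (simp_all only: AE_completion_iff)
  qed
  define \<Sigma> where "\<Sigma> r = SX (Im a + 1 * r) + SX (Im a + (-1) * r) + (SY (Re a + 1 * r) + SY (Re a + (-1) * r))"
    for r
  have [measurable]: "\<Sigma> \<in> borel_measurable borel" unfolding \<Sigma>_def[abs_def] by measurable
  have minus_one_neq: "- 1 \<noteq> (0::real)" by simp
  have main: "AE r in lborel. ennreal (L\<^sup>2 / 32 * (1 / r)) * indicator {\<theta> * \<rho>..\<rho>} r \<le> \<Sigma> r"
    using AE_lborel_affine[OF acls(1) one_neq_zero, of "Im a"] AE_lborel_affine[OF acls(1) minus_one_neq, of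
      "Im a"]
      AE_lborel_affine[OF acls(2) one_neq_zero, of "Re a"] AE_lborel_affine[OF acls(2) minus_one_neq, of "Re a"]
  proof eventually_elim
    fix r
    assume ac:
      "Im a + 1 * r \<in> {Im a - \<rho>..Im a + \<rho>} \<longrightarrow> abs_cont {Re a - \<rho>..Re a + \<rho>} (\<lambda>x. F (Complex x (Im a + 1 * r)))"
      "Im a + (-1) * r \<in> {Im a - \<rho>..Im a + \<rho>} \<longrightarrow>
        abs_cont {Re a - \<rho>..Re a + \<rho>} (\<lambda>x. F (Complex x (Im a + (-1) * r)))"
      "Re a + 1 * r \<in> {Re a - \<rho>..Re a + \<rho>} \<longrightarrow> abs_cont {Im a - \<rho>..Im a + \<rho>} (\<lambda>y. F (Complex (Re a + 1 * r) y))"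
      "Re a + (-1) * r \<in> {Re a - \<rho>..Re a + \<rho>} \<longrightarrow>
        abs_cont {Im a - \<rho>..Im a + \<rho>} (\<lambda>y. F (Complex (Re a + (-1) * r) y))"
    show "ennreal (L\<^sup>2 / 32 * (1 / r)) * indicator {\<theta> * \<rho>..\<rho>} r \<le> \<Sigma> r"
    proof (cases "r \<in> {\<theta> * \<rho>..\<rho>}")
      case True
      have r: "r \<le> \<rho>" "\<theta> * \<rho> \<le> r" using True by auto
      have r: "0 < r" "r \<le> \<rho>" "\<theta> * \<rho> \<le> r" using r mult_pos_pos[OF lam1(1) \<rho>] by linarith+
      have ac': "abs_cont {Re a - \<rho>..Re a + \<rho>} (\<lambda>x. F (Complex x (Im a + r)))"
        "abs_cont {Re a - \<rho>..Re a + \<rho>} (\<lambda>x. F (Complex x (Im a - r)))"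
        "abs_cont {Im a - \<rho>..Im a + \<rho>} (\<lambda>y. F (Complex (Re a + r) y))"
        "abs_cont {Im a - \<rho>..Im a + \<rho>} (\<lambda>y. F (Complex (Re a - r) y))"
        using ac r by simp_all
      obtain w where w: "w \<in> square a r" "w \<notin> interior (square a r)" "cmod (F w - F a) < L / 2"
        using near[OF r(1,2)] by blast
      let ?T = "\<integral>\<^sup>+x\<in>{Re a - r..Re a + r}. X (Complex x (Im a + r)) \<partial>lborel"
      let ?B = "\<integral>\<^sup>+x\<in>{Re a - r..Re a + r}. X (Complex x (Im a - r)) \<partial>lborel"
      let ?R = "\<integral>\<^sup>+y\<in>{Im a - r..Im a + r}. Y (Complex (Re a + r) y) \<partial>lborel"
      let ?L = "\<integral>\<^sup>+y\<in>{Im a - r..Im a + r}. Y (Complex (Re a - r) y) \<partial>lborel"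
      have chain: "ennreal \<bar>m (Complex (Re a + r) (Im a)) - m w\<bar> \<le> ?T + ?B + (?R + ?L)"
        by (rule square_boundary_chain[OF r(1) w(1,2)])
          (use r in \<open>auto intro!: horiz[OF ac'(1)] horiz[OF ac'(2)] vert[OF ac'(3)] vert[OF ac'(4)]\<close>)
      have mP: "m (Complex (Re a + r) (Im a)) = L" using far[OF r(3,2)] by (simp add: m_def)
      have mw: "m w < L / 2" using w(3) L by (simp add: m_def)
      have "ennreal (L / 2) \<le> ennreal \<bar>m (Complex (Re a + r) (Im a)) - m w\<bar>"
        by (rule ennreal_leI, use mP mw in linarith)
      also note chain
      finally have 1: "ennreal (L / 2) \<le> ?T + ?B + (?R + ?L)" .
      \<comment> \<open>Each side contributes the constant
        \<open>r / (2 * \<alpha>) = L / 16\<close>, so the four sides use up \<open>L / 4\<close> of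
        the lower bound \<open>L / 2\<close>. The rest gives
        \<open>\<Sigma> r \<ge> L\<^sup>2 / (32 * r)\<close>, whose integral is logarithmic.\<close>
      define \<alpha> where "\<alpha> = 8 * r / L"
      have \<alpha>: "\<alpha> > 0" using r L by (simp add: \<alpha>_def)
      have q: "ennreal (r / (2 * \<alpha>)) = ennreal (L / 16)" using r L by (simp add: \<alpha>_def)
      have r0: "0 \<le> r" using r by simp
      have
        "?T + ?B + (?R + ?L) \<le> (ennreal \<alpha> * SX (Im a + r) + ennreal (L / 16)) + (ennreal \<alpha> * SX (Im a - r)
        + ennreal (L / 16)) +
          ((ennreal \<alpha> * SY (Re a + r) + ennreal (L / 16)) + (ennreal \<alpha> * SY (Re a - r) + ennreal (L / 16)))"
        unfolding SX_def SY_def q[symmetric] by (intro add_mono amgm_integral \<alpha> r0 Xl Yl)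
      also have
        "\<dots> = ennreal \<alpha> * \<Sigma> r + (ennreal (L / 16) + ennreal (L / 16) + (ennreal (L / 16) + ennreal (L / 16)))"
        by (simp add: \<Sigma>_def distrib_left ac_simps)
      also have "ennreal (L / 16) + ennreal (L / 16) + (ennreal (L / 16) + ennreal (L / 16)) = ennreal (L / 4)"
        using L by (simp flip: ennreal_plus)
      finally have 2: "ennreal (L / 2) \<le> ennreal \<alpha> * \<Sigma> r + ennreal (L / 4)" using 1
        by (rule order_trans[rotated])
      show ?thesis
      proof (cases "\<Sigma> r")
        case (real s)
        then have "ennreal (L / 2) \<le> ennreal (\<alpha> * s + L / 4)" using 2 \<alpha> L
          by (simp add: ennreal_mult ennreal_plus)
        then have "L / 2 \<le> \<alpha> * s + L / 4" using real \<alpha> L by (subst (asm) ennreal_le_iff) auto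
        then have "L\<^sup>2 / 32 * (1 / r) \<le> s" using r L by (simp add: \<alpha>_def field_simps power2_eq_square)
        then show ?thesis using True real by (simp add: ennreal_leI)
      next
        case top then show ?thesis by simp
      qed
    qed simp
  qed
  have
    "ennreal (L\<^sup>2 / 32 * (ln \<rho> - ln (\<theta> * \<rho>)))
    = (\<integral>\<^sup>+r. ennreal (L\<^sup>2 / 32 * (1 / r)) * indicator {\<theta> * \<rho>..\<rho>} r \<partial>lborel)"
  proof -
    have "(\<integral>\<^sup>+r. ennreal (L\<^sup>2 / 32 * (1 / r)) * indicator {\<theta> * \<rho>..\<rho>} r \<partial>lborel)
      = ennreal (L\<^sup>2 / 32 * ln \<rho> - L\<^sup>2 / 32 * ln (\<theta> * \<rho>))"
    proof (rule nn_integral_FTC_Icc)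
      show "(\<lambda>r. L\<^sup>2 / 32 * (1 / r)) \<in> borel_measurable borel" by measurable
      have pos: "0 < r" if "\<theta> * \<rho> \<le> r" for r using that mult_pos_pos[OF lam1(1) \<rho>] by linarith
      show "((\<lambda>r. L\<^sup>2 / 32 * ln r) has_real_derivative L\<^sup>2 / 32 * (1 / r)) (at r)" if "r \<in> {\<theta> * \<rho>..\<rho>}" for r
        using pos[of r] that by (auto intro!: derivative_eq_intros)
      show "0 \<le> L\<^sup>2 / 32 * (1 / r)" if "r \<in> {\<theta> * \<rho>..\<rho>}" for r using pos[of r] that by simp
      show "\<theta> * \<rho> \<le> \<rho>" using lam1 \<rho> by simp
    qed
    then show ?thesis by (simp add: right_diff_distrib)
  qed
  also have "\<dots> \<le> (\<integral>\<^sup>+r. \<Sigma> r \<partial>lborel)" by (rule nn_integral_mono_AE[OF main])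
  also have "\<dots> = ((\<integral>\<^sup>+r. SX (Im a + 1 * r) \<partial>lborel) + (\<integral>\<^sup>+r. SX (Im a + (-1) * r) \<partial>lborel))
    + ((\<integral>\<^sup>+r. SY (Re a + 1 * r) \<partial>lborel) + (\<integral>\<^sup>+r. SY (Re a + (-1) * r) \<partial>lborel))"
    unfolding \<Sigma>_def by (simp add: nn_integral_add)
  also have
    "\<dots> = ((\<integral>\<^sup>+z. (X z)\<^sup>2 \<partial>lborel) + (\<integral>\<^sup>+z. (X z)\<^sup>2 \<partial>lborel))
    + ((\<integral>\<^sup>+z. (Y z)\<^sup>2 \<partial>lborel) + (\<integral>\<^sup>+z. (Y z)\<^sup>2 \<partial>lborel))"
  proof -
    have aff: "(\<integral>\<^sup>+r. f (t + c * r) \<partial>lborel) = (\<integral>\<^sup>+r. f r \<partial>lborel)" if "\<bar>c\<bar> = 1" "f \<in> borel_measurable borel"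
      for f :: "real \<Rightarrow> ennreal" and c t
    proof -
      have "c \<noteq> 0" using that(1) by auto
      from nn_integral_real_affine[OF that(2) this, of t] that(1) show ?thesis by simp
    qed
    have m1: "\<bar>- 1 :: real\<bar> = 1" by simp
    have hX: "(\<integral>\<^sup>+r. SX (Im a + c * r) \<partial>lborel) = (\<integral>\<^sup>+r. SX r \<partial>lborel)" if "\<bar>c\<bar> = 1" for c
      by (rule aff[OF that]) measurable
    have hY: "(\<integral>\<^sup>+r. SY (Re a + c * r) \<partial>lborel) = (\<integral>\<^sup>+r. SY r \<partial>lborel)" if "\<bar>c\<bar> = 1" for c
      by (rule aff[OF that]) measurable
    show ?thesis unfolding IX[symmetric] IY[symmetric] hX[OF abs_one] hX[OF m1] hY[OF abs_one] hY[OF m1] ..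
  qed
  finally have up:
    "ennreal (L\<^sup>2 / 32 * (ln \<rho> - ln (\<theta> * \<rho>))) \<le> ((\<integral>\<^sup>+z. (X z)\<^sup>2 \<partial>lborel) + (\<integral>\<^sup>+z. (X z)\<^sup>2 \<partial>lborel))
    + ((\<integral>\<^sup>+z. (Y z)\<^sup>2 \<partial>lborel) + (\<integral>\<^sup>+z. (Y z)\<^sup>2 \<partial>lborel))" .
  obtain G where G: "homeomorphism W (F ` W) F G" using invariance_of_domain_homeomorphism[OF W F(1) _ F(2)]
    by auto
  have opW: "open (F ` W)" by (rule invariance_of_domain[OF F(1) W F(2)])
  note stretch = qc_stretch_ae[OF W F acl k]
  define c where "c z = (1 - k) / 2 * cmod (wirtinger F z)" for z
  have area: "(\<integral>\<^sup>+z. ennreal ((c z)\<^sup>2) * indicator {z \<in> W. F z \<in> ball (F a) (2 * L)} z \<partial>lborel)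
    \<le> emeasure lborel (ball (F a) (2 * L))"
  proof (rule area_bound[OF W G opW])
    show "AE z in lborel. z \<in> W \<and> F z \<in> ball (F a) (2 * L) \<longrightarrow> (\<exists>h0>0. \<forall>h. 0 < h \<and> h < h0 \<longrightarrow> ball (F z) (c z * h)
      \<subseteq> F ` (ball z h \<inter> W))"
      using stretch by (rule eventually_mono) (auto simp: c_def)
  qed (use k in \<open>auto simp: c_def\<close>)
  have vol: "emeasure lborel (ball (F a) (2 * L)) = ennreal (4 * v * L\<^sup>2)"
    using emeasure_ball[of "2 * L" "F a"] L by (simp add: v_def power_mult_distrib mult_ac)
  have sq: "(ennreal (2 * p))\<^sup>2 * ennreal (1 / \<kappa>) = ennreal (((1 - k) / 2 * p)\<^sup>2)" if "0 \<le> p" for p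
  proof -
    have "(ennreal (2 * p))\<^sup>2 * ennreal (1 / \<kappa>) = ennreal ((2 * p)\<^sup>2 * (1 / \<kappa>))" using that \<kappa>
      by (subst ennreal_power, simp, subst ennreal_mult) auto
    also have "(2 * p)\<^sup>2 * (1 / \<kappa>) = ((1 - k) / 2 * p)\<^sup>2" using k
      by (simp add: \<kappa>_def power2_eq_square field_simps)
    finally show ?thesis .
  qed
  have bd: "(\<integral>\<^sup>+z. (dirderiv F W e z * indicator U z)\<^sup>2 \<partial>lborel) * ennreal (1 / \<kappa>) \<le> ennreal (4 * v * L\<^sup>2)"
    if e: "e = 1 \<or> e = \<i>" for e
  proof -
    have [measurable]: "dirderiv F W e \<in> borel_measurable borel" using W F(1) by (rule dirderiv_measurable)
    have "(\<integral>\<^sup>+z. (dirderiv F W e z * indicator U z)\<^sup>2 \<partial>lborel) * ennreal (1 / \<kappa>)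
      = (\<integral>\<^sup>+z. (dirderiv F W e z * indicator U z)\<^sup>2 * ennreal (1 / \<kappa>) \<partial>lborel)"
      by (rule nn_integral_multc[symmetric]) measurable
    also have "\<dots> \<le> (\<integral>\<^sup>+z. ennreal ((c z)\<^sup>2) * indicator {z \<in> W. F z \<in> ball (F a) (2 * L)} z \<partial>lborel)"
    proof (rule nn_integral_mono_AE, use stretch in eventually_elim)
      case (elim z)
      show ?case
      proof (cases "z \<in> U")
        case True
        then have "dirderiv F W e z \<le> ennreal (2 * cmod (wirtinger F z))" using elim e by (auto simp: U_def)
        then have "(dirderiv F W e z)\<^sup>2 \<le> (ennreal (2 * cmod (wirtinger F z)))\<^sup>2" by (rule power_mono) simp
        then have
          "(dirderiv F W e z * indicator U z)\<^sup>2 * ennreal (1 / \<kappa>)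
          \<le> (ennreal (2 * cmod (wirtinger F z)))\<^sup>2 * ennreal (1 /
          \<kappa>)" using True by (simp add: mult_right_mono)
        then show ?thesis unfolding sq[OF norm_ge_zero] using True by (simp add: c_def U_def)
      qed simp
    qed
    also note area
    also note vol
    finally show ?thesis .
  qed
  have bX: "(\<integral>\<^sup>+z. (X z)\<^sup>2 \<partial>lborel) * ennreal (1 / \<kappa>) \<le> ennreal (4 * v * L\<^sup>2)" unfolding X_def by (rule bd) simp
  have bY: "(\<integral>\<^sup>+z. (Y z)\<^sup>2 \<partial>lborel) * ennreal (1 / \<kappa>) \<le> ennreal (4 * v * L\<^sup>2)" unfolding Y_def by (rule bd) simp
  \<comment> \<open>After division by \<kappa> the lower bound is
    \<open>513 / 32 * v * L\<^sup>2\<close>. Each of the four area integrals is at most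
    \<open>4 * v * L\<^sup>2\<close>, together \<open>512 / 32 * v * L\<^sup>2\<close>.\<close>
  have "ln \<rho> - ln (\<theta> * \<rho>) = - ln \<theta>" using lam1 \<rho> by (simp add: ln_mult)
  also have "\<dots> = 513 * (\<kappa> * v)" by (simp add: lam \<kappa>_def v_def)
  finally have lnl: "ln \<rho> - ln (\<theta> * \<rho>) = 513 * (\<kappa> * v)" .
  have
    "ennreal (L\<^sup>2 / 32 * (513 * (\<kappa> * v)) * (1 / \<kappa>))
    = ennreal (L\<^sup>2 / 32 * (ln \<rho> - ln (\<theta> * \<rho>))) * ennreal (1 / \<kappa>)"
    unfolding lnl using \<kappa> v by (intro ennreal_mult) auto
  also have
    "\<dots> \<le> (((\<integral>\<^sup>+z. (X z)\<^sup>2 \<partial>lborel) + (\<integral>\<^sup>+z. (X z)\<^sup>2 \<partial>lborel))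
    + ((\<integral>\<^sup>+z. (Y z)\<^sup>2 \<partial>lborel) + (\<integral>\<^sup>+z. (Y z)\<^sup>2 \<partial>lborel))) * ennreal (1 / \<kappa>)"
    by (intro mult_right_mono up) simp
  also have
    "\<dots> \<le> (ennreal (4 * v * L\<^sup>2) + ennreal (4 * v * L\<^sup>2)) + (ennreal (4 * v * L\<^sup>2) + ennreal (4 * v * L\<^sup>2))"
    unfolding distrib_right by (intro add_mono bX bY)
  also have "\<dots> = ennreal (16 * v * L\<^sup>2)" using v by (simp flip: ennreal_plus)
  finally have "ennreal (L\<^sup>2 / 32 * (513 * (\<kappa> * v)) * (1 / \<kappa>)) \<le> ennreal (16 * v * L\<^sup>2)" .
  then have "L\<^sup>2 / 32 * (513 * (\<kappa> * v)) * (1 / \<kappa>) \<le> 16 * v * L\<^sup>2" using v by (subst (asm) ennreal_le_iff) auto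
  then have "513 * (v * L\<^sup>2) \<le> 512 * (v * L\<^sup>2)" using \<kappa> by (simp add: field_simps)
  moreover have "v * L\<^sup>2 > 0" using v L by simp
  ultimately show False by linarith
qed

section \<open>Injectivity near infinity\<close>

context jordan_pre_schwarzian begin

(* If every strip contained two points with the same image, then local injectivity keeps them apart, the
   hypotheses keep them bounded, and a limit point contradicts injectivity on the closed half-plane. *)
lemma injective_strip:
  assumes far: "\<And>B. \<exists>\<tau> M. 0 < \<tau> \<and> (\<forall>z. - \<tau> < Re z \<and> M < cmod z \<longrightarrow> B < cmod (g z))"
    and sep: "\<exists>\<tau> M. 0 < \<tau> \<and> (\<forall>z z'. - \<tau> < Re z \<and> - \<tau> < Re z' \<and> M < cmod z \<and> M < cmod z' \<and> g z = g z' \<longrightarrow>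
      4 * cmod (z - z') \<le> t0)"
  shows "\<exists>\<tau>. 0 < \<tau> \<and> \<tau> \<le> t0 \<and> inj_on g {z. - \<tau> < Re z}"
proof (rule ccontr)
  assume contra: "\<not> ?thesis"
  obtain \<tau>2 M2 where sep: "0 < \<tau>2" "\<And>z z'. - \<tau>2 < Re z \<Longrightarrow> - \<tau>2 < Re z' \<Longrightarrow> M2 < cmod z \<Longrightarrow> M2 < cmod z' \<Longrightarrow>
    g z = g z' \<Longrightarrow> 4 * cmod (z - z') \<le> t0"
    using sep by blast
  \<comment> \<open>In a pair with equal images, the point of smaller modulus lies in
    \<open>K\<close>, since \<open>sep\<close> together with local injectivity excludes that both
    are far out. Its value is then bounded by \<open>B\<close>, and \<open>far\<close> bounds the
    other point.\<close>
  define K where "K = cball 0 M2 \<inter> {z. - (t0 / 2) \<le> Re z}"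
  have "compact K" unfolding K_def by (intro compact_Int_closed compact_cball closed_halfspace_Re_ge)
  moreover have "continuous_on K g"
    by (intro continuous_at_imp_continuous_on ballI fhat_isCont) (use t0 in \<open>auto simp: K_def\<close>)
  ultimately have "bounded (g ` K)" by (intro compact_imp_bounded compact_continuous_image)
  then obtain B where B: "\<And>z. z \<in> K \<Longrightarrow> cmod (g z) \<le> B" unfolding bounded_iff by blast
  obtain \<tau>3 M3 where far: "0 < \<tau>3" "\<And>z. - \<tau>3 < Re z \<Longrightarrow> M3 < cmod z \<Longrightarrow> B < cmod (g z)"
    using far[of B] by blast
  define \<delta> where "\<delta> = min (t0 / 2) (min \<tau>2 \<tau>3)"
  have \<delta>: "0 < \<delta>" "\<delta> \<le> t0 / 2" "\<delta> \<le> \<tau>2" "\<delta> \<le> \<tau>3" using t0 sep(1) far(1) by (auto simp: \<delta>_def)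
  define R where "R = max M2 M3"
  have "\<exists>p. fst p \<in> cball 0 R \<and> snd p \<in> cball 0 R \<and> - (\<delta> * inverse (real (Suc n))) \<le> Re (fst p) \<and>
    - (\<delta> * inverse (real (Suc n))) \<le> Re (snd p) \<and>
    g (fst p) = g (snd p) \<and> t0 / 4 \<le> cmod (fst p - snd p)" for n
  proof -
    define e where "e = \<delta> * inverse (real (Suc n))"
    have e: "0 < e" using \<delta>(1) by (simp add: e_def)
    have "e \<le> \<delta> * 1" unfolding e_def using \<delta>(1) by (intro mult_left_mono) (auto simp: inverse_eq_divide)
    then have e': "e \<le> \<delta>" by simp
    then have "\<not> inj_on g {z. - e < Re z}" using contra e \<delta> t0 by auto
    then obtain u v where uv: "- e < Re u" "- e < Re v" "u \<noteq> v" "g u = g v" unfolding inj_on_def by blast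
    have "\<exists>u v. - e < Re u \<and> - e < Re v \<and> u \<noteq> v \<and> g u = g v \<and> cmod u \<le> cmod v"
    proof (cases "cmod u \<le> cmod v")
      case True
      show ?thesis by (rule exI[of _ u], rule exI[of _ v]) (use True uv in simp)
    next
      case False
      show ?thesis by (rule exI[of _ v], rule exI[of _ u]) (use False uv in simp)
    qed
    then obtain u v where uv: "- e < Re u" "- e < Re v" "u \<noteq> v" "g u = g v" "cmod u \<le> cmod v" by blast
    have "\<not> 4 * cmod (u - v) \<le> t0"
    proof
      assume "4 * cmod (u - v) \<le> t0"
      then have "g u \<noteq> g v" by (intro fhat_locally_injective) (use uv e' \<delta>(2) t0 in auto)
      then show False using uv(4) by contradiction
    qed
    then have d: "t0 / 4 \<le> cmod (u - v)" "t0 < 4 * cmod (u - v)" by auto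
    have "\<not> M2 < cmod u"
    proof
      assume "M2 < cmod u"
      then have "4 * cmod (u - v) \<le> t0" using uv e' \<delta> by (intro sep(2)) auto
      then show False using d by simp
    qed
    then have u: "cmod u \<le> M2" by simp
    then have "u \<in> K" using uv(1) e' \<delta>(2) by (simp add: K_def)
    then have "cmod (g v) \<le> B" using B[of u] uv(4) by simp
    then have "cmod v \<le> M3" using far(2)[of v] uv(2) e' \<delta>(4) by force
    then show ?thesis using u uv d(1)
      by (intro exI[of _ "(u, v)"]) (auto simp: R_def e_def[symmetric] simp del: of_nat_Suc)
  qed
  then obtain p where p: "\<And>n. fst (p n) \<in> cball 0 R" "\<And>n. snd (p n) \<in> cball 0 R"
    "\<And>n. - (\<delta> * inverse (real (Suc n))) \<le> Re (fst (p n))" "\<And>n. - (\<delta> * inverse (real (Suc n))) \<le> Re (snd (p n))"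
    "\<And>n. g (fst (p n)) = g (snd (p n))" "\<And>n. t0 / 4 \<le> cmod (fst (p n) - snd (p n))"
    by metis
  have "compact (cball (0::complex) R \<times> cball (0::complex) R)" by (intro compact_Times compact_cball)
  then have "seq_compact (cball (0::complex) R \<times> cball (0::complex) R)"
    by (simp add: compact_eq_seq_compact_metric)
  moreover have "\<forall>n. p n \<in> cball 0 R \<times> cball 0 R" using p(1,2) by (simp add: mem_Times_iff)
  ultimately obtain l r where l: "strict_mono r" "(p \<circ> r) \<longlonglongrightarrow> l" by (rule seq_compactE)
  have lf: "(\<lambda>n. fst (p (r n))) \<longlonglongrightarrow> fst l" and ls: "(\<lambda>n. snd (p (r n))) \<longlonglongrightarrow> snd l"
    using tendsto_fst[OF l(2)] tendsto_snd[OF l(2)] by (auto simp: o_def)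
  have "(\<lambda>n. - (\<delta> * inverse (real (Suc n)))) \<longlonglongrightarrow> - (\<delta> * 0)"
    by (intro tendsto_intros LIMSEQ_inverse_real_of_nat)
  from LIMSEQ_subseq_LIMSEQ[OF this l(1)] have z: "(\<lambda>n. - (\<delta> * inverse (real (Suc (r n))))) \<longlonglongrightarrow> 0"
    by (simp add: o_def)
  have re: "0 \<le> Re (fst l)" "0 \<le> Re (snd l)"
    using LIMSEQ_le[OF z tendsto_Re[OF lf]] LIMSEQ_le[OF z tendsto_Re[OF ls]] p(3,4) by blast+
  have "(\<lambda>n. g (fst (p (r n)))) \<longlonglongrightarrow> g (fst l)" "(\<lambda>n. g (snd (p (r n)))) \<longlonglongrightarrow> g (snd l)"
    by (rule isCont_tendsto_compose[OF fhat_isCont lf] isCont_tendsto_compose[OF fhat_isCont ls]; use re t0 in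
      linarith)+
  then have "g (fst l) = g (snd l)" unfolding p(5) by (rule LIMSEQ_unique)
  then have "fst l = snd l" using g_closed_half_plane_inj re by (auto dest: inj_onD)
  moreover have "t0 / 4 \<le> cmod (fst l - snd l)"
    by (rule LIMSEQ_le_const[OF tendsto_norm[OF tendsto_diff[OF lf ls]]]) (use p(6) in blast)
  ultimately show False using t0 by simp
qed

text \<open>Left of the axis the extension differs from \<open>f\<close> at the reflected point
  \<open>w\<close> by \<open>2 * Re z\<close> times \<open>deriv f w\<close>. This product is
  comparable to an increment of \<open>f\<close> over half the distance of \<open>w\<close> to the
  axis, which uniform continuity makes small.\<close>

lemma uniform_approximation:
  assumes uc: "uniformly_continuous_on {z \<in> H. cmod z > M} f" and \<eta>: "0 < \<eta>"
  shows "\<exists>\<tau> M1. 0 < \<tau> \<and> (\<forall>z. - \<tau> < Re z \<and> M1 < cmod z \<longrightarrow> (\<exists>w\<in>H. cmod (w - z) \<le> \<eta> \<and> cmod (g z - f w) \<le> \<eta>))"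
proof -
  have "0 < \<eta> / 10" using \<eta> by simp
  then obtain \<delta> where \<delta>: "0 < \<delta>" "\<And>w w'. w \<in> {z \<in> H. cmod z > M} \<Longrightarrow> w' \<in> {z \<in> H. cmod z > M} \<Longrightarrow> dist w' w < \<delta> \<Longrightarrow>
    dist (f w') (f w) < \<eta> / 10"
    using uc unfolding uniformly_continuous_on_def by meson
  define \<tau> where "\<tau> = min \<delta> (min t0 (\<eta> / 2))"
  have \<tau>: "0 < \<tau>" "\<tau> \<le> \<delta>" "\<tau> \<le> t0" "\<tau> \<le> \<eta> / 2" using \<delta>(1) t0 \<eta> by (auto simp: \<tau>_def)
  show ?thesis
  proof (rule exI[of _ \<tau>], rule exI[of _ "M + \<tau>"], intro conjI allI impI \<tau>(1))
    fix z assume z: "- \<tau> < Re z \<and> M + \<tau> < cmod z"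
    consider "0 < Re z" | "Re z = 0" | "Re z < 0" by linarith
    then show "\<exists>w\<in>H. cmod (w - z) \<le> \<eta> \<and> cmod (g z - f w) \<le> \<eta>"
    proof cases
      case 1
      show ?thesis by (rule bexI[of _ z]) (use 1 \<eta> in \<open>auto simp: fhat_pos right_half_plane_def\<close>)
    next
      case 2
      have "eventually (\<lambda>w. dist (f w) (g z) < \<eta>) (at z within H)" using tendstoD[OF fhat_boundary[OF 2] \<eta>] .
      moreover have "eventually (\<lambda>w. dist w z < \<eta>) (at z within H)" using tendstoD[OF tendsto_ident_at \<eta>] .
      moreover have "eventually (\<lambda>w. w \<in> H) (at z within H)" by (simp add: eventually_at_filter)
      ultimately have "eventually (\<lambda>w. w \<in> H \<and> dist w z < \<eta> \<and> dist (f w) (g z) < \<eta>) (at z within H)"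
        by eventually_elim simp
      then obtain w where w: "w \<in> H" "dist w z < \<eta>" "dist (f w) (g z) < \<eta>"
        using eventually_happens'[OF trivial_limit_rhp[OF 2]] by blast
      show ?thesis by (rule bexI[OF _ w(1)]) (use w in \<open>simp add: dist_norm norm_minus_commute\<close>)
    next
      case 3
      define x where "x = - Re z"
      define w where "w = - cnj z"
      \<comment> \<open>Halfway between the axis and \<open>w\<close>: up to a small relative error
        the increment of \<open>f\<close> is \<open>x / 2\<close> times \<open>deriv f w\<close>.
        With the increment below \<open>\<eta> / 10\<close> this gives the required
        \<open>2 * (x * cmod (deriv f w)) \<le> \<eta>\<close>.\<close>
      define w' where "w' = Complex (x / 2) (Im z)"
      have x: "0 < x" "x < \<tau>" using 3 z by (auto simp: x_def)
      have wc: "w = Complex x (Im z)" by (simp add: w_def x_def complex_eq_iff)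
      have d1: "w' - w = of_real (- (x / 2))" by (simp add: wc w'_def complex_eq_iff)
      have n1: "cmod (w' - w) = x / 2" unfolding d1 norm_of_real using x by simp
      have cw: "cmod w = cmod z" by (simp add: w_def)
      have cw': "M < cmod w'" using norm_triangle_sub[of w w'] n1 x z cw by (simp add: norm_minus_commute)
      have in1: "w \<in> {z \<in> H. cmod z > M}" "w' \<in> {z \<in> H. cmod z > M}"
        using x z cw cw' \<tau>(1) by (auto simp: right_half_plane_def wc w'_def)
      have "dist (f w') (f w) < \<eta> / 10"
        by (rule \<delta>(2)[OF in1]) (use n1 x \<tau>(2) in \<open>simp add: dist_norm\<close>)
      then have c: "cmod (f w' - f w) < \<eta> / 10" by (simp add: dist_norm)
      have lin: "cmod (f w' - f w - deriv f w * (w' - w)) \<le> 24 * \<kappa> * Re w * cmod (deriv f w)"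
        by (rule f_linear) (use x \<tau> in \<open>auto simp: wc w'_def\<close>)
      have "24 * \<kappa> * (Re w * cmod (deriv f w)) \<le> 24 * (1 / 1000) * (Re w * cmod (deriv f w))"
        using kap x by (intro mult_right_mono mult_left_mono) (auto simp: wc)
      then have lin': "cmod (f w' - f w - deriv f w * (w' - w)) \<le> 24 / 1000 * (x * cmod (deriv f w))" using lin
        by (simp add: wc mult_ac)
      have "cmod (deriv f w * (w' - w)) = x * cmod (deriv f w) / 2" using n1 by (simp add: norm_mult)
      then have sm: "2 * (x * cmod (deriv f w)) \<le> \<eta>"
        using c lin' norm_triangle_sub[of "deriv f w * (w' - w)" "f w' - f w"] \<eta> norm_minus_commute[of
          "deriv f w * (w' - w)" "f w' - f w"] by linarith
      have gz: "g z - f w = of_real (2 * Re z) * deriv f w" using fhat_neg[OF 3] by (simp add: w_def)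
      have "cmod (g z - f w) = 2 * (x * cmod (deriv f w))" unfolding gz norm_mult norm_of_real using 3
        by (simp add: x_def)
      moreover have "cmod (w - z) \<le> \<eta>"
      proof -
        have "w - z = of_real (2 * x)" by (simp add: wc x_def complex_eq_iff)
        then show ?thesis using x \<tau>(4) by (simp only: norm_of_real)
      qed
      ultimately show ?thesis using sm in1(1) by (intro bexI[of _ w]) auto
    qed
  qed
qed

text \<open>Equal values at \<open>z\<close> and \<open>z'\<close> bring \<open>f w\<close> and
  \<open>f w'\<close> within \<open>2 * \<eta>\<close>, hence \<open>w\<close> and \<open>w'\<close>
  within \<open>t0 / 8\<close> by uniform continuity of the inverse. With two errors of at most
  \<open>t0 / 16\<close> this gives distance at most \<open>t0 / 4\<close>.\<close>

lemma injective_strip_uniformly_continuous: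
  assumes "locally_unif_cont_at_infinity f"
  shows "\<exists>\<tau>. 0 < \<tau> \<and> \<tau> \<le> t0 \<and> inj_on g {z. - \<tau> < Re z}"
proof -
  obtain M where M: "uniformly_continuous_on {z \<in> H. cmod z > M} f"
    "uniformly_continuous_on {w \<in> f ` H. cmod w > M} (inv_into H f)"
    using assms unfolding locally_unif_cont_at_infinity_def by blast
  show ?thesis
  proof (rule injective_strip)
    fix B
    obtain \<tau> M1 where A: "0 < \<tau>" "\<And>z. - \<tau> < Re z \<Longrightarrow> M1 < cmod z \<Longrightarrow> \<exists>w\<in>H. cmod (w - z) \<le> 1 \<and> cmod (g z - f w) \<le> 1"
      using uniform_approximation[OF M(1), of 1] by auto
    obtain M2 where M2: "0 < M2" "\<And>z. z \<in> H \<Longrightarrow> M2 \<le> cmod z \<Longrightarrow> B + 1 < cmod (f z)" using norm_f_large[of "B + 1"]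
      by metis
    show "\<exists>\<tau> M. 0 < \<tau> \<and> (\<forall>z. - \<tau> < Re z \<and> M < cmod z \<longrightarrow> B < cmod (g z))"
    proof (rule exI[of _ \<tau>], rule exI[of _ "max M1 (M2 + 1)"], intro conjI allI impI A(1))
      fix z assume z: "- \<tau> < Re z \<and> max M1 (M2 + 1) < cmod z"
      obtain w where w: "w \<in> H" "cmod (w - z) \<le> 1" "cmod (g z - f w) \<le> 1" using A(2)[of z] z by auto
      have "M2 \<le> cmod w" using norm_triangle_sub[of z w] w(2) z by (simp add: norm_minus_commute)
      then show "B < cmod (g z)" using M2(2)[OF w(1)] norm_triangle_sub[of "f w" "g z"] w(3)
        by (simp add: norm_minus_commute)
    qed
  next
    have "0 < t0 / 8" using t0 by simp
    then obtain \<delta> where \<delta>: "0 < \<delta>" "\<And>w w'. w \<in> {w \<in> f ` H. cmod w > M} \<Longrightarrow> w' \<in> {w \<in> f ` H. cmod w > M} \<Longrightarrow>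
      dist w' w < \<delta> \<Longrightarrow> dist (inv_into H f w') (inv_into H f w) < t0 / 8"
      using M(2) unfolding uniformly_continuous_on_def by meson
    define \<eta> where "\<eta> = min (\<delta> / 3) (t0 / 16)"
    have \<eta>: "0 < \<eta>" "\<eta> \<le> \<delta> / 3" "\<eta> \<le> t0 / 16" using \<delta>(1) t0 by (auto simp: \<eta>_def)
    obtain \<tau> M1 where A: "0 < \<tau>" "\<And>z. - \<tau> < Re z \<Longrightarrow> M1 < cmod z \<Longrightarrow> \<exists>w\<in>H. cmod (w - z) \<le> \<eta> \<and> cmod (g z - f w) \<le> \<eta>"
      using uniform_approximation[OF M(1) \<eta>(1)] by auto
    obtain M2 where M2: "0 < M2" "\<And>z. z \<in> H \<Longrightarrow> M2 \<le> cmod z \<Longrightarrow> M < cmod (f z)" using norm_f_large[of M] by metis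
    show "\<exists>\<tau> M. 0 < \<tau> \<and> (\<forall>z z'. - \<tau> < Re z \<and> - \<tau> < Re z' \<and> M < cmod z \<and> M < cmod z' \<and> g z = g z' \<longrightarrow>
      4 * cmod (z - z') \<le> t0)"
    proof (rule exI[of _ \<tau>], rule exI[of _ "max M1 (M2 + \<eta>)"], intro conjI allI impI A(1))
      fix z z' assume z: "- \<tau> < Re z \<and> - \<tau> < Re z' \<and> max M1 (M2 + \<eta>) < cmod z \<and> max M1 (M2 + \<eta>) < cmod z' \<and>
        g z = g z'"
      obtain w where w: "w \<in> H" "cmod (w - z) \<le> \<eta>" "cmod (g z - f w) \<le> \<eta>" using A(2)[of z] z by auto
      obtain w' where w': "w' \<in> H" "cmod (w' - z') \<le> \<eta>" "cmod (g z' - f w') \<le> \<eta>" using A(2)[of z'] z by auto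
      have "M2 \<le> cmod w" using norm_triangle_sub[of z w] w(2) z by (simp add: norm_minus_commute)
      then have 1: "f w \<in> {w \<in> f ` H. cmod w > M}" using M2(2)[OF w(1)] w(1) by simp
      have "M2 \<le> cmod w'" using norm_triangle_sub[of z' w'] w'(2) z by (simp add: norm_minus_commute)
      then have 2: "f w' \<in> {w \<in> f ` H. cmod w > M}" using M2(2)[OF w'(1)] w'(1) by simp
      have "dist (f w') (f w) \<le> dist (f w') (g z) + dist (g z) (f w)" by (rule dist_triangle)
      also have "\<dots> \<le> \<eta> + \<eta>" using w(3) w'(3) z by (simp add: dist_norm norm_minus_commute)
      finally have "dist (f w') (f w) < \<delta>" using \<eta> \<delta>(1) by linarith
      from \<delta>(2)[OF 1 2 this] have "dist w' w < t0 / 8" using w(1) w'(1) inj by simp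
      then have "dist z z' \<le> \<eta> + t0 / 8 + \<eta>"
        using dist_triangle[of z z' w] dist_triangle[of w z' w'] w(2) w'(2)
          by (simp add: dist_norm norm_minus_commute)
      then show "4 * cmod (z - z') \<le> t0" using \<eta>(3) by (simp add: dist_norm)
    qed
  qed
qed

(* F(a + r) stays at distance at least L from F(a) for all r from s to rho1, where L is comparable to
   s |f'(a + s)|, so F maps the square around a onto a disc of radius L/2. In the strip of width s/100 the value
   g z differs from g a = F a by less than that. *)
lemma quasiconformal_preimage:
  assumes F: "quasiconformal_on F {z. cmod z > M}" and Ff: "\<And>z. z \<in> H \<Longrightarrow> cmod z > M \<Longrightarrow> F z = f z"
    and \<rho>: "0 < \<rho>"
  shows "\<exists>\<tau> M1. 0 < \<tau> \<and> (\<forall>z. - \<tau> < Re z \<and> M1 < cmod z \<longrightarrow> (\<exists>b. M < cmod b \<and> cmod (b - z) \<le> \<rho> \<and> g z = F b))"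
proof -
  define W where "W = {z. cmod z > M}"
  obtain k where W: "open W" and ex: "\<exists>G. homeomorphism W (F ` W) F G" and acl: "ACL_on W F"
    and k: "0 \<le> k" "k < 1" "AE z in lebesgue. z \<in> W \<longrightarrow> cmod (wirtinger_bar F z) \<le> k * cmod (wirtinger F z)"
    using F unfolding quasiconformal_on_def W_def[symmetric] by blast
  have cont: "continuous_on W F" and injF: "inj_on F W"
    using ex by (auto simp: homeomorphism_def intro: inj_on_inverseI)
  \<comment> \<open>On the axis both \<open>F\<close>, by continuity, and \<open>g\<close>, by
    construction, are limits of \<open>f\<close> from within the half-plane.\<close>
  have Fg: "F a = g a" if a: "Re a = 0" "a \<in> W" for a
  proof -
    have "isCont F a" using cont W a(2) by (simp add: continuous_on_eq_continuous_at)
    then have "(F \<longlongrightarrow> F a) (at a within H)" unfolding isCont_def by (rule tendsto_within_subset) simp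
    moreover have "(F \<longlongrightarrow> g a) (at a within H)"
    proof (rule Lim_transform_eventually[OF fhat_boundary[OF a(1)]])
      have "eventually (\<lambda>w. w \<in> W) (at a within H)" using W a(2)
        by (rule eventually_at_in_open'[THEN filter_leD[OF at_le[OF subset_UNIV]]])
      moreover have "eventually (\<lambda>w. w \<in> H) (at a within H)" by (simp add: eventually_at_filter)
      ultimately show "eventually (\<lambda>w. f w = F w) (at a within H)" by eventually_elim (simp add: Ff W_def)
    qed
    ultimately show ?thesis using tendsto_unique[OF trivial_limit_rhp[OF a(1)]] by blast
  qed
  define \<rho>1 where "\<rho>1 = min \<rho> t0 / 4"
  have \<rho>1: "0 < \<rho>1" "4 * \<rho>1 \<le> \<rho>" "\<rho>1 \<le> t0" using \<rho> t0 by (auto simp: \<rho>1_def)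
  define \<theta> where "\<theta> = exp (- (513 * (16 / (1 - k)\<^sup>2 * unit_ball_vol 2)))"
  have "0 < 513 * (16 / (1 - k)\<^sup>2 * unit_ball_vol (2 :: real))" using k(2) by simp
  then have \<theta>: "0 < \<theta>" "\<theta> < 1" by (simp_all add: \<theta>_def del: mult_pos_pos)
  \<comment> \<open>The smallest radius at which the distortion estimate requires a lower bound. It
    depends only on \<open>k\<close> and \<open>\<rho>1\<close>, so the resulting width of the strip
    is the same for all \<open>z\<close>.\<close>
  define s where "s = \<theta> * \<rho>1"
  have s: "0 < s" "s < \<rho>1" using \<theta> \<rho>1(1) by (simp_all add: s_def)
  show ?thesis
  proof (rule exI[of _ "s / 100"], rule exI[of _ "M + 4 * \<rho>1"], intro conjI allI impI)
    show "0 < s / 100" using s by simp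
    fix z assume z: "- (s / 100) < Re z \<and> M + 4 * \<rho>1 < cmod z"
    show "\<exists>b. M < cmod b \<and> cmod (b - z) \<le> \<rho> \<and> g z = F b"
    proof (cases "0 < Re z")
      case True
      then show ?thesis using z \<rho>1 \<rho> by (intro exI[of _ z]) (simp add: Ff fhat_pos right_half_plane_def)
    next
      case False
      define a where "a = Complex 0 (Im z)"
      have a: "Re a = 0" "Im a = Im z" by (simp_all add: a_def)
      have az: "cmod (a - z) \<le> \<rho>1"
      proof -
        have "a - z = of_real (- Re z)" by (simp add: a_def complex_eq_iff)
        then have "cmod (a - z) = \<bar>Re z\<bar>" by (simp only: norm_of_real abs_minus_cancel)
        then show ?thesis using z False s by linarith
      qed
      have sqd: "cmod (b - a) \<le> 2 * \<rho>1" if "b \<in> square a \<rho>1" for b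
        using that cmod_le[of "b - a"] by (simp add: mem_square)
      \<comment> \<open>Points of the square are at most \<open>3 * \<rho>1\<close> from
        \<open>z\<close>, whence the bound \<open>M + 4 * \<rho>1\<close> for the modulus of
        \<open>z\<close>.\<close>
      have Q: "square a \<rho>1 \<subseteq> W"
      proof
        fix b assume "b \<in> square a \<rho>1"
        then show "b \<in> W" using sqd[of b] az z norm_triangle_sub[of z a] norm_triangle_sub[of a b] \<rho>1(1)
          by (simp add: W_def norm_minus_commute)
      qed
      have aW: "a \<in> W" using Q \<rho>1(1) by (auto simp: mem_square)
      define D where "D r = cmod (deriv f (Complex r (Im z)))" for r
      have D: "0 \<le> D r" for r by (simp add: D_def)
      have D_le: "D r \<le> D r' + 8 / 1000 * sqrt (r' / r) * D r'" "D r \<ge> D r' - 8 / 1000 * sqrt (r' / r) * D r'"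
        if r: "0 < r" "r \<le> r'" "r' \<le> t0" for r r'
      proof -
        have "cmod (deriv f (Complex r (Im z)) - deriv f (Complex r' (Im z))) \<le> 8 * \<kappa> * sqrt (r' / r) * D r'"
          using deriv_ratio[of "Complex r (Im z)" "Complex r' (Im z)"] r by (simp add: D_def)
        also have "\<dots> \<le> 8 * (1 / 1000) * sqrt (r' / r) * D r'"
          using kap r D by (intro mult_right_mono mult_left_mono) auto
        finally show "D r \<le> D r' + 8 / 1000 * sqrt (r' / r) * D r'"
          "D r \<ge> D r' - 8 / 1000 * sqrt (r' / r) * D r'"
          using norm_triangle_ineq3[of "deriv f (Complex r (Im z))" "deriv f (Complex r' (Im z))"]
            by (auto simp: D_def)
      qed
      have lin: "cmod (g v - f (Complex r (Im z)) - deriv f (Complex r (Im z)) * (v - Complex r (Im z)))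
        \<le> 40 / 1000 * (r * D r)"
        if "\<bar>Re v\<bar> \<le> r" "Im v = Im z" "0 < r" "r \<le> t0" for v r
      proof -
        have "cmod (g v - f (Complex r (Im z)) - deriv f (Complex r (Im z)) * (v - Complex r (Im z)))
          \<le> 40 * \<kappa> * r * D r"
          using fhat_linear[of v "Complex r (Im z)"] that by (simp add: D_def)
        also have "\<dots> \<le> 40 * (1 / 1000) * r * D r" using kap that D
          by (intro mult_right_mono mult_left_mono) auto
        finally show ?thesis by simp
      qed
      \<comment> \<open>For \<open>r\<close> between \<open>s\<close> and \<open>\<rho>1\<close>,
        the distance from \<open>g a\<close> is at least \<open>0.96 * (r * D r)\<close>, and
        \<open>r * D r \<ge> s * D s / 1.008\<close>. The factor 9/10 stays below the resulting
        constant.\<close>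
      define L where "L = 9 / 10 * (s * D s)"
      have Ds: "0 < D s" using deriv_nz[of "Complex s (Im z)"] s by (simp add: D_def)
      have L: "0 < L" using s Ds by (simp add: L_def)
      have "ball (F a) (L / 2) \<subseteq> F ` square a \<rho>1"
      proof (rule quasiconformal_distortion[OF W cont injF acl k Q \<rho>1(1) L \<theta>_def])
        fix r assume r: "\<theta> * \<rho>1 \<le> r" "r \<le> \<rho>1"
        have sr: "s \<le> r" "0 < r" using r(1) s(1) by (auto simp: s_def[symmetric])
        let ?p = "Complex r (Im z)"
        have pQ: "?p \<in> square a \<rho>1" using a r(2) sr \<rho>1(1) by (simp add: mem_square)
        have "F ?p = f ?p" by (rule Ff) (use sr Q pQ in \<open>auto simp: right_half_plane_def W_def\<close>)
        then have FF: "F (Complex (Re a + r) (Im a)) - F a = f ?p - g a" by (simp add: a(1,2) Fg[OF a(1) aW])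
        have "a - ?p = of_real (- r)" by (simp add: a_def complex_eq_iff)
        then have n: "cmod (deriv f ?p * (a - ?p)) = r * D r" using sr
          by (simp only: norm_mult norm_of_real) (simp add: D_def)
        have "r * D r \<le> cmod (f ?p - g a) + 40 / 1000 * (r * D r)"
        proof -
          have "cmod (g a - f ?p - deriv f ?p * (a - ?p)) \<le> 40 / 1000 * (r * D r)"
            by (rule lin) (use a sr r \<rho>1 in auto)
          then show ?thesis using n norm_triangle_sub[of "deriv f ?p * (a - ?p)" "g a - f ?p"]
            norm_minus_commute[of "g a - f ?p" "deriv f ?p * (a - ?p)"] norm_minus_commute[of "g a" "f ?p"]
              by linarith
        qed
        moreover have "s * D s \<le> 1008 / 1000 * (r * D r)"
        proof -
          have "s * D s \<le> s * (D r + 8 / 1000 * sqrt (r / s) * D r)" using s sr r \<rho>1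
            by (intro mult_left_mono D_le) auto
          also have "\<dots> = s * D r + 8 / 1000 * (s * sqrt (r / s)) * D r" by (simp add: algebra_simps)
          also have "s * sqrt (r / s) = sqrt (r * s)" using s sr by (intro mult_sqrt_divide) auto
          finally have "s * D s \<le> s * D r + 8 / 1000 * (sqrt (r * s) * D r)" by simp
          moreover have "sqrt (r * s) * D r \<le> r * D r"
          proof (rule mult_right_mono[OF _ D])
            have "sqrt (r * s) \<le> sqrt (r * r)" using sr s by (intro real_sqrt_le_mono mult_left_mono) auto
            then show "sqrt (r * s) \<le> r" using sr by simp
          qed
          moreover have "s * D r \<le> r * D r" using sr(1) D by (rule mult_right_mono)
          ultimately show ?thesis by linarith
        qed
        moreover have "0 \<le> r * D r" using sr D by simp
        ultimately have "L \<le> cmod (f ?p - g a)" unfolding L_def by linarith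
        then show "L \<le> cmod (F (Complex (Re a + r) (Im a)) - F a)" unfolding FF .
      qed
      moreover have "g z \<in> ball (F a) (L / 2)"
      proof -
        \<comment> \<open>A base point at the distance of the strip width from the axis:
          \<open>fhat_linear\<close> then applies to both \<open>z\<close> and \<open>a\<close>.
          Since \<open>sqrt (s / \<xi>) = 10\<close>, \<open>D \<xi>\<close> exceeds
          \<open>D s\<close> by at most 8 percent, so the increment is about
          \<open>0.012 * (s * D s)\<close>, well below \<open>L / 2\<close>.\<close>
        define \<xi> where "\<xi> = s / 100"
        let ?p = "Complex \<xi> (Im z)"
        have \<xi>: "0 < \<xi>" "\<xi> \<le> s" "\<xi> \<le> t0" "\<bar>Re z\<bar> \<le> \<xi>" using s \<rho>1 z False by (auto simp: \<xi>_def)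
        have 1: "cmod (g z - f ?p - deriv f ?p * (z - ?p)) \<le> 40 / 1000 * (\<xi> * D \<xi>)"
          by (rule lin) (use \<xi> in auto)
        have 2: "cmod (g a - f ?p - deriv f ?p * (a - ?p)) \<le> 40 / 1000 * (\<xi> * D \<xi>)"
          by (rule lin) (use \<xi> a in auto)
        have "z - a = of_real (Re z)" by (simp add: a_def complex_eq_iff)
        then have "cmod (deriv f ?p * (z - a)) = D \<xi> * \<bar>Re z\<bar>" by (simp only: norm_mult norm_of_real D_def)
        also have "\<dots> \<le> D \<xi> * \<xi>" using \<xi>(4) D by (intro mult_left_mono)
        finally have 3: "cmod (deriv f ?p * (z - a)) \<le> \<xi> * D \<xi>" by (simp add: mult.commute)
        have eq: "g z - g a = (g z - f ?p - deriv f ?p * (z - ?p)) - (g a - f ?p - deriv f ?p * (a - ?p))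
          + deriv f ?p * (z - a)"
          by (simp add: algebra_simps)
        have "cmod (g z - g a) \<le> 108 / 100 * (\<xi> * D \<xi>)"
          unfolding eq
            using 1 2 3 norm_triangle_ineq[of "(g z - f ?p - deriv f ?p * (z - ?p))
            - (g a - f ?p - deriv f ?p * (a - ?p))" "deriv f ?p * (z - a)"]
            norm_triangle_ineq4[of "g z - f ?p - deriv f ?p * (z - ?p)" "g a - f ?p - deriv f ?p * (a - ?p)"]
              by linarith
        moreover have "\<xi> * D \<xi> \<le> \<xi> * (108 / 100 * D s)"
        proof (rule mult_left_mono)
          have "s / \<xi> = 10\<^sup>2" using s by (simp add: \<xi>_def)
          then have "sqrt (s / \<xi>) = 10" by (simp only: real_sqrt_abs abs_numeral)
          then show "D \<xi> \<le> 108 / 100 * D s" using D_le(1)[of \<xi> s] \<xi> s \<rho>1 by simp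
        qed (use \<xi> in simp)
        ultimately have "cmod (g z - g a) \<le> 108 / 100 * (s / 100 * (108 / 100 * D s))" unfolding \<xi>_def
          by linarith
        moreover have "0 < s * D s" using s Ds by simp
        ultimately have "cmod (g z - g a) < L / 2" unfolding L_def by simp
        then show ?thesis using Fg[OF a(1) aW] by (simp add: dist_norm norm_minus_commute)
      qed
      ultimately obtain b where b: "b \<in> square a \<rho>1" "g z = F b" by blast
      have "cmod (b - z) \<le> \<rho>" using norm_triangle_ineq[of "b - a" "a - z"] sqd[OF b(1)] az \<rho>1 by simp
      moreover have "M < cmod b" using b(1) Q by (auto simp: W_def)
      ultimately show ?thesis using b(2) by blast
    qed
  qed
qed

text \<open>Equal values of \<open>g\<close> at \<open>z\<close> and \<open>z'\<close> are values of
  \<open>F\<close> at points near \<open>z\<close> and near \<open>z'\<close>. By injectivity of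
  \<open>F\<close> these points coincide, so \<open>z\<close> and \<open>z'\<close> are within
  \<open>t0 / 8\<close> of one point.\<close>

lemma injective_strip_qc_extendible:
  assumes "locally_qc_extendible_at_infinity f"
  shows "\<exists>\<tau>. 0 < \<tau> \<and> \<tau> \<le> t0 \<and> inj_on g {z. - \<tau> < Re z}"
proof -
  obtain M F where F: "quasiconformal_on F {z. cmod z > M}" "\<And>z. z \<in> H \<Longrightarrow> cmod z > M \<Longrightarrow> F z = f z"
    "filterlim F at_infinity at_infinity"
    using assms unfolding locally_qc_extendible_at_infinity_def by blast
  have injF: "inj_on F {z. cmod z > M}"
    using F(1) by (auto simp: quasiconformal_on_def homeomorphism_def intro: inj_on_inverseI)
  have preimage:
    "\<exists>\<tau> M1. 0 < \<tau> \<and> (\<forall>z. - \<tau> < Re z \<and> M1 < cmod z \<longrightarrow> (\<exists>b. M < cmod b \<and> cmod (b - z) \<le> \<rho> \<and> g z = F b))" if "0 < \<rho>"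
    for \<rho>
    by (rule quasiconformal_preimage[OF F(1) _ that]) (rule F(2))
  show ?thesis
  proof (rule injective_strip)
    fix B
    have "eventually (\<lambda>z. B < cmod (F z)) at_infinity"
      using filterlim_at_infinity_imp_norm_at_top[OF F(3)] unfolding filterlim_at_top_dense by (rule spec)
    then obtain R where R: "\<And>z. R \<le> cmod z \<Longrightarrow> B < cmod (F z)" unfolding eventually_at_infinity by blast
    obtain \<tau> M1 where A: "0 < \<tau>" "\<And>z. - \<tau> < Re z \<Longrightarrow> M1 < cmod z \<Longrightarrow> \<exists>b. M < cmod b \<and> cmod (b - z) \<le> 1 \<and> g z = F b"
      using preimage[OF zero_less_one] by blast
    show "\<exists>\<tau> M. 0 < \<tau> \<and> (\<forall>z. - \<tau> < Re z \<and> M < cmod z \<longrightarrow> B < cmod (g z))"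
    proof (rule exI[of _ \<tau>], rule exI[of _ "max M1 (R + 1)"], intro conjI allI impI A(1))
      fix z assume z: "- \<tau> < Re z \<and> max M1 (R + 1) < cmod z"
      obtain b where b: "cmod (b - z) \<le> 1" "g z = F b" using A(2)[of z] z by auto
      have "R \<le> cmod b" using norm_triangle_sub[of z b] b(1) z by (simp add: norm_minus_commute)
      then show "B < cmod (g z)" using R b(2) by simp
    qed
  next
    have "0 < t0 / 8" using t0 by simp
    then obtain \<tau> M1 where A: "0 < \<tau>" "\<And>z. - \<tau> < Re z \<Longrightarrow> M1 < cmod z \<Longrightarrow> \<exists>b. M < cmod b \<and> cmod (b - z) \<le> t0 / 8 \<and>
      g z = F b"
      using preimage[of "t0 / 8"] by blast
    show "\<exists>\<tau> M. 0 < \<tau> \<and> (\<forall>z z'. - \<tau> < Re z \<and> - \<tau> < Re z' \<and> M < cmod z \<and> M < cmod z' \<and> g z = g z' \<longrightarrow>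
      4 * cmod (z - z') \<le> t0)"
    proof (rule exI[of _ \<tau>], rule exI[of _ M1], intro conjI allI impI A(1))
      fix z z' assume z: "- \<tau> < Re z \<and> - \<tau> < Re z' \<and> M1 < cmod z \<and> M1 < cmod z' \<and> g z = g z'"
      obtain b where b: "M < cmod b" "cmod (b - z) \<le> t0 / 8" "g z = F b" using A(2)[of z] z by auto
      obtain b' where b': "M < cmod b'" "cmod (b' - z') \<le> t0 / 8" "g z' = F b'" using A(2)[of z'] z by auto
      have "b = b'" by (rule inj_onD[OF injF]) (use b b' z in auto)
      then show "4 * cmod (z - z') \<le> t0"
        using norm_triangle_ineq4[of "b - z'" "b - z"] b(2) b'(2) by simp
    qed
  qed
qed

end

theorem theorem5p1:
  fixes f :: "complex \<Rightarrow> complex"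
  assumes "f holomorphic_on right_half_plane"
    and "inj_on f right_half_plane"
    and "filterlim f at_infinity (inf at_infinity (principal right_half_plane))"
    and "jordan_domain_sphere (Some ` f ` right_half_plane)"
    and "((\<lambda>t. SUP z\<in>{z. 0 < Re z \<and> Re z \<le> t}.
            ereal (2 * Re z * cmod (pre_schwarzian f z))) \<longlongrightarrow> 0) (at_right 0)"
    and "locally_unif_cont_at_infinity f \<or> locally_qc_extendible_at_infinity f"
  shows "\<exists>\<tau>>0. quasiconformal_on (reflected_extension f) {z. - \<tau> < Re z} \<and>
           (\<forall>z. - \<tau> < Re z \<and> Re z < 0 \<longrightarrow>
              complex_dilatation (reflected_extension f) z
                = - of_real (2 * Re z) * pre_schwarzian f (- cnj z))"
proof -
  have "eventually (\<lambda>t. (SUP z\<in>{z. 0 < Re z \<and> Re z \<le> t}. ereal (2 * Re z * cmod (pre_schwarzian f z)))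
    < ereal (2 / 1000)) (at_right 0)"
    by (rule order_tendstoD(2)[OF assms(5)]) simp
  then obtain b where b: "b > 0"
    "\<And>t. 0 < t \<Longrightarrow> t < b \<Longrightarrow> (SUP z\<in>{z. 0 < Re z \<and> Re z \<le> t}. ereal (2 * Re z * cmod (pre_schwarzian f z)))
    < ereal (2 / 1000)"
    unfolding eventually_at_right_field by blast
  \<comment> \<open>The supremum contains the factor 2, so the bound 2/1000 yields
    \<open>\<kappa> = 1 / 1000\<close>. It is available only for \<open>t < b\<close>, hence the
    choice \<open>t0 = b / 2\<close>.\<close>
  interpret jordan_pre_schwarzian f "1 / 1000" "b / 2"
  proof
    fix z assume z: "0 < Re z" "Re z \<le> b / 2"
    have
      "ereal (2 * Re z * cmod (pre_schwarzian f z))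
      \<le> (SUP z\<in>{z. 0 < Re z \<and> Re z \<le> b / 2}. ereal (2 * Re z * cmod (pre_schwarzian f z)))"
      by (rule SUP_upper) (use z in simp)
    also have "\<dots> < ereal (2 / 1000)" by (rule b(2)) (use b(1) in auto)
    finally show "Re z * cmod (pre_schwarzian f z) \<le> 1 / 1000" by simp
  qed (use assms b in auto)
  obtain \<tau> where \<tau>: "0 < \<tau>" "\<tau> \<le> b / 2" "inj_on (reflected_extension f) {z. - \<tau> < Re z}"
    using assms(6) injective_strip_uniformly_continuous injective_strip_qc_extendible by blast
  show ?thesis
  proof (intro exI[of _ \<tau>] conjI allI impI)
    show "complex_dilatation (reflected_extension f) z = - of_real (2 * Re z) * pre_schwarzian f (- cnj z)"
      if "- \<tau> < Re z \<and> Re z < 0" for z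
      by (rule fhat_dilatation(1)) (use that \<tau>(2) in auto)
  qed (use \<tau> fhat_quasiconformal in auto)
qed

end
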